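(* Let $d \geq 1$ be an integer, let $K$ be a number field, and let $S$ be a finite set of places of $K$ containing the archimedean ones. Let $D$ be a non-empty effective divisor on $\mathbb{P}^1$ defined over $K$, and let $\mathcal{R} \subset \mathbb{P}^1(\overline{\mathbb{Q}},d)$ be a set of $(D,S)$-integral points. Then $$\lim_{B \rightarrow \infty} \frac{\#\{P \in \mathcal{R} \mid H(P) \leq B\}}{\#\{P \in \mathbb{P}^1(\overline{\mathbb{Q}},d) \mid H(P) \leq B\}} = 0.$$
   Context: **Points of bounded degree.** $\mathbb{P}^1(\overline{\mathbb{Q}},d) = \{P \in \mathbb{P}^1(\overline{\mathbb{Q}}) \mid [\mathbb{Q}(P):\mathbb{Q}] \leq d\}$, where $\mathbb{Q}(P)$ is the field of definition of $P$ over $\mathbb{Q}$. **Height.** $H$ is the absolute multiplicative Weil height on $\mathbb{P}^1(\overline{\mathbb{Q}})$: $H([1:0])=1$, and for $\alpha\in\overline{\mathbb{Q}}$, $$H([\alpha:1]) = \Big(a\prod_{\alpha'} \max\{1,|\alpha'|\}\Big)^{1/[\mathbb{Q}(\alpha):\mathbb{Q}]},$$ where $\alpha'$ runs over the conjugates of $\alpha$ over $\mathbb{Q}$ (including $\alpha$) in $\mathbb{C}$ and $a>0$ is the leading coefficient of the minimal polynomial of $\alpha$ over $\mathbb{Z}$ (the minimal polynomial over $\mathbb{Q}$ multiplied by the smallest positive integer clearing denominators). For fixed $d$ and $B$, the set of $P \in \mathbb{P}^1(\overline{\mathbb{Q}},d)$ with $H(P)\le B$ is finite (Northcott). **$(D,S)$-integral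 points.** Let $X$ be a (projective) variety over $K$ (here $X=\mathbb{P}^1$) and $D$ a divisor on $X$ defined over $K$. A set $\mathcal{R} \subset (X\setminus D)(\overline{\mathbb{Q}})$ (points outside the support of $D$) is called a set of $(D,S)$-integral points if there exists a global Weil function $\lambda_D$ for $D$ such that for all places $v$ of $K$ not in $S$, $\lambda_{D,v}(P)\le 0$ for all $P\in\mathcal{R}$. Here the value at $v$ of a Weil function on a point of $X(\overline{\mathbb{Q}})$ is taken with respect to every absolute value $w$ of $\overline{\mathbb{Q}}$ extending that of $v$, i.e. the inequality is required for all such $w$. **Global Weil functions.** These are in the standard sense of Lang and Vojta. Let $M$ be the set of absolute values on $\overline{\mathbb{Q}}$ extending the normalized absolute values of the places $v\in M_K$ of $K$. An $M_K$-constant is a family of real numbers $(\gamma_v)_{v\in M_K}$ with $\gamma_v=0$ for all but finitely many $v$. A subset $E\subset U(\overline{\mathbb{Q}})\times M$, with $U$ an affine variety over $K$ with affine coordinates $x_1,\dots,x_n$, is affine $M_K$-bounded if there is an $M_K$-constant $\gamma$ with $|x_j(P)|_w\le e^{\gamma_v}$ for all $j$ and all $(P,w)\in E$, where $w$ lies over $v$. A global Weil function for $D$ is a function $\lambda_D : (X\setminus D)(\overline{\mathbb{Q}})\times M\to\mathbb{R}$ such that whenever $D$ is represented on a Zariski open $U\subset X$ by a rational function $f$, one has $\lambda_D(P,w) = -\log|f(P)|_w+\alpha(P,w)$ for all $P\in (U\setminus D)(\overline{\mathbb{Q}})$ and $w \in M$, where $\alpha: U(\overline{\mathbb{Q}})\times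 M\to\mathbb{R}$ is continuous in $P$ for the $w$-adic topology for each $w$ and is locally $M_K$-bounded: for every affine open $U'\subset U$ over $K$ and every affine $M_K$-bounded subset $E$ of $U'(\overline{\mathbb{Q}})\times M$, there is an $M_K$-constant $\gamma$ with $|\alpha(P,w)|\le\gamma_v$ for all $(P,w)\in E$, $w$ over $v$. One writes $\lambda_{D,v}(P)$ for the values $\lambda_D(P,w)$ with $w$ lying over $v$. *)

theory Defs
  imports
    "HOL-Analysis.Analysis"
    "HOL-Computational_Algebra.Computational_Algebra"
    "HOL-Library.Poly_Mapping"
begin

section \<open>Number fields and algebraic numbers\<close>

text \<open>The field of algebraic numbers is the set of algebraic complex numbers; number fields are
  subfields of it.\<close>

definition Qbar :: "complex set" where
  "Qbar = {x. algebraic x}"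

interpretation Q_complex: vector_space "\<lambda>(q::rat) (x::complex). of_rat q * x"
  by unfold_locales (auto simp: algebra_simps of_rat_add of_rat_mult)

definition is_subfield :: "complex set \<Rightarrow> bool" where
  "is_subfield F \<longleftrightarrow> 1 \<in> F \<and> (\<forall>x\<in>F. \<forall>y\<in>F. x - y \<in> F \<and> x * y \<in> F) \<and> (\<forall>x\<in>F. inverse x \<in> F)"

definition number_field :: "complex set \<Rightarrow> bool" where
  "number_field K \<longleftrightarrow> is_subfield K \<and> (\<exists>A. finite A \<and> K \<subseteq> Q_complex.span A)"

definition field_generated :: "complex set \<Rightarrow> complex set" where
  "field_generated A = \<Inter>{F. is_subfield F \<and> A \<subseteq> F}"

text \<open>Junk value 0 in infinite degree.\<close>

definition degree_over_Q :: "complex set \<Rightarrow> nat" where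
  "degree_over_Q F = Q_complex.dim F"

section \<open>The projective line\<close>

text \<open>\<open>Affine a\<close> is the point \<open>[a : 1]\<close> and \<open>At_Infinity\<close> is the point \<open>[1 : 0]\<close>.\<close>

datatype proj1 = Affine complex | At_Infinity

definition P1 :: "proj1 set" where
  "P1 = insert At_Infinity (Affine ` Qbar)"

fun coord_x :: "proj1 \<Rightarrow> complex" where
  "coord_x (Affine a) = a"
| "coord_x At_Infinity = 1"

fun coord_y :: "proj1 \<Rightarrow> complex" where
  "coord_y (Affine a) = 1"
| "coord_y At_Infinity = 0"

fun field_of_definition :: "proj1 \<Rightarrow> complex set" where
  "field_of_definition (Affine a) = field_generated {a}"
| "field_of_definition At_Infinity = field_generated {}"

definition P1_deg :: "nat \<Rightarrow> proj1 set" where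
  "P1_deg d = {P \<in> P1. degree_over_Q (field_of_definition P) \<le> d}"

section \<open>The height\<close>

definition min_poly_Q :: "complex \<Rightarrow> rat poly" where
  "min_poly_Q a = (THE m. lead_coeff m = 1 \<and> poly (map_poly of_rat m) a = 0 \<and>
     (\<forall>f. f \<noteq> 0 \<and> poly (map_poly of_rat f) a = 0 \<longrightarrow> degree m \<le> degree f))"

definition denominator_poly :: "rat poly \<Rightarrow> nat" where
  "denominator_poly m = (LEAST n. n > 0 \<and> (\<exists>f::int poly. map_poly of_int f = smult (of_nat n) m))"

definition min_poly_Z :: "complex \<Rightarrow> int poly" where
  "min_poly_Z a = (THE f. map_poly of_int f =
     smult (of_nat (denominator_poly (min_poly_Q a))) (min_poly_Q a))"

definition conjugates :: "complex \<Rightarrow> complex set" where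
  "conjugates a = {z. poly (map_poly of_rat (min_poly_Q a)) z = 0}"

fun height :: "proj1 \<Rightarrow> real" where
  "height (Affine a) = root (degree_over_Q (field_generated {a}))
     (of_int (lead_coeff (min_poly_Z a)) * (\<Prod>z\<in>conjugates a. max 1 (norm z)))"
| "height At_Infinity = 1"

section \<open>Absolute values and places\<close>

definition absolute_value_on :: "complex set \<Rightarrow> (complex \<Rightarrow> real) \<Rightarrow> bool" where
  "absolute_value_on F w \<longleftrightarrow> w \<in> extensional F \<and>
     (\<forall>x\<in>F. w x \<ge> 0 \<and> (w x = 0 \<longleftrightarrow> x = 0)) \<and>
     (\<forall>x\<in>F. \<forall>y\<in>F. w (x * y) = w x * w y \<and> w (x + y) \<le> w x + w y)"

definition padic_abs :: "nat \<Rightarrow> rat \<Rightarrow> real" where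
  "padic_abs p q = (if q = 0 then 0 else
     real p powi (int (multiplicity (int p) (snd (quotient_of q)))
                  - int (multiplicity (int p) (fst (quotient_of q)))))"

definition archimedean :: "(complex \<Rightarrow> real) \<Rightarrow> bool" where
  "archimedean v \<longleftrightarrow> (\<forall>q::rat. v (of_rat q) = of_rat \<bar>q\<bar>)"

text \<open>Normalized means, as for Lang, extending one of the standard absolute values of the rationals
  (the ordinary one, or the \<open>p\<close>-adic one with value \<open>1/p\<close> at \<open>p\<close>). By Ostrowski's theorem
  every place contains exactly one such absolute value, so a place is identified with it.
  Absolute values are \<^const>\<open>extensional\<close> functions, so that distinct places are distinct
  functions and \<open>w\<close> lies over \<open>v\<close> iff \<open>restrict w K = v\<close>.\<close>

definition places :: "complex set \<Rightarrow> (complex \<Rightarrow> real) set" where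
  "places K = {v. absolute_value_on K v \<and>
     (archimedean v \<or> (\<exists>p. prime p \<and> (\<forall>q. v (of_rat q) = padic_abs p q)))}"

definition abs_Qbar :: "complex set \<Rightarrow> (complex \<Rightarrow> real) set" where
  "abs_Qbar K = {w. absolute_value_on Qbar w \<and> restrict w K \<in> places K}"

definition MK_constant :: "complex set \<Rightarrow> ((complex \<Rightarrow> real) \<Rightarrow> real) \<Rightarrow> bool" where
  "MK_constant K \<gamma> \<longleftrightarrow> finite {v \<in> places K. \<gamma> v \<noteq> 0}"

section \<open>Zariski open sets, rational functions and divisors over \<open>K\<close>\<close>

text \<open>The value at \<open>P\<close> of the binary form of degree \<open>n\<close> with coefficients \<open>c 0, \<dots>, c n\<close>.\<close>

definition form :: "nat \<Rightarrow> (nat \<Rightarrow> complex) \<Rightarrow> proj1 \<Rightarrow> complex" where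
  "form n c P = (\<Sum>i\<le>n. c i * coord_x P ^ i * coord_y P ^ (n - i))"

definition zariski_open :: "complex set \<Rightarrow> proj1 set \<Rightarrow> bool" where
  "zariski_open K U \<longleftrightarrow> (\<exists>T. (\<forall>(n, c)\<in>T. \<forall>i. c i \<in> K) \<and>
     U = {P \<in> P1. \<exists>(n, c)\<in>T. form n c P \<noteq> 0})"

text \<open>A nonzero rational function over \<open>K\<close> is written \<open>p(x/y) / q(x/y)\<close> in lowest terms. Homogenizing both
  polynomials to degree \<open>max (degree p) (degree q)\<close> gives a quotient of forms without common
  zeros, which is evaluated at \<open>P\<close>, including the point at infinity.\<close>

definition rational_function :: "complex set \<Rightarrow> complex poly \<times> complex poly \<Rightarrow> bool" where
  "rational_function K f \<longleftrightarrow> (case f of (p, q) \<Rightarrow>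
     set (coeffs p) \<subseteq> K \<and> set (coeffs q) \<subseteq> K \<and> p \<noteq> 0 \<and> q \<noteq> 0 \<and> coprime p q)"

definition rf_value :: "complex poly \<times> complex poly \<Rightarrow> proj1 \<Rightarrow> complex" where
  "rf_value f P = (case f of (p, q) \<Rightarrow> let n = max (degree p) (degree q) in
     form n (coeff p) P / form n (coeff q) P)"

fun rf_ord :: "complex poly \<times> complex poly \<Rightarrow> proj1 \<Rightarrow> int" where
  "rf_ord (p, q) (Affine a) = int (order a p) - int (order a q)"
| "rf_ord (p, q) At_Infinity = int (degree q) - int (degree p)"

text \<open>A divisor is a finitely supported integer-valued function on points; \<^const>\<open>Poly_Mapping.keys\<close>
  is its support.\<close>

type_synonym divisor = "proj1 \<Rightarrow>\<^sub>0 int"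

definition represents :: "divisor \<Rightarrow> proj1 set \<Rightarrow> complex poly \<times> complex poly \<Rightarrow> bool" where
  "represents D U f \<longleftrightarrow> (\<forall>P\<in>U. rf_ord f P = Poly_Mapping.lookup D P)"

definition divisor_over :: "complex set \<Rightarrow> divisor \<Rightarrow> bool" where
  "divisor_over K D \<longleftrightarrow> Poly_Mapping.keys D \<subseteq> P1 \<and>
     (\<forall>P\<in>P1. \<exists>U f. P \<in> U \<and> zariski_open K U \<and> rational_function K f \<and> represents D U f)"

definition effective :: "divisor \<Rightarrow> bool" where
  "effective D \<longleftrightarrow> (\<forall>P. Poly_Mapping.lookup D P \<ge> 0)"

section \<open>Affine open sets and affine coordinates\<close>

definition regular_on :: "complex set \<Rightarrow> proj1 set \<Rightarrow> (proj1 \<Rightarrow> complex) \<Rightarrow> bool" where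
  "regular_on K U g \<longleftrightarrow> (\<forall>P\<in>U. \<exists>n a b. (\<forall>i. a i \<in> K \<and> b i \<in> K) \<and> form n b P \<noteq> 0 \<and>
     (\<forall>Q\<in>U. form n b Q \<noteq> 0 \<longrightarrow> g Q = form n a Q / form n b Q))"

inductive_set generated_algebra :: "complex set \<Rightarrow> ('a \<Rightarrow> complex) set \<Rightarrow> ('a \<Rightarrow> complex) set"
  for K :: "complex set" and X :: "('a \<Rightarrow> complex) set" where
  const: "c \<in> K \<Longrightarrow> (\<lambda>_. c) \<in> generated_algebra K X"
| gen: "g \<in> X \<Longrightarrow> g \<in> generated_algebra K X"
| add: "g \<in> generated_algebra K X \<Longrightarrow> h \<in> generated_algebra K X \<Longrightarrow>
    (\<lambda>P. g P + h P) \<in> generated_algebra K X"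
| mult: "g \<in> generated_algebra K X \<Longrightarrow> h \<in> generated_algebra K X \<Longrightarrow>
    (\<lambda>P. g P * h P) \<in> generated_algebra K X"

definition polynomial_functions :: "complex set \<Rightarrow> nat \<Rightarrow> ((nat \<Rightarrow> complex) \<Rightarrow> complex) set" where
  "polynomial_functions K n = generated_algebra K ((\<lambda>j a. a j) ` {..<n})"

definition zariski_closed_affine :: "complex set \<Rightarrow> nat \<Rightarrow> (nat \<Rightarrow> complex) set \<Rightarrow> bool" where
  "zariski_closed_affine K n Z \<longleftrightarrow> (\<exists>T\<subseteq>polynomial_functions K n.
     Z = {a \<in> {..<n} \<rightarrow>\<^sub>E Qbar. \<forall>g\<in>T. g a = 0})"

text \<open>The functions \<open>x 0, \<dots>, x (n - 1)\<close> embed the open set \<open>U\<close> as a Zariski closed subset of affine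
  \<open>n\<close>-space, with every regular function on \<open>U\<close> over \<open>K\<close> a polynomial in them. Hence \<open>U\<close> is
  affine as soon as it has affine coordinates.\<close>

definition affine_coordinates ::
    "complex set \<Rightarrow> proj1 set \<Rightarrow> nat \<Rightarrow> (nat \<Rightarrow> proj1 \<Rightarrow> complex) \<Rightarrow> bool" where
  "affine_coordinates K U n x \<longleftrightarrow> zariski_open K U \<and>
     (\<forall>j<n. regular_on K U (x j)) \<and>
     inj_on (\<lambda>P. \<lambda>j\<in>{..<n}. x j P) U \<and>
     zariski_closed_affine K n ((\<lambda>P. \<lambda>j\<in>{..<n}. x j P) ` U) \<and>
     (\<forall>g. regular_on K U g \<longrightarrow> (\<exists>h\<in>generated_algebra K (x ` {..<n}). \<forall>P\<in>U. g P = h P))"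

section \<open>Weil functions and integral points\<close>

text \<open>Basic neighbourhoods for the \<open>w\<close>-adic topology, in the charts \<open>x/y\<close> and \<open>y/x\<close>.\<close>

fun w_ball :: "(complex \<Rightarrow> real) \<Rightarrow> proj1 \<Rightarrow> real \<Rightarrow> proj1 set" where
  "w_ball w (Affine a) e = Affine ` {b \<in> Qbar. w (b - a) < e}"
| "w_ball w At_Infinity e = insert At_Infinity (Affine ` {b \<in> Qbar. b \<noteq> 0 \<and> w (1 / b) < e})"

definition w_topology :: "(complex \<Rightarrow> real) \<Rightarrow> proj1 topology" where
  "w_topology w = topology_generated_by {w_ball w P e | P e. P \<in> P1 \<and> e > 0}"

definition affine_MK_bounded ::
    "complex set \<Rightarrow> nat \<Rightarrow> (nat \<Rightarrow> proj1 \<Rightarrow> complex) \<Rightarrow> (proj1 \<times> (complex \<Rightarrow> real)) set \<Rightarrow> bool" where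
  "affine_MK_bounded K n x E \<longleftrightarrow> (\<exists>\<gamma>. MK_constant K \<gamma> \<and>
     (\<forall>(P, w)\<in>E. \<forall>j<n. w (x j P) \<le> exp (\<gamma> (restrict w K))))"

definition locally_MK_bounded ::
    "complex set \<Rightarrow> proj1 set \<Rightarrow> (proj1 \<Rightarrow> (complex \<Rightarrow> real) \<Rightarrow> real) \<Rightarrow> bool" where
  "locally_MK_bounded K U \<alpha> \<longleftrightarrow> (\<forall>U' n x E. U' \<subseteq> U \<and> affine_coordinates K U' n x \<and>
     E \<subseteq> U' \<times> abs_Qbar K \<and> affine_MK_bounded K n x E \<longrightarrow>
     (\<exists>\<gamma>. MK_constant K \<gamma> \<and> (\<forall>(P, w)\<in>E. \<bar>\<alpha> P w\<bar> \<le> \<gamma> (restrict w K))))"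

text \<open>Only the values \<open>L P w\<close> with \<open>P\<close> outside the support of \<open>D\<close> and \<open>w \<in> abs_Qbar K\<close> matter.\<close>

definition weil_function ::
    "complex set \<Rightarrow> divisor \<Rightarrow> (proj1 \<Rightarrow> (complex \<Rightarrow> real) \<Rightarrow> real) \<Rightarrow> bool" where
  "weil_function K D L \<longleftrightarrow> (\<forall>U f. zariski_open K U \<and> rational_function K f \<and> represents D U f \<longrightarrow>
     (\<exists>\<alpha>. (\<forall>P\<in>U - Poly_Mapping.keys D. \<forall>w\<in>abs_Qbar K. L P w = - ln (w (rf_value f P)) + \<alpha> P w) \<and>
        (\<forall>w\<in>abs_Qbar K. continuous_map (subtopology (w_topology w) U) euclideanreal (\<lambda>P. \<alpha> P w)) \<and>
        locally_MK_bounded K U \<alpha>))"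

definition integral_points ::
    "complex set \<Rightarrow> divisor \<Rightarrow> (complex \<Rightarrow> real) set \<Rightarrow> proj1 set \<Rightarrow> bool" where
  "integral_points K D S R \<longleftrightarrow> R \<subseteq> P1 - Poly_Mapping.keys D \<and>
     (\<exists>L. weil_function K D L \<and>
       (\<forall>v\<in>places K - S. \<forall>w\<in>abs_Qbar K. restrict w K = v \<longrightarrow> (\<forall>P\<in>R. L P w \<le> 0)))"

end

(* Let Q be a point in the support of D and B the height bound. For all but finitely many primes p, an integral
   point stays away from Q at every place over p. A point of degree e <= d corresponds to its minimal polynomial
   over the integers, an integer vector in a box of side T of order B^d, and Eisenstein polynomials show that a
   positive proportion of the box occurs, so it suffices that integral points use a vanishing proportion.
   If Q is affine, write Q = gamma / b with gamma an algebraic integer. If the minimal polynomial f (of degree d)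
   stays irreducible over the field generated by gamma, then a prime dividing the norm of b^d f(gamma / b) gives a place
   at which a root of f is close to Q; so this norm is an S-unit, and S-units are sparse. If f becomes
   reducible there, then f is reducible modulo each prime having a place of degree one, a condition that
   a sieve over finitely many such primes shows to be rare. If Q is at infinity, the leading coefficient of f is
   an S-unit. *)

theory Submission
  imports "Berlekamp_Zassenhaus.Factor_Bound" "Jordan_Normal_Form.Spectral_Radius" Defs
begin

hide_const (open) Mahler_Measure.height Henstock_Kurzweil_Integration.content

section \<open>Subrings, adjunction and number fields\<close>

text \<open>The exceptional primes are finite in number because an M_K-constant vanishes at almost
  all places: there the bounded correction term of the Weil function is zero, and closeness to
  \<open>Q\<close> makes its value strictly positive. Contradicting integrality takes an absolute
  value on all of \<open>Qbar\<close> at which a prescribed element is small. It comes from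
  Chevalley's theorem: if \<open>p\<close> and \<open>y\<close> generate a proper ideal of a ring,
  both are non-units in some valuation ring above it. So each place is obtained by checking that one
  ideal is proper, which is a matter of polynomial identities. For
  \<open>y = b * \<alpha> - \<gamma>\<close>, a relation \<open>p * u + y * v = 1\<close> is lifted
  to polynomials over \<open>\<int>[\<gamma>]\<close>; the lifted difference vanishes at
  \<open>\<alpha>\<close>, hence is a multiple of \<open>f\<close>, and evaluation at
  \<open>\<gamma> / b\<close> kills the factor that lifts \<open>y\<close>. This requires
  \<open>f\<close> to be minimal for \<open>\<alpha>\<close> over the field of
  \<open>\<gamma>\<close> too, which is why the other polynomials have to be sieved out. Points of
  degree below \<open>d\<close> are harmless: padded with zeros, their coefficient vectors lie in a
  hyperplane of the box.\<close>

definition subring :: "complex set \<Rightarrow> bool" where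
  "subring R \<longleftrightarrow> 1 \<in> R \<and> (\<forall>x\<in>R. \<forall>y\<in>R. x - y \<in> R \<and> x * y \<in> R)"

text \<open>Rings are sets of complex numbers here, so \<open>R[x]\<close> is a set inside one fixed
  type of polynomials. This lets the integers, the rationals, \<open>\<int>[\<gamma>]\<close>,
  number fields and valuation rings be mixed in one computation.\<close>

definition polys_over :: "complex set \<Rightarrow> complex poly set" where
  "polys_over R = {p. \<forall>i. coeff p i \<in> R}"

definition adjoin :: "complex set \<Rightarrow> complex \<Rightarrow> complex set" where
  "adjoin R x = (\<lambda>p. poly p x) ` polys_over R"

lemma subring_1: "subring R \<Longrightarrow> 1 \<in> R"
  and subring_diff: "subring R \<Longrightarrow> x \<in> R \<Longrightarrow> y \<in> R \<Longrightarrow> x - y \<in> R"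
  and subring_mult: "subring R \<Longrightarrow> x \<in> R \<Longrightarrow> y \<in> R \<Longrightarrow> x * y \<in> R"
  by (auto simp: subring_def)

lemma subring_0: "subring R \<Longrightarrow> 0 \<in> R"
  using subring_diff[of R 1 1] subring_1 by simp

lemma subring_minus: "subring R \<Longrightarrow> x \<in> R \<Longrightarrow> - x \<in> R"
  using subring_diff[of R 0 x] subring_0 by simp

lemma subring_add: "subring R \<Longrightarrow> x \<in> R \<Longrightarrow> y \<in> R \<Longrightarrow> x + y \<in> R"
  using subring_diff[of R x "- y"] subring_minus by simp

lemma subring_power: "subring R \<Longrightarrow> x \<in> R \<Longrightarrow> x ^ n \<in> R"
  by (induction n) (auto intro: subring_1 subring_mult)

lemma subring_sum: "subring R \<Longrightarrow> (\<And>i. i \<in> A \<Longrightarrow> f i \<in> R) \<Longrightarrow> sum f A \<in> R"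
  by (induction A rule: infinite_finite_induct) (auto intro: subring_0 subring_add)

lemma subring_of_nat: "subring R \<Longrightarrow> of_nat n \<in> R"
  by (induction n) (auto intro: subring_0 subring_1 subring_add)

lemma subring_of_int: "subring R \<Longrightarrow> of_int n \<in> R"
  by (cases n rule: int_cases2) (auto intro: subring_of_nat subring_minus)

lemma subring_Ints: "subring \<int>" and subring_Rats: "subring \<rat>"
  by (auto simp: subring_def)

lemma subring_poly:
  assumes "subring R" "p \<in> polys_over R" "x \<in> R"
  shows "poly p x \<in> R"
  unfolding poly_altdef using assms
  by (auto simp: polys_over_def intro!: subring_sum subring_mult subring_power)

lemma polys_over_mono: "R \<subseteq> S \<Longrightarrow> polys_over R \<subseteq> polys_over S"
  by (auto simp: polys_over_def)

lemma polys_over_diff: "subring R \<Longrightarrow> p \<in> polys_over R \<Longrightarrow> q \<in> polys_over R \<Longrightarrow> p - q \<in> polys_over R"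
  by (auto simp: polys_over_def intro: subring_diff)

lemma polys_over_add: "subring R \<Longrightarrow> p \<in> polys_over R \<Longrightarrow> q \<in> polys_over R \<Longrightarrow> p + q \<in> polys_over R"
  by (auto simp: polys_over_def intro: subring_add)

lemma polys_over_mult: "subring R \<Longrightarrow> p \<in> polys_over R \<Longrightarrow> q \<in> polys_over R \<Longrightarrow> p * q \<in> polys_over R"
  by (auto simp: polys_over_def coeff_mult intro!: subring_sum subring_mult)

lemma polys_over_smult: "subring R \<Longrightarrow> c \<in> R \<Longrightarrow> q \<in> polys_over R \<Longrightarrow> smult c q \<in> polys_over R"
  by (auto simp: polys_over_def intro!: subring_mult)

lemma polys_over_pCons: "c \<in> R \<Longrightarrow> q \<in> polys_over R \<Longrightarrow> pCons c q \<in> polys_over R"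
  by (auto simp: polys_over_def coeff_pCons split: nat.splits)

lemma polys_over_0: "subring R \<Longrightarrow> 0 \<in> polys_over R"
  by (auto simp: polys_over_def subring_0)

lemma polys_over_monom: "subring R \<Longrightarrow> c \<in> R \<Longrightarrow> monom c n \<in> polys_over R"
  by (auto simp: polys_over_def subring_0)

lemma polys_over_power: "subring R \<Longrightarrow> p \<in> polys_over R \<Longrightarrow> p ^ n \<in> polys_over R"
proof (induction n)
  case 0
  then show ?case by (auto simp: polys_over_def coeff_1 subring_0 subring_1)
next
  case (Suc n)
  then show ?case by (auto intro: polys_over_mult)
qed

lemma polys_over_Ints_iff: "p \<in> polys_over \<int> \<longleftrightarrow> (\<exists>q. p = map_poly of_int q)"
proof
  assume *: "p \<in> polys_over \<int>"
  \<comment> \<open>The second conjunct makes the chosen coefficients vanish beyond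
    \<open>degree p\<close>, so that they form a polynomial.\<close>
  have "\<exists>r. coeff p i = of_int r \<and> (coeff p i = 0 \<longrightarrow> r = 0)" for i
  proof -
    have "coeff p i \<in> \<int>" using * by (simp add: polys_over_def)
    then obtain r where "coeff p i = of_int r" by (rule Ints_cases)
    then show ?thesis by (intro exI[of _ r]) auto
  qed
  then obtain r where r: "\<And>i. coeff p i = of_int (r i)" "\<And>i. coeff p i = 0 \<Longrightarrow> r i = 0" by metis
  have "coeff (Abs_poly r) = r"
    by (rule Abs_poly_inverse) (use r(2) in \<open>auto simp: MOST_nat intro!: exI[of _ "degree p"] coeff_eq_0\<close>)
  then have "p = map_poly of_int (Abs_poly r)"
    by (intro poly_eqI) (simp add: coeff_map_poly r(1))
  then show "\<exists>q. p = map_poly of_int q" ..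
qed (auto simp: polys_over_def coeff_map_poly)

lemma polys_over_Rats_iff: "p \<in> polys_over \<rat> \<longleftrightarrow> (\<exists>q. p = map_poly of_rat q)"
proof
  assume *: "p \<in> polys_over \<rat>"
  have "\<exists>r. coeff p i = of_rat r \<and> (coeff p i = 0 \<longrightarrow> r = 0)" for i
  proof -
    have "coeff p i \<in> \<rat>" using * by (simp add: polys_over_def)
    then obtain r where "coeff p i = of_rat r" by (rule Rats_cases)
    then show ?thesis by (intro exI[of _ r]) auto
  qed
  then obtain r where r: "\<And>i. coeff p i = of_rat (r i)" "\<And>i. coeff p i = 0 \<Longrightarrow> r i = 0" by metis
  have "coeff (Abs_poly r) = r"
    by (rule Abs_poly_inverse) (use r(2) in \<open>auto simp: MOST_nat intro!: exI[of _ "degree p"] coeff_eq_0\<close>)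
  then have "p = map_poly of_rat (Abs_poly r)"
    by (intro poly_eqI) (simp add: coeff_map_poly r(1))
  then show "\<exists>q. p = map_poly of_rat q" ..
qed (auto simp: polys_over_def coeff_map_poly)

lemma adjoinI: "p \<in> polys_over R \<Longrightarrow> poly p x \<in> adjoin R x"
  by (auto simp: adjoin_def)

lemma subring_adjoin:
  assumes "subring R"
  shows "subring (adjoin R x)"
  unfolding subring_def
proof (intro conjI ballI)
  have "[:1:] \<in> polys_over R" by (intro polys_over_pCons polys_over_0 assms subring_1)
  from adjoinI[OF this] show "1 \<in> adjoin R x" by simp
next
  fix a b assume "a \<in> adjoin R x" "b \<in> adjoin R x"
  then obtain p q where *: "p \<in> polys_over R" "q \<in> polys_over R" "a = poly p x" "b = poly q x"
    by (auto simp: adjoin_def)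
  show "a - b \<in> adjoin R x" "a * b \<in> adjoin R x"
    using adjoinI[OF polys_over_diff[OF assms *(1,2)]] adjoinI[OF polys_over_mult[OF assms *(1,2)]] *
    by auto
qed

lemma subset_adjoin: "subring R \<Longrightarrow> R \<subseteq> adjoin R x"
proof
  fix c assume "subring R" "c \<in> R"
  then have "[:c:] \<in> polys_over R" by (intro polys_over_pCons polys_over_0)
  from adjoinI[OF this] show "c \<in> adjoin R x" by simp
qed

lemma adjoin_self: "subring R \<Longrightarrow> x \<in> adjoin R x"
proof -
  assume "subring R"
  then have "[:0, 1:] \<in> polys_over R" by (intro polys_over_pCons polys_over_0 subring_0 subring_1)
  from adjoinI[OF this] show ?thesis by simp
qed

lemma adjoin_Ints_iff: "y \<in> adjoin \<int> x \<longleftrightarrow> (\<exists>q. y = poly (map_poly of_int q) x)"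
  unfolding adjoin_def image_iff Bex_def polys_over_Ints_iff by blast

lemma adjoin_Rats_iff: "y \<in> adjoin \<rat> x \<longleftrightarrow> (\<exists>q. y = poly (map_poly of_rat q) x)"
  unfolding adjoin_def image_iff Bex_def polys_over_Rats_iff by blast

lemma is_subfield_subring: "is_subfield F \<Longrightarrow> subring F"
  by (auto simp: is_subfield_def subring_def)

lemma is_subfield_inverse: "is_subfield F \<Longrightarrow> x \<in> F \<Longrightarrow> inverse x \<in> F"
  by (auto simp: is_subfield_def)

lemma is_subfield_divide: "is_subfield F \<Longrightarrow> x \<in> F \<Longrightarrow> y \<in> F \<Longrightarrow> x / y \<in> F"
  by (simp add: divide_inverse is_subfield_inverse is_subfield_subring subring_mult)

lemma of_rat_eq_divide: "of_rat q = of_int (fst (quotient_of q)) / (of_int (snd (quotient_of q)) :: 'a :: field_char_0)"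
proof -
  have "q = of_int (fst (quotient_of q)) / of_int (snd (quotient_of q))"
    by (rule quotient_of_div) simp
  then have "of_rat q = (of_rat (of_int (fst (quotient_of q)) / of_int (snd (quotient_of q))) :: 'a)" by simp
  then show ?thesis by (simp add: of_rat_divide)
qed

lemma Rats_subset_subfield: "is_subfield F \<Longrightarrow> \<rat> \<subseteq> F"
  by (auto elim!: Rats_cases simp: of_rat_eq_divide intro!: is_subfield_divide subring_of_int is_subfield_subring)

text \<open>The division algorithm is run explicitly in order to see that quotient and remainder
  keep their coefficients in \<open>F\<close>: only divisions by \<open>lead_coeff b\<close>
  occur.\<close>

lemma polys_over_division:
  assumes F: "is_subfield F" and b: "b \<in> polys_over F" "b \<noteq> 0"
  shows "a \<in> polys_over F \<Longrightarrow> \<exists>q r. q \<in> polys_over F \<and> r \<in> polys_over F \<and> a = q * b + r \<and> (r = 0 \<or> degree r < degree b)"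
proof (induction "degree a" arbitrary: a rule: less_induct)
  case less
  note R = is_subfield_subring[OF F]
  show ?case
  proof (cases "a = 0 \<or> degree a < degree b")
    case True
    then show ?thesis using less.prems by (intro exI[of _ 0] exI[of _ a]) (auto intro: polys_over_0 R)
  next
    case False
    define m where "m = monom (lead_coeff a / lead_coeff b) (degree a - degree b)"
    have m: "m \<in> polys_over F" unfolding m_def
      using less.prems b by (intro polys_over_monom R is_subfield_divide F) (auto simp: polys_over_def)
    define a' where "a' = a - m * b"
    have a': "a' \<in> polys_over F" unfolding a'_def
      by (intro polys_over_diff polys_over_mult R less.prems m b)
    have nz: "lead_coeff a / lead_coeff b \<noteq> 0" using False b by auto
    have "a' = 0 \<or> degree a' < degree a"
    \<comment> \<open>For constants the cancellation of leading terms cannot be read off the degree,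
      since \<open>0\<close> has degree 0 as well; \<open>a'\<close> is then zero outright.\<close>
    proof (cases "degree a = 0")
      case True
      then have "degree b = 0" using False by auto
      then obtain c e where "a = [:c:]" "b = [:e:]" using True by (metis degree_eq_zeroE)
      then show ?thesis using b by (auto simp: a'_def m_def monom_0)
    next
      case False2: False
      have "degree (m * b) = degree a" using nz b False
        by (subst degree_mult_eq) (auto simp: m_def degree_monom_eq)
      moreover have "coeff (m * b) (degree a) = coeff a (degree a)"
        using nz b False lead_coeff_mult[of m b] calculation by (simp add: m_def degree_monom_eq)
      ultimately show ?thesis
        using False2 unfolding a'_def
        by (metis coeff_diff degree_diff_le leading_coeff_0_iff eq_iff le_less right_minus_eq)
    qed
    then show ?thesis
    proof
      assume "a' = 0"
      then show ?thesis using m by (intro exI[of _ m] exI[of _ 0]) (auto simp: a'_def intro: polys_over_0 R)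
    next
      assume "degree a' < degree a"
      from less.hyps[OF this a'] obtain q r where "q \<in> polys_over F" "r \<in> polys_over F" "a' = q * b + r"
        "r = 0 \<or> degree r < degree b" by blast
      then show ?thesis
        by (intro exI[of _ "q + m"] exI[of _ r]) (auto simp: a'_def algebra_simps intro: polys_over_add R m)
    qed
  qed
qed

text \<open>The remainder of a division over \<open>F\<close> is still divisible by \<open>b\<close>
  and has smaller degree, so it is zero and the quotient is already defined over
  \<open>F\<close>.\<close>

lemma polys_over_dvdE:
  assumes F: "is_subfield F" and b: "b \<in> polys_over F" and a: "a \<in> polys_over F" and dvd: "b dvd a"
  obtains q where "q \<in> polys_over F" "a = b * q"
proof (cases "b = 0")
  case True
  then show ?thesis using dvd that[of 0] by (auto intro: polys_over_0 is_subfield_subring F)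
next
  case False
  from polys_over_division[OF F b False a] obtain q r where *: "q \<in> polys_over F" "a = q * b + r"
    "r = 0 \<or> degree r < degree b" by blast
  then have "b dvd r" using dvd by (simp add: dvd_add_right_iff)
  then have "r = 0" using *(3) False by (auto dest: dvd_imp_degree_le)
  then show ?thesis using * that by (auto simp: mult.commute)
qed

section \<open>Algebraic numbers through finite-dimensional rational vector spaces\<close>

lemma algebraic_if_powers_in_span:
  assumes fin: "finite A" and sp: "\<And>i. z ^ i \<in> Q_complex.span A"
  shows "algebraic z"
\<comment> \<open>Either two of the first \<open>card A + 1\<close> powers coincide, or they are too
  many to be independent; each case gives a polynomial.\<close>
proof (cases "inj_on (\<lambda>i. z ^ i) {..card A}")
  case False
  then obtain i j where ij: "i \<noteq> j" "z ^ i = z ^ j" by (auto simp: inj_on_def)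
  have "monom 1 i \<noteq> (monom 1 j :: complex poly)" using ij(1)
    by (metis degree_monom_eq zero_neq_one)
  then show ?thesis using ij
    by (intro algebraicI'[of "monom 1 i - monom 1 j"]) (auto simp: poly_monom)
next
  case True
  let ?S = "(\<lambda>i. z ^ i) ` {..card A}"
  have card: "card ?S = Suc (card A)" using True by (simp add: card_image)
  have "Q_complex.dependent ?S"
  proof (rule ccontr)
    assume "Q_complex.independent ?S"
    from Q_complex.independent_span_bound[OF fin this] sp card show False by auto
  qed
  then obtain u where u: "\<exists>v\<in>?S. u v \<noteq> 0" "(\<Sum>v\<in>?S. of_rat (u v) * v) = 0"
    by (subst (asm) Q_complex.dependent_finite) auto
  from u(2) have s: "(\<Sum>i\<le>card A. of_rat (u (z ^ i)) * z ^ i) = 0"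
    by (subst (asm) sum.reindex[OF True]) simp
  let ?p = "\<Sum>i\<le>card A. monom (of_rat (u (z ^ i)) :: complex) i"
  have "poly ?p z = 0" using s by (simp add: poly_sum poly_monom)
  moreover have cf: "coeff ?p k = (if k \<le> card A then of_rat (u (z ^ k)) else 0)" for k
    by (simp add: coeff_sum)
  moreover from u(1) obtain k where "k \<le> card A" "u (z ^ k) \<noteq> 0" by auto
  with cf[of k] have "?p \<noteq> 0" by (auto simp del: coeff_sum)
  ultimately show ?thesis by (intro algebraicI'[of ?p]) auto
qed

text \<open>A space that contains 1 and is stable under multiplication by \<open>z\<close> contains
  all powers of \<open>z\<close>. The closure properties below are reduced to finding such a
  space.\<close>

lemma algebraic_if_mult_span:
  assumes fin: "finite A" and one: "1 \<in> Q_complex.span A"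
    and cl: "\<And>a. a \<in> A \<Longrightarrow> z * a \<in> Q_complex.span A"
  shows "algebraic z"
proof -
  have mul: "z * v \<in> Q_complex.span A" if "v \<in> Q_complex.span A" for v
    using that
  proof (induction rule: Q_complex.span_induct_alt)
    case base
    show ?case by (simp add: Q_complex.span_zero)
  next
    case (step c x y)
    have "z * (of_rat c * x + y) = of_rat c * (z * x) + z * y" by (simp add: algebra_simps)
    then show ?case using cl[OF step(1)] step by (metis Q_complex.span_add Q_complex.span_scale)
  qed
  have "z ^ i \<in> Q_complex.span A" for i
    by (induction i) (auto intro: one mul)
  then show ?thesis using algebraic_if_powers_in_span[OF fin] by blast
qed

lemma Rats_mult_span: "c \<in> \<rat> \<Longrightarrow> x \<in> Q_complex.span A \<Longrightarrow> c * x \<in> Q_complex.span A"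
  by (elim Rats_cases) (auto intro: Q_complex.span_scale)

lemma algebraic_power_reduction:
  fixes x :: complex
  assumes "algebraic x"
  shows "\<exists>n c. n > 0 \<and> (\<forall>i. c i \<in> \<rat>) \<and> x ^ n = (\<Sum>i<n. c i * x ^ i)"
proof -
  from assms obtain p where p: "\<And>i. coeff p i \<in> \<rat>" "p \<noteq> 0" "poly p x = 0"
    unfolding algebraic_altdef by auto
  define n where "n = degree p"
  have "n > 0" using p unfolding n_def by (metis degree_eq_zeroE gr0I poly_const_conv pCons_0_0)
  let ?l = "lead_coeff p"
  have "0 = (\<Sum>i\<le>n. coeff p i * x ^ i)" using p(3) by (simp add: poly_altdef n_def)
  also have "\<dots> = (\<Sum>i<n. coeff p i * x ^ i) + ?l * x ^ n" by (simp add: n_def lessThan_Suc_atMost[symmetric])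
  finally have "?l * x ^ n = - (\<Sum>i<n. coeff p i * x ^ i)" by (simp add: eq_neg_iff_add_eq_0 add.commute)
  then have "x ^ n = - (\<Sum>i<n. coeff p i * x ^ i) / ?l" using p(2) by (simp add: field_simps)
  also have "\<dots> = (\<Sum>i<n. (- coeff p i / ?l) * x ^ i)"
    by (simp add: sum_divide_distrib sum_negf)
  finally show ?thesis using \<open>n > 0\<close> p(1) by (intro exI[of _ n] exI[of _ "\<lambda>i. - coeff p i / ?l"]) auto
qed

text \<open>The products \<open>x^i * y^j\<close> with exponents below the degrees of relations for
  \<open>x\<close> and \<open>y\<close> span a space stable under both multiplications, hence under
  those by \<open>x + y\<close> and \<open>x * y\<close>.\<close>

lemma algebraic_plus_mult:
  fixes x y :: complex
  assumes "algebraic x" "algebraic y"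
  shows "algebraic (x + y)" "algebraic (x * y)"
proof -
  obtain n :: nat and c :: "nat \<Rightarrow> complex" where n: "n > 0" "\<And>i. c i \<in> \<rat>" "x ^ n = (\<Sum>i<n. c i * x ^ i)"
    using algebraic_power_reduction[OF assms(1)] by auto
  obtain m :: nat and e :: "nat \<Rightarrow> complex" where m: "m > 0" "\<And>i. e i \<in> \<rat>" "y ^ m = (\<Sum>i<m. e i * y ^ i)"
    using algebraic_power_reduction[OF assms(2)] by auto
  define A where "A = (\<lambda>(i, j). x ^ i * y ^ j) ` ({..<n} \<times> {..<m})"
  have inA: "x ^ i * y ^ j \<in> Q_complex.span A" if "i < n" "j < m" for i j
    using that by (auto simp: A_def intro!: Q_complex.span_base)
  have fin: "finite A" by (auto simp: A_def)
  have one: "1 \<in> Q_complex.span A" using inA[of 0 0] n m by simp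
  have x: "x * a \<in> Q_complex.span A" if "a \<in> A" for a
  proof -
    from that obtain i j where ij: "i < n" "j < m" "a = x ^ i * y ^ j" by (auto simp: A_def)
    show ?thesis
    proof (cases "Suc i < n")
      case True
      then show ?thesis using inA[of "Suc i" j] ij by (simp add: mult.assoc)
    next
      case False
      then have "Suc i = n" using ij by simp
      then have "x * a = x ^ n * y ^ j" using ij by (metis mult.assoc power_Suc)
      also have "\<dots> = (\<Sum>i<n. c i * (x ^ i * y ^ j))" unfolding n(3) by (simp add: sum_distrib_right mult.assoc)
      finally show ?thesis by (auto intro!: Q_complex.span_sum Rats_mult_span n(2) inA ij)
    qed
  qed
  have y: "y * a \<in> Q_complex.span A" if "a \<in> A" for a
  proof -
    from that obtain i j where ij: "i < n" "j < m" "a = x ^ i * y ^ j" by (auto simp: A_def)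
    show ?thesis
    proof (cases "Suc j < m")
      case True
      then show ?thesis using inA[of i "Suc j"] ij by (simp add: mult_ac)
    next
      case False
      then have "Suc j = m" using ij by simp
      then have "y * a = x ^ i * y ^ m" using ij by (metis mult.left_commute power_Suc)
      also have "\<dots> = (\<Sum>j<m. e j * (x ^ i * y ^ j))" by (simp add: m(3) sum_distrib_left mult_ac)
      finally show ?thesis by (auto intro!: Q_complex.span_sum Rats_mult_span m(2) inA ij)
    qed
  qed
  show "algebraic (x + y)"
    by (rule algebraic_if_mult_span[OF fin one]) (auto simp: distrib_right intro: Q_complex.span_add x y)
  have xs: "x * v \<in> Q_complex.span A" if "v \<in> Q_complex.span A" for v
    using that
  proof (induction rule: Q_complex.span_induct_alt)
    case base
    show ?case by (simp add: Q_complex.span_zero)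
  next
    case (step c u v)
    have "x * (of_rat c * u + v) = of_rat c * (x * u) + x * v" by (simp add: algebra_simps)
    then show ?case using x[OF step(1)] step by (metis Q_complex.span_add Q_complex.span_scale)
  qed
  show "algebraic (x * y)"
    by (rule algebraic_if_mult_span[OF fin one]) (auto simp: mult.assoc intro: xs y)
qed

lemma is_subfield_Qbar: "is_subfield Qbar"
  unfolding is_subfield_def Qbar_def mem_Collect_eq
proof (intro conjI ballI)
  fix x y :: complex assume "x \<in> {x. algebraic x}" "y \<in> {x. algebraic x}"
  then show "algebraic (x - y)" "algebraic (x * y)"
    using algebraic_plus_mult[of x "- y"] algebraic_plus_mult[of x y] by auto
qed auto

lemma number_field_subset_Qbar: "number_field K \<Longrightarrow> K \<subseteq> Qbar"
proof
  fix z assume K: "number_field K" and z: "z \<in> K"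
  then obtain A where A: "finite A" "K \<subseteq> Q_complex.span A" by (auto simp: number_field_def)
  have "z ^ i \<in> K" for i using K z by (auto simp: number_field_def intro!: subring_power is_subfield_subring)
  then show "z \<in> Qbar" unfolding Qbar_def using algebraic_if_powers_in_span[OF A(1)] A(2) by auto
qed

text \<open>Products of a rational basis of \<open>K\<close> with the powers of \<open>t\<close>
  below \<open>degree p\<close> span a stable space. The fact is needed because regular functions
  are only controlled at points of \<open>Qbar\<close>, while the zeros of their denominators are a
  priori just complex.\<close>

lemma root_over_number_field:
  assumes K: "number_field K" and p: "p \<in> polys_over K" "p \<noteq> 0" and t: "poly p t = 0"
  shows "t \<in> Qbar"
proof -
  have F: "is_subfield K" using K by (auto simp: number_field_def)
  note R = is_subfield_subring[OF F]
  from K obtain A where A: "finite A" "K \<subseteq> Q_complex.span A" by (auto simp: number_field_def)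
  obtain B where B: "B \<subseteq> K" "Q_complex.independent B" "K \<subseteq> Q_complex.span B"
    using Q_complex.maximal_independent_subset by blast
  have finB: "finite B" using Q_complex.independent_span_bound[OF A(1) B(2)] A B by auto
  define n where "n = degree p"
  have "n > 0" using p t unfolding n_def by (metis degree_eq_zeroE gr0I poly_const_conv pCons_0_0)
  define C where "C = (\<lambda>(b, j). b * t ^ j) ` (B \<times> {..<n})"
  have finC: "finite C" using finB by (auto simp: C_def)
  have KC: "c * t ^ j \<in> Q_complex.span C" if "c \<in> K" "j < n" for c j
  proof -
    have "c \<in> Q_complex.span B" using that B by auto
    then show ?thesis
    proof (induction rule: Q_complex.span_induct_alt)
      case base
      show ?case by (simp add: Q_complex.span_zero)
    next
      case (step k x y)
      have "(of_rat k * x + y) * t ^ j = of_rat k * (x * t ^ j) + y * t ^ j" by (simp add: algebra_simps)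
      moreover have "x * t ^ j \<in> Q_complex.span C" using step(1) that
        by (intro Q_complex.span_base) (auto simp: C_def)
      ultimately show ?case using step by (metis Q_complex.span_add Q_complex.span_scale)
    qed
  qed
  let ?l = "lead_coeff p"
  have "0 = (\<Sum>i\<le>n. coeff p i * t ^ i)" using t by (simp add: poly_altdef n_def)
  also have "\<dots> = (\<Sum>i<n. coeff p i * t ^ i) + ?l * t ^ n" by (simp add: n_def lessThan_Suc_atMost[symmetric])
  finally have "?l * t ^ n = - (\<Sum>i<n. coeff p i * t ^ i)" by (simp add: eq_neg_iff_add_eq_0 add.commute)
  then have "t ^ n = - (\<Sum>i<n. coeff p i * t ^ i) / ?l" using p(2) by (simp add: field_simps)
  also have "\<dots> = (\<Sum>i<n. (- coeff p i / ?l) * t ^ i)"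
    by (simp add: sum_divide_distrib sum_negf)
  finally have tn: "t ^ n = (\<Sum>i<n. (- coeff p i / ?l) * t ^ i)" .
  have "algebraic t"
  proof (rule algebraic_if_mult_span[OF finC])
    show "1 \<in> Q_complex.span C" using KC[of 1 0] \<open>n > 0\<close> R by (simp add: subring_1)
    fix a assume "a \<in> C"
    then obtain b j where bj: "b \<in> B" "j < n" "a = b * t ^ j" by (auto simp: C_def)
    show "t * a \<in> Q_complex.span C"
    proof (cases "Suc j < n")
      case True
      then show ?thesis using KC[of b "Suc j"] bj B by (auto simp: mult_ac)
    next
      case False
      then have "Suc j = n" using bj by simp
      then have "t * a = b * t ^ n" using bj by (metis mult.left_commute power_Suc)
      also have "\<dots> = (\<Sum>i<n. (b * (- coeff p i / ?l)) * t ^ i)" unfolding tn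
        by (simp add: sum_distrib_left mult_ac)
      also have "\<dots> \<in> Q_complex.span C"
        using p B bj by (intro Q_complex.span_sum KC subring_mult R is_subfield_divide F subring_minus)
          (auto simp: polys_over_def)
      finally show ?thesis .
    qed
  qed
  then show ?thesis by (simp add: Qbar_def)
qed

section \<open>Minimal polynomials over the integers and heights\<close>

text \<open>The last clause makes \<open>f\<close> a generator of the kernel of evaluation at
  \<open>x\<close> on integer polynomials. Gauss's lemma is thereby built into the definition, and
  relations in \<open>\<int>[x]\<close> become divisibilities of integer polynomials.\<close>

definition minpoly_int :: "int poly \<Rightarrow> complex \<Rightarrow> bool" where
  "minpoly_int f x \<longleftrightarrow> content f = 1 \<and> lead_coeff f > 0 \<and>
     (\<forall>q. poly (map_poly of_int q) x = 0 \<longleftrightarrow> f dvd q)"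

lemma minpoly_int_content: "minpoly_int f x \<Longrightarrow> content f = 1"
  and minpoly_int_lead_coeff: "minpoly_int f x \<Longrightarrow> lead_coeff f > 0"
  and minpoly_int_dvd_iff: "minpoly_int f x \<Longrightarrow> poly (map_poly of_int q) x = 0 \<longleftrightarrow> f dvd q"
  by (auto simp: minpoly_int_def)

lemma minpoly_int_root: "minpoly_int f x \<Longrightarrow> poly (map_poly of_int f) x = 0"
  by (simp add: minpoly_int_dvd_iff)

lemma minpoly_int_nonzero: "minpoly_int f x \<Longrightarrow> f \<noteq> 0"
  by (auto simp: minpoly_int_def)

lemma degree_minpoly_int_pos:
  assumes "minpoly_int f x"
  shows "degree f > 0"
proof (rule ccontr)
  assume "\<not> degree f > 0"
  then obtain c where c: "f = [:c:]" by (metis degree_eq_zeroE gr0I)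
  then show False using minpoly_int_root[OF assms] minpoly_int_nonzero[OF assms] by simp
qed

text \<open>A non-zero annihilating polynomial \<open>g\<close> of least degree is made primitive
  with positive leading coefficient. Pseudo-division by \<open>g\<close> leaves a remainder that
  again vanishes at \<open>x\<close>, so \<open>g\<close> divides an integer multiple of every
  annihilating \<open>q\<close>; passing to the primitive part removes that integer.\<close>

lemma minpoly_int_exists:
  assumes "algebraic (x :: complex)"
  shows "\<exists>f. minpoly_int f x"
proof -
  define P where "P g \<longleftrightarrow> g \<noteq> 0 \<and> poly (map_poly of_int g) x = 0" for g :: "int poly"
  from assms obtain p where p: "\<forall>i. coeff p i \<in> \<int>" "p \<noteq> 0" "poly p x = 0" by (auto simp: algebraic_def)
  then have "p \<in> polys_over \<int>" by (simp add: polys_over_def)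
  then obtain q where "p = map_poly of_int q" by (auto simp: polys_over_Ints_iff)
  with p have "P q" by (auto simp: P_def)
  then obtain g where g: "P g" "\<And>h. P h \<Longrightarrow> degree g \<le> degree h"
    using arg_min_natI[of P q degree] arg_min_nat_le[of P _ degree] by blast
  have g0: "g \<noteq> 0" using g by (auto simp: P_def)
  define f where "f = smult (sgn (lead_coeff g)) (primitive_part g)"
  have sg: "sgn (lead_coeff g) = 1 \<or> sgn (lead_coeff g) = -1" using g0 by (auto simp: sgn_if)
  have gf: "g = smult (sgn (lead_coeff g) * content g) f"
    using sg content_times_primitive_part[of g] by (auto simp: f_def)
  have cg: "content g > 0" using g0 content_ge_0_int[of g] content_eq_zero_iff[of g] by linarith
  have cont: "content f = 1" using sg g0 by (auto simp: f_def)
  have "lead_coeff g = sgn (lead_coeff g) * content g * lead_coeff f"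
    using arg_cong[OF gf, of lead_coeff] by (simp only: lead_coeff_smult)
  then have lc: "lead_coeff f > 0" using sg cg g0
    by (smt (verit) leading_coeff_0_iff mult_minus1 mult_minus_left mult_1 sgn_1_neg sgn_1_pos zero_less_mult_iff mult_neg_pos)
  have root: "poly (map_poly of_int f) x = 0"
  proof -
    have "map_poly of_int g = smult (of_int (sgn (lead_coeff g) * content g)) (map_poly of_int f :: complex poly)"
      by (subst gf, rule poly_eqI) (simp add: coeff_map_poly)
    then have "of_int (sgn (lead_coeff g) * content g) * poly (map_poly of_int f) x = 0"
      using g(1) unfolding P_def by (metis poly_smult)
    then show ?thesis using sg cg by (auto simp del: of_int_mult)
  qed
  have "poly (map_poly of_int q) x = 0 \<longleftrightarrow> f dvd q" for q
  proof
    assume "f dvd q"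
    then obtain h where "q = f * h" by (rule dvdE)
    then show "poly (map_poly of_int q) x = 0" using root by (simp add: hom_distribs)
  next
    assume q: "poly (map_poly of_int q) x = 0"
    obtain a b where ab: "a \<noteq> 0" "smult a q = g * b + pseudo_mod q g" using pseudo_mod(1)[OF g0] by blast
    let ?r = "pseudo_mod q g"
    have r: "?r = 0 \<or> degree ?r < degree g" using pseudo_mod(2)[OF g0] .
    have "map_poly of_int (smult a q) = (map_poly of_int (g * b + ?r) :: complex poly)" using ab by simp
    then have "poly (map_poly of_int (smult a q)) x = poly (map_poly of_int (g * b + ?r)) x" by simp
    then have "poly (map_poly of_int ?r) x = 0" using q g(1) by (simp add: hom_distribs P_def)
    then have "?r = 0" using r g(2)[of ?r] by (fastforce simp: P_def)
    then have "g dvd smult a q" using ab by auto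
    then have "primitive_part g dvd q" using dvd_smult_int[OF ab(1)] by blast
    then show "f dvd q" using sg by (auto simp: f_def)
  qed
  then show ?thesis using cont lc by (auto simp: minpoly_int_def)
qed

lemma minpoly_int_unique:
  assumes "minpoly_int f x" "minpoly_int g x"
  shows "f = g"
proof -
  have "f dvd g" "g dvd f" using assms minpoly_int_root minpoly_int_dvd_iff by blast+
  then obtain h k where hk: "g = f * h" "f = g * k" unfolding dvd_def by blast
  have "f * (h * k) = f * 1" using hk by (metis mult.assoc mult.right_neutral)
  then have "h * k = 1" using minpoly_int_nonzero[OF assms(1)] by (simp only: mult_cancel_left) auto
  then have "h dvd 1" by (metis dvd_triv_left)
  then obtain c where c: "h = [:c:]" "c dvd 1" using is_unit_polyE by metis
  then have "c = 1 \<or> c = -1" by auto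
  moreover have g: "g = smult c f" using hk(1) c by simp
  moreover have "lead_coeff g = c * lead_coeff f" unfolding g by (rule lead_coeff_smult)
  ultimately have "c = 1" using minpoly_int_lead_coeff[OF assms(1)] minpoly_int_lead_coeff[OF assms(2)]
    by auto
  then show ?thesis using g by simp
qed

lemma minpoly_int_degree_le:
  assumes "minpoly_int f x" "q \<noteq> 0" "poly (map_poly of_int q) x = 0"
  shows "degree f \<le> degree q"
  using assms minpoly_int_dvd_iff by (metis dvd_imp_degree_le)

text \<open>The minimal polynomial \<open>g\<close> of \<open>z\<close> divides \<open>f\<close>,
  and the cofactor cannot vanish at \<open>x\<close> because its degree is too small; so
  \<open>g\<close> vanishes at \<open>x\<close> and \<open>f\<close> divides it in turn.\<close>

lemma minpoly_int_conjugate: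
  assumes f: "minpoly_int f x" and z: "poly (map_poly of_int f) z = 0"
  shows "minpoly_int f z"
proof -
  have "algebraic z" unfolding algebraic_def
    by (rule exI[of _ "map_poly of_int f"]) (use z minpoly_int_nonzero[OF f] in auto)
  then obtain g where g: "minpoly_int g z" using minpoly_int_exists by blast
  then obtain h where h: "f = g * h" using z minpoly_int_dvd_iff by (metis dvdE)
  have "poly (map_poly of_int g) x * poly (map_poly of_int h) x = 0"
    using minpoly_int_root[OF f] h by (simp add: hom_distribs)
  moreover have "poly (map_poly of_int h) x \<noteq> 0"
  proof
    assume "poly (map_poly of_int h) x = 0"
    moreover have "h \<noteq> 0" using h minpoly_int_nonzero[OF f] by auto
    ultimately have "degree f \<le> degree h" by (intro minpoly_int_degree_le[OF f])
    moreover have "degree f = degree g + degree h" using h minpoly_int_nonzero[OF f] by (auto simp: degree_mult_eq)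
    ultimately show False using degree_minpoly_int_pos[OF g] by simp
  qed
  ultimately have "f dvd g" using f minpoly_int_dvd_iff by simp
  then have "poly (map_poly of_int q) z = 0 \<longleftrightarrow> f dvd q" for q
    using g h minpoly_int_dvd_iff by (metis dvd_trans dvd_triv_left)
  then show ?thesis using f by (auto simp: minpoly_int_def)
qed

lemma minpoly_int_simple_root:
  fixes z :: complex
  assumes f: "minpoly_int f x" and z: "poly (map_poly of_int f) z = 0"
  shows "poly (map_poly of_int (pderiv f)) z \<noteq> 0"
proof
  assume *: "poly (map_poly of_int (pderiv f)) z = 0"
  have "pderiv f \<noteq> 0" using degree_minpoly_int_pos[OF f] by (simp add: pderiv_eq_0_iff)
  from minpoly_int_degree_le[OF minpoly_int_conjugate[OF f z] this *]
  show False using degree_minpoly_int_pos[OF f] by (simp add: degree_pderiv)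
qed

lemma minpoly_int_if_irreducible:
  assumes irr: "irreducible f" and "content f = 1" "lead_coeff f > 0" and x: "poly (map_poly of_int f) x = 0"
  shows "minpoly_int f x"
proof -
  have "f \<noteq> 0" using assms by auto
  then have "algebraic x" unfolding algebraic_def
    by (intro exI[of _ "map_poly of_int f"]) (use x in auto)
  then obtain g where g: "minpoly_int g x" using minpoly_int_exists by blast
  then obtain h where h: "f = g * h" using x minpoly_int_dvd_iff by (metis dvdE)
  have "\<not> g dvd 1" using degree_minpoly_int_pos[OF g] by (auto simp: poly_dvd_1)
  then have "h dvd 1" using irr h by (auto dest: irreducibleD)
  then obtain c where c: "h = [:c:]" "c dvd 1" using is_unit_polyE by metis
  then have "c = 1 \<or> c = -1" by auto
  moreover have "lead_coeff f = lead_coeff g * c" using h c by (simp add: lead_coeff_mult)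
  ultimately have "c = 1" using assms(3) minpoly_int_lead_coeff[OF g] by auto
  then show ?thesis using g h c by simp
qed

lemma map_poly_of_rat_mult: "map_poly of_rat (p * q) = (map_poly of_rat p * map_poly of_rat q :: complex poly)"
  and map_poly_of_rat_add: "map_poly of_rat (p + q) = (map_poly of_rat p + map_poly of_rat q :: complex poly)"
  and map_poly_of_rat_smult: "map_poly of_rat (smult c p) = (smult (of_rat c) (map_poly of_rat p) :: complex poly)"
  by (rule poly_eqI, simp add: coeff_map_poly coeff_mult of_rat_sum of_rat_mult of_rat_add)+

lemma minpoly_int_rat_dvd_iff:
  assumes f: "minpoly_int f x"
  shows "poly (map_poly of_rat q) x = 0 \<longleftrightarrow> map_poly of_int f dvd q"
proof
  have ri: "map_poly of_rat (map_poly of_int g :: rat poly) = (map_poly of_int g :: complex poly)" for g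
    by (rule poly_eqI) (simp add: coeff_map_poly)
  {
    assume "map_poly of_int f dvd q"
    then obtain h where "q = map_poly of_int f * h" by (rule dvdE)
    then show "poly (map_poly of_rat q) x = 0" using minpoly_int_root[OF f] by (simp add: map_poly_of_rat_mult ri)
  }
  assume q: "poly (map_poly of_rat q) x = 0"
  obtain d g where dg: "rat_to_normalized_int_poly q = (d, g)" by fastforce
  note * = rat_to_normalized_int_poly(1,2)[OF dg]
  have "poly (map_poly of_int g) x = 0" using q *(2) by (subst (asm) *(1)) (simp add: map_poly_of_rat_smult ri)
  then have "f dvd g" using f minpoly_int_dvd_iff by blast
  then obtain h where "g = f * h" by (rule dvdE)
  then show "map_poly of_int f dvd q" by (subst *(1)) (auto simp: hom_distribs intro: dvd_smult)
qed

lemma minpoly_int_independent: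
  assumes f: "minpoly_int f x" and c: "\<And>i. c i \<in> \<rat>" and s: "(\<Sum>i<degree f. c i * x ^ i) = 0" and i: "i < degree f"
  shows "c i = 0"
proof -
  let ?p = "\<Sum>i<degree f. monom (c i) i"
  have cf: "coeff ?p k = (if k < degree f then c k else 0)" for k by (simp add: coeff_sum)
  have "?p \<in> polys_over \<rat>" using c by (auto simp: polys_over_def cf simp del: coeff_sum)
  then obtain q where q: "?p = map_poly of_rat q" by (auto simp: polys_over_Rats_iff)
  have "poly ?p x = 0" using s by (simp add: poly_sum poly_monom)
  then have dvd: "map_poly of_int f dvd q" using minpoly_int_rat_dvd_iff[OF f] q by simp
  have "degree q < degree f"
  proof -
    have "degree ?p \<le> degree f - 1" by (rule degree_le) (auto simp: cf simp del: coeff_sum)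
    then show ?thesis using degree_minpoly_int_pos[OF f] q by simp
  qed
  then have "q = 0" using dvd by (auto dest: dvd_imp_degree_le)
  then have "?p = 0" using q by simp
  then show ?thesis using cf[of i] i by (simp del: coeff_sum)
qed

text \<open>Only inverses need an argument. The minimal polynomial of a non-zero \<open>y\<close>
  has the form \<open>c + X * g\<close> with \<open>c\<close> non-zero, so
  \<open>inverse y = - g(y) / c\<close>.\<close>

lemma adjoin_Rats_subfield:
  assumes "algebraic x"
  shows "is_subfield (adjoin \<rat> x)"
proof -
  note R = subring_adjoin[OF subring_Rats, of x]
  have inv: "inverse y \<in> adjoin \<rat> x" if y: "y \<in> adjoin \<rat> x" for y
  proof (cases "y = 0")
    case True
    then show ?thesis using subring_0[OF R] by simp
  next
    case False
    have "adjoin \<rat> x \<subseteq> Qbar"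
    proof
      fix z assume "z \<in> adjoin \<rat> x"
      then obtain p where "p \<in> polys_over \<rat>" "z = poly p x" by (auto simp: adjoin_def)
      then show "z \<in> Qbar"
        using subring_poly[OF is_subfield_subring[OF is_subfield_Qbar], of p x]
          Rats_subset_subfield[OF is_subfield_Qbar] polys_over_mono[of \<rat> Qbar] assms
        by (auto simp: Qbar_def)
    qed
    then have "algebraic y" using y by (auto simp: Qbar_def)
    then obtain f where f: "minpoly_int f y" using minpoly_int_exists by blast
    have c0: "coeff f 0 \<noteq> 0"
    proof
      assume "coeff f 0 = 0"
      then obtain g where g: "f = pCons 0 g" by (cases f) auto
      then have "y * poly (map_poly of_int g) y = 0" using minpoly_int_root[OF f] by (simp add: of_int_hom.map_poly_pCons_hom)
      then have "poly (map_poly of_int g) y = 0" using False by simp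
      moreover have "g \<noteq> 0" using g minpoly_int_nonzero[OF f] by auto
      ultimately have "degree f \<le> degree g" by (intro minpoly_int_degree_le[OF f])
      then show False using g \<open>g \<noteq> 0\<close> by simp
    qed
    obtain c g where g: "f = pCons c g" by (cases f)
    let ?v = "poly (map_poly of_int g) y"
    have eq: "of_int c + y * ?v = 0" using minpoly_int_root[OF f] g by (simp add: of_int_hom.map_poly_pCons_hom)
    have "c \<noteq> 0" using c0 g by simp
    then have "inverse y = - inverse (of_int c) * ?v" using eq False
      by (simp add: field_simps eq_neg_iff_add_eq_0 add.commute)
    moreover have "?v \<in> adjoin \<rat> x"
      by (rule subring_poly[OF R]) (auto simp: polys_over_def coeff_map_poly y intro: subring_of_int[OF R])
    moreover have "- inverse (of_int c) \<in> adjoin \<rat> x"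
      using subset_adjoin[OF subring_Rats, of x] by auto
    ultimately show ?thesis using subring_mult[OF R] by metis
  qed
  then show ?thesis using R by (auto simp: is_subfield_def subring_def)
qed

lemma field_generated_singleton:
  assumes "algebraic x"
  shows "field_generated {x} = adjoin \<rat> x"
proof
  show "field_generated {x} \<subseteq> adjoin \<rat> x"
    unfolding field_generated_def using adjoin_Rats_subfield[OF assms] adjoin_self[OF subring_Rats, of x] by blast
  show "adjoin \<rat> x \<subseteq> field_generated {x}"
  proof
    fix z assume "z \<in> adjoin \<rat> x"
    then obtain p where p: "p \<in> polys_over \<rat>" "z = poly p x" by (auto simp: adjoin_def)
    have "z \<in> F" if "is_subfield F" "x \<in> F" for F
      using subring_poly[OF is_subfield_subring[OF that(1)], of p x] p that
        polys_over_mono[OF Rats_subset_subfield[OF that(1)]] by auto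
    then show "z \<in> field_generated {x}" by (auto simp: field_generated_def)
  qed
qed

lemma degree_over_Q_field_generated:
  assumes f: "minpoly_int f x"
  shows "degree_over_Q (field_generated {x}) = degree f"
proof -
  have alg: "algebraic x" unfolding algebraic_def
    by (intro exI[of _ "map_poly of_int f"]) (use minpoly_int_root[OF f] minpoly_int_nonzero[OF f] in auto)
  let ?n = "degree f"
  let ?B = "(\<lambda>i. x ^ i) ` {..<?n}"
  have inj: "inj_on (\<lambda>i. x ^ i) {..<?n}"
  proof (rule inj_onI, rule ccontr)
    fix i j assume ij: "i \<in> {..<?n}" "j \<in> {..<?n}" "x ^ i = x ^ j" "i \<noteq> j"
    define c :: "nat \<Rightarrow> complex" where "c = (\<lambda>k. if k = i then 1 else if k = j then -1 else 0)"
    have "(\<Sum>k<?n. c k * x ^ k) = (\<Sum>k\<in>{i, j}. c k * x ^ k)"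
      by (rule sum.mono_neutral_right) (use ij in \<open>auto simp: c_def\<close>)
    also have "\<dots> = 0" using ij by (auto simp: c_def)
    finally have s: "(\<Sum>k<?n. c k * x ^ k) = 0" .
    have "c k \<in> \<rat>" for k by (simp add: c_def)
    from minpoly_int_independent[OF f this s, of i] ij(1) have "c i = 0" by simp
    then show False by (simp add: c_def)
  qed
  have ind: "Q_complex.independent ?B"
  proof
    assume "Q_complex.dependent ?B"
    then obtain u where u: "\<exists>v\<in>?B. u v \<noteq> 0" "(\<Sum>v\<in>?B. of_rat (u v) * v) = 0"
      by (subst (asm) Q_complex.dependent_finite) auto
    from u(2) have s: "(\<Sum>i<?n. of_rat (u (x ^ i)) * x ^ i) = 0"
      by (subst (asm) sum.reindex[OF inj]) simp
    have "of_rat (u (x ^ i)) = (0::complex)" if "i < ?n" for i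
      using minpoly_int_independent[OF f _ s that] by simp
    then show False using u(1) by auto
  qed
  have sub: "?B \<subseteq> adjoin \<rat> x"
    by (auto intro!: subring_power subring_adjoin subring_Rats adjoin_self)
  have "adjoin \<rat> x \<subseteq> Q_complex.span ?B"
  proof
    fix z assume "z \<in> adjoin \<rat> x"
    then obtain q where q: "z = poly (map_poly of_rat q) x" by (auto simp: adjoin_Rats_iff)
    define g where "g = (map_poly of_int f :: rat poly)"
    define r where "r = q mod g"
    have g0: "g \<noteq> 0" "degree g = ?n" using minpoly_int_nonzero[OF f] by (auto simp: g_def)
    have "poly (map_poly of_rat g) x = 0" using minpoly_int_rat_dvd_iff[OF f, of g] by (simp add: g_def)
    then have "z = poly (map_poly of_rat r) x"
    proof -
      have "q = q div g * g + r" by (simp add: r_def)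
      then have "z = poly (map_poly of_rat (q div g * g + r)) x" using q by simp
      also have "\<dots> = poly (map_poly of_rat r) x"
        unfolding map_poly_of_rat_mult map_poly_of_rat_add using \<open>poly (map_poly of_rat g) x = 0\<close> by simp
      finally show ?thesis .
    qed
    also have "\<dots> = (\<Sum>i<?n. of_rat (coeff r i) * x ^ i)"
    proof -
      have "degree r < ?n" using degree_mod_less'[of g q] g0 degree_minpoly_int_pos[OF f]
        by (cases "r = 0") (auto simp: r_def)
      then show ?thesis unfolding poly_altdef
        by (intro sum.mono_neutral_cong_left) (auto simp: coeff_map_poly coeff_eq_0)
    qed
    also have "\<dots> \<in> Q_complex.span ?B"
      by (intro Q_complex.span_sum Q_complex.span_scale Q_complex.span_base) auto
    finally show "z \<in> Q_complex.span ?B" .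
  qed
  from Q_complex.dim_unique[OF sub this ind card_image[OF inj]]
  show ?thesis by (simp add: degree_over_Q_def field_generated_singleton[OF alg])
qed

section \<open>Comparison with the given minimal polynomials, denominators and heights\<close>

lemma min_poly_Q_eq:
  assumes f: "minpoly_int f x"
  shows "min_poly_Q x = smult (inverse (of_int (lead_coeff f))) (map_poly of_int f)" (is "_ = ?m")
proof -
  define M where "M = ?m"
  have lc: "lead_coeff f \<noteq> 0" using minpoly_int_nonzero[OF f] by simp
  have iff: "poly (map_poly of_rat g) x = 0 \<longleftrightarrow> M dvd g" for g
    using minpoly_int_rat_dvd_iff[OF f, of g] lc by (simp add: smult_dvd_iff M_def)
  have lm: "lead_coeff M = 1" using lc by (simp add: M_def)
  have *: "degree M \<le> degree g" if "g \<noteq> 0" "poly (map_poly of_rat g) x = 0" for g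
    using iff[of g] that dvd_imp_degree_le by blast
  have rM: "poly (map_poly of_rat M) x = 0" using iff[of M] by simp
  show ?thesis unfolding min_poly_Q_def M_def[symmetric]
  proof (rule the_equality)
  show "lead_coeff M = 1 \<and> poly (map_poly of_rat M) x = 0 \<and>
     (\<forall>g. g \<noteq> 0 \<and> poly (map_poly of_rat g) x = 0 \<longrightarrow> degree M \<le> degree g)"
    using * lm rM by blast
  fix m assume m: "lead_coeff m = 1 \<and> poly (map_poly of_rat m) x = 0 \<and>
     (\<forall>g. g \<noteq> 0 \<and> poly (map_poly of_rat g) x = 0 \<longrightarrow> degree m \<le> degree g)"
  then have "M dvd m" using iff by blast
  then obtain h where h: "m = M * h" by (rule dvdE)
  have m0: "M \<noteq> 0" "m \<noteq> 0" using lm m by auto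
  have "degree m \<le> degree M" using m m0 rM by blast
  moreover have "degree m = degree M + degree h" using h m0 by (metis degree_mult_eq mult_zero_right)
  ultimately have "degree h = 0" by simp
  then obtain c where c: "h = [:c:]" by (metis degree_eq_zeroE)
  have "lead_coeff m = lead_coeff M * lead_coeff h" using h lead_coeff_mult by metis
  then have "c = 1" using m lm c by simp
  then show "m = M" using h c by simp
qed
qed

text \<open>If \<open>n\<close> clears the denominators of the monic polynomial, then
  \<open>lead_coeff f * g = n * f\<close> for an integral \<open>g\<close>. As \<open>f\<close> is
  primitive, comparing contents shows that \<open>lead_coeff f\<close> divides
  \<open>n\<close>.\<close>

lemma denominator_poly_eq:
  assumes f: "minpoly_int f x"
  shows "denominator_poly (min_poly_Q x) = nat (lead_coeff f)"
  unfolding denominator_poly_def min_poly_Q_eq[OF f]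
proof (rule Least_equality)
  have lc: "lead_coeff f > 0" using minpoly_int_lead_coeff[OF f] .
  have lc': "rat_of_int (lead_coeff f) \<noteq> 0" using minpoly_int_nonzero[OF f] by simp
  have "map_poly of_int f = smult (of_nat (nat (lead_coeff f))) (smult (inverse (of_int (lead_coeff f))) (map_poly of_int f :: rat poly))"
    using lc lc' by simp
  then show "nat (lead_coeff f) > 0 \<and> (\<exists>g :: int poly. map_poly of_int g = smult (of_nat (nat (lead_coeff f)))
     (smult (inverse (of_int (lead_coeff f))) (map_poly of_int f :: rat poly)))" using lc by auto
  fix n assume "n > 0 \<and> (\<exists>g :: int poly. map_poly of_int g = smult (of_nat n)
     (smult (inverse (of_int (lead_coeff f))) (map_poly of_int f :: rat poly)))"
  then obtain g :: "int poly" where n: "n > 0" and g: "map_poly of_int g = smult (of_nat n)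
     (smult (inverse (of_int (lead_coeff f))) (map_poly of_int f :: rat poly))" by blast
  have "map_poly of_int (smult (lead_coeff f) g) = (map_poly of_int (smult (int n) f) :: rat poly)"
    using lc' by (simp add: hom_distribs g mult.left_commute[of "rat_of_int _"] del: of_int_eq_0_iff)
  then have "smult (lead_coeff f) g = smult (int n) f" by simp
  then have "content (smult (lead_coeff f) g) = content (smult (int n) f)" by simp
  then have "lead_coeff f * content g = int n"
    using lc minpoly_int_content[OF f] by simp
  then have "lead_coeff f dvd int n" by (metis dvd_triv_left)
  then have "lead_coeff f \<le> int n" using n by (auto intro: zdvd_imp_le)
  then show "nat (lead_coeff f) \<le> n" by simp
qed

lemma min_poly_Z_eq:
  assumes f: "minpoly_int f x"
  shows "min_poly_Z x = f"
  unfolding min_poly_Z_def denominator_poly_eq[OF f] unfolding min_poly_Q_eq[OF f]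
proof (rule the_equality)
  have lc: "lead_coeff f > 0" using minpoly_int_lead_coeff[OF f] .
  have lc': "rat_of_int (lead_coeff f) \<noteq> 0" using minpoly_int_nonzero[OF f] by simp
  show eq: "map_poly of_int f = smult (of_nat (nat (lead_coeff f)))
    (smult (inverse (of_int (lead_coeff f))) (map_poly of_int f :: rat poly))"
    using lc lc' by simp
  fix g :: "int poly"
  assume "map_poly of_int g = smult (of_nat (nat (lead_coeff f)))
    (smult (inverse (of_int (lead_coeff f))) (map_poly of_int f :: rat poly))"
  then have "map_poly of_int g = (map_poly of_int f :: rat poly)" using eq by simp
  then show "g = f" by simp
qed

lemma conjugates_eq:
  assumes f: "minpoly_int f x"
  shows "conjugates x = {z. poly (map_poly of_int f) z = 0}"
proof -
  have lc: "lead_coeff f > 0" using minpoly_int_lead_coeff[OF f] .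
  have "map_poly of_rat (min_poly_Q x) = smult (inverse (of_int (lead_coeff f))) (map_poly of_int f :: complex poly)"
    unfolding min_poly_Q_eq[OF f] by (rule poly_eqI) (simp add: coeff_map_poly of_rat_mult of_rat_inverse)
  then show ?thesis using lc by (auto simp: conjugates_def)
qed

text \<open>The height is a product over a set of conjugates, the Mahler measure a product over a
  list of roots with multiplicity. They agree because a repeated root would be a common root of
  \<open>f\<close> and its derivative.\<close>

lemma height_Affine:
  assumes f: "minpoly_int f x"
  shows "height (Affine x) = root (degree f) (mahler_measure f)"
proof -
  let ?F = "map_poly of_int f :: complex poly"
  define as where "as = complex_roots_complex ?F"
  note as = complex_roots[of ?F, folded as_def]
  have F0: "?F \<noteq> 0" using minpoly_int_nonzero[OF f] by simp
  have set: "set as = conjugates x"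
  proof -
    have "poly ?F z = 0 \<longleftrightarrow> z \<in> set as" for z
      by (subst as(1)[symmetric]) (use F0 in \<open>auto simp: poly_prod_list prod_list_zero_iff\<close>)
    then show ?thesis by (auto simp: conjugates_eq[OF f])
  qed
  have "distinct as"
  proof (rule ccontr)
    assume "\<not> distinct as"
    then obtain xs ys zs a where a: "as = xs @ [a] @ ys @ [a] @ zs" using not_distinct_decomp by blast
    define R where "R = smult (lead_coeff ?F) (\<Prod>b\<leftarrow>xs @ ys @ zs. [:- b, 1:])"
    have perm: "prod_list (map L as) = L a * (L a * prod_list (map L (xs @ ys @ zs)))"
      for L :: "complex \<Rightarrow> complex poly" by (simp add: a mult_ac)
    have eq: "?F = [:- a, 1:] * ([:- a, 1:] * R)"
      by (subst as(1)[symmetric]) (simp only: perm R_def mult_smult_right)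
    have "poly (pderiv ?F) a = 0" unfolding eq pderiv_mult poly_add poly_mult by simp
    moreover have "poly ?F a = 0" unfolding eq poly_mult by simp
    ultimately show False using minpoly_int_simple_root[OF f, of a]
      unfolding of_int_hom.map_poly_pderiv by blast
  qed
  then have "(\<Prod>z\<in>conjugates x. max 1 (norm z)) = (\<Prod>z\<leftarrow>as. max 1 (norm z))"
    unfolding set[symmetric] by (rule prod.distinct_set_conv_list)
  moreover have "of_int (lead_coeff f) = norm (lead_coeff ?F)" using minpoly_int_lead_coeff[OF f] by simp
  ultimately have "of_int (lead_coeff f) * (\<Prod>z\<in>conjugates x. max 1 (norm z)) = mahler_measure f"
    unfolding mahler_measure_def mahler_measure_poly_def as_def by (simp only:)
  then show ?thesis
    unfolding height.simps degree_over_Q_field_generated[OF f] min_poly_Z_eq[OF f] by (simp only:)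
qed

section \<open>Extending p-adic absolute values\<close>

definition padic_places :: "nat \<Rightarrow> (complex \<Rightarrow> real) set" where
  "padic_places p = {w. absolute_value_on Qbar w \<and>
     (\<forall>x\<in>Qbar. \<forall>y\<in>Qbar. w (x + y) \<le> max (w x) (w y)) \<and>
     (\<forall>q. w (of_rat q) = padic_abs p q)}"

text \<open>The two relations say that the ideal \<open>J\<close> becomes the unit ideal both in
  \<open>V[x]\<close> and in \<open>V[1/x]\<close>. The one of smaller or equal degree serves to
  remove the leading term of the other, so the sum of the degrees could be lowered forever.\<close>

lemma chevalley_reduction:
  assumes V: "subring V" and J: "\<And>a b. a \<in> J \<Longrightarrow> b \<in> J \<Longrightarrow> a + b \<in> J"
    "\<And>a v. a \<in> J \<Longrightarrow> v \<in> V \<Longrightarrow> v * a \<in> J" "0 \<in> J" "1 \<notin> J" "J \<subseteq> V"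
  shows "x \<noteq> 0 \<Longrightarrow> P \<in> polys_over J \<Longrightarrow> Q \<in> polys_over J \<Longrightarrow> poly P x = 1 \<Longrightarrow> poly Q (inverse x) = 1 \<Longrightarrow> False"
proof (induction "degree P + degree Q" arbitrary: P Q x rule: less_induct)
  case less
  have Jsum: "sum f A \<in> J" if "\<And>i. i \<in> A \<Longrightarrow> f i \<in> J" for f :: "nat \<Rightarrow> complex" and A
    using that by (induction A rule: infinite_finite_induct) (auto intro: J)
  have red: "\<exists>P'. P' \<in> polys_over J \<and> poly P' x = 1 \<and> degree P' < degree P"
    if x: "x \<noteq> 0" and P: "P \<in> polys_over J" "poly P x = 1" and Q: "Q \<in> polys_over J" "poly Q (inverse x) = 1"
      and le: "degree Q \<le> degree P" for P Q :: "complex poly" and x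
  proof -
    define n where "n = degree P"
    define m where "m = degree Q"
    define a where "a = coeff P"
    define b where "b = coeff Q"
    have ab: "a i \<in> J" "b i \<in> J" for i using P Q by (auto simp: polys_over_def a_def b_def)
    have n: "n > 0"
    proof (rule ccontr)
      assume "\<not> n > 0"
      then obtain c where "P = [:c:]" by (metis degree_eq_zeroE gr0I n_def)
      then show False using P ab(1)[of 0] J by (simp add: a_def)
    qed
    \<comment> \<open>Multiply \<open>P(x) = 1\<close> by \<open>1 - b 0\<close> and add
      \<open>b 0\<close>. The leading term \<open>(1 - b 0) * a n * x^n\<close> is rewritten with
      \<open>1 - b 0 = b 1 / x + ... + b m / x^m\<close>; as \<open>m \<le> n\<close>, only the
      powers \<open>x^(n-j)\<close> with \<open>j \<ge> 1\<close> arise from it.\<close>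
    define P' where "P' = [:b 0:] + (\<Sum>i<n. monom ((1 - b 0) * a i) i) + (\<Sum>j\<in>{1..m}. monom (a n * b j) (n - j))"
    have xP: "(\<Sum>i<n. a i * x ^ i) + a n * x ^ n = 1"
      using P(2) by (simp add: poly_altdef a_def n_def lessThan_Suc_atMost[symmetric])
    have xQ: "b 0 + (\<Sum>j\<in>{1..m}. b j * inverse x ^ j) = 1"
    proof -
      have "{..m} = insert 0 {1..m}" by auto
      then show ?thesis using Q(2) by (simp add: poly_altdef b_def m_def)
    qed
    have "(\<Sum>j\<in>{1..m}. a n * b j * x ^ (n - j)) = a n * x ^ n * (\<Sum>j\<in>{1..m}. b j * inverse x ^ j)"
      unfolding sum_distrib_left
    proof (rule sum.cong[OF refl])
      fix j assume "j \<in> {1..m}"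
      then have "x ^ n = x ^ (n - j) * x ^ j" using le by (simp add: n_def m_def power_add[symmetric])
      then show "a n * b j * x ^ (n - j) = a n * x ^ n * (b j * inverse x ^ j)"
        using x by (simp add: field_simps)
    qed
    also have "(\<Sum>j\<in>{1..m}. b j * inverse x ^ j) = 1 - b 0" using xQ by (simp add: eq_diff_eq add.commute)
    finally have "poly P' x = b 0 + (1 - b 0) * (\<Sum>i<n. a i * x ^ i) + a n * x ^ n * (1 - b 0)"
      by (simp add: P'_def poly_sum poly_monom sum_distrib_left mult_ac)
    also have "\<dots> = b 0 + (1 - b 0) * ((\<Sum>i<n. a i * x ^ i) + a n * x ^ n)" by (simp add: algebra_simps)
    finally have "poly P' x = 1" using xP by simp
    moreover have "P' \<in> polys_over J"
    proof -
      have 1: "1 - b 0 \<in> V" using V J ab by (intro subring_diff subring_1) auto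
      have 2: "coeff P' k = (if k = 0 then b 0 else 0) + (\<Sum>i<n. if i = k then (1 - b 0) * a i else 0)
         + (\<Sum>j\<in>{1..m}. if n - j = k then a n * b j else 0)" for k
        by (simp add: P'_def coeff_sum coeff_pCons split: nat.splits)
      have 3: "a n * b j \<in> J" for j using J(2)[OF ab(2)] J(5) ab(1) by blast
      have "coeff P' k \<in> J" for k unfolding 2
        using ab J 1 3 by (intro J(1) Jsum) auto
      then show ?thesis by (simp add: polys_over_def)
    qed
    moreover have "degree P' \<le> n - 1"
      unfolding P'_def using n
      by (intro degree_add_le degree_sum_le) (auto intro!: order_trans[OF degree_monom_le])
    ultimately show ?thesis using n unfolding n_def by (intro exI[of _ P']) auto
  qed
  show False
  proof (cases "degree Q \<le> degree P")
    case True
    from red[OF less.prems(1,2,4,3,5) True] obtain P' where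
      "P' \<in> polys_over J" "poly P' x = 1" "degree P' < degree P" by blast
    then show False using less.hyps[of P' Q x] less.prems by auto
  next
    case False
    have "poly P (inverse (inverse x)) = 1" "inverse x \<noteq> 0" using less.prems by auto
    from red[OF this(2) less.prems(3,5,2) this(1)] False obtain Q' where
      "Q' \<in> polys_over J" "poly Q' (inverse x) = 1" "degree Q' < degree Q" by auto
    then show False using less.hyps[of P Q' x] less.prems by auto
  qed
qed

text \<open>Chevalley's extension theorem, for the ideal generated by two elements.\<close>

lemma valuation_ring_exists:
  assumes A: "subring A" and cy: "c \<in> A" "y \<in> A" and proper: "\<And>u v. u \<in> A \<Longrightarrow> v \<in> A \<Longrightarrow> c * u + y * v \<noteq> 1"
  obtains V where "subring V" "A \<subseteq> V" "\<And>x. x \<in> V \<or> inverse x \<in> V"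
    "\<And>u v. u \<in> V \<Longrightarrow> v \<in> V \<Longrightarrow> c * u + y * v \<noteq> 1"
proof -
  define S where "S = {B. subring B \<and> A \<subseteq> B \<and> (\<forall>u\<in>B. \<forall>v\<in>B. c * u + y * v \<noteq> 1)}"
  \<comment> \<open>Zorn's lemma: a violation of properness involves only the two elements
    \<open>u\<close> and \<open>v\<close>, so properness survives unions of chains.\<close>
  have "\<exists>M\<in>S. \<forall>X\<in>S. M \<subseteq> X \<longrightarrow> X = M"
  proof (rule subset_Zorn_nonempty)
    show "S \<noteq> {}" using A proper by (auto simp: S_def)
    fix C assume C: "C \<noteq> {}" "subset.chain S C"
    then have CS: "C \<subseteq> S" and lin: "\<And>B B'. B \<in> C \<Longrightarrow> B' \<in> C \<Longrightarrow> B \<subseteq> B' \<or> B' \<subseteq> B"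
      by (auto simp: subset.chain_def)
    have two: "\<exists>B\<in>C. u \<in> B \<and> v \<in> B" if "u \<in> \<Union>C" "v \<in> \<Union>C" for u v
      using that lin by (meson Union_iff subsetD)
    have sub: "subring B" if "B \<in> C" for B using that CS by (auto simp: S_def)
    have "subring (\<Union>C)" unfolding subring_def
    proof (intro conjI ballI)
      show "1 \<in> \<Union>C" using C(1) sub subring_1 by blast
      fix u v assume "u \<in> \<Union>C" "v \<in> \<Union>C"
      then obtain B where "B \<in> C" "u \<in> B" "v \<in> B" using two by blast
      then show "u - v \<in> \<Union>C" "u * v \<in> \<Union>C" using sub subring_diff subring_mult by blast+
    qed
    moreover have "A \<subseteq> \<Union>C" using C(1) CS by (auto simp: S_def)
    moreover have "c * u + y * v \<noteq> 1" if "u \<in> \<Union>C" "v \<in> \<Union>C" for u v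
    proof -
      from two[OF that] obtain B where "B \<in> C" "u \<in> B" "v \<in> B" by blast
      then show ?thesis using CS by (auto simp: S_def)
    qed
    ultimately show "\<Union>C \<in> S" by (simp add: S_def)
  qed
  then obtain V where V: "V \<in> S" and max: "\<And>X. X \<in> S \<Longrightarrow> V \<subseteq> X \<Longrightarrow> X = V" by blast
  have subV: "subring V" and AV: "A \<subseteq> V" and prp: "\<And>u v. u \<in> V \<Longrightarrow> v \<in> V \<Longrightarrow> c * u + y * v \<noteq> 1"
    using V by (auto simp: S_def)
  define J where "J = {c * u + y * v | u v. u \<in> V \<and> v \<in> V}"
  have cyV: "c \<in> V" "y \<in> V" using AV cy by auto
  have J: "a + b \<in> J" if ab: "a \<in> J" "b \<in> J" for a b
  proof -
    from ab obtain u v u' v' where "u \<in> V" "v \<in> V" "u' \<in> V" "v' \<in> V" "a = c * u + y * v" "b = c * u' + y * v'"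
      by (auto simp: J_def)
    then show ?thesis unfolding J_def
      by (intro CollectI exI[of _ "u + u'"] exI[of _ "v + v'"]) (auto simp: algebra_simps intro: subring_add subV)
  qed
  have J2: "v * a \<in> J" if "a \<in> J" "v \<in> V" for a v
  proof -
    from that obtain u u' where "u \<in> V" "u' \<in> V" "a = c * u + y * u'" by (auto simp: J_def)
    then show ?thesis unfolding J_def using that
      by (intro CollectI exI[of _ "v * u"] exI[of _ "v * u'"]) (auto simp: algebra_simps intro: subring_mult subV)
  qed
  have J3: "0 \<in> J" using subring_0[OF subV] by (force simp: J_def)
  have J4: "1 \<notin> J" using prp by (force simp: J_def)
  have J5: "J \<subseteq> V" using cyV by (auto simp: J_def intro!: subring_add subring_mult subV)
  \<comment> \<open>By maximality \<open>c\<close> and \<open>y\<close> generate the unit ideal of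
    \<open>V[x]\<close>. Sorted by powers of \<open>x\<close>, this relation has its coefficients in
    the ideal \<open>J\<close> of \<open>V\<close>.\<close>
  have ex: "\<exists>P. P \<in> polys_over J \<and> poly P x = 1" if x: "x \<notin> V" for x
  proof -
    have "adjoin V x \<notin> S"
      using max[of "adjoin V x"] subset_adjoin[OF subV, of x] adjoin_self[OF subV, of x] x by auto
    then obtain u v where uv: "u \<in> adjoin V x" "v \<in> adjoin V x" "c * u + y * v = 1"
      using subring_adjoin[OF subV, of x] AV subset_adjoin[OF subV, of x] by (auto simp: S_def)
    then obtain P Q where PQ: "P \<in> polys_over V" "Q \<in> polys_over V" "u = poly P x" "v = poly Q x"
      by (auto simp: adjoin_def)
    have "smult c P + smult y Q \<in> polys_over J" using PQ by (auto simp: polys_over_def J_def)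
    moreover have "poly (smult c P + smult y Q) x = 1" using uv PQ by simp
    ultimately show ?thesis by blast
  qed
  have "x \<in> V \<or> inverse x \<in> V" for x
  proof (rule ccontr)
    assume *: "\<not> (x \<in> V \<or> inverse x \<in> V)"
    then have "x \<noteq> 0" using subring_0[OF subV] by auto
    moreover obtain P where "P \<in> polys_over J" "poly P x = 1" using ex * by blast
    moreover obtain Q where "Q \<in> polys_over J" "poly Q (inverse x) = 1" using ex * by blast
    ultimately show False using chevalley_reduction[OF subV, of J] J J2 J3 J4 J5 by blast
  qed
  then show thesis using that subV AV prp by blast
qed

text \<open>A valuation ring of the complex numbers whose maximal ideal contains the prime \<open>p\<close>. Its value group
  restricted to algebraic numbers is commensurable with the powers of \<open>p\<close>, so the valuation is real.\<close>

locale padic_valuation_ring =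
  fixes V :: "complex set" and p :: nat
  assumes sub: "subring V" and total: "x \<in> V \<or> inverse x \<in> V" and prime: "prime p"
    and p_nonunit: "inverse (of_nat p) \<notin> V"
begin

definition units :: "complex set" where
  "units = {x. x \<noteq> 0 \<and> x \<in> V \<and> inverse x \<in> V}"

definition nonunits :: "complex set" where
  "nonunits = {x \<in> V. x \<notin> units}"

abbreviation pp :: complex where "pp \<equiv> of_nat p"

lemma pp_nonzero: "pp \<noteq> 0" using prime by (auto simp: prime_gt_0_nat)

lemma units_mult: "x \<in> units \<Longrightarrow> y \<in> units \<Longrightarrow> x * y \<in> units"
  by (auto simp: units_def intro: subring_mult sub)

lemma units_inverse: "x \<in> units \<Longrightarrow> inverse x \<in> units"
  by (auto simp: units_def)

lemma units_divide: "x \<in> units \<Longrightarrow> y \<in> units \<Longrightarrow> x / y \<in> units"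
  by (simp add: divide_inverse units_mult units_inverse)

lemma units_1: "1 \<in> units" by (simp add: units_def subring_1 sub)

lemma units_power: "x \<in> units \<Longrightarrow> x ^ n \<in> units"
  by (induction n) (auto intro: units_1 units_mult)

lemma units_in: "x \<in> units \<Longrightarrow> x \<in> V" and units_nonzero: "x \<in> units \<Longrightarrow> x \<noteq> 0"
  by (auto simp: units_def)

lemma units_factor: "x \<in> V \<Longrightarrow> y \<in> V \<Longrightarrow> x * y \<in> units \<Longrightarrow> x \<in> units"
proof -
  assume *: "x \<in> V" "y \<in> V" "x * y \<in> units"
  then have nz: "x \<noteq> 0" "y \<noteq> 0" by (auto simp: units_def)
  then have "inverse x = y * inverse (x * y)" by (simp add: field_simps)
  also have "\<dots> \<in> V" using * by (intro subring_mult sub) (auto simp: units_def)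
  finally show ?thesis using * nz by (simp add: units_def)
qed

lemma nonunits_mult: "x \<in> nonunits \<Longrightarrow> v \<in> V \<Longrightarrow> v * x \<in> nonunits"
  using units_factor[of x v] by (auto simp: nonunits_def mult.commute intro: subring_mult sub)

text \<open>Of two non-zero elements of a valuation ring one divides the other, so the sum is a
  multiple of one of them.\<close>

lemma nonunits_add:
  assumes x: "x \<in> nonunits" and y: "y \<in> nonunits"
  shows "x + y \<in> nonunits"
proof (cases "x = 0 \<or> y = 0")
  case False
  have *: "x + y \<in> nonunits" if "x \<in> nonunits" "y \<in> V" "y / x \<in> V" "x \<noteq> 0" for x y
  proof -
    have "1 + y / x \<in> V" using that by (intro subring_add subring_1 sub)
    then have "(1 + y / x) * x \<in> nonunits" using that nonunits_mult by blast
    then show ?thesis using that by (simp add: field_simps)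
  qed
  have "y / x \<in> V \<or> x / y \<in> V" using total[of "y / x"] by simp
  then show ?thesis using *[of x y] *[of y x] x y False by (auto simp: nonunits_def add.commute)
qed (use x y in auto)

lemma nonunits_0: "0 \<in> nonunits" by (simp add: nonunits_def units_def subring_0 sub)

lemma nonunits_sum: "(\<And>i. i \<in> A \<Longrightarrow> f i \<in> nonunits) \<Longrightarrow> sum f A \<in> nonunits"
  by (induction A rule: infinite_finite_induct) (auto intro: nonunits_0 nonunits_add)

lemma pp_nonunits: "pp \<in> nonunits"
  using p_nonunit by (auto simp: nonunits_def units_def subring_of_nat sub)

lemma of_int_units:
  assumes "\<not> int p dvd k"
  shows "of_int k \<in> units"
proof (rule ccontr)
  assume "of_int k \<notin> units"
  then have k: "of_int k \<in> nonunits" by (simp add: nonunits_def subring_of_int sub)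
  have "gcd (int p) k = 1" using prime_imp_coprime[of "int p" k] assms prime by (simp add: coprime_iff_gcd_eq_1)
  then obtain a b where "a * int p + b * k = 1" using bezout_int[of "int p" k] by auto
  then have "of_int a * pp + of_int b * of_int k = (1 :: complex)"
    by (metis of_int_1 of_int_add of_int_mult of_int_of_nat_eq)
  moreover have "of_int a * pp + of_int b * of_int k \<in> nonunits"
    by (intro nonunits_add nonunits_mult pp_nonunits k subring_of_int sub)
  ultimately show False using units_1 by (simp add: nonunits_def)
qed

lemma of_int_decompose:
  assumes "k \<noteq> 0"
  obtains e u where "of_int k = pp ^ e * u" "u \<in> units" "e = multiplicity (int p) k"
proof -
  obtain k' where k': "k = int p ^ multiplicity (int p) k * k'" "\<not> int p dvd k'"
  proof (rule multiplicity_decompose'[of k "int p"])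
    show "k \<noteq> 0" "\<not> is_unit (int p)" using assms prime_gt_1_nat[OF prime] by auto
  qed
  then have "of_int k = pp ^ multiplicity (int p) k * of_int k'"
    by (metis of_int_mult of_int_of_nat_eq of_int_power)
  then show thesis using that of_int_units k'(2) by blast
qed

lemma pp_powi_units_iff: "pp powi n \<in> units \<longleftrightarrow> n = 0"
proof
  have pos: "pp ^ k \<notin> units" if "k > 0" for k
  proof
    assume "pp ^ k \<in> units"
    moreover have "pp ^ k = pp * pp ^ (k - 1)" using that by (cases k) auto
    ultimately have "pp \<in> units" using units_factor[of pp "pp ^ (k - 1)"] by (simp add: subring_power subring_of_nat sub)
    then show False using pp_nonunits by (simp add: nonunits_def)
  qed
  assume *: "pp powi n \<in> units"
  show "n = 0"
  proof (rule ccontr)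
    assume "n \<noteq> 0"
    then have "pp ^ nat \<bar>n\<bar> \<notin> units" by (intro pos) simp
    moreover have "pp ^ nat \<bar>n\<bar> \<in> units"
    proof (cases "n \<ge> 0")
      case True
      then show ?thesis using * by (simp add: power_int_def)
    next
      case False
      then have "pp powi n = inverse (pp ^ nat \<bar>n\<bar>)" by (simp add: power_int_def power_inverse)
      then show ?thesis using * units_inverse[of "pp powi n"] by simp
    qed
    ultimately show False by simp
  qed
qed (simp add: units_1)

text \<open>\<open>r\<close> is the valuation of \<open>x\<close>, normalized so that
  \<open>p\<close> has valuation 1. It is introduced as a relation because the existence of such a
  rational \<open>r\<close> is a theorem about algebraic numbers.\<close>

definition slope :: "complex \<Rightarrow> real \<Rightarrow> bool" where
  "slope x r \<longleftrightarrow> (\<exists>s>0. \<exists>t. r = of_int t / of_nat s \<and> x ^ s * pp powi (- t) \<in> units)"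

text \<open>Newton polygon argument: in the equation \<open>f(x) = 0\<close> a single term of least
  valuation cannot be cancelled by the others, so two terms differ by a unit factor. Their
  coefficients are powers of \<open>p\<close> up to units, and so is the power of \<open>x\<close>
  by which they differ.\<close>

lemma slope_exists:
  assumes "algebraic x" "x \<noteq> 0"
  shows "\<exists>r. slope x r"
proof -
  obtain f where f: "minpoly_int f x" using minpoly_int_exists assms by blast
  define I where "I = {i. coeff f i \<noteq> 0}"
  have finI: "finite I" unfolding I_def by (rule finite_subset[of _ "{..degree f}"]) (auto intro: le_degree)
  have neI: "I \<noteq> {}" using minpoly_int_nonzero[OF f] by (auto simp: I_def intro: exI[of _ "degree f"])
  define T where "T i = of_int (coeff f i) * x ^ i" for i
  have T0: "T i \<noteq> 0" if "i \<in> I" for i using that assms by (auto simp: T_def I_def)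
  \<comment> \<open>\<open>T i\<close> is a term of least valuation; it exists because of any two
    elements one divides the other.\<close>
  have "\<exists>i\<in>I. \<forall>j\<in>I. T j / T i \<in> V"
    using finI neI T0
  proof (induction I rule: finite_ne_induct)
    case (singleton i)
    then show ?case by (auto intro: subring_1 sub)
  next
    case (insert k F)
    then obtain i where i: "i \<in> F" "\<And>j. j \<in> F \<Longrightarrow> T j / T i \<in> V" by auto
    show ?case
    proof (cases "T k / T i \<in> V")
      case True
      then show ?thesis using i by auto
    next
      case False
      then have ik: "T i / T k \<in> V" using total[of "T k / T i"] by simp
      have "T j / T k \<in> V" if "j \<in> F" for j
      proof -
        have "T j / T k = (T j / T i) * (T i / T k)" using insert.prems i(1) by simp
        then show ?thesis using ik i(2)[OF that] subring_mult[OF sub] by metis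
      qed
      moreover have "T k / T k \<in> V" using insert.prems by (simp add: subring_1 sub)
      ultimately show ?thesis by auto
    qed
  qed
  then obtain i where i: "i \<in> I" "\<And>j. j \<in> I \<Longrightarrow> T j / T i \<in> V" by blast
  have sum0: "(\<Sum>j\<in>I. T j) = 0"
  proof -
    have "(\<Sum>j\<in>I. T j) = (\<Sum>j\<le>degree f. T j)"
      by (rule sum.mono_neutral_left) (auto simp: I_def T_def intro: le_degree)
    also have "\<dots> = poly (map_poly of_int f) x" by (simp add: poly_altdef T_def coeff_map_poly)
    finally show ?thesis using minpoly_int_root[OF f] by simp
  qed
  \<comment> \<open>Otherwise \<open>-1\<close>, the sum of the remaining quotients, would be a
    non-unit.\<close>
  have "\<exists>j\<in>I - {i}. T j / T i \<in> units"
  proof (rule ccontr)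
    assume "\<not> (\<exists>j\<in>I - {i}. T j / T i \<in> units)"
    then have "(\<Sum>j\<in>I - {i}. T j / T i) \<in> nonunits"
      using i by (intro nonunits_sum) (auto simp: nonunits_def)
    moreover have "(\<Sum>j\<in>I - {i}. T j / T i) = -1"
    proof -
      have "(\<Sum>j\<in>I - {i}. T j) = - T i" using sum0 sum.remove[OF finI i(1), of T] by (simp add: eq_neg_iff_add_eq_0 add.commute)
      then show ?thesis using T0[OF i(1)] by (simp add: sum_divide_distrib[symmetric])
    qed
    moreover have "(-1) \<in> units" using sub by (simp add: units_def subring_minus subring_1)
    ultimately show False by (simp add: nonunits_def)
  qed
  then obtain j where j: "j \<in> I" "j \<noteq> i" "T j / T i \<in> units" by blast
  have *: "\<exists>r. slope x r" if ij: "i \<in> I" "j \<in> I" "i < j" "T j / T i \<in> units" for i j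
  proof -
    obtain e u where u: "of_int (coeff f i) = pp ^ e * u" "u \<in> units"
      using of_int_decompose[of "coeff f i"] ij(1,2) unfolding I_def by blast
    obtain e' u' where u': "of_int (coeff f j) = pp ^ e' * u'" "u' \<in> units"
      using of_int_decompose[of "coeff f j"] ij(1,2) unfolding I_def by blast
    have xj: "x ^ j = x ^ (j - i) * x ^ i" using ij by (simp add: power_add[symmetric])
    have "x ^ (j - i) * pp powi (int e' - int e) = (T j / T i) * (u / u')"
      using u u' pp_nonzero assms units_nonzero[OF u(2)] units_nonzero[OF u'(2)]
      by (simp add: T_def xj power_int_diff field_simps)
    also have "\<dots> \<in> units" by (intro units_mult units_divide u u' ij)
    finally show ?thesis using ij(3) unfolding slope_def
      by (intro exI[of _ "of_int (int e - int e') / of_nat (j - i)"] exI[of _ "j - i"] conjI exI[of _ "int e - int e'"]) auto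
  qed
  have "T i / T j \<in> units" using units_inverse[OF j(3)] by simp
  then show ?thesis using *[of i j] *[of j i] i j by (cases "i < j") auto
qed

lemma power_times_powi:
  "(x ^ s * pp powi a) ^ k = x ^ (s * k) * pp powi (a * int k)"
  by (simp add: power_mult_distrib power_mult power_int_mult)

lemma slope_unique:
  assumes "slope x r" "slope x r'" "x \<noteq> 0"
  shows "r = r'"
proof -
  from assms obtain s t s' t' where st: "s > 0" "r = of_int t / of_nat s" "x ^ s * pp powi (- t) \<in> units"
    "s' > 0" "r' = of_int t' / of_nat s'" "x ^ s' * pp powi (- t') \<in> units" by (auto simp: slope_def)
  have "(x ^ s * pp powi (- t)) ^ s' / (x ^ s' * pp powi (- t')) ^ s \<in> units"
    by (intro units_divide units_power st)
  also have "(x ^ s * pp powi (- t)) ^ s' / (x ^ s' * pp powi (- t')) ^ s = pp powi (t' * int s - t * int s')"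
  proof -
    have "(x ^ s * pp powi (- t)) ^ s' / (x ^ s' * pp powi (- t')) ^ s
      = pp powi (- t * int s') / pp powi (- t' * int s)"
      using assms(3) unfolding power_times_powi by (simp add: mult.commute[of s'])
    also have "\<dots> = pp powi (- t * int s' - (- t' * int s))" by (rule power_int_diff[symmetric]) (use pp_nonzero in simp)
    finally show ?thesis by simp
  qed
  finally have "t' * int s = t * int s'" using pp_powi_units_iff by simp
  then have "of_int t' * real s = of_int t * real s'" by (metis of_int_mult of_int_of_nat_eq)
  then show ?thesis unfolding st(2,5) using st(1,4) by (simp add: frac_eq_eq mult.commute)
qed

lemma slope_mult:
  assumes "slope x r" "slope y r'"
  shows "slope (x * y) (r + r')"
proof -
  from assms obtain s t s' t' where st: "s > 0" "r = of_int t / of_nat s" "x ^ s * pp powi (- t) \<in> units"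
    "s' > 0" "r' = of_int t' / of_nat s'" "y ^ s' * pp powi (- t') \<in> units" by (auto simp: slope_def)
  have "(x ^ s * pp powi (- t)) ^ s' * (y ^ s' * pp powi (- t')) ^ s \<in> units"
    by (intro units_mult units_power st)
  also have "(x ^ s * pp powi (- t)) ^ s' * (y ^ s' * pp powi (- t')) ^ s
      = (x * y) ^ (s * s') * pp powi (- (t * int s' + t' * int s))"
  proof -
    have "pp powi (- (t * int s' + t' * int s)) = pp powi (- t * int s') * pp powi (- t' * int s)"
      using power_int_add[of pp "- t * int s'" "- t' * int s"] pp_nonzero by simp
    then show ?thesis unfolding power_times_powi by (simp add: power_mult_distrib mult_ac)
  qed
  finally show ?thesis unfolding slope_def using st
    by (intro exI[of _ "s * s'"] conjI exI[of _ "t * int s' + t' * int s"]) (auto simp: field_simps)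
qed

lemma slope_nonneg_iff:
  assumes "slope x r" "x \<noteq> 0"
  shows "r \<ge> 0 \<longleftrightarrow> x \<in> V"
proof -
  from assms obtain s t where st: "s > 0" "r = of_int t / of_nat s" "x ^ s * pp powi (- t) \<in> units"
    by (auto simp: slope_def)
  have ppV: "pp \<in> V" by (simp add: subring_of_nat sub)
  have r: "r \<ge> 0 \<longleftrightarrow> t \<ge> 0" using st by (simp add: zero_le_divide_iff)
  show ?thesis
  proof
    assume "r \<ge> 0"
    then have t: "t \<ge> 0" using r by simp
    have "x ^ s = (x ^ s * pp powi (- t)) * pp ^ nat t"
      using t pp_nonzero by (simp add: power_int_minus power_int_def power_inverse)
    also have "\<dots> \<in> V" by (intro subring_mult[OF sub units_in[OF st(3)]] subring_power sub ppV)
    finally have xs: "x ^ s \<in> V" .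
    \<comment> \<open>A valuation ring is closed under taking roots: if \<open>x\<close> were
      outside, its inverse would be inside, and \<open>x\<close> could be recovered from
      \<open>x^s\<close>.\<close>
    show "x \<in> V"
    proof (rule ccontr)
      assume "x \<notin> V"
      then have "inverse x \<in> V" using total by blast
      then have "x ^ s * inverse x ^ (s - 1) \<in> V" by (intro subring_mult sub xs subring_power)
      also have "x ^ s * inverse x ^ (s - 1) = x" using st(1) assms(2)
        by (cases s) (auto simp: field_simps)
      finally show False using \<open>x \<notin> V\<close> by simp
    qed
  next
    assume x: "x \<in> V"
    show "r \<ge> 0"
    proof (rule ccontr)
      assume "\<not> r \<ge> 0"
      then have t: "t < 0" using r by simp
      then have eq: "pp powi (- t) = pp * pp ^ (nat (- t) - 1)"
        by (cases "nat (- t)") (auto simp: power_int_def)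
      have "pp * (x ^ s * pp ^ (nat (- t) - 1)) \<in> units"
        using st(3) unfolding eq by (simp only: mult.left_commute)
      then have "pp \<in> units"
        by (rule units_factor[rotated 2]) (intro ppV subring_mult sub subring_power x)+
      then show False using pp_nonunits by (simp add: nonunits_def)
    qed
  qed
qed

lemma slope_pos:
  assumes "slope x r" "x \<in> nonunits" "x \<noteq> 0"
  shows "r > 0"
proof (rule ccontr)
  assume *: "\<not> r > 0"
  have "r \<ge> 0" using slope_nonneg_iff assms by (auto simp: nonunits_def)
  then have "r = 0" using * by simp
  then obtain s where s: "s > 0" "x ^ s \<in> units" using assms(1) by (auto simp: slope_def)
  then have "x * x ^ (s - 1) \<in> units" by (cases s) auto
  then have "x \<in> units" using units_factor[of x "x ^ (s - 1)"] assms by (simp add: nonunits_def subring_power sub)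
  then show False using assms by (simp add: nonunits_def)
qed

lemma slope_of_rat:
  assumes "q \<noteq> 0"
  shows "slope (of_rat q) (of_int (int (multiplicity (int p) (fst (quotient_of q))) - int (multiplicity (int p) (snd (quotient_of q)))))"
proof -
  let ?a = "fst (quotient_of q)" and ?b = "snd (quotient_of q)"
  have b: "?b \<noteq> 0" using quotient_of_denom_pos' by (metis less_irrefl)
  have q: "of_rat q = of_int ?a / (of_int ?b :: complex)" by (rule of_rat_eq_divide)
  then have a: "?a \<noteq> 0" using assms by (metis div_0 of_int_0 of_rat_eq_0_iff)
  obtain e u where u: "of_int ?a = pp ^ e * u" "u \<in> units" "e = multiplicity (int p) ?a"
    using of_int_decompose[OF a] by blast
  obtain e' u' where u': "of_int ?b = pp ^ e' * u'" "u' \<in> units" "e' = multiplicity (int p) ?b"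
    using of_int_decompose[OF b] by blast
  have "of_rat q ^ 1 * pp powi (- (int e - int e')) = u / u'"
    unfolding q using u u' pp_nonzero units_nonzero[OF u'(2)] by (simp add: power_int_diff field_simps)
  then have "of_rat q ^ 1 * pp powi (- (int e - int e')) \<in> units"
    using units_divide u u' by simp
  then show ?thesis unfolding slope_def u(3) u'(3)
    by (intro exI[of _ 1] conjI exI[of _ "int (multiplicity (int p) ?a) - int (multiplicity (int p) ?b)"]) auto
qed

definition absval :: "complex \<Rightarrow> real" where
  "absval = restrict (\<lambda>x. if x = 0 then 0 else real p powr (- (THE r. slope x r))) Qbar"

lemma absval_eq:
  assumes "x \<in> Qbar" "x \<noteq> 0" "slope x r"
  shows "absval x = real p powr (- r)"
proof -
  have "(THE r. slope x r) = r" using assms slope_unique by blast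
  then show ?thesis using assms by (simp add: absval_def)
qed

lemma absval_0: "absval 0 = 0"
  using is_subfield_Qbar by (simp add: absval_def subring_0 is_subfield_subring)

lemma absval_le_1_iff:
  assumes "x \<in> Qbar"
  shows "absval x \<le> 1 \<longleftrightarrow> x \<in> V"
proof (cases "x = 0")
  case True
  then show ?thesis by (simp add: absval_0 subring_0 sub)
next
  case False
  obtain r where r: "slope x r" using slope_exists assms False by (auto simp: Qbar_def)
  have "real p > 1" using prime_gt_1_nat[OF prime] by simp
  then have "absval x \<le> 1 \<longleftrightarrow> r \<ge> 0"
    using absval_eq[OF assms False r] powr_le_cancel_iff[of "real p" "- r" 0] by simp
  then show ?thesis using slope_nonneg_iff[OF r False] by simp
qed

lemma absval_less_1:
  assumes "x \<in> Qbar" "x \<in> nonunits"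
  shows "absval x < 1"
proof (cases "x = 0")
  case False
  obtain r where r: "slope x r" using slope_exists assms False by (auto simp: Qbar_def)
  have "real p > 1" using prime_gt_1_nat[OF prime] by simp
  then show ?thesis
    using absval_eq[OF assms(1) False r] powr_less_cancel_iff[of "real p" "- r" 0] slope_pos[OF r assms(2) False] by simp
qed (simp add: absval_0)

lemma absval_nonneg: "x \<in> Qbar \<Longrightarrow> absval x \<ge> 0" by (simp add: absval_def)

lemma absval_eq_0_iff: "x \<in> Qbar \<Longrightarrow> absval x = 0 \<longleftrightarrow> x = 0"
  using prime_gt_0_nat[OF prime] by (auto simp: absval_def)

lemma absval_mult:
  assumes "x \<in> Qbar" "y \<in> Qbar"
  shows "absval (x * y) = absval x * absval y"
proof (cases "x = 0 \<or> y = 0")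
  case False
  obtain r r' where r: "slope x r" "slope y r'"
    using slope_exists[of x] slope_exists[of y] assms False unfolding Qbar_def by blast
  have xy: "x * y \<in> Qbar" using assms subring_mult[OF is_subfield_subring[OF is_subfield_Qbar]] by blast
  show ?thesis using absval_eq[OF xy _ slope_mult[OF r]] absval_eq[OF assms(1) _ r(1)] absval_eq[OF assms(2) _ r(2)] False
    by (simp add: powr_add[symmetric])
qed (auto simp: absval_0)

lemma absval_ultrametric:
  assumes "x \<in> Qbar" "y \<in> Qbar"
  shows "absval (x + y) \<le> max (absval x) (absval y)"
proof -
  have *: "absval (x + y) \<le> absval x" if xy: "x \<in> Qbar" "y \<in> Qbar" "absval y \<le> absval x" for x y
  proof (cases "x = 0")
    case True
    then have "y = 0" using xy absval_nonneg[of y] absval_eq_0_iff[of y] by (simp add: absval_0)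
    then show ?thesis using True by simp
  next
    case False
    have d: "y / x \<in> Qbar" using is_subfield_divide[OF is_subfield_Qbar] xy by blast
    have "absval y = absval (y / x) * absval x" using absval_mult[OF d xy(1)] False by simp
    moreover have "absval x > 0" using absval_nonneg absval_eq_0_iff xy False by (simp add: less_le)
    moreover have "absval (y / x) * absval x \<le> 1 * absval x" using calculation(1) xy(3) by simp
    ultimately have "absval (y / x) \<le> 1" by (simp only: mult_le_cancel_right_pos)
    then have "y / x \<in> V" using absval_le_1_iff d by blast
    then have V: "1 + y / x \<in> V" by (intro subring_add subring_1 sub)
    have d': "1 + y / x \<in> Qbar" using d by (intro subring_add subring_1 is_subfield_subring is_subfield_Qbar)
    have "absval (x + y) = absval (1 + y / x) * absval x"
      using absval_mult[OF d' xy(1)] False by (simp add: field_simps)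
    also have "\<dots> \<le> 1 * absval x" using V absval_le_1_iff[OF d'] absval_nonneg[OF xy(1)] by (intro mult_right_mono) auto
    finally show ?thesis by simp
  qed
  show ?thesis using *[of x y] *[of y x] assms by (cases "absval y \<le> absval x") (auto simp: add.commute)
qed

lemma absval_of_rat: "absval (of_rat q) = padic_abs p q"
proof (cases "q = 0")
  case False
  have Q: "of_rat q \<in> Qbar" using Rats_subset_subfield[OF is_subfield_Qbar] by auto
  show ?thesis using absval_eq[OF Q _ slope_of_rat[OF False]] False prime_gt_0_nat[OF prime]
    by (simp add: padic_abs_def powr_real_of_int' flip: of_int_diff of_int_minus)
qed (simp add: absval_0 padic_abs_def)

lemma absval_padic_place: "absval \<in> padic_places p"
proof -
  have "absval (x + y) \<le> absval x + absval y" if "x \<in> Qbar" "y \<in> Qbar" for x y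
    using absval_ultrametric[OF that] absval_nonneg[of x] absval_nonneg[of y] that by linarith
  then show ?thesis
    unfolding padic_places_def absolute_value_on_def
    using absval_mult absval_nonneg absval_eq_0_iff absval_ultrametric absval_of_rat
    by (auto simp: absval_def)
qed

end

text \<open>The source of all absolute values constructed in the proof. A divisibility by
  \<open>p\<close> is turned into a place by checking that \<open>p\<close> and a suitable
  \<open>y\<close> generate a proper ideal.\<close>

lemma padic_place_exists:
  assumes p: "prime p" and A: "subring A" and y: "y \<in> A" "y \<in> Qbar"
    and proper: "\<And>u v. u \<in> A \<Longrightarrow> v \<in> A \<Longrightarrow> of_nat p * u + y * v \<noteq> 1"
  obtains w where "w \<in> padic_places p" "\<And>x. x \<in> A \<Longrightarrow> x \<in> Qbar \<Longrightarrow> w x \<le> 1" "w y < 1"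
proof -
  obtain V where V: "subring V" "A \<subseteq> V" "\<And>x. x \<in> V \<or> inverse x \<in> V"
    "\<And>u v. u \<in> V \<Longrightarrow> v \<in> V \<Longrightarrow> of_nat p * u + y * v \<noteq> 1"
    using valuation_ring_exists[OF A subring_of_nat[OF A] y(1) proper] by metis
  have p0: "of_nat p \<noteq> (0 :: complex)" using prime_gt_0_nat[OF p] by simp
  interpret padic_valuation_ring V p
  proof
    show "inverse (of_nat p) \<notin> V" using V(4)[of "inverse (of_nat p)" 0] p0 subring_0[OF V(1)] by auto
  qed (use V p in auto)
  have "y \<in> nonunits"
    using V(4)[of 0 "inverse y"] y V(2) subring_0[OF V(1)] by (auto simp: nonunits_def units_def)
  then have "absval y < 1" by (rule absval_less_1[OF y(2)])
  moreover have "absval x \<le> 1" if "x \<in> A" "x \<in> Qbar" for x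
    using absval_le_1_iff that V(2) by auto
  ultimately show thesis using that absval_padic_place by blast
qed

lemma QbarI_int [simp]: "of_int k \<in> Qbar"
  by (intro subring_of_int is_subfield_subring is_subfield_Qbar)

lemmas Qbar_subring = is_subfield_subring[OF is_subfield_Qbar]

lemma Qbar_1 [simp]: "1 \<in> Qbar" and Qbar_0 [simp]: "0 \<in> Qbar"
  and Qbar_diff: "x \<in> Qbar \<Longrightarrow> y \<in> Qbar \<Longrightarrow> x - y \<in> Qbar"
  and Qbar_add: "x \<in> Qbar \<Longrightarrow> y \<in> Qbar \<Longrightarrow> x + y \<in> Qbar"
  and Qbar_mult: "x \<in> Qbar \<Longrightarrow> y \<in> Qbar \<Longrightarrow> x * y \<in> Qbar"
  and Qbar_minus: "x \<in> Qbar \<Longrightarrow> - x \<in> Qbar"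
  and Qbar_power: "x \<in> Qbar \<Longrightarrow> x ^ n \<in> Qbar"
  and Qbar_inverse: "x \<in> Qbar \<Longrightarrow> inverse x \<in> Qbar"
  and Qbar_divide: "x \<in> Qbar \<Longrightarrow> y \<in> Qbar \<Longrightarrow> x / y \<in> Qbar"
  using Qbar_subring is_subfield_Qbar
  by (auto intro: subring_1 subring_0 subring_diff subring_add subring_mult subring_minus subring_power
      is_subfield_inverse is_subfield_divide)

lemmas Qbar_intros = Qbar_diff Qbar_add Qbar_mult Qbar_minus Qbar_power Qbar_inverse Qbar_divide

lemma minpoly_int_Qbar: "minpoly_int f x \<Longrightarrow> x \<in> Qbar"
  unfolding Qbar_def mem_Collect_eq algebraic_def
  by (rule exI[of _ "map_poly of_int f"]) (use minpoly_int_root minpoly_int_nonzero in auto)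

lemma poly_int_Qbar: "x \<in> Qbar \<Longrightarrow> poly (map_poly of_int q) x \<in> Qbar"
  by (rule subring_poly[OF Qbar_subring]) (auto simp: polys_over_def coeff_map_poly)

section \<open>Arithmetic at a fixed p-adic place\<close>

locale padic_place =
  fixes p :: nat and w :: "complex \<Rightarrow> real"
  assumes prime: "prime p" and place: "w \<in> padic_places p"
begin

lemma nonneg: "x \<in> Qbar \<Longrightarrow> w x \<ge> 0"
  and eq_0_iff: "x \<in> Qbar \<Longrightarrow> w x = 0 \<longleftrightarrow> x = 0"
  and mult: "x \<in> Qbar \<Longrightarrow> y \<in> Qbar \<Longrightarrow> w (x * y) = w x * w y"
  and add_le: "x \<in> Qbar \<Longrightarrow> y \<in> Qbar \<Longrightarrow> w (x + y) \<le> max (w x) (w y)"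
  and of_rat: "w (of_rat q) = padic_abs p q"
  using place by (auto simp: padic_places_def absolute_value_on_def)

lemma zero: "w 0 = 0" by (simp add: eq_0_iff)

lemma pos: "x \<in> Qbar \<Longrightarrow> x \<noteq> 0 \<Longrightarrow> w x > 0"
  using nonneg[of x] eq_0_iff[of x] by simp

lemma of_int: "k \<noteq> 0 \<Longrightarrow> w (of_int k) = real p powi (- int (multiplicity (int p) k))"
  using of_rat[of "of_int k"] by (simp add: padic_abs_def)

lemma one: "w 1 = 1" using of_int[of 1] by simp

lemma minus: "x \<in> Qbar \<Longrightarrow> w (- x) = w x"
proof -
  assume x: "x \<in> Qbar"
  have "w (- 1) = 1" using of_int[of "- 1"] by simp
  then show ?thesis using mult[of "- 1" x] x Qbar_minus[OF Qbar_1] by simp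
qed

lemma diff_le: "x \<in> Qbar \<Longrightarrow> y \<in> Qbar \<Longrightarrow> w (x - y) \<le> max (w x) (w y)"
  using add_le[of x "- y"] minus[of y] Qbar_minus[of y] by simp

lemma of_int_le_1: "w (of_int k) \<le> 1"
proof (cases "k = 0")
  case False
  have "real p \<ge> 1" using prime_gt_0_nat[OF prime] by simp
  then show ?thesis using of_int[OF False] by (simp add: power_int_minus inverse_le_1_iff one_le_power)
qed (simp add: zero)

lemma of_int_less_1_iff: "w (of_int k) < 1 \<longleftrightarrow> int p dvd k"
proof (cases "k = 0")
  case False
  have p: "real p > 1" using prime_gt_1_nat[OF prime] by simp
  have "w (of_int k) < 1 \<longleftrightarrow> multiplicity (int p) k > 0"
    using of_int[OF False] p by (auto simp: power_int_minus inverse_less_1_iff one_less_power intro: gr0I)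
  also have "\<dots> \<longleftrightarrow> int p dvd k"
    using False prime_gt_1_nat[OF prime] by (simp add: multiplicity_gt_zero_iff)
  finally show ?thesis .
qed (simp add: zero)

lemma of_int_eq_1: "\<not> int p dvd k \<Longrightarrow> w (of_int k) = 1"
  using of_int_less_1_iff[of k] of_int_le_1[of k] by simp

lemma power: "x \<in> Qbar \<Longrightarrow> w (x ^ n) = w x ^ n"
  by (induction n) (auto simp: one mult Qbar_power)

lemma inverse: "x \<in> Qbar \<Longrightarrow> w (inverse x) = inverse (w x)"
proof (cases "x = 0")
  case False
  assume x: "x \<in> Qbar"
  have "w x * w (inverse x) = 1" using mult[of x "inverse x"] x False one by (simp add: Qbar_inverse)
  then show ?thesis by (metis inverse_unique)
qed (simp add: zero)

lemma divide: "x \<in> Qbar \<Longrightarrow> y \<in> Qbar \<Longrightarrow> w (x / y) = w x / w y"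
  by (simp add: divide_inverse mult inverse Qbar_inverse)

lemma subring_integers: "subring {x \<in> Qbar. w x \<le> 1}"
proof -
  have "w (x - y) \<le> 1" if "x \<in> Qbar" "y \<in> Qbar" "w x \<le> 1" "w y \<le> 1" for x y
    using diff_le[OF that(1,2)] that by simp
  then show ?thesis
    unfolding subring_def by (auto simp: one mult Qbar_intros intro: mult_le_one nonneg)
qed

lemma poly_le_1: "P \<in> polys_over {x \<in> Qbar. w x \<le> 1} \<Longrightarrow> x \<in> Qbar \<Longrightarrow> w x \<le> 1 \<Longrightarrow> w (poly P x) \<le> 1"
  using subring_poly[OF subring_integers, of P x] by simp

lemma poly_int_le_1: "x \<in> Qbar \<Longrightarrow> w x \<le> 1 \<Longrightarrow> w (poly (map_poly of_int q) x) \<le> 1"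
  by (rule poly_le_1) (auto simp: polys_over_def coeff_map_poly of_int_le_1)

lemma eq_1_if_close:
  assumes "x \<in> Qbar" "y \<in> Qbar" "w (x - y) < 1" "w y = 1"
  shows "w x = 1"
proof (rule antisym)
  show "w x \<le> 1" using add_le[of "x - y" y] assms by (auto simp: Qbar_intros)
  show "1 \<le> w x"
  proof (rule ccontr)
    assume "\<not> 1 \<le> w x"
    then have "w (x - (x - y)) < 1" using diff_le[of x "x - y"] assms by (auto simp: Qbar_intros)
    then show False using assms by simp
  qed
qed

lemma le_1_if_close:
  assumes "x \<in> Qbar" "y \<in> Qbar" "w (x - y) < 1" "w y \<le> 1"
  shows "w x \<le> 1"
  using add_le[of "x - y" y] assms by (auto simp: Qbar_intros)

lemma poly_close:
  assumes P: "P \<in> polys_over {x \<in> Qbar. w x \<le> 1}" and "x \<in> Qbar" "y \<in> Qbar" "w x \<le> 1" "w y \<le> 1" "w (x - y) < 1"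
  shows "w (poly P x - poly P y) < 1"
  using P
proof (induction P)
  case 0
  show ?case by (simp add: zero)
next
  case (pCons c P)
  have P: "P \<in> polys_over {x \<in> Qbar. w x \<le> 1}"
  proof -
    have "coeff P i = coeff (pCons c P) (Suc i)" for i by simp
    then show ?thesis using pCons.prems unfolding polys_over_def mem_Collect_eq by metis
  qed
  note IH = pCons.IH[OF P]
  have Q: "poly P x \<in> Qbar" "poly P y \<in> Qbar"
    using subring_poly[OF subring_integers P] assms by auto
  have "poly (pCons c P) x - poly (pCons c P) y = (x - y) * poly P x + y * (poly P x - poly P y)"
    by (simp add: algebra_simps)
  moreover have "w ((x - y) * poly P x) < 1"
    unfolding mult[OF Qbar_diff[OF assms(2,3)] Q(1)]
    using le_less_trans[OF mult_left_le[OF poly_le_1[OF P assms(2,4)] nonneg[OF Qbar_diff[OF assms(2,3)]]] assms(6)] .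
  moreover have "w (y * (poly P x - poly P y)) < 1"
    unfolding mult[OF assms(3) Qbar_diff[OF Q]]
    using le_less_trans[OF mult_left_le_one_le[OF nonneg[OF Qbar_diff[OF Q]] nonneg[OF assms(3)] assms(5)] IH] .
  moreover have "w ((x - y) * poly P x + y * (poly P x - poly P y))
      \<le> max (w ((x - y) * poly P x)) (w (y * (poly P x - poly P y)))"
    by (intro add_le Qbar_mult Qbar_diff assms Q)
  ultimately show ?case by (simp only: max_less_iff_conj le_less_trans)
qed

lemma sum_le:
  assumes "\<And>i. i \<in> A \<Longrightarrow> f i \<in> Qbar" "\<And>i. i \<in> A \<Longrightarrow> w (f i) \<le> M" "M \<ge> 0"
  shows "w (sum f A) \<le> M"
  using assms(1,2)
proof (induction A rule: infinite_finite_induct)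
  case (insert i A)
  have "sum f A \<in> Qbar" using insert.prems by (intro subring_sum[OF Qbar_subring]) auto
  then show ?case using insert add_le[of "f i" "sum f A"] by fastforce
qed (use assms(3) in \<open>auto simp: zero\<close>)

text \<open>If \<open>w x\<close> exceeded 1, the power \<open>x^n\<close> would strictly dominate
  every term on the right.\<close>

lemma le_1_if_monic_root:
  assumes x: "x \<in> Qbar" and c: "\<And>i. c i \<in> Qbar" "\<And>i. w (c i) \<le> 1" and eq: "x ^ n = (\<Sum>i<n. c i * x ^ i)"
  shows "w x \<le> 1"
proof (rule ccontr)
  assume "\<not> w x \<le> 1"
  then have gt: "w x > 1" by simp
  show False
  proof (cases "n = 0")
    case True
    then show False using eq by simp
  next
    case False
    have "w (\<Sum>i<n. c i * x ^ i) \<le> w x ^ (n - 1)"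
    proof (rule sum_le)
      fix i assume "i \<in> {..<n}"
      then have "w x ^ i \<le> w x ^ (n - 1)" using gt by (intro power_increasing) auto
      moreover have "w (c i * x ^ i) \<le> 1 * w x ^ i" using c x
        by (simp add: mult power Qbar_intros mult_left_le_one_le nonneg)
      ultimately show "w (c i * x ^ i) \<le> w x ^ (n - 1)" by simp
    qed (use x c gt in \<open>auto intro: Qbar_intros\<close>)
    then have "w x ^ n \<le> w x ^ (n - 1)" using eq x power by metis
    moreover have "w x ^ n > w x ^ (n - 1)" using gt False by (intro power_strict_increasing) auto
    ultimately show False by simp
  qed
qed

lemma le_1_if_lead_coeff_unit:
  assumes f: "minpoly_int f x" and p: "\<not> int p dvd lead_coeff f"
  shows "w x \<le> 1"
proof (rule le_1_if_monic_root[where n = "degree f"])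
  let ?l = "of_int (lead_coeff f) :: complex"
  let ?c = "\<lambda>i. of_int (- coeff f i) / ?l"
  show "x \<in> Qbar" using minpoly_int_Qbar[OF f] .
  show "?c i \<in> Qbar" for i by (intro Qbar_divide QbarI_int)
  show "w (?c i) \<le> 1" for i using of_int_le_1[of "- coeff f i"] of_int_eq_1[OF p] by (simp only: divide[OF QbarI_int QbarI_int] div_by_1)
  have l: "?l \<noteq> 0" using minpoly_int_nonzero[OF f] by simp
  have "0 = (\<Sum>i\<le>degree f. of_int (coeff f i) * x ^ i)"
    using minpoly_int_root[OF f] by (simp add: poly_altdef coeff_map_poly)
  also have "\<dots> = (\<Sum>i<degree f. of_int (coeff f i) * x ^ i) + ?l * x ^ degree f"
    by (simp add: lessThan_Suc_atMost[symmetric])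
  finally have "?l * x ^ degree f = - (\<Sum>i<degree f. of_int (coeff f i) * x ^ i)"
    by (simp add: eq_neg_iff_add_eq_0 add.commute)
  then have "x ^ degree f = - (\<Sum>i<degree f. of_int (coeff f i) * x ^ i) / ?l" using l by (simp add: field_simps)
  then show "x ^ degree f = (\<Sum>i<degree f. ?c i * x ^ i)"
    by (simp add: sum_divide_distrib sum_negf)
qed

end

lemma finite_primes_dvd: "k \<noteq> 0 \<Longrightarrow> finite {p. prime p \<and> int p dvd k}"
  by (rule finite_subset[of _ "{..nat \<bar>k\<bar>}"]) (auto dest!: dvd_imp_le_int simp: nat_le_eq_zle le_nat_iff)

text \<open>The exceptional primes divide the leading coefficient of the minimal polynomial of
  \<open>c\<close>, and this criterion serves all places above \<open>p\<close>
  simultaneously.\<close>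

lemma almost_all_integral:
  assumes "c \<in> Qbar"
  shows "finite {p. prime p \<and> (\<exists>w\<in>padic_places p. \<not> w c \<le> 1)}"
proof -
  obtain f where f: "minpoly_int f c" using minpoly_int_exists assms by (auto simp: Qbar_def)
  have "{p. prime p \<and> (\<exists>w\<in>padic_places p. \<not> w c \<le> 1)} \<subseteq> {p. prime p \<and> int p dvd lead_coeff f}"
    using padic_place.le_1_if_lead_coeff_unit[OF _ f] by (auto simp: padic_place_def)
  then show ?thesis
    by (rule finite_subset) (use minpoly_int_nonzero[OF f] in \<open>auto intro: finite_primes_dvd\<close>)
qed

lemma almost_all_unit:
  assumes "c \<in> Qbar" "c \<noteq> 0"
  shows "finite {p. prime p \<and> (\<exists>w\<in>padic_places p. w c \<noteq> 1)}"
proof (rule finite_subset)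
  show "finite ({p. prime p \<and> (\<exists>w\<in>padic_places p. \<not> w c \<le> 1)} \<union> {p. prime p \<and> (\<exists>w\<in>padic_places p. \<not> w (inverse c) \<le> 1)})"
    using almost_all_integral assms Qbar_inverse by blast
  show "{p. prime p \<and> (\<exists>w\<in>padic_places p. w c \<noteq> 1)} \<subseteq>
    {p. prime p \<and> (\<exists>w\<in>padic_places p. \<not> w c \<le> 1)} \<union> {p. prime p \<and> (\<exists>w\<in>padic_places p. \<not> w (inverse c) \<le> 1)}"
  proof safe
    fix p w assume p: "prime p" "w \<in> padic_places p" "w c \<noteq> 1" and
      n: "\<not> (\<exists>w\<in>padic_places p. \<not> w (inverse c) \<le> 1)"
    interpret padic_place p w using p by unfold_locales
    have "inverse (w c) \<le> 1" using n p inverse[OF assms(1)] by auto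
    then have "w c \<ge> 1" using pos[OF assms] by (simp add: inverse_le_1_iff)
    then show "\<exists>w\<in>padic_places p. \<not> w c \<le> 1" using p by (intro bexI[of _ w]) auto
  qed
qed

text \<open>The ideal generated by \<open>p\<close> and \<open>x - r\<close> in
  \<open>\<int>[x]\<close> is proper: a relation between these generators and 1 lifts to an integer
  polynomial divisible by \<open>f\<close>, and its value at \<open>r\<close> would make
  \<open>p\<close> divide 1.\<close>

lemma place_near_root_mod_p:
  assumes f: "minpoly_int f x" and p: "prime p" and r: "int p dvd poly f r"
  obtains w where "w \<in> padic_places p" "\<And>z. z \<in> adjoin \<int> x \<Longrightarrow> w z \<le> 1" "w (x - of_int r) < 1"
proof -
  have xQ: "x \<in> Qbar" using minpoly_int_Qbar[OF f] .
  have Asub: "adjoin \<int> x \<subseteq> Qbar" using poly_int_Qbar[OF xQ] by (auto simp: adjoin_Ints_iff)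
  note A = subring_adjoin[OF subring_Ints, of x]
  have y: "x - of_int r \<in> adjoin \<int> x"
    by (intro subring_diff[OF A] adjoin_self subring_Ints subring_of_int[OF A])
  have proper: "of_nat p * u + (x - of_int r) * v \<noteq> 1" if uv: "u \<in> adjoin \<int> x" "v \<in> adjoin \<int> x" for u v
  proof
    assume *: "of_nat p * u + (x - of_int r) * v = 1"
    obtain a b where ab: "u = poly (map_poly of_int a) x" "v = poly (map_poly of_int b) x"
      using uv by (auto simp: adjoin_Ints_iff)
    define E where "E = smult (int p) a + [:- r, 1:] * b - 1"
    have "poly (map_poly of_int E) x = 0" using * by (simp add: E_def ab hom_distribs algebra_simps)
    then have "f dvd E" using minpoly_int_dvd_iff[OF f] by blast
    then obtain h where "E = f * h" by (rule dvdE)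
    then have "poly E r = poly f r * poly h r" by simp
    moreover have "poly E r = int p * poly a r - 1" by (simp add: E_def)
    ultimately have "int p dvd int p * poly a r - 1" using r by simp
    then have "int p dvd 1" by (metis dvd_diff_right_iff dvd_triv_left)
    then show False using prime_gt_1_nat[OF p] by simp
  qed
  show thesis
  proof (rule padic_place_exists[OF p A y _ proper])
    show "x - of_int r \<in> Qbar" by (intro Qbar_diff xQ QbarI_int)
  qed (use that Asub in auto)
qed

section \<open>Weil functions near the support of the divisor\<close>

lemma polys_over_1: "subring R \<Longrightarrow> 1 \<in> polys_over R"
  by (auto simp: polys_over_def coeff_1 subring_0 subring_1)

lemma padic_abs_of_int: "padic_abs p (of_int k) = (if k = 0 then 0 else real p powi (- int (multiplicity (int p) k)))"
  by (simp add: padic_abs_def)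

lemma padic_abs_inj:
  assumes "prime p" "prime p'" "\<And>q. padic_abs p q = padic_abs p' q"
  shows "p = p'"
proof -
  have p: "real p > 1" using prime_gt_1_nat[OF assms(1)] by simp
  have "multiplicity (int p) (int p) = 1" using assms(1) by (intro multiplicity_self) auto
  then have "padic_abs p (of_int (int p)) < 1" using p unfolding padic_abs_of_int by (simp add: power_int_minus inverse_less_1_iff)
  then have "padic_abs p' (of_int (int p)) < 1" using assms(3) by simp
  then have "multiplicity (int p') (int p) \<noteq> 0" using p unfolding padic_abs_of_int by (intro notI) simp
  then have "p' dvd p" using not_dvd_imp_multiplicity_0[of "int p'" "int p"] by auto
  then show ?thesis using assms(1,2) primes_dvd_imp_eq by blast
qed

text \<open>The values on the rationals determine \<open>p\<close>, so each place of
  \<open>B\<close> accounts for at most one prime.\<close>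

lemma finite_primes_below_places:
  assumes "finite B"
  shows "finite {p. prime p \<and> (\<exists>v\<in>B. \<forall>q. v (of_rat q) = padic_abs p q)}"
proof (rule finite_surj[OF assms])
  show "{p. prime p \<and> (\<exists>v\<in>B. \<forall>q. v (of_rat q) = padic_abs p q)}
    \<subseteq> (\<lambda>v. THE p. prime p \<and> (\<forall>q. v (of_rat q) = padic_abs p q)) ` B"
  proof
    fix p assume "p \<in> {p. prime p \<and> (\<exists>v\<in>B. \<forall>q. v (of_rat q) = padic_abs p q)}"
    then obtain v where v: "prime p" "v \<in> B" "\<forall>q. v (of_rat q) = padic_abs p q" by blast
    have "(THE p. prime p \<and> (\<forall>q. v (of_rat q) = padic_abs p q)) = p"
    proof (rule the_equality)
      fix p' assume "prime p' \<and> (\<forall>q. v (of_rat q) = padic_abs p' q)"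
      then show "p' = p" using v padic_abs_inj[of p' p] by metis
    qed (use v in blast)
    then show "p \<in> (\<lambda>v. THE p. prime p \<and> (\<forall>q. v (of_rat q) = padic_abs p q)) ` B" using v(2) by force
  qed
qed

lemma restrict_padic_place:
  assumes "prime p" "w \<in> padic_places p" "is_subfield K" "K \<subseteq> Qbar"
  shows "restrict w K \<in> places K"
proof -
  interpret padic_place p w using assms by unfold_locales
  note KR = is_subfield_subring[OF assms(3)]
  have tri: "w (x + y) \<le> w x + w y" if "x \<in> Qbar" "y \<in> Qbar" for x y
    using add_le[OF that] nonneg[OF that(1)] nonneg[OF that(2)] by linarith
  have "absolute_value_on K (restrict w K)"
    unfolding absolute_value_on_def
  proof (intro conjI ballI)
    show "restrict w K \<in> extensional K" by simp
    fix x assume x: "x \<in> K"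
    then have xQ: "x \<in> Qbar" using assms(4) by blast
    show "restrict w K x \<ge> 0" "restrict w K x = 0 \<longleftrightarrow> x = 0" using x nonneg[OF xQ] eq_0_iff[OF xQ] by simp_all
    fix y assume y: "y \<in> K"
    then have yQ: "y \<in> Qbar" using assms(4) by blast
    have "x * y \<in> K" "x + y \<in> K" using x y KR by (auto intro: subring_mult subring_add)
    then show "restrict w K (x * y) = restrict w K x * restrict w K y"
      "restrict w K (x + y) \<le> restrict w K x + restrict w K y"
      using x y mult[OF xQ yQ] tri[OF xQ yQ] by simp_all
  qed
  moreover have "restrict w K (of_rat q) = padic_abs p q" for q
  proof -
    have "of_rat q \<in> K" using Rats_subset_subfield[OF assms(3)] Rats_of_rat by blast
    then show ?thesis using of_rat[of q] by simp
  qed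
  ultimately show ?thesis using assms(1) unfolding places_def by blast
qed

text \<open>Neighbourhoods of finite points and of infinity are treated by one argument.
  \<open>\<iota>\<close> parametrizes an affine line, \<open>miss\<close> is the remaining point,
  \<open>s\<close> rescales to the chosen homogeneous coordinates, and \<open>\<sigma>\<close> is
  the identity or the reversal of coefficients. The last assumption reads the zeros of a reduced
  fraction off its dehomogenized numerator and denominator.\<close>

locale chart =
  fixes \<iota> :: "complex \<Rightarrow> proj1" and s :: "complex \<Rightarrow> complex" and \<sigma> :: "nat \<Rightarrow> nat \<Rightarrow> nat" and miss :: proj1
  assumes inj: "inj \<iota>" and s_nonzero: "s t \<noteq> 0"
    and form_\<iota>: "form n c (\<iota> t) = s t ^ n * (\<Sum>i\<le>n. c (\<sigma> n i) * t ^ i)"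
    and \<sigma>: "i \<le> n \<Longrightarrow> \<sigma> n i \<le> n" "i \<le> n \<Longrightarrow> \<sigma> n (\<sigma> n i) = i"
    and P1_eq: "P1 = insert miss (\<iota> ` Qbar)"
    and form_miss: "form n c miss = c (\<sigma> n n)"
    and rf_ord_pos_iff: "\<And>K p q t N. rational_function K (p, q) \<Longrightarrow> N = max (degree p) (degree q) \<Longrightarrow>
       rf_ord (p, q) (\<iota> t) > 0 \<longleftrightarrow>
         (\<Sum>i\<le>N. coeff p (\<sigma> N i) * t ^ i) = 0 \<and> (\<Sum>i\<le>N. coeff q (\<sigma> N i) * t ^ i) \<noteq> 0"
begin

definition dehom :: "nat \<Rightarrow> (nat \<Rightarrow> complex) \<Rightarrow> complex poly" where
  "dehom n c = (\<Sum>i\<le>n. monom (c (\<sigma> n i)) i)"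

lemma poly_dehom: "poly (dehom n c) t = (\<Sum>i\<le>n. c (\<sigma> n i) * t ^ i)"
  by (simp add: dehom_def poly_sum poly_monom)

lemma coeff_dehom: "coeff (dehom n c) i = (if i \<le> n then c (\<sigma> n i) else 0)"
  by (simp add: dehom_def coeff_sum)

lemma form_dehom: "form n c (\<iota> t) = s t ^ n * poly (dehom n c) t"
  by (simp add: form_\<iota> poly_dehom)

lemma form_zero_iff: "form n c (\<iota> t) = 0 \<longleftrightarrow> poly (dehom n c) t = 0"
  by (simp add: form_dehom s_nonzero)

lemma form_divide: "form n a (\<iota> t) / form n b (\<iota> t) = poly (dehom n a) t / poly (dehom n b) t"
  by (simp add: form_dehom s_nonzero)

lemma dehom_over: "subring K \<Longrightarrow> (\<And>i. c i \<in> K) \<Longrightarrow> dehom n c \<in> polys_over K"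
  by (auto simp: polys_over_def coeff_dehom subring_0)

definition hom :: "nat \<Rightarrow> complex poly \<Rightarrow> nat \<Rightarrow> complex" where
  "hom n p i = (if i \<le> n then coeff p (\<sigma> n i) else 0)"

lemma dehom_hom: "degree p \<le> n \<Longrightarrow> dehom n (hom n p) = p"
  by (rule poly_eqI) (auto simp: coeff_dehom hom_def \<sigma> coeff_eq_0)

lemma hom_over: "subring K \<Longrightarrow> p \<in> polys_over K \<Longrightarrow> hom n p i \<in> K"
  by (auto simp: hom_def polys_over_def subring_0)

definition \<upsilon> :: "proj1 \<Rightarrow> complex" where "\<upsilon> = inv_into UNIV \<iota>"

lemma \<upsilon>_\<iota> [simp]: "\<upsilon> (\<iota> t) = t" by (simp add: \<upsilon>_def inj)

definition nbhd :: "complex poly \<Rightarrow> proj1 set" where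
  "nbhd g = \<iota> ` {t \<in> Qbar. poly g t \<noteq> 0}"

text \<open>The embedding \<open>t \<mapsto> (t, 1 / g(t))\<close> of a principal open set as the
  plane curve \<open>g(x) * y = 1\<close>. Bounding the second coordinate keeps \<open>t\<close>
  away from the zeros of \<open>g\<close>.\<close>

definition coord :: "complex poly \<Rightarrow> nat \<Rightarrow> proj1 \<Rightarrow> complex" where
  "coord g j P = (if j = 0 then \<upsilon> P else 1 / poly g (\<upsilon> P))"

lemma zariski_open_nbhd:
  assumes K: "subring K" and g: "g \<in> polys_over K"
  shows "zariski_open K (nbhd g)"
  unfolding zariski_open_def
proof (intro exI conjI)
  \<comment> \<open>One degree above that of \<open>g\<close>: the additional factor makes the form
    vanish at \<open>miss\<close>, so that the open set is exactly \<open>nbhd g\<close>.\<close>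
  let ?n = "Suc (degree g)"
  let ?T = "{(?n, hom ?n g)}"
  show "\<forall>(n, c)\<in>?T. \<forall>i. c i \<in> K" using hom_over[OF K g] by auto
  have "form ?n (hom ?n g) miss = 0"
    unfolding form_miss using \<sigma>[of ?n ?n] by (simp add: hom_def coeff_eq_0)
  moreover have "form ?n (hom ?n g) (\<iota> t) = 0 \<longleftrightarrow> poly g t = 0" for t
    using form_zero_iff[of ?n "hom ?n g" t] by (simp add: dehom_hom)
  ultimately show "nbhd g = {P \<in> P1. \<exists>(n, c)\<in>?T. form n c P \<noteq> 0}"
    by (auto simp: nbhd_def P1_eq)
qed

lemma regular_onI:
  assumes K: "subring K" and ab: "a \<in> polys_over K" "b \<in> polys_over K"
    and b: "\<And>t. t \<in> Qbar \<Longrightarrow> poly g t \<noteq> 0 \<Longrightarrow> poly b t \<noteq> 0"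
    and h: "\<And>t. t \<in> Qbar \<Longrightarrow> poly g t \<noteq> 0 \<Longrightarrow> h (\<iota> t) = poly a t / poly b t"
  shows "regular_on K (nbhd g) h"
  unfolding regular_on_def
proof
  fix P assume P: "P \<in> nbhd g"
  define n where "n = max (degree a) (degree b)"
  have d: "dehom n (hom n a) = a" "dehom n (hom n b) = b" by (rule dehom_hom, simp add: n_def)+
  show "\<exists>n a b. (\<forall>i. a i \<in> K \<and> b i \<in> K) \<and> form n b P \<noteq> 0 \<and>
     (\<forall>Q\<in>nbhd g. form n b Q \<noteq> 0 \<longrightarrow> h Q = form n a Q / form n b Q)"
  proof (intro exI conjI ballI impI allI)
    show "hom n a i \<in> K" "hom n b i \<in> K" for i using hom_over K ab by auto
    show "form n (hom n b) P \<noteq> 0" using P b by (auto simp: nbhd_def form_zero_iff d)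
    fix Q assume "Q \<in> nbhd g"
    then show "h Q = form n (hom n a) Q / form n (hom n b) Q"
      using h by (auto simp: nbhd_def form_divide d)
  qed
qed

lemma polynomial_in_algebra:
  assumes K: "subring K" and p: "p \<in> polys_over K" and x: "x \<in> generated_algebra K X"
  shows "(\<lambda>P. poly p (x P)) \<in> generated_algebra K X"
  using p
proof (induction p)
  case 0
  then show ?case using generated_algebra.const[of 0 K X] subring_0[OF K] by simp
next
  case (pCons c p)
  have "coeff p i = coeff (pCons c p) (Suc i)" for i by simp
  then have p: "p \<in> polys_over K" using pCons.prems unfolding polys_over_def mem_Collect_eq by metis
  have "c = coeff (pCons c p) 0" by simp
  then have c: "c \<in> K" using pCons.prems unfolding polys_over_def mem_Collect_eq by metis
  show ?case
    using generated_algebra.add[OF generated_algebra.const[OF c] generated_algebra.mult[OF x pCons.IH(1)[OF p]]]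
    by simp
qed

lemma power_in_algebra: "subring K \<Longrightarrow> x \<in> generated_algebra K X \<Longrightarrow> (\<lambda>P. x P ^ n) \<in> generated_algebra K X"
proof (induction n)
  case 0
  then show ?case using generated_algebra.const[of 1 K X] subring_1 by simp
next
  case (Suc n)
  then show ?case using generated_algebra.mult[of x K X "\<lambda>P. x P ^ n"] by simp
qed

text \<open>The denominators of a regular function form an ideal of \<open>K[x]\<close>. An element of minimal degree
  generates it and has no zeros on the open set, so it divides a power of \<open>g\<close>.\<close>

lemma regular_function_polynomial:
  assumes K: "number_field K" and g: "g \<in> polys_over K" "g \<noteq> 0" and reg: "regular_on K (nbhd g) h"
  shows "\<exists>h'\<in>generated_algebra K (coord g ` {..<2}). \<forall>P\<in>nbhd g. h P = h' P"
proof (cases "nbhd g = {}")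
  case True
  have "(1 :: complex) \<in> K" using K by (auto simp: number_field_def is_subfield_def)
  then show ?thesis using True generated_algebra.const[of 1 K] by auto
next
  case False
  have F: "is_subfield K" using K by (simp add: number_field_def)
  note R = is_subfield_subring[OF F]
  define I where "I = {b \<in> polys_over K. \<exists>a\<in>polys_over K. \<forall>t\<in>Qbar. poly g t \<noteq> 0 \<longrightarrow> poly b t * h (\<iota> t) = poly a t}"
  have loc: "\<exists>b\<in>I. poly b t \<noteq> 0" if t: "t \<in> Qbar" "poly g t \<noteq> 0" for t
  proof -
    have "\<iota> t \<in> nbhd g" using t by (auto simp: nbhd_def)
    then obtain n a b where ab: "\<And>i. a i \<in> K" "\<And>i. b i \<in> K" "form n b (\<iota> t) \<noteq> 0"
      "\<And>Q. Q \<in> nbhd g \<Longrightarrow> form n b Q \<noteq> 0 \<Longrightarrow> h Q = form n a Q / form n b Q"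
      using reg unfolding regular_on_def by meson
    define A where "A = dehom n a"
    define B where "B = dehom n b"
    have AB: "A \<in> polys_over K" "B \<in> polys_over K" using dehom_over[OF R] ab by (auto simp: A_def B_def)
    have Bt: "poly B t \<noteq> 0" using ab(3) by (simp add: form_zero_iff B_def)
    \<comment> \<open>\<open>B * h = A\<close> is known only where \<open>B\<close> is non-zero.
      With one more factor \<open>B\<close> both sides vanish at the other points.\<close>
    have "poly (B * B) u * h (\<iota> u) = poly (A * B) u" if u: "u \<in> Qbar" "poly g u \<noteq> 0" for u
    proof (cases "poly B u = 0")
      case False
      then have "h (\<iota> u) = poly A u / poly B u"
        using ab(4)[of "\<iota> u"] u by (auto simp: nbhd_def form_zero_iff form_divide A_def B_def)
      then show ?thesis using False by (simp add: field_simps)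
    qed simp
    then have "B * B \<in> I" using polys_over_mult[OF R] AB unfolding I_def by blast
    then show ?thesis using Bt by (intro bexI[of _ "B * B"]) auto
  qed
  have I0: "\<exists>b. b \<in> I \<and> b \<noteq> 0"
  proof -
    from False obtain t where "t \<in> Qbar" "poly g t \<noteq> 0" by (auto simp: nbhd_def)
    from loc[OF this] show ?thesis by force
  qed
  then obtain m where m: "m \<in> I" "m \<noteq> 0" "\<And>b. b \<in> I \<Longrightarrow> b \<noteq> 0 \<Longrightarrow> degree m \<le> degree b"
    using ex_has_least_nat[of "\<lambda>b. b \<in> I \<and> b \<noteq> 0" _ degree] by blast
  obtain a where a: "a \<in> polys_over K" "\<And>t. t \<in> Qbar \<Longrightarrow> poly g t \<noteq> 0 \<Longrightarrow> poly m t * h (\<iota> t) = poly a t"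
    using m(1) by (auto simp: I_def)
  have mK: "m \<in> polys_over K" using m(1) by (simp add: I_def)
  have dvd: "m dvd b" if b: "b \<in> I" for b
  proof -
    have bK: "b \<in> polys_over K" using b by (simp add: I_def)
    obtain c where c: "c \<in> polys_over K" "\<And>t. t \<in> Qbar \<Longrightarrow> poly g t \<noteq> 0 \<Longrightarrow> poly b t * h (\<iota> t) = poly c t"
      using b by (auto simp: I_def)
    obtain q r where qr: "q \<in> polys_over K" "r \<in> polys_over K" "b = q * m + r" "r = 0 \<or> degree r < degree m"
      using polys_over_division[OF F mK m(2) bK] by blast
    have "poly r t * h (\<iota> t) = poly (c - q * a) t" if "t \<in> Qbar" "poly g t \<noteq> 0" for t
    proof -
      have "poly r t = poly b t - poly q t * poly m t" by (simp add: qr(3))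
      then have "poly r t * h (\<iota> t) = poly b t * h (\<iota> t) - poly q t * (poly m t * h (\<iota> t))"
        by (simp only: left_diff_distrib mult.assoc)
      then show ?thesis using c(2)[OF that] a(2)[OF that] by simp
    qed
    moreover have "c - q * a \<in> polys_over K" by (intro polys_over_diff polys_over_mult R c qr a)
    ultimately have "r \<in> I" using qr(2) unfolding I_def by blast
    then have "r = 0" using m(3)[of r] qr(4) by (metis not_le)
    then show ?thesis using qr(3) by simp
  qed
  have "\<forall>t. poly m t = 0 \<longrightarrow> poly g t = 0"
  proof (intro allI impI, rule ccontr)
    fix t assume t: "poly m t = 0" "poly g t \<noteq> 0"
    \<comment> \<open>Local denominators are provided only at points of \<open>Qbar\<close>, so the
      zero of \<open>m\<close> first has to be seen to be algebraic.\<close>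
    have "t \<in> Qbar" by (rule root_over_number_field[OF K mK m(2) t(1)])
    from loc[OF this t(2)] obtain b where "b \<in> I" "poly b t \<noteq> 0" by blast
    then show False using dvd[of b] t(1) by (auto elim!: dvdE)
  qed
  then have "m dvd g ^ degree m" using nullstellensatz_univariate[of m g] m(2) by blast
  then obtain r where r: "r \<in> polys_over K" "g ^ degree m = m * r"
    using polys_over_dvdE[OF F mK polys_over_power[OF R g(1)]] by metis
  have c01: "coord g 0 \<in> generated_algebra K (coord g ` {..<2})" "coord g 1 \<in> generated_algebra K (coord g ` {..<2})"
    by (auto intro!: generated_algebra.gen)
  have alg: "(\<lambda>P. poly (r * a) (coord g 0 P) * coord g 1 P ^ degree m) \<in> generated_algebra K (coord g ` {..<2})"
    by (intro generated_algebra.mult polynomial_in_algebra power_in_algebra R c01 polys_over_mult r a)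
  have "h P = poly (r * a) (coord g 0 P) * coord g 1 P ^ degree m" if "P \<in> nbhd g" for P
  proof -
    from that obtain t where t: "t \<in> Qbar" "poly g t \<noteq> 0" "P = \<iota> t" by (auto simp: nbhd_def)
    have e: "poly g t ^ degree m = poly m t * poly r t"
      using arg_cong[OF r(2), of "\<lambda>p. poly p t"] by simp
    have "h P * poly g t ^ degree m = poly r t * (poly m t * h P)" unfolding e by (simp only: mult_ac)
    also have "\<dots> = poly (r * a) t" using a(2)[OF t(1,2)] t(3) by simp
    finally have "h P = poly (r * a) t / poly g t ^ degree m" using t(2) by (simp add: nonzero_eq_divide_eq)
    moreover have "coord g 0 P = t" "coord g 1 P = 1 / poly g t" by (simp_all add: coord_def t(3))
    ultimately show ?thesis by (simp only: power_one_over times_divide_eq_right mult_1_right)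
  qed
  then show ?thesis by (intro bexI[OF _ alg] ballI)
qed

text \<open>The local bound on the correction term of a Weil function is available only for genuine
  affine coordinates, with closed image and generating all regular functions; \<open>coord\<close>
  has to be certified as such.\<close>

lemma affine_coordinates_nbhd:
  assumes K: "number_field K" and g: "g \<in> polys_over K" "g \<noteq> 0"
  shows "affine_coordinates K (nbhd g) 2 (coord g)"
  unfolding affine_coordinates_def
proof (intro conjI allI impI)
  have F: "is_subfield K" using K by (simp add: number_field_def)
  note R = is_subfield_subring[OF F]
  have KQ: "K \<subseteq> Qbar" using number_field_subset_Qbar[OF K] .
  have gQ: "poly g t \<in> Qbar" if "t \<in> Qbar" for t
    using subring_poly[OF Qbar_subring _ that, of g] polys_over_mono[OF KQ] g by auto
  show "zariski_open K (nbhd g)" by (rule zariski_open_nbhd[OF R g(1)])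
  show "regular_on K (nbhd g) (coord g j)" if "j < 2" for j
  proof (cases "j = 0")
    case True
    show ?thesis
      by (rule regular_onI[OF R, of "[:0, 1:]" "[:1:]"])
        (auto simp: True coord_def intro!: polys_over_pCons polys_over_0 polys_over_1 R subring_0 subring_1)
  next
    case False
    show ?thesis
      by (rule regular_onI[OF R, of "[:1:]" g])
        (auto simp: False coord_def g intro!: polys_over_pCons polys_over_0 polys_over_1 R subring_0 subring_1)
  qed
  show "inj_on (\<lambda>P. \<lambda>j\<in>{..<2}. coord g j P) (nbhd g)"
  proof (rule inj_onI)
    fix P Q assume PQ: "P \<in> nbhd g" "Q \<in> nbhd g" "(\<lambda>j\<in>{..<2}. coord g j P) = (\<lambda>j\<in>{..<2}. coord g j Q)"
    from fun_cong[OF PQ(3), of 0] have "\<upsilon> P = \<upsilon> Q" by (simp add: coord_def)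
    then show "P = Q" using PQ by (auto simp: nbhd_def)
  qed
  show "\<exists>h'\<in>generated_algebra K (coord g ` {..<2}). \<forall>P\<in>nbhd g. h P = h' P" if "regular_on K (nbhd g) h" for h
    by (rule regular_function_polynomial[OF K g that])
  show "zariski_closed_affine K 2 ((\<lambda>P. \<lambda>j\<in>{..<2}. coord g j P) ` nbhd g)"
    unfolding zariski_closed_affine_def
  proof (intro exI conjI)
    let ?G = "\<lambda>a :: nat \<Rightarrow> complex. poly g (a 0) * a 1 + (-1)"
    have *: "(\<lambda>a. a j) \<in> polynomial_functions K 2" if "j < 2" for j
      unfolding polynomial_functions_def using that by (intro generated_algebra.gen) auto
    have "?G \<in> polynomial_functions K 2"
      unfolding polynomial_functions_def
      by (intro generated_algebra.add generated_algebra.mult polynomial_in_algebra generated_algebra.const R g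
          *[unfolded polynomial_functions_def] subring_minus subring_1) auto
    then show "{?G} \<subseteq> polynomial_functions K 2" by simp
    have "(\<lambda>P. \<lambda>j\<in>{..<2}. coord g j P) ` nbhd g = {a \<in> {..<2} \<rightarrow>\<^sub>E Qbar. ?G a = 0}"
    proof (rule Set.set_eqI, rule iffI)
      fix a assume "a \<in> (\<lambda>P. \<lambda>j\<in>{..<2}. coord g j P) ` nbhd g"
      then obtain t where t: "t \<in> Qbar" "poly g t \<noteq> 0" "a = (\<lambda>j\<in>{..<2}. coord g j (\<iota> t))"
        unfolding nbhd_def by blast
      have a01: "a 0 = t" "a 1 = 1 / poly g t" by (simp_all add: t(3) coord_def)
      have "a \<in> {..<2} \<rightarrow>\<^sub>E Qbar"
      proof (rule PiE_I)
        fix j :: nat assume "j \<in> {..<2}"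
        then have "j = 0 \<or> j = 1" by auto
        then show "a j \<in> Qbar" using a01 t(1) Qbar_divide[OF Qbar_1 gQ[OF t(1)]] by metis
      next
        fix j :: nat assume "j \<notin> {..<2}"
        then show "a j = undefined" by (simp add: t(3))
      qed
      moreover have "?G a = 0" using a01 t(2) by simp
      ultimately show "a \<in> {a \<in> {..<2} \<rightarrow>\<^sub>E Qbar. ?G a = 0}" by (intro CollectI conjI)
    next
      fix a assume a: "a \<in> {a \<in> {..<2} \<rightarrow>\<^sub>E Qbar. ?G a = 0}"
      have aE: "a \<in> {..<2} \<rightarrow>\<^sub>E Qbar" by (rule conjunct1[OF CollectD[OF a]])
      have "?G a = 0" by (rule conjunct2[OF CollectD[OF a]])
      then have eq: "poly g (a 0) * a 1 = 1" by simp
      have a0: "a 0 \<in> Qbar" using aE by (rule PiE_mem) simp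
      have gnz: "poly g (a 0) \<noteq> 0" using eq by (metis mult_zero_left zero_neq_one)
      have "a = (\<lambda>j\<in>{..<2}. coord g j (\<iota> (a 0)))"
      proof
        fix j show "a j = (\<lambda>j\<in>{..<2}. coord g j (\<iota> (a 0))) j"
        proof (cases "j < 2")
          case True
          then have "j = 0 \<or> j = 1" by auto
          then show ?thesis using eq gnz True by (auto simp: coord_def nonzero_eq_divide_eq mult.commute)
        next
          case False
          then show ?thesis using PiE_arb[OF aE, of j] by simp
        qed
      qed
      moreover have "\<iota> (a 0) \<in> nbhd g" using a0 gnz unfolding nbhd_def by blast
      ultimately show "a \<in> (\<lambda>P. \<lambda>j\<in>{..<2}. coord g j P) ` nbhd g" by (rule image_eqI)
    qed
    then show "(\<lambda>P. \<lambda>j\<in>{..<2}. coord g j P) ` nbhd g = {a \<in> {..<2} \<rightarrow>\<^sub>E Qbar. \<forall>G\<in>{?G}. G a = 0}"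
      by simp
  qed
qed

lemma rf_value_dehom:
  "rf_value (a, b) (\<iota> t) = poly (dehom (max (degree a) (degree b)) (coeff a)) t / poly (dehom (max (degree a) (degree b)) (coeff b)) t"
  by (simp add: rf_value_def Let_def form_divide)

lemma rf_ord_dehom:
  assumes "rational_function K (a, b)"
  shows "rf_ord (a, b) (\<iota> t) > 0 \<longleftrightarrow>
    poly (dehom (max (degree a) (degree b)) (coeff a)) t = 0 \<and> poly (dehom (max (degree a) (degree b)) (coeff b)) t \<noteq> 0"
  using rf_ord_pos_iff[OF assms refl, of t] by (simp only: poly_dehom)

text \<open>Near \<open>t0\<close> the Weil function differs from minus the logarithm of the local equation by a function
  which vanishes at almost all places.\<close>

lemma weil_function_local:
  assumes K: "number_field K" and L: "weil_function K D L" and U0: "zariski_open K U0" "\<iota> t0 \<in> U0"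
    and f: "rational_function K (a, b)" "represents D U0 (a, b)"
  obtains g \<gamma> where "g \<in> polys_over K" "poly g t0 \<noteq> 0" "MK_constant K \<gamma>"
    "represents D (nbhd g) (a, b)"
    "\<And>t w. t \<in> Qbar \<Longrightarrow> poly g t \<noteq> 0 \<Longrightarrow> \<iota> t \<notin> Poly_Mapping.keys D \<Longrightarrow> w \<in> abs_Qbar K \<Longrightarrow>
      w t \<le> 1 \<Longrightarrow> w (1 / poly g t) \<le> 1 \<Longrightarrow> \<gamma> (restrict w K) = 0 \<Longrightarrow> L (\<iota> t) w = - ln (w (rf_value (a, b) (\<iota> t)))"
proof -
  have F: "is_subfield K" using K by (simp add: number_field_def)
  note KR = is_subfield_subring[OF F]
  obtain T where T: "\<And>n c i. (n, c) \<in> T \<Longrightarrow> c i \<in> K" "U0 = {P \<in> P1. \<exists>(n, c)\<in>T. form n c P \<noteq> 0}"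
    using U0(1) unfolding zariski_open_def by blast
  obtain n c where nc: "(n, c) \<in> T" "form n c (\<iota> t0) \<noteq> 0" using U0(2) unfolding T(2) by blast
  define g where "g = dehom n c"
  have g: "g \<in> polys_over K" unfolding g_def by (rule dehom_over[OF KR T(1)[OF nc(1)]])
  have gt0: "poly g t0 \<noteq> 0" using nc(2) by (simp add: g_def form_zero_iff)
  then have g0: "g \<noteq> 0" by auto
  have sub: "nbhd g \<subseteq> U0"
  proof
    fix P assume "P \<in> nbhd g"
    then obtain t where t: "t \<in> Qbar" "poly g t \<noteq> 0" "P = \<iota> t" unfolding nbhd_def by blast
    have "form n c P \<noteq> 0" unfolding t(3) form_zero_iff using t(2) by (simp add: g_def)
    moreover have "P \<in> P1" unfolding t(3) P1_eq using t(1) by blast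
    ultimately show "P \<in> U0" using nc(1) unfolding T(2) by blast
  qed
  have rep: "represents D (nbhd g) (a, b)" using f(2) sub unfolding represents_def by blast
  obtain \<alpha> where \<alpha>: "\<forall>P\<in>nbhd g - Poly_Mapping.keys D. \<forall>w\<in>abs_Qbar K.
      L P w = - ln (w (rf_value (a, b) P)) + \<alpha> P w" "locally_MK_bounded K (nbhd g) \<alpha>"
    using L[unfolded weil_function_def, rule_format, OF conjI[OF zariski_open_nbhd[OF KR g] conjI[OF f(1) rep]]]
    by (elim exE conjE)
  \<comment> \<open>Both coordinates have size at most 1 on \<open>E\<close>, so the zero
    M_K-constant bounds them. The bound on \<open>\<alpha>\<close> obtained in return is uniform on
    \<open>E\<close> and vanishes at almost all places.\<close>
  define E where "E = {(P, w). P \<in> nbhd g \<and> w \<in> abs_Qbar K \<and> w (coord g 0 P) \<le> 1 \<and> w (coord g 1 P) \<le> 1}"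
  have "affine_MK_bounded K 2 (coord g) E" unfolding affine_MK_bounded_def
  proof (intro exI conjI)
    show "MK_constant K (\<lambda>_. 0)" by (simp add: MK_constant_def)
    have "w (coord g j P) \<le> 1" if "(P, w) \<in> E" "j < 2" for P w j
    proof -
      have "j = 0 \<or> j = 1" using that(2) by linarith
      then show ?thesis using that(1) unfolding E_def by blast
    qed
    then show "\<forall>(P, w)\<in>E. \<forall>j<2. w (coord g j P) \<le> exp 0" by auto
  qed
  moreover have "E \<subseteq> nbhd g \<times> abs_Qbar K" unfolding E_def by blast
  ultimately obtain \<gamma> where \<gamma>: "MK_constant K \<gamma>" "\<forall>(P, w)\<in>E. \<bar>\<alpha> P w\<bar> \<le> \<gamma> (restrict w K)"
    using \<alpha>(2)[unfolded locally_MK_bounded_def, rule_format, OF conjI[OF subset_refl conjI[OF affine_coordinates_nbhd[OF K g g0]]], of E]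
    by blast
  show thesis
  proof (rule that[OF g gt0 \<gamma>(1) rep])
    fix t w assume t: "t \<in> Qbar" "poly g t \<noteq> 0" "\<iota> t \<notin> Poly_Mapping.keys D" "w \<in> abs_Qbar K"
      "w t \<le> 1" "w (1 / poly g t) \<le> 1" "\<gamma> (restrict w K) = 0"
    have nb: "\<iota> t \<in> nbhd g" using t(1,2) unfolding nbhd_def by blast
    have "(\<iota> t, w) \<in> E" using nb t(4,5,6) by (simp add: E_def coord_def)
    then have "\<bar>\<alpha> (\<iota> t) w\<bar> \<le> \<gamma> (restrict w K)" using \<gamma>(2) by blast
    then have "\<alpha> (\<iota> t) w = 0" using t(7) by simp
    then show "L (\<iota> t) w = - ln (w (rf_value (a, b) (\<iota> t)))" using \<alpha>(1) nb t(3,4) by simp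
  qed
qed

text \<open>Near \<open>t0\<close> the local equation \<open>a' / b'\<close> has a numerator of size
  below 1 and a unit as denominator, so the Weil function is minus the logarithm of a number below 1
  and hence positive, against integrality. This uses that \<open>\<gamma>\<close> vanishes at the
  place, that the place is outside \<open>S\<close>, that the coefficients are integral, and that
  \<open>g(t0)\<close> and \<open>b'(t0)\<close> are units; each condition excludes finitely many
  primes.\<close>

lemma integral_points_avoid_residue_class:
  assumes K: "number_field K" and L: "weil_function K D L" and U0: "zariski_open K U0" "\<iota> t0 \<in> U0"
    and t0: "t0 \<in> Qbar" and f: "rational_function K (a, b)" "represents D U0 (a, b)"
    and D: "Poly_Mapping.lookup D (\<iota> t0) > 0" and S: "finite S"
    and R: "R \<subseteq> P1 - Poly_Mapping.keys D"
      "\<And>v w P. v \<in> places K - S \<Longrightarrow> w \<in> abs_Qbar K \<Longrightarrow> restrict w K = v \<Longrightarrow> P \<in> R \<Longrightarrow> L P w \<le> 0"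
  shows "\<exists>S0. finite S0 \<and> (\<forall>p w t. prime p \<and> p \<notin> S0 \<and> w \<in> padic_places p \<and> t \<in> Qbar \<and> \<iota> t \<in> R \<longrightarrow> \<not> w (t - t0) < 1)"
proof -
  have F: "is_subfield K" using K by (simp add: number_field_def)
  note KR = is_subfield_subring[OF F]
  have KQ: "K \<subseteq> Qbar" using number_field_subset_Qbar[OF K] .
  obtain g \<gamma> where g: "g \<in> polys_over K" "poly g t0 \<noteq> 0" and \<gamma>: "MK_constant K \<gamma>" and rep: "represents D (nbhd g) (a, b)"
    and loc: "\<And>t w. t \<in> Qbar \<Longrightarrow> poly g t \<noteq> 0 \<Longrightarrow> \<iota> t \<notin> Poly_Mapping.keys D \<Longrightarrow> w \<in> abs_Qbar K \<Longrightarrow>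
      w t \<le> 1 \<Longrightarrow> w (1 / poly g t) \<le> 1 \<Longrightarrow> \<gamma> (restrict w K) = 0 \<Longrightarrow> L (\<iota> t) w = - ln (w (rf_value (a, b) (\<iota> t)))"
    using weil_function_local[OF K L U0 f] by blast
  define B where "B = S \<union> {v \<in> places K. \<gamma> v \<noteq> 0}"
  have "finite B" using S \<gamma> by (simp add: B_def MK_constant_def)
  define S1 where "S1 = {p. prime p \<and> (\<exists>v\<in>B. \<forall>q. v (of_rat q) = padic_abs p q)}"
  have fin1: "finite S1" unfolding S1_def by (rule finite_primes_below_places[OF \<open>finite B\<close>])
  define a' where "a' = dehom (max (degree a) (degree b)) (coeff a)"
  define b' where "b' = dehom (max (degree a) (degree b)) (coeff b)"
  have coeffK: "coeff p i \<in> K" if "set (coeffs p) \<subseteq> K" for p :: "complex poly" and i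
  proof (cases "coeff p i = 0")
    case True
    then show ?thesis using subring_0[OF KR] by simp
  next
    case False
    then have "coeff p i \<in> set (coeffs p)" by (metis coeff_in_coeffs le_degree coeff_0)
    then show ?thesis using that by blast
  qed
  have sets: "set (coeffs a) \<subseteq> K" "set (coeffs b) \<subseteq> K" using f(1) by (simp_all add: rational_function_def)
  have ab'K: "a' \<in> polys_over K" "b' \<in> polys_over K"
    unfolding a'_def b'_def by (rule dehom_over[OF KR], rule coeffK, rule sets)+
  have pos_iff: "rf_ord (a, b) (\<iota> t) > 0 \<longleftrightarrow> poly a' t = 0 \<and> poly b' t \<noteq> 0" for t
    unfolding a'_def b'_def by (rule rf_ord_dehom[OF f(1)])
  have t0': "poly a' t0 = 0" "poly b' t0 \<noteq> 0"
  proof -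
    have "rf_ord (a, b) (\<iota> t0) > 0" using f(2) U0(2) D unfolding represents_def by metis
    then show "poly a' t0 = 0" "poly b' t0 \<noteq> 0" using pos_iff by blast+
  qed
  have val: "rf_value (a, b) (\<iota> t) = poly a' t / poly b' t" for t
    unfolding a'_def b'_def by (rule rf_value_dehom)
  define C where "C = insert t0 (set (coeffs a') \<union> set (coeffs b') \<union> set (coeffs g))"
  have inC: "coeff p i \<in> insert 0 C" if "p \<in> {a', b', g}" for p i
  proof (cases "coeff p i = 0")
    case False
    then have "coeff p i \<in> set (coeffs p)" by (metis coeff_in_coeffs le_degree coeff_0)
    then show ?thesis using that unfolding C_def by blast
  qed simp
  have overQ: "poly p t \<in> Qbar" if "p \<in> polys_over K" "t \<in> Qbar" for p t
    using subring_poly[OF Qbar_subring _ that(2), of p] polys_over_mono[OF KQ] that(1) by blast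
  have CQ: "C \<subseteq> Qbar"
  proof -
    have "set (coeffs p) \<subseteq> Qbar" if "p \<in> polys_over K" for p
      using that KQ unfolding polys_over_def coeffs_def by auto
    then show ?thesis using ab'K g(1) t0 unfolding C_def by blast
  qed
  define S2 where "S2 = (\<Union>c\<in>C. {p. prime p \<and> (\<exists>w\<in>padic_places p. \<not> w c \<le> 1)})"
  have fin2: "finite S2" unfolding S2_def
  proof (rule finite_UN_I)
    show "finite C" by (simp add: C_def)
    show "finite {p. prime p \<and> (\<exists>w\<in>padic_places p. \<not> w c \<le> 1)}" if "c \<in> C" for c
      by (rule almost_all_integral) (use that CQ in blast)
  qed
  define S3 where "S3 = {p. prime p \<and> (\<exists>w\<in>padic_places p. w (poly g t0) \<noteq> 1)} \<union>
    {p. prime p \<and> (\<exists>w\<in>padic_places p. w (poly b' t0) \<noteq> 1)}"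
  have fin3: "finite S3" unfolding S3_def
    by (intro finite_UnI almost_all_unit overQ g t0 t0' ab'K)
  have "\<not> w (t - t0) < 1"
    if p: "prime p" "p \<notin> S1" "p \<notin> S2" "p \<notin> S3" "w \<in> padic_places p" "t \<in> Qbar" "\<iota> t \<in> R" for p w t
  proof
    assume close: "w (t - t0) < 1"
    interpret padic_place p w using p by unfold_locales
    have C1: "w c \<le> 1" if "c \<in> C" for c using that p unfolding S2_def by blast
    have over: "P \<in> polys_over {x \<in> Qbar. w x \<le> 1}" if "P \<in> {a', b', g}" for P
    proof -
      have "coeff P i \<in> {x \<in> Qbar. w x \<le> 1}" for i
        using inC[OF that, of i] C1 CQ zero by auto
      then show ?thesis unfolding polys_over_def by blast
    qed
    have wt0: "w t0 \<le> 1" using C1 by (simp add: C_def)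
    have wt: "w t \<le> 1" by (rule le_1_if_close[OF p(6) t0 close wt0])
    note pc = poly_close[OF over p(6) t0 wt wt0 close]
    have "w (poly g t0) = 1" "w (poly b' t0) = 1" using p unfolding S3_def by blast+
    then have g1: "w (poly g t) = 1" and b1: "w (poly b' t) = 1"
      using eq_1_if_close[OF overQ[OF g(1) p(6)] overQ[OF g(1) t0] pc]
        eq_1_if_close[OF overQ[OF ab'K(2) p(6)] overQ[OF ab'K(2) t0] pc] by blast+
    have "w (poly a' t - poly a' t0) < 1" by (rule pc) blast
    then have a1: "w (poly a' t) < 1" unfolding t0'(1) by simp
    have gt: "poly g t \<noteq> 0" and bt: "poly b' t \<noteq> 0" using g1 b1 zero by (metis zero_neq_one)+
    have nb: "\<iota> t \<in> nbhd g" using gt p(6) unfolding nbhd_def by blast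
    have nk: "\<iota> t \<notin> Poly_Mapping.keys D" using R(1) p(7) by blast
    then have "Poly_Mapping.lookup D (\<iota> t) = 0" by (simp add: in_keys_iff)
    then have "rf_ord (a, b) (\<iota> t) = 0" using rep nb unfolding represents_def by metis
    \<comment> \<open>Off the support the order is zero. This excludes the value 0, for which the
      convention \<open>ln 0 = 0\<close> would spoil the strict inequality.\<close>
    then have at: "poly a' t \<noteq> 0" using pos_iff[of t] bt by (metis less_irrefl)
    have rat: "restrict w K (of_rat q) = padic_abs p q" for q
    proof -
      have "of_rat q \<in> K" using Rats_subset_subfield[OF F] Rats_of_rat by blast
      then show ?thesis using of_rat[of q] by simp
    qed
    have pl: "restrict w K \<in> places K" by (rule restrict_padic_place[OF p(1,5) F KQ])
    have abs: "w \<in> abs_Qbar K" using p(5) pl by (simp add: abs_Qbar_def padic_places_def)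
    have nB: "restrict w K \<notin> B" using p(1,2) rat unfolding S1_def by blast
    have \<gamma>0: "\<gamma> (restrict w K) = 0" using nB pl unfolding B_def by blast
    have wg: "w (1 / poly g t) \<le> 1" using g1 one divide[OF Qbar_1 overQ[OF g(1) p(6)]] by simp
    have "L (\<iota> t) w = - ln (w (poly a' t / poly b' t))"
      using loc[OF p(6) gt nk abs wt wg \<gamma>0] unfolding val .
    also have "w (poly a' t / poly b' t) = w (poly a' t)"
      using b1 divide[OF overQ[OF ab'K(1) p(6)] overQ[OF ab'K(2) p(6)]] by simp
    finally have "L (\<iota> t) w > 0" using a1 pos[OF overQ[OF ab'K(1) p(6)] at] by simp
    moreover have "L (\<iota> t) w \<le> 0"
    proof (rule R(2)[OF _ abs refl p(7)])
      show "restrict w K \<in> places K - S" using pl nB unfolding B_def by blast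
    qed
    ultimately show False by simp
  qed
  then show ?thesis using fin1 fin2 fin3 by (intro exI[of _ "S1 \<union> S2 \<union> S3"]) blast
qed

end

section \<open>The two standard charts of the projective line\<close>

interpretation affine_chart: chart Affine "\<lambda>_. 1" "\<lambda>n i. i" At_Infinity
proof
  show "inj Affine" by (auto simp: inj_def)
  show "P1 = insert At_Infinity (Affine ` Qbar)" by (simp add: P1_def)
  show "form n c (Affine t) = 1 ^ n * (\<Sum>i\<le>n. c i * t ^ i)" for n c t by (simp add: form_def)
  show "form n c At_Infinity = c n" for n c
  proof -
    have "(\<Sum>i\<le>n. c i * 0 ^ (n - i)) = (\<Sum>i\<in>{n}. c i * (0::complex) ^ (n - i))"
      by (rule sum.mono_neutral_right) auto
    then show ?thesis by (simp add: form_def)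
  qed
  fix K :: "complex set" and p q t N assume pq: "rational_function K (p, q)" and N: "N = max (degree p) (degree q)"
  have e: "(\<Sum>i\<le>N. coeff p i * t ^ i) = poly p t" "(\<Sum>i\<le>N. coeff q i * t ^ i) = poly q t"
    unfolding N poly_altdef by (rule sum.mono_neutral_right; auto simp: coeff_eq_0)+
  have "\<not> (poly p t = 0 \<and> poly q t = 0)"
    using pq coprime_poly_0[of p q t] by (auto simp: rational_function_def)
  then show "rf_ord (p, q) (Affine t) > 0 \<longleftrightarrow> (\<Sum>i\<le>N. coeff p i * t ^ i) = 0 \<and> (\<Sum>i\<le>N. coeff q i * t ^ i) \<noteq> 0"
    unfolding e using pq order_root[of p t] order_root[of q t] by (auto simp: rational_function_def)
qed auto

text \<open>The parametrization \<open>t \<mapsto> [1 : t]\<close>, expressed by the two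
  constructors of \<open>proj1\<close>.\<close>

definition infinity_chart :: "complex \<Rightarrow> proj1" where
  "infinity_chart t = (if t = 0 then At_Infinity else Affine (1 / t))"

lemma reflected_sum:
  assumes "t \<noteq> 0"
  shows "(\<Sum>i\<le>n. c (n - i) * t ^ i) = (t :: complex) ^ n * (\<Sum>i\<le>n. c i * (1 / t) ^ i)"
proof -
  have "(\<Sum>i\<le>n. c (n - i) * t ^ i) = (\<Sum>i\<le>n. c i * t ^ (n - i))"
    by (rule sum.reindex_bij_witness[of _ "\<lambda>i. n - i" "\<lambda>i. n - i"]) auto
  also have "\<dots> = (\<Sum>i\<le>n. t ^ n * (c i * (1 / t) ^ i))"
    by (rule sum.cong) (use assms in \<open>auto simp: power_diff field_simps\<close>)
  finally show ?thesis by (simp add: sum_distrib_left)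
qed

interpretation infinity_chart: chart infinity_chart "\<lambda>t. if t = 0 then 1 else 1 / t" "\<lambda>n i. n - i" "Affine 0"
proof
  show "inj infinity_chart" by (auto simp: inj_def infinity_chart_def)
  show "P1 = insert (Affine 0) (infinity_chart ` Qbar)"
  proof (rule Set.set_eqI, rule iffI)
    fix P assume "P \<in> P1"
    then show "P \<in> insert (Affine 0) (infinity_chart ` Qbar)"
    proof (cases P)
      case (Affine a)
      then show ?thesis using \<open>P \<in> P1\<close>
        by (cases "a = 0") (auto simp: P1_def infinity_chart_def image_iff intro!: bexI[of _ "1 / a"] Qbar_divide)
    next
      case At_Infinity
      then show ?thesis by (auto simp: infinity_chart_def image_iff intro!: bexI[of _ 0])
    qed
  qed (auto simp: P1_def infinity_chart_def intro!: Qbar_divide)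
  have z: "(\<Sum>i\<le>n. c i * 0 ^ i) = (c 0 :: complex)" for n c
  proof -
    have "(\<Sum>i\<le>n. c i * 0 ^ i) = (\<Sum>i\<in>{0}. c i * (0::complex) ^ i)"
      by (rule sum.mono_neutral_right) auto
    then show ?thesis by simp
  qed
  show "form n c (Affine 0) = c (n - n)" for n c using z[of c n] by (simp add: form_def)
  show "form n c (infinity_chart t) = (if t = 0 then 1 else 1 / t) ^ n * (\<Sum>i\<le>n. c (n - i) * t ^ i)" for n c t
  proof (cases "t = 0")
    case True
    then show ?thesis using affine_chart.form_miss[of n c] z[of "\<lambda>i. c (n - i)" n] by (simp add: infinity_chart_def)
  next
    case False
    then show ?thesis unfolding reflected_sum[OF False]
      by (simp add: infinity_chart_def form_def power_one_over)
  qed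
  fix K :: "complex set" and p q t N assume pq: "rational_function K (p, q)" and N: "N = max (degree p) (degree q)"
  show "rf_ord (p, q) (infinity_chart t) > 0 \<longleftrightarrow>
    (\<Sum>i\<le>N. coeff p (N - i) * t ^ i) = 0 \<and> (\<Sum>i\<le>N. coeff q (N - i) * t ^ i) \<noteq> 0"
  proof (cases "t = 0")
    case True
    have pq0: "p \<noteq> 0" "q \<noteq> 0" using pq by (auto simp: rational_function_def)
    have "degree p < degree q \<longleftrightarrow> coeff p N = 0 \<and> coeff q N \<noteq> 0"
    proof (cases "degree p < degree q")
      case True
      then show ?thesis using N pq0 by (auto simp: coeff_eq_0)
    next
      case False
      then have "N = degree p" using N by simp
      then show ?thesis using False pq0 by auto
    qed
    then show ?thesis using True z[of "\<lambda>i. coeff p (N - i)" N] z[of "\<lambda>i. coeff q (N - i)" N]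
      by (simp add: infinity_chart_def)
  next
    case False
    then show ?thesis
      using affine_chart.rf_ord_pos_iff[OF pq N, of "1 / t"] unfolding reflected_sum[OF False]
      by (simp add: infinity_chart_def)
  qed
qed auto

text \<open>One point of the support suffices, and effectivity gives it positive multiplicity. In
  the second alternative \<open>inverse a\<close> is the coordinate of the point at infinity's
  chart; the point missed by that chart is excluded since \<open>inverse 0 = 0\<close>.\<close>

lemma integral_points_avoidance:
  assumes K: "number_field K" and S: "finite S" and D: "divisor_over K D" "effective D" "D \<noteq> 0"
    and R: "integral_points K D S R"
  obtains S0 \<beta> where "finite S0" "\<beta> \<in> Qbar"
      "\<And>p w a. prime p \<Longrightarrow> p \<notin> S0 \<Longrightarrow> w \<in> padic_places p \<Longrightarrow> Affine a \<in> R \<Longrightarrow> \<not> w (a - \<beta>) < 1"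
  | S0 where "finite S0"
      "\<And>p w a. prime p \<Longrightarrow> p \<notin> S0 \<Longrightarrow> w \<in> padic_places p \<Longrightarrow> Affine a \<in> R \<Longrightarrow> a \<noteq> 0 \<Longrightarrow> \<not> w (inverse a) < 1"
proof -
  obtain L where RL: "R \<subseteq> P1 - Poly_Mapping.keys D" and L: "weil_function K D L"
    "\<And>v w P. v \<in> places K - S \<Longrightarrow> w \<in> abs_Qbar K \<Longrightarrow> restrict w K = v \<Longrightarrow> P \<in> R \<Longrightarrow> L P w \<le> 0"
    using R unfolding integral_points_def by blast
  have "Poly_Mapping.keys D \<noteq> {}" using D(3) by simp
  then obtain Q where Q: "Q \<in> Poly_Mapping.keys D" by blast
  then have QD: "Poly_Mapping.lookup D Q > 0" and QP: "Q \<in> P1"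
    using D(1,2) by (auto simp: effective_def divisor_over_def in_keys_iff less_le)
  obtain U a b where U: "Q \<in> U" "zariski_open K U" "rational_function K (a, b)" "represents D U (a, b)"
    using D(1) QP unfolding divisor_over_def by (metis surj_pair)
  have RQ: "x \<in> Qbar" if "Affine x \<in> R" for x using that RL by (auto simp: P1_def)
  show thesis
  proof (cases Q)
    case (Affine \<beta>)
    have \<beta>: "\<beta> \<in> Qbar" using QP Affine by (auto simp: P1_def)
    from affine_chart.integral_points_avoid_residue_class[OF K L(1) U(2) U(1)[unfolded Affine] \<beta> U(3,4) QD[unfolded Affine] S RL L(2)]
    obtain S0 where S0: "finite S0 \<and> (\<forall>p w t. prime p \<and> p \<notin> S0 \<and> w \<in> padic_places p \<and> t \<in> Qbar \<and> Affine t \<in> R \<longrightarrow> \<not> w (t - \<beta>) < 1)"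
      by (rule exE)
    show thesis
    proof (rule that(1)[OF conjunct1[OF S0] \<beta>])
      fix p w a assume "prime p" "p \<notin> S0" "w \<in> padic_places p" "Affine a \<in> R"
      then show "\<not> w (a - \<beta>) < 1" using conjunct2[OF S0, rule_format, of p w a] RQ[of a] by simp
    qed
  next
    case At_Infinity
    then have Q0: "Q = infinity_chart 0" by (simp add: infinity_chart_def)
    from infinity_chart.integral_points_avoid_residue_class[OF K L(1) U(2) U(1)[unfolded Q0] Qbar_0 U(3,4) QD[unfolded Q0] S RL L(2)]
    obtain S0 where S0: "finite S0 \<and> (\<forall>p w t. prime p \<and> p \<notin> S0 \<and> w \<in> padic_places p \<and> t \<in> Qbar \<and> infinity_chart t \<in> R \<longrightarrow> \<not> w (t - 0) < 1)"
      by (rule exE)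
    have "\<not> w (inverse a) < 1" if "prime p" "p \<notin> S0" "w \<in> padic_places p" "Affine a \<in> R" "a \<noteq> 0" for p w a
    proof -
      have "infinity_chart (inverse a) = Affine a" using that(5) by (simp add: infinity_chart_def inverse_eq_divide)
      then show ?thesis using conjunct2[OF S0, rule_format, of p w "inverse a"] that RQ[OF that(4)] Qbar_inverse[of a] by simp
    qed
    then show thesis by (rule that(2)[OF conjunct1[OF S0]])
  qed
qed

section \<open>Generic polynomials and norms\<close>

hide_const (open) Finite_Cartesian_Product.mat Finite_Cartesian_Product.vec

no_notation Finite_Cartesian_Product.vec_nth (infixl \<open>$\<close> 90)

lemma integral_multiple:
  assumes "\<beta> \<in> Qbar"
  obtains b H where "b > (0 :: int)" "minpoly_int H (of_int b * \<beta>)" "lead_coeff H = 1"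
proof -
  obtain h where h: "minpoly_int h \<beta>" using minpoly_int_exists assms by (auto simp: Qbar_def)
  define n where "n = degree h"
  define b where "b = lead_coeff h"
  have n: "n > 0" and b: "b > 0" using degree_minpoly_int_pos[OF h] minpoly_int_lead_coeff[OF h] by (auto simp: n_def b_def)
  \<comment> \<open>\<open>G(X) = b^(n-1) * h(X / b)\<close>, which is monic because
    \<open>b\<close> is the leading coefficient of \<open>h\<close>.\<close>
  define G where "G = monom 1 n + (\<Sum>i<n. monom (coeff h i * b ^ (n - 1 - i)) i)"
  have cG: "coeff G k = (if k = n then 1 else 0) + (if k < n then coeff h k * b ^ (n - 1 - k) else 0)" for k
    by (simp add: G_def coeff_sum)
  have G1: "degree G = n" "lead_coeff G = 1"
  proof -
    have "degree G \<le> n" by (rule degree_le) (auto simp: cG)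
    moreover have "coeff G n = 1" by (simp add: cG)
    ultimately show "degree G = n" using le_degree[of G n] by simp
    then show "lead_coeff G = 1" by (simp add: cG)
  qed
  have "0 = (\<Sum>i\<le>n. of_int (coeff h i) * \<beta> ^ i)"
    using minpoly_int_root[OF h] by (simp add: poly_altdef coeff_map_poly n_def)
  also have "\<dots> = (\<Sum>i<n. of_int (coeff h i) * \<beta> ^ i) + of_int b * \<beta> ^ n"
    by (simp add: lessThan_Suc_atMost[symmetric] b_def n_def)
  finally have hb: "(\<Sum>i<n. of_int (coeff h i) * \<beta> ^ i) + of_int b * \<beta> ^ n = 0" by simp
  have "poly (map_poly of_int G) (of_int b * \<beta>) = (\<Sum>i\<le>n. of_int (coeff G i) * (of_int b * \<beta>) ^ i)"
    by (simp add: poly_altdef coeff_map_poly G1)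
  also have "\<dots> = (\<Sum>i<n. of_int (coeff h i * b ^ (n - 1 - i)) * (of_int b * \<beta>) ^ i) + (of_int b * \<beta>) ^ n"
    by (simp add: lessThan_Suc_atMost[symmetric] cG)
  also have "(\<Sum>i<n. of_int (coeff h i * b ^ (n - 1 - i)) * (of_int b * \<beta>) ^ i)
      = of_int b ^ (n - 1) * (\<Sum>i<n. of_int (coeff h i) * \<beta> ^ i)"
    unfolding sum_distrib_left
  proof (rule sum.cong[OF refl])
    fix i assume "i \<in> {..<n}"
    then have "of_int b ^ (n - 1) = (of_int b :: complex) ^ (n - 1 - i) * of_int b ^ i" by (simp add: power_add[symmetric])
    then show "of_int (coeff h i * b ^ (n - 1 - i)) * (of_int b * \<beta>) ^ i = of_int b ^ (n - 1) * (of_int (coeff h i) * \<beta> ^ i)"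
      by (simp add: power_mult_distrib)
  qed
  also have "(of_int b * \<beta>) ^ n = of_int b ^ (n - 1) * (of_int b * \<beta> ^ n)"
    using n by (cases n) (auto simp: power_mult_distrib)
  finally have root: "poly (map_poly of_int G) (of_int b * \<beta>) = 0"
    using hb by (simp add: distrib_left[symmetric])
  have "of_int b * \<beta> \<in> Qbar" using assms by (intro Qbar_mult QbarI_int)
  then obtain H where H: "minpoly_int H (of_int b * \<beta>)" using minpoly_int_exists by (auto simp: Qbar_def)
  then have "H dvd G" using root minpoly_int_dvd_iff by blast
  then obtain k where "G = H * k" by (rule dvdE)
  then have "lead_coeff H * lead_coeff k = 1" using G1(2) by (simp add: lead_coeff_mult)
  then have "lead_coeff H = 1" using minpoly_int_lead_coeff[OF H] by (auto simp: zmult_eq_1_iff)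
  then show thesis using that b H by blast
qed

section \<open>The order generated by an algebraic integer\<close>

locale integral_generator =
  fixes H :: "int poly" and \<gamma> :: complex
  assumes H: "minpoly_int H \<gamma>" and monic: "lead_coeff H = 1"
begin

abbreviation n :: nat where "n \<equiv> degree H"

abbreviation F :: "complex set" where "F \<equiv> adjoin \<rat> \<gamma>"

abbreviation Og :: "complex set" where "Og \<equiv> adjoin \<int> \<gamma>"

lemma gamma_Qbar: "\<gamma> \<in> Qbar" using minpoly_int_Qbar[OF H] .

lemma n_pos: "n > 0" using degree_minpoly_int_pos[OF H] .

lemma subfield_F: "is_subfield F" using adjoin_Rats_subfield gamma_Qbar by (simp add: Qbar_def)

lemma subring_O: "subring Og" by (rule subring_adjoin[OF subring_Ints])

lemma O_subset_F: "Og \<subseteq> F"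
  unfolding adjoin_def by (intro image_mono polys_over_mono) (auto elim!: Ints_cases)

lemma rat_representation:
  assumes "z \<in> F"
  obtains r where "z = (\<Sum>i<n. of_rat (r i) * \<gamma> ^ i)"
proof -
  obtain q where q: "z = poly (map_poly of_rat q) \<gamma>" using assms by (auto simp: adjoin_Rats_iff)
  define g where "g = (map_poly of_int H :: rat poly)"
  define r where "r = q mod g"
  have g0: "g \<noteq> 0" "degree g = n" using minpoly_int_nonzero[OF H] by (auto simp: g_def)
  have g\<gamma>: "poly (map_poly of_rat g) \<gamma> = 0" using minpoly_int_rat_dvd_iff[OF H, of g] by (simp add: g_def)
  have "q = q div g * g + r" by (simp add: r_def)
  then have "z = poly (map_poly of_rat (q div g * g + r)) \<gamma>" using q by simp
  also have "\<dots> = poly (map_poly of_rat r) \<gamma>"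
    unfolding map_poly_of_rat_mult map_poly_of_rat_add using g\<gamma> by simp
  also have "\<dots> = (\<Sum>i<n. of_rat (coeff r i) * \<gamma> ^ i)"
  proof -
    have "degree r < n" using degree_mod_less'[of g q] g0 n_pos
      by (cases "r = 0") (auto simp: r_def)
    then show ?thesis unfolding poly_altdef
      by (intro sum.mono_neutral_cong_left) (auto simp: coeff_map_poly coeff_eq_0)
  qed
  finally show thesis by (rule that)
qed

lemma int_representation:
  assumes "z \<in> Og"
  obtains r where "z = (\<Sum>i<n. of_int (r i) * \<gamma> ^ i)"
proof -
  obtain a where a: "z = poly (map_poly of_int a) \<gamma>" using assms by (auto simp: adjoin_Ints_iff)
  obtain q r where qr: "pseudo_divmod a H = (q, r)" by fastforce
  note * = pseudo_divmod[OF minpoly_int_nonzero[OF H] qr]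
  have "a = H * q + r" using *(1) monic by simp
  then have "z = poly (map_poly of_int r) \<gamma>" using a minpoly_int_root[OF H] by (simp add: hom_distribs)
  also have "\<dots> = (\<Sum>i<n. of_int (coeff r i) * \<gamma> ^ i)"
  proof -
    have "degree r < n" using *(2) n_pos by auto
    then show ?thesis unfolding poly_altdef
      by (intro sum.mono_neutral_cong_left) (auto simp: coeff_map_poly coeff_eq_0)
  qed
  finally show thesis by (rule that)
qed

lemma power_representation: "\<exists>m. \<forall>k. \<gamma> ^ k = (\<Sum>i<n. of_int (m k i) * \<gamma> ^ i)"
proof -
  have "\<gamma> ^ k \<in> Og" for k by (intro subring_power subring_O adjoin_self subring_Ints)
  then have "\<forall>k. \<exists>r. \<gamma> ^ k = (\<Sum>i<n. of_int (r i) * \<gamma> ^ i)" using int_representation by metis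
  then show ?thesis by metis
qed

text \<open>As \<open>H\<close> is monic, \<open>Og\<close> has the \<open>\<int>\<close>-basis \<open>1, \<gamma>, \<dots>, \<gamma>^(n-1)\<close>, so Gauss's lemma can be applied to each
  coordinate.\<close>

lemma gauss_over_O:
  assumes f: "minpoly_int f \<alpha>" and E: "E \<in> polys_over Og" and q: "q \<in> polys_over F"
    and eq: "E = map_poly of_int f * q"
  shows "q \<in> polys_over Og"
proof -
  have "\<exists>r. coeff q k = (\<Sum>i<n. of_rat (r i) * \<gamma> ^ i)" for k
    using q rat_representation[of "coeff q k"] unfolding polys_over_def by blast
  then obtain r where r: "\<And>k. coeff q k = (\<Sum>i<n. of_rat (r k i) * \<gamma> ^ i)" by metis
  have "\<exists>r. coeff E k = (\<Sum>i<n. of_int (r i) * \<gamma> ^ i)" for k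
    using E int_representation[of "coeff E k"] unfolding polys_over_def by blast
  then obtain e where e: "\<And>k. coeff E k = (\<Sum>i<n. of_int (e k i) * \<gamma> ^ i)" by metis
  \<comment> \<open>\<open>Qi i\<close> and \<open>Ei i\<close> collect the \<open>i\<close>-th
    coordinates of all coefficients with respect to the powers of \<open>\<gamma>\<close>.\<close>
  define Qi where "Qi i = (\<Sum>k\<le>degree q. monom (r k i) k)" for i
  define Ei where "Ei i = (\<Sum>k\<le>degree E. monom (e k i) k)" for i
  have cQ: "coeff (Qi i) k = (if k \<le> degree q then r k i else 0)" for i k by (simp add: Qi_def coeff_sum)
  have cE: "coeff (Ei i) k = (if k \<le> degree E then e k i else 0)" for i k by (simp add: Ei_def coeff_sum)
  have qs: "q = (\<Sum>i<n. smult (\<gamma> ^ i) (map_poly of_rat (Qi i)))"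
  proof (rule poly_eqI)
    fix k show "coeff q k = coeff (\<Sum>i<n. smult (\<gamma> ^ i) (map_poly of_rat (Qi i))) k"
      using r[of k] by (cases "k \<le> degree q") (auto simp: coeff_sum coeff_map_poly cQ coeff_eq_0 mult.commute)
  qed
  have Es: "E = (\<Sum>i<n. smult (\<gamma> ^ i) (map_poly of_rat (map_poly of_int (Ei i))))"
  proof (rule poly_eqI)
    fix k show "coeff E k = coeff (\<Sum>i<n. smult (\<gamma> ^ i) (map_poly of_rat (map_poly of_int (Ei i)))) k"
      using e[of k] by (cases "k \<le> degree E") (auto simp: coeff_sum coeff_map_poly cE coeff_eq_0 mult.commute)
  qed
  have fr: "map_poly of_int f = (map_poly of_rat (map_poly of_int f :: rat poly) :: complex poly)"
    by (rule poly_eqI) (simp add: coeff_map_poly)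
  \<comment> \<open>As \<open>f\<close> has rational coefficients, multiplication by it acts on each
    coordinate separately.\<close>
  have coord: "map_poly of_int (Ei i) = map_poly of_int f * Qi i" if i: "i < n" for i
  proof (rule poly_eqI)
    fix k
    let ?D = "\<lambda>i. coeff (map_poly of_int (Ei i)) k - coeff (map_poly of_int f * Qi i) k :: rat"
    have 1: "coeff E k = (\<Sum>i<n. \<gamma> ^ i * of_rat (coeff (map_poly of_int (Ei i)) k))"
      by (subst Es) (simp add: coeff_sum coeff_map_poly)
    have 2: "coeff E k = (\<Sum>i<n. \<gamma> ^ i * of_rat (coeff (map_poly of_int f * Qi i) k))"
      unfolding eq fr by (subst qs)
        (simp add: sum_distrib_left coeff_sum mult_smult_right map_poly_of_rat_mult[symmetric] coeff_map_poly del: map_poly_of_rat_mult)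
    have "(\<Sum>i<n. of_rat (?D i) * \<gamma> ^ i) = (\<Sum>i<n. \<gamma> ^ i * of_rat (coeff (map_poly of_int (Ei i)) k)
        - \<gamma> ^ i * of_rat (coeff (map_poly of_int f * Qi i) k))"
      by (simp only: of_rat_diff right_diff_distrib mult.commute[of _ "\<gamma> ^ _"])
    also have "\<dots> = 0" unfolding sum_subtractf 1[symmetric] 2[symmetric] by simp
    finally have "(\<Sum>i<n. of_rat (?D i) * \<gamma> ^ i) = 0" .
    then have "of_rat (?D i) = (0 :: complex)"
      using minpoly_int_independent[OF H, of "\<lambda>i. of_rat (?D i)" i] i by simp
    then show "coeff (map_poly of_int (Ei i)) k = coeff (map_poly of_int f * Qi i) k" by simp
  qed
  have "\<exists>g. Qi i = map_poly of_int g" if i: "i < n" for i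
  proof -
    have "map_poly of_int f dvd (map_poly of_int (Ei i) :: rat poly)" using coord[OF i] by simp
    then have "poly (map_poly of_rat (map_poly of_int (Ei i))) \<alpha> = 0" using minpoly_int_rat_dvd_iff[OF f] by blast
    also have "map_poly of_rat (map_poly of_int (Ei i) :: rat poly) = (map_poly of_int (Ei i) :: complex poly)"
      by (rule poly_eqI) (simp add: coeff_map_poly)
    finally have "f dvd Ei i" using minpoly_int_dvd_iff[OF f] by blast
    then obtain g where "Ei i = f * g" by (rule dvdE)
    then have "map_poly of_int f * Qi i = map_poly of_int f * map_poly of_int g"
      using coord[OF i] by (simp only: of_int_poly_hom.hom_mult)
    then have "Qi i = map_poly of_int g" using minpoly_int_nonzero[OF f] by (metis mult_left_cancel of_int_poly_hom.hom_0_iff)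
    then show ?thesis ..
  qed
  then obtain g where g: "\<And>i. i < n \<Longrightarrow> Qi i = map_poly of_int (g i)" by metis
  have "coeff q k \<in> Og" for k
  proof -
    have "coeff q k = (\<Sum>i<n. \<gamma> ^ i * of_rat (coeff (Qi i) k))"
      by (subst qs) (simp add: coeff_sum coeff_map_poly)
    also have "\<dots> = (\<Sum>i<n. \<gamma> ^ i * of_int (coeff (g i) k))"
      by (rule sum.cong) (auto simp: g coeff_map_poly)
    also have "\<dots> \<in> Og"
      by (intro subring_sum subring_O subring_mult subring_power adjoin_self subring_Ints subring_of_int)
    finally show ?thesis .
  qed
  then show ?thesis by (simp add: polys_over_def)
qed

text \<open>For the minimal polynomial \<open>f\<close> of \<open>\<alpha>\<close> this means that
  \<open>f\<close> stays irreducible over \<open>F\<close>. The formulation by degrees can be used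
  directly after a division with remainder, and its negation supplies a polynomial of smaller
  degree.\<close>

definition generic :: "int poly \<Rightarrow> complex \<Rightarrow> bool" where
  "generic f \<alpha> \<longleftrightarrow> (\<forall>E\<in>polys_over F. poly E \<alpha> = 0 \<longrightarrow> E = 0 \<or> degree f \<le> degree E)"

lemma polys_over_int: "subring R \<Longrightarrow> map_poly of_int f \<in> polys_over R"
  by (auto simp: polys_over_def coeff_map_poly subring_of_int)

lemma generic_dvd:
  assumes f: "minpoly_int f \<alpha>" and gen: "generic f \<alpha>" and E: "E \<in> polys_over F" "poly E \<alpha> = 0"
  obtains q where "q \<in> polys_over F" "E = map_poly of_int f * q"
proof -
  note FR = is_subfield_subring[OF subfield_F]
  have fF: "map_poly of_int f \<in> polys_over F" using polys_over_int[OF FR] .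
  have f0: "map_poly of_int f \<noteq> (0 :: complex poly)" using minpoly_int_nonzero[OF f] by simp
  obtain q r where qr: "q \<in> polys_over F" "r \<in> polys_over F" "E = q * map_poly of_int f + r"
    "r = 0 \<or> degree r < degree (map_poly of_int f :: complex poly)"
    using polys_over_division[OF subfield_F fF f0 E(1)] by blast
  have "poly r \<alpha> = 0" using E(2) minpoly_int_root[OF f] by (simp add: qr(3))
  then have "r = 0" using gen qr(2,4) unfolding generic_def by fastforce
  then show thesis using that[of q] qr by (simp add: mult.commute)
qed

text \<open>The value \<open>b^d * f(\<gamma> / b)\<close> with its denominators cleared: an element
  of \<open>Og\<close>, linear in the coefficients of \<open>f\<close>. Its norm enters only through
  the constant coefficient of its minimal polynomial, of which the norm is a power up to
  sign.\<close>

definition xi :: "int \<Rightarrow> nat \<Rightarrow> int poly \<Rightarrow> complex" where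
  "xi b d f = (\<Sum>i\<le>d. of_int (coeff f i * b ^ (d - i)) * \<gamma> ^ i)"

lemma xi_eq:
  assumes "b \<noteq> 0" "degree f \<le> d"
  shows "xi b d f = of_int b ^ d * poly (map_poly of_int f) (\<gamma> / of_int b)"
proof -
  have "poly (map_poly of_int f) (\<gamma> / of_int b) = (\<Sum>i\<le>d. of_int (coeff f i) * (\<gamma> / of_int b) ^ i)"
    unfolding poly_altdef using assms by (intro sum.mono_neutral_cong_left) (auto simp: coeff_map_poly coeff_eq_0)
  moreover have "of_int (coeff f i * b ^ (d - i)) * \<gamma> ^ i = of_int b ^ d * (of_int (coeff f i) * (\<gamma> / of_int b) ^ i)"
    if "i \<le> d" for i
  proof -
    have "of_int b ^ d = (of_int b :: complex) ^ (d - i) * of_int b ^ i" using that by (simp add: power_add[symmetric])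
    then show ?thesis using assms by (simp add: power_divide)
  qed
  ultimately show ?thesis unfolding xi_def by (simp only: sum_distrib_left) (rule sum.cong, auto)
qed

lemma xi_Qbar: "xi b d f \<in> Qbar"
  unfolding xi_def by (intro subring_sum Qbar_subring Qbar_mult Qbar_power gamma_Qbar QbarI_int)

text \<open>The ideal generated by \<open>p\<close> and \<open>b * \<alpha> - \<gamma>\<close> in
  \<open>Og[\<alpha>]\<close> is proper. A relation with value 1 lifts to a polynomial
  \<open>E\<close>; genericity and Gauss's lemma make it \<open>f * q\<close> with \<open>q\<close>
  over \<open>Og\<close>. At \<open>\<gamma> / b\<close> the linear factor vanishes, leaving
  \<open>p * P - 1 = f * q\<close>. This is impossible at a place where \<open>\<gamma> / b\<close>
  is integral and both \<open>p\<close> and \<open>f(\<gamma> / b)\<close> have size below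
  1.\<close>

lemma place_near_if_dvd_norm:
  assumes f: "minpoly_int f \<alpha>" and gen: "generic f \<alpha>" and p: "prime p" "\<not> int p dvd b"
    and g: "minpoly_int g (xi b (degree f) f)" and dvd: "int p dvd poly g 0"
  obtains w where "w \<in> padic_places p" "w (of_int b * \<alpha> - \<gamma>) < 1"
proof -
  define A where "A = adjoin Og \<alpha>"
  have A: "subring A" unfolding A_def by (rule subring_adjoin[OF subring_O])
  have OA: "Og \<subseteq> A" unfolding A_def by (rule subset_adjoin[OF subring_O])
  have \<alpha>Q: "\<alpha> \<in> Qbar" using minpoly_int_Qbar[OF f] .
  have b0: "b \<noteq> 0" using p by auto
  let ?b = "of_int b :: complex"
  have \<gamma>Og: "\<gamma> \<in> Og" by (rule adjoin_self[OF subring_Ints])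
  have y: "?b * \<alpha> - \<gamma> \<in> A"
    using \<gamma>Og OA by (intro subring_diff[OF A] subring_mult[OF A] subring_of_int[OF A]) (auto simp: A_def adjoin_self subring_O)
  have proper: "of_nat p * u + (?b * \<alpha> - \<gamma>) * v \<noteq> 1" if uv: "u \<in> A" "v \<in> A" for u v
  proof
    assume eq1: "of_nat p * u + (?b * \<alpha> - \<gamma>) * v = 1"
    obtain P Q where PQ: "P \<in> polys_over Og" "Q \<in> polys_over Og" "u = poly P \<alpha>" "v = poly Q \<alpha>"
      using uv by (auto simp: A_def adjoin_def)
    define E where "E = smult (of_nat p) P + [:- \<gamma>, ?b:] * Q - 1"
    have EO: "E \<in> polys_over Og" unfolding E_def
      by (intro polys_over_diff polys_over_add polys_over_mult polys_over_smult polys_over_pCons polys_over_0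
          polys_over_1 subring_O subring_of_nat subring_of_int subring_minus PQ \<gamma>Og)
    have "poly E \<alpha> = 0" using eq1 PQ by (simp add: E_def algebra_simps)
    then obtain q where q: "q \<in> polys_over F" "E = map_poly of_int f * q"
      using generic_dvd[OF f gen] EO polys_over_mono[OF O_subset_F] by blast
    have qO: "q \<in> polys_over Og" by (rule gauss_over_O[OF f EO q])
    let ?t = "\<gamma> / ?b"
    have key: "of_nat p * poly P ?t - 1 = poly (map_poly of_int f) ?t * poly q ?t"
      using arg_cong[OF q(2), of "\<lambda>p. poly p ?t"] b0 by (simp add: E_def)
    have "int p dvd poly g 0" using dvd .
    \<comment> \<open>\<open>p\<close> divides \<open>g(0)\<close>, so 0 is a root of
      \<open>g\<close> modulo \<open>p\<close> and some place makes \<open>xi\<close> small. This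
      place is auxiliary: it only refutes the relation and says nothing about
      \<open>\<alpha>\<close>.\<close>
    from place_near_root_mod_p[OF g p(1) this] obtain w where
      w: "w \<in> padic_places p" "w (xi b (degree f) f - of_int 0) < 1" by blast
    interpret padic_place p w using p w by unfold_locales
    have tQ: "?t \<in> Qbar" by (intro Qbar_divide gamma_Qbar QbarI_int)
    have wb: "w ?b = 1" using of_int_eq_1[OF p(2)] .
    have w\<gamma>: "w \<gamma> \<le> 1" using le_1_if_lead_coeff_unit[OF H] monic prime_gt_1_nat[OF p(1)] by simp
    then have wt: "w ?t \<le> 1" using wb by (simp add: divide gamma_Qbar)
    have Oint: "Og \<subseteq> {x \<in> Qbar. w x \<le> 1}"
      using poly_int_le_1[OF gamma_Qbar w\<gamma>] poly_int_Qbar[OF gamma_Qbar] by (auto simp: adjoin_Ints_iff)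
    have PQt: "poly P ?t \<in> Qbar" "w (poly P ?t) \<le> 1" "poly q ?t \<in> Qbar" "w (poly q ?t) \<le> 1"
      using subring_poly[OF subring_integers, of _ ?t] polys_over_mono[OF Oint] PQ(1) qO tQ wt by auto
    let ?ft = "poly (map_poly of_int f) ?t"
    have ftQ: "?ft \<in> Qbar" by (rule poly_int_Qbar[OF tQ])
    have "w (xi b (degree f) f) = w ?ft"
      unfolding xi_eq[OF b0 order_refl] using wb by (simp add: mult power ftQ Qbar_power)
    then have wf: "w ?ft < 1" using w(2) by simp
    have "w (?ft * poly q ?t) < 1"
      unfolding mult[OF ftQ PQt(3)] using le_less_trans[OF mult_left_le[OF PQt(4) nonneg[OF ftQ]] wf] .
    moreover have "w (of_nat p) < 1" using of_int_less_1_iff[of "int p"] by simp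
    then have "w (of_nat p * poly P ?t) < 1"
      using le_less_trans[OF mult_left_le[OF PQt(2) nonneg[OF QbarI_int[of "int p"]]]] mult[OF QbarI_int[of "int p"] PQt(1)] by simp
    ultimately have "w (of_nat p * poly P ?t - ?ft * poly q ?t) < 1"
      using diff_le[of "of_nat p * poly P ?t" "?ft * poly q ?t"] QbarI_int[of "int p"] PQt ftQ
      by (auto simp: Qbar_mult)
    moreover have "of_nat p * poly P ?t - ?ft * poly q ?t = 1" using key by (simp add: algebra_simps)
    ultimately show False using one by simp
  qed
  show thesis
  proof (rule padic_place_exists[OF p(1) A y _ proper])
    show "?b * \<alpha> - \<gamma> \<in> Qbar" by (intro Qbar_diff Qbar_mult QbarI_int \<alpha>Q gamma_Qbar)
  qed (use that in auto)
qed

text \<open>The eigenvalues of the integer matrix of multiplication by \<open>xi\<close> include all conjugates of \<open>xi\<close>.\<close>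

lemma minpoly_xi:
  obtains C :: real where "C \<ge> 1" "\<And>f T. (\<And>i. i \<le> d \<Longrightarrow> \<bar>coeff f i\<bar> \<le> T) \<Longrightarrow>
    \<exists>g. minpoly_int g (xi b d f) \<and> lead_coeff g = 1 \<and> degree g \<le> n \<and>
      (\<forall>z::complex. poly (map_poly of_int g) z = 0 \<longrightarrow> norm z \<le> C * of_int T)"
proof -
  obtain m where m: "\<And>k. \<gamma> ^ k = (\<Sum>i<n. of_int (m k i) * \<gamma> ^ i)" using power_representation by blast
  \<comment> \<open>The sum dominates every absolute row sum of the matrix \<open>M\<close> below
    when the coefficients of \<open>f\<close> have size at most 1; the summand 1 ensures
    \<open>C \<ge> 1\<close>.\<close>
  define C where "C = 1 + (\<Sum>i<n. \<Sum>j<n. \<Sum>k\<le>d. real_of_int (\<bar>b\<bar> ^ (d - k) * \<bar>m (k + i) j\<bar>))"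
  have C1: "C \<ge> 1" unfolding C_def by (auto intro!: sum_nonneg)
  have "\<exists>g. minpoly_int g (xi b d f) \<and> lead_coeff g = 1 \<and> degree g \<le> n \<and>
      (\<forall>z::complex. poly (map_poly of_int g) z = 0 \<longrightarrow> norm z \<le> C * of_int T)"
    if T: "\<And>i. i \<le> d \<Longrightarrow> \<bar>coeff f i\<bar> \<le> T" for f T
  proof -
    have T0: "T \<ge> 0" using T[of 0] by simp
    define M where "M = mat n n (\<lambda>(i, j). \<Sum>k\<le>d. coeff f k * b ^ (d - k) * m (k + i) j)"
    have M: "M \<in> carrier_mat n n" by (simp add: M_def)
    let ?x = "xi b d f"
    have xM: "?x * \<gamma> ^ i = (\<Sum>j<n. of_int (M $$ (i, j)) * \<gamma> ^ j)" if "i < n" for i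
    proof -
      have "?x * \<gamma> ^ i = (\<Sum>k\<le>d. of_int (coeff f k * b ^ (d - k)) * \<gamma> ^ (k + i))"
        by (simp add: xi_def sum_distrib_right power_add mult.assoc)
      also have "\<dots> = (\<Sum>k\<le>d. \<Sum>j<n. of_int (coeff f k * b ^ (d - k) * m (k + i) j) * \<gamma> ^ j)"
      proof (rule sum.cong[OF refl])
        fix k
        show "of_int (coeff f k * b ^ (d - k)) * \<gamma> ^ (k + i) = (\<Sum>j<n. of_int (coeff f k * b ^ (d - k) * m (k + i) j) * \<gamma> ^ j)"
          unfolding m[of "k + i"] sum_distrib_left by (rule sum.cong[OF refl]) (simp add: mult.assoc)
      qed
      also have "\<dots> = (\<Sum>j<n. \<Sum>k\<le>d. of_int (coeff f k * b ^ (d - k) * m (k + i) j) * \<gamma> ^ j)"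
        by (rule sum.swap)
      also have "\<dots> = (\<Sum>j<n. of_int (M $$ (i, j)) * \<gamma> ^ j)"
        using that by (intro sum.cong[OF refl]) (simp add: M_def sum_distrib_right)
      finally show ?thesis .
    qed
    define MC where "MC = map_mat complex_of_int M"
    have MC: "MC \<in> carrier_mat n n" by (simp add: MC_def M)
    define cp where "cp = char_poly M"
    have cpC: "map_poly of_int cp = char_poly MC"
      unfolding cp_def MC_def by (rule of_int_hom.char_poly_hom[OF M, symmetric])
    have cp: "degree cp = n" "lead_coeff cp = 1"
      using degree_monic_char_poly[OF M] by (auto simp: cp_def)
    \<comment> \<open>The vector of powers of \<open>\<gamma>\<close> is an eigenvector, since row
      \<open>i\<close> of \<open>M\<close> expresses \<open>xi * \<gamma>^i\<close> in these
      powers.\<close>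
    have "eigenvalue MC ?x"
      unfolding eigenvalue_def eigenvector_def
    proof (intro exI conjI)
      let ?v = "vec n (\<lambda>i. \<gamma> ^ i)"
      show "?v \<in> carrier_vec (dim_row MC)" using MC by auto
      show "?v \<noteq> 0\<^sub>v (dim_row MC)"
      proof
        assume "?v = 0\<^sub>v (dim_row MC)"
        then have "?v $ 0 = 0\<^sub>v (dim_row MC) $ 0" by simp
        then show False using n_pos MC by auto
      qed
      show "MC *\<^sub>v ?v = ?x \<cdot>\<^sub>v ?v"
      proof (rule eq_vecI)
        fix i assume "i < dim_vec (?x \<cdot>\<^sub>v ?v)"
        then have i: "i < n" by simp
        have "(MC *\<^sub>v ?v) $ i = (\<Sum>j<n. MC $$ (i, j) * \<gamma> ^ j)"
          using i MC by (simp add: scalar_prod_def atLeast0LessThan)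
        also have "\<dots> = ?x * \<gamma> ^ i" unfolding xM[OF i] using i M by (simp add: MC_def)
        finally show "(MC *\<^sub>v ?v) $ i = (?x \<cdot>\<^sub>v ?v) $ i" using i by simp
      qed (use MC in auto)
    qed
    then have root: "poly (map_poly of_int cp) ?x = 0"
      using eigenvalue_root_char_poly[OF MC] by (simp add: cpC)
    obtain g where g: "minpoly_int g ?x"
      using minpoly_int_exists[of ?x] xi_Qbar[of b d f] unfolding Qbar_def by blast
    then have "g dvd cp" using root minpoly_int_dvd_iff by blast
    then obtain k where k: "cp = g * k" by (rule dvdE)
    then have "lead_coeff g * lead_coeff k = 1" using cp(2) by (simp add: lead_coeff_mult)
    then have lg: "lead_coeff g = 1" using minpoly_int_lead_coeff[OF g] by (auto simp: zmult_eq_1_iff)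
    have cp0: "cp \<noteq> 0" using cp(2) by auto
    have dg: "degree g \<le> n" using dvd_imp_degree_le[OF \<open>g dvd cp\<close> cp0] cp(1) by simp
    have "norm z \<le> C * of_int T" if z: "poly (map_poly of_int g) z = 0" for z :: complex
    proof -
      have "poly (char_poly MC) z = 0" using z by (simp add: cpC[symmetric] k hom_distribs)
      then have "eigenvalue MC z" using eigenvalue_root_char_poly[OF MC] by simp
      then obtain v where v: "v \<in> carrier_vec n" "v \<noteq> 0\<^sub>v n" "MC *\<^sub>v v = z \<cdot>\<^sub>v v"
        using MC by (auto simp: eigenvalue_def eigenvector_def)
      \<comment> \<open>The row belonging to a largest entry of the eigenvector: it shows that
        \<open>norm z\<close> is at most an absolute row sum.\<close>
      obtain i where i: "i < n" "\<And>j. j < n \<Longrightarrow> norm (v $ j) \<le> norm (v $ i)"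
      proof -
        have "finite {..<n}" "{..<n} \<noteq> {}" using n_pos by auto
        from ex_is_arg_min_if_finite[OF this, of "\<lambda>j. - norm (v $ j)"]
        obtain i where "is_arg_min (\<lambda>j. - norm (v $ j)) (\<lambda>j. j \<in> {..<n}) i" by (rule exE)
        then have "i < n" "\<And>j. j < n \<Longrightarrow> norm (v $ j) \<le> norm (v $ i)"
          unfolding is_arg_min_linorder by auto
        then show thesis by (rule that)
      qed
      have vi: "norm (v $ i) > 0"
      proof (rule ccontr)
        assume "\<not> norm (v $ i) > 0"
        then have "v $ j = 0" if "j < n" for j using i(2)[OF that] by simp
        then have "v = 0\<^sub>v n" using v(1) by (intro eq_vecI) auto
        then show False using v(2) by simp
      qed
      have "z * v $ i = (\<Sum>j<n. MC $$ (i, j) * v $ j)"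
      proof -
        have "(MC *\<^sub>v v) $ i = (\<Sum>j<n. MC $$ (i, j) * v $ j)"
          using i MC v(1) by (simp add: scalar_prod_def atLeast0LessThan)
        then show ?thesis unfolding v(3) using i v(1) by simp
      qed
      from arg_cong[OF this, of norm] have "norm z * norm (v $ i) \<le> (\<Sum>j<n. norm (MC $$ (i, j)) * norm (v $ j))"
        using norm_sum[of "\<lambda>j. MC $$ (i, j) * v $ j" "{..<n}"] by (simp only: norm_mult)
      also have "\<dots> \<le> (\<Sum>j<n. norm (MC $$ (i, j)) * norm (v $ i))"
        by (intro sum_mono mult_left_mono i) auto
      also have "\<dots> = (\<Sum>j<n. norm (MC $$ (i, j))) * norm (v $ i)" by (simp add: sum_distrib_right)
      finally have "norm z \<le> (\<Sum>j<n. norm (MC $$ (i, j)))" using vi by simp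
      also have "\<dots> \<le> (\<Sum>j<n. of_int T * (\<Sum>k\<le>d. real_of_int (\<bar>b\<bar> ^ (d - k) * \<bar>m (k + i) j\<bar>)))"
      proof (rule sum_mono)
        fix j assume "j \<in> {..<n}"
        then have "norm (MC $$ (i, j)) = real_of_int \<bar>\<Sum>k\<le>d. coeff f k * b ^ (d - k) * m (k + i) j\<bar>"
          using i M by (simp add: MC_def M_def del: of_int_sum of_int_mult of_int_power)
        also have "\<bar>\<Sum>k\<le>d. coeff f k * b ^ (d - k) * m (k + i) j\<bar> \<le> (\<Sum>k\<le>d. \<bar>coeff f k * b ^ (d - k) * m (k + i) j\<bar>)"
          by (rule sum_abs)
        also have "\<dots> \<le> (\<Sum>k\<le>d. T * (\<bar>b\<bar> ^ (d - k) * \<bar>m (k + i) j\<bar>))"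
          by (intro sum_mono) (use T in \<open>auto simp: abs_mult power_abs mult.assoc intro!: mult_right_mono\<close>)
        finally show "norm (MC $$ (i, j)) \<le> of_int T * (\<Sum>k\<le>d. real_of_int (\<bar>b\<bar> ^ (d - k) * \<bar>m (k + i) j\<bar>))"
          by (simp add: sum_distrib_left)
      qed
      also have "\<dots> = of_int T * (\<Sum>j<n. \<Sum>k\<le>d. real_of_int (\<bar>b\<bar> ^ (d - k) * \<bar>m (k + i) j\<bar>))"
        by (simp add: sum_distrib_left)
      also have "\<dots> \<le> of_int T * C"
      proof (rule mult_left_mono)
        have "(\<Sum>j<n. \<Sum>k\<le>d. real_of_int (\<bar>b\<bar> ^ (d - k) * \<bar>m (k + i) j\<bar>))
          \<le> (\<Sum>i<n. \<Sum>j<n. \<Sum>k\<le>d. real_of_int (\<bar>b\<bar> ^ (d - k) * \<bar>m (k + i) j\<bar>))"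
          by (rule member_le_sum[of i]) (use i in \<open>auto intro!: sum_nonneg\<close>)
        then show "(\<Sum>j<n. \<Sum>k\<le>d. real_of_int (\<bar>b\<bar> ^ (d - k) * \<bar>m (k + i) j\<bar>)) \<le> C" by (simp add: C_def)
      qed (use T0 in simp)
      finally show ?thesis by (simp add: mult.commute)
    qed
    then show ?thesis using g lg dg by blast
  qed
  then show thesis using that C1 by blast
qed

end

text \<open>Substitution carries annihilating polynomials of \<open>x\<close> to those of
  \<open>x + m\<close> and back, which forces equal degrees; both polynomials being monic, the
  cofactor is 1.\<close>

lemma minpoly_int_shift:
  assumes g: "minpoly_int g x" "lead_coeff g = 1" and g': "minpoly_int g' (x + of_int m)" "lead_coeff g' = 1"
  shows "g' = g \<circ>\<^sub>p [:- m, 1:]"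
proof -
  have comp: "poly (map_poly of_int (h \<circ>\<^sub>p [:k, 1:])) z = poly (map_poly of_int h) (z + of_int k)" for h k and z :: complex
    by (simp add: of_int_hom.map_poly_pcompose poly_pcompose hom_distribs add.commute)
  have lc: "lead_coeff (h \<circ>\<^sub>p [:k, 1:]) = lead_coeff h" for h :: "int poly" and k
    by (subst lead_coeff_comp) auto
  have dg: "degree (h \<circ>\<^sub>p [:k, 1:]) = degree h" for h :: "int poly" and k
    by (simp add: degree_pcompose)
  have 1: "g' dvd g \<circ>\<^sub>p [:- m, 1:]"
    using minpoly_int_dvd_iff[OF g'(1)] comp[of g "- m" "x + of_int m"] minpoly_int_root[OF g(1)] by simp
  have 2: "g dvd g' \<circ>\<^sub>p [:m, 1:]"
    using minpoly_int_dvd_iff[OF g(1)] comp[of g' m x] minpoly_int_root[OF g'(1)] by simp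
  have nz: "g \<circ>\<^sub>p [:- m, 1:] \<noteq> 0" "g' \<circ>\<^sub>p [:m, 1:] \<noteq> 0" using lc[of g "- m"] lc[of g' m] g(2) g'(2) by auto
  from 1 obtain h where h: "g \<circ>\<^sub>p [:- m, 1:] = g' * h" by (rule dvdE)
  have le: "degree g' \<le> degree g" using dvd_imp_degree_le[OF 1 nz(1)] unfolding dg .
  have ge: "degree g \<le> degree g'" using dvd_imp_degree_le[OF 2 nz(2)] unfolding dg .
  have nz': "g' \<noteq> 0" "h \<noteq> 0" using nz(1) unfolding h by simp_all
  have "degree g = degree g' + degree h" using degree_mult_eq[OF nz'] unfolding h[symmetric] dg .
  then have "degree h = 0" using le ge by linarith
  then obtain c where c: "h = [:c:]" by (metis degree_eq_zeroE)
  have "lead_coeff g = lead_coeff g' * lead_coeff h"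
    using arg_cong[OF h, of lead_coeff] unfolding lc lead_coeff_mult .
  then have "c = 1" using g(2) g'(2) unfolding c by simp
  then show ?thesis using h unfolding c by simp
qed

section \<open>Irreducible polynomials over finite fields and the sieve\<close>

hide_const (open) Coset.order Divisibility.prime

definition monic_polys :: "nat \<Rightarrow> 'a :: {finite, field_gcd} poly set" where
  "monic_polys d = {f. lead_coeff f = 1 \<and> degree f = d}"

definition monic_irreducibles :: "nat \<Rightarrow> 'a :: {finite, field_gcd} poly set" where
  "monic_irreducibles d = {f \<in> monic_polys d. irreducible f}"

lemma finite_card_polys_below:
  "finite {f :: 'a :: {finite, field_gcd} poly. \<forall>i\<ge>k. coeff f i = 0} \<and>
   card {f :: 'a poly. \<forall>i\<ge>k. coeff f i = 0} = CARD('a) ^ k"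
proof (induction k)
  case 0
  have "{f :: 'a poly. \<forall>i\<ge>0. coeff f i = 0} = {0}" by (auto simp: poly_eq_iff)
  then show ?case by simp
next
  case (Suc k)
  let ?P = "\<lambda>k. {f :: 'a poly. \<forall>i\<ge>k. coeff f i = 0}"
  have eq: "?P (Suc k) = (\<lambda>(c, f). pCons c f) ` (UNIV \<times> ?P k)"
  proof (rule Set.set_eqI, rule iffI)
    fix f :: "'a poly" assume f: "f \<in> ?P (Suc k)"
    obtain c g where cg: "f = pCons c g" by (cases f)
    have "coeff g i = 0" if "i \<ge> k" for i
    proof -
      have "coeff f (Suc i) = 0" using f that by simp
      then show ?thesis by (simp add: cg)
    qed
    then show "f \<in> (\<lambda>(c, f). pCons c f) ` (UNIV \<times> ?P k)" using cg by force
  qed (auto simp: coeff_pCons split: nat.splits)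
  have "inj_on (\<lambda>(c, f). pCons c f) (UNIV \<times> ?P k)" by (auto simp: inj_on_def)
  then have "card (?P (Suc k)) = CARD('a) * card (?P k)"
    unfolding eq by (simp add: card_image card_cartesian_product)
  moreover have "finite (?P (Suc k))" unfolding eq using Suc by auto
  ultimately show ?case using Suc by simp
qed

lemma finite_monic_polys: "finite (monic_polys d :: 'a :: {finite, field_gcd} poly set)"
  and card_monic_polys: "card (monic_polys d :: 'a poly set) = CARD('a) ^ d"
proof -
  let ?P = "{f :: 'a poly. \<forall>i\<ge>d. coeff f i = 0}"
  have eq: "monic_polys d = (\<lambda>f. monom 1 d + f) ` ?P"
  proof (rule Set.set_eqI, rule iffI)
    fix f :: "'a poly" assume f: "f \<in> monic_polys d"
    have "f - monom 1 d \<in> ?P"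
      using f by (auto simp: monic_polys_def coeff_eq_0)
    moreover have "f = monom 1 d + (f - monom 1 d)" by simp
    ultimately show "f \<in> (\<lambda>f. monom 1 d + f) ` ?P" by blast
  next
    fix f :: "'a poly" assume "f \<in> (\<lambda>f. monom 1 d + f) ` ?P"
    then obtain g where g: "\<And>i. i \<ge> d \<Longrightarrow> coeff g i = 0" "f = monom 1 d + g" by auto
    have cd: "coeff f d = 1" using g by simp
    have "degree f \<le> d" using g by (intro degree_le) auto
    moreover have "degree f \<ge> d" using cd by (intro le_degree) simp
    ultimately show "f \<in> monic_polys d" using cd by (simp add: monic_polys_def)
  qed
  show "finite (monic_polys d :: 'a poly set)" unfolding eq using finite_card_polys_below by blast
  show "card (monic_polys d :: 'a poly set) = CARD('a) ^ d"
    unfolding eq using finite_card_polys_below[where 'a = 'a and k = d] by (subst card_image) auto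
qed

lemma monic_mult_iff:
  fixes Q :: "'a :: {finite, field_gcd} poly"
  assumes "lead_coeff Q = 1"
  shows "Q * g \<in> monic_polys d \<longleftrightarrow> degree Q \<le> d \<and> g \<in> monic_polys (d - degree Q)"
proof -
  have Q0: "Q \<noteq> 0" using assms by auto
  have lc: "lead_coeff (Q * g) = lead_coeff g" using assms by (simp add: lead_coeff_mult)
  show ?thesis
  proof (cases "g = 0")
    case True
    then show ?thesis by (simp add: monic_polys_def)
  next
    case False
    then have "degree (Q * g) = degree Q + degree g" using Q0 by (simp add: degree_mult_eq)
    then show ?thesis unfolding monic_polys_def mem_Collect_eq lc by auto
  qed
qed

lemma card_monic_multiples:
  fixes Q :: "'a :: {finite, field_gcd} poly"
  assumes "lead_coeff Q = 1"
  shows "card {f \<in> monic_polys d. Q dvd f} = (if degree Q \<le> d then CARD('a) ^ (d - degree Q) else 0)"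
proof (cases "degree Q \<le> d")
  case True
  have Q0: "Q \<noteq> 0" using assms by auto
  have "{f \<in> monic_polys d. Q dvd f} = (\<lambda>g. Q * g) ` monic_polys (d - degree Q)"
    using monic_mult_iff[OF assms, of _ d] True by (auto simp: dvd_def)
  moreover have "inj_on (\<lambda>g. Q * g) (monic_polys (d - degree Q))" using Q0 by (auto simp: inj_on_def)
  ultimately show ?thesis using True by (simp add: card_image card_monic_polys)
next
  case False
  then have "{f \<in> monic_polys d. Q dvd f} = {}"
    using monic_mult_iff[OF assms, of _ d] by (auto simp: dvd_def)
  then show ?thesis using False by (simp only: card.empty if_False)
qed

lemma normalize_eq_monic:
  fixes f :: "'a :: {finite, field_gcd} poly"
  assumes "lead_coeff f = 1"
  shows "normalize f = f"
  using assms by (simp add: normalize_poly_eq_map_poly)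

lemma prime_iff_monic_irreducible:
  fixes f :: "'a :: {finite, field_gcd} poly"
  shows "prime f \<longleftrightarrow> irreducible f \<and> lead_coeff f = 1"
proof
  assume p: "prime f"
  have irr: "irreducible f" by (rule prime_elem_imp_irreducible[OF prime_imp_prime_elem[OF p]])
  have f0: "f \<noteq> 0" using p not_prime_0 by (rule_tac notI) simp
  have "unit_factor f = 1" by (rule unit_factor_prime[OF p])
  then have "[:unit_factor (lead_coeff f):] = 1" unfolding unit_factor_poly_def .
  then have 1: "unit_factor (lead_coeff f) = 1" by (simp only: one_pCons pCons_eq_iff)
  have "is_unit (lead_coeff f)" using f0 by (simp add: dvd_field_iff)
  then have "lead_coeff f = 1" using is_unit_unit_factor[of "lead_coeff f"] 1 by simp
  then show "irreducible f \<and> lead_coeff f = 1" using irr by (rule conjI[rotated])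
next
  assume a: "irreducible f \<and> lead_coeff f = 1"
  then have "prime_elem f" using irreducible_imp_prime_elem by blast
  then show "prime f" using normalize_eq_monic[of f] a by (intro normalization_semidom_class.primeI) simp_all
qed

section \<open>Counting irreducible polynomials with the analogue of the von Mangoldt
  function\<close>

definition prime_powers :: "nat \<Rightarrow> ('a :: {finite, field_gcd} poly \<times> nat) set" where
  "prime_powers d = {(P, j). prime P \<and> j \<ge> 1 \<and> j * degree P \<le> d}"

lemma prime_degree_pos:
  assumes "prime (P :: 'a :: {finite, field_gcd} poly)"
  shows "degree P \<ge> 1"
proof (rule ccontr)
  assume "\<not> degree P \<ge> 1"
  moreover have "P \<noteq> 0" using assms by (rule_tac notI) simp
  ultimately have "is_unit P" by (simp add: is_unit_iff_degree)
  then show False using assms not_prime_unit by blast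
qed

lemma finite_prime_powers: "finite (prime_powers d :: ('a :: {finite, field_gcd} poly \<times> nat) set)"
proof (rule finite_subset)
  show "(prime_powers d :: ('a poly \<times> nat) set) \<subseteq> (\<Union>k\<le>d. monic_polys k) \<times> {..d}"
  proof
    fix x :: "'a poly \<times> nat" assume "x \<in> prime_powers d"
    then obtain P j where x: "x = (P, j)" "prime P" "j \<ge> 1" "j * degree P \<le> d" by (auto simp: prime_powers_def)
    have "degree P \<le> j * degree P" "j \<le> j * degree P" using x prime_degree_pos[OF x(2)] by auto
    then have "degree P \<le> d" "j \<le> d" using x(4) by (blast intro: order_trans)+
    then show "x \<in> (\<Union>k\<le>d. monic_polys k) \<times> {..d}"
      using x prime_iff_monic_irreducible[of P] by (auto simp: monic_polys_def)
  qed
qed (auto intro: finite_monic_polys)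

text \<open>Analogue of writing \<open>log n\<close> as the sum of the von Mangoldt function over
  the divisors of \<open>n\<close>: each prime \<open>P\<close> is counted once for every
  \<open>j\<close> up to its multiplicity, with weight \<open>degree P\<close>.\<close>

lemma degree_eq_sum_prime_powers:
  fixes f :: "'a :: {finite, field_gcd} poly"
  assumes f: "f \<in> monic_polys d"
  shows "d = (\<Sum>(P, j) \<in> prime_powers d. if P ^ j dvd f then degree P else 0)"
proof -
  have f0: "f \<noteq> 0" and lf: "lead_coeff f = 1" and df: "degree f = d" using f by (auto simp: monic_polys_def)
  have "d = degree (\<Prod>P\<in>prime_factors f. P ^ multiplicity P f)"
    using prod_prime_factors[OF f0] normalize_eq_monic[OF lf] df by simp
  also have "\<dots> = (\<Sum>P\<in>prime_factors f. multiplicity P f * degree P)"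
  proof -
    have nz: "P \<noteq> 0" if "P \<in> prime_factors f" for P using that by auto
    have "degree (\<Prod>P\<in>prime_factors f. P ^ multiplicity P f) = (\<Sum>P\<in>prime_factors f. degree (P ^ multiplicity P f))"
      by (rule degree_prod_eq_sum_degree) (simp add: nz)
    also have "\<dots> = (\<Sum>P\<in>prime_factors f. multiplicity P f * degree P)"
      by (rule sum.cong[OF refl]) (simp add: degree_power_eq nz)
    finally show ?thesis .
  qed
  also have "\<dots> = (\<Sum>P\<in>prime_factors f. \<Sum>j\<in>{1..multiplicity P f}. degree P)" by simp
  also have "\<dots> = (\<Sum>(P, j)\<in>Sigma (prime_factors f) (\<lambda>P. {1..multiplicity P f}). degree P)"
    by (rule sum.Sigma) auto
  also have "\<dots> = (\<Sum>(P, j)\<in>prime_powers d. if P ^ j dvd f then degree P else 0)"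
  proof (rule sum.mono_neutral_cong_left)
    have dv: "P ^ j dvd f \<longleftrightarrow> j \<le> multiplicity P f" if "prime P" for P j
      by (rule power_dvd_iff_le_multiplicity[OF f0]) (use that not_prime_unit in blast)
    show "Sigma (prime_factors f) (\<lambda>P. {1..multiplicity P f}) \<subseteq> prime_powers d"
    proof
      fix x assume "x \<in> Sigma (prime_factors f) (\<lambda>P. {1..multiplicity P f})"
      then obtain P j where x: "x = (P, j)" "P \<in> prime_factors f" "1 \<le> j" "j \<le> multiplicity P f" by auto
      have "prime P" using x(2) by auto
      have "P ^ j dvd f" using x(4) dv[OF \<open>prime P\<close>] by blast
      then have "degree (P ^ j) \<le> d" using f0 df dvd_imp_degree_le by blast
      then show "x \<in> prime_powers d" using x \<open>prime P\<close> by (auto simp: prime_powers_def degree_power_eq mult.commute)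
    qed
    show "\<forall>x\<in>prime_powers d - Sigma (prime_factors f) (\<lambda>P. {1..multiplicity P f}).
      (case x of (P, j) \<Rightarrow> if P ^ j dvd f then degree P else 0) = 0"
    proof
      fix x assume x: "x \<in> prime_powers d - Sigma (prime_factors f) (\<lambda>P. {1..multiplicity P f})"
      obtain P j where Pj: "x = (P, j)" by fastforce
      have pj: "prime P" "j \<ge> 1" using x Pj by (auto simp: prime_powers_def)
      have "\<not> P ^ j dvd f"
      proof
        assume d: "P ^ j dvd f"
        then have "P dvd f" using pj(2) by (metis dvd_power dvd_trans not_one_le_zero gr0I)
        then have "P \<in> prime_factors f" using pj(1) f0 by (simp add: in_prime_factors_iff)
        then show False using x Pj pj d dv[OF pj(1)] by simp
      qed
      then show "(case x of (P, j) \<Rightarrow> if P ^ j dvd f then degree P else 0) = 0" using Pj by simp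
    qed
    show "(case x of (P, j) \<Rightarrow> degree P) = (case x of (P, j) \<Rightarrow> if P ^ j dvd f then degree P else 0)"
      if "x \<in> Sigma (prime_factors f) (\<lambda>P. {1..multiplicity P f})" for x
    proof -
      obtain P j where x: "x = (P, j)" "P \<in> prime_factors f" "j \<le> multiplicity P f" using \<open>x \<in> _\<close> by auto
      have "prime P" using x(2) by (rule in_prime_factors_imp_prime)
      then show ?thesis using x dv by simp
    qed
  qed (rule finite_prime_powers)
  finally show ?thesis .
qed

text \<open>The preceding identity is summed over all monic polynomials of degree \<open>d\<close>;
  after exchanging the sums one counts the monic multiples of each prime power.\<close>

lemma sum_prime_powers:
  fixes d :: nat
  defines "q \<equiv> CARD('a :: {finite, field_gcd})"
  shows "d * q ^ d = (\<Sum>(P :: 'a poly, j) \<in> prime_powers d. degree P * q ^ (d - j * degree P))"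
proof -
  have "d * q ^ d = (\<Sum>f\<in>(monic_polys d :: 'a poly set). d)" by (simp add: card_monic_polys q_def)
  also have "\<dots> = (\<Sum>f\<in>(monic_polys d :: 'a poly set). \<Sum>(P, j) \<in> prime_powers d. if P ^ j dvd f then degree P else 0)"
    by (rule sum.cong[OF refl]) (rule degree_eq_sum_prime_powers)
  also have "\<dots> = (\<Sum>x \<in> prime_powers d. \<Sum>f\<in>(monic_polys d :: 'a poly set). case x of (P, j) \<Rightarrow> if P ^ j dvd f then degree P else 0)"
    by (rule sum.swap)
  also have "\<dots> = (\<Sum>(P :: 'a poly, j) \<in> prime_powers d. degree P * q ^ (d - j * degree P))"
  proof (rule sum.cong[OF refl])
    fix x :: "'a poly \<times> nat" assume x: "x \<in> prime_powers d"
    obtain P j where Pj: "x = (P, j)" by fastforce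
    have P: "prime P" "j * degree P \<le> d" using x Pj by (auto simp: prime_powers_def)
    have lc: "lead_coeff (P ^ j) = 1" using prime_iff_monic_irreducible[of P] P by (simp add: lead_coeff_power)
    have dg: "degree (P ^ j) = j * degree P" using P by (subst degree_power_eq) auto
    have "(\<Sum>f\<in>(monic_polys d :: 'a poly set). if P ^ j dvd f then degree P else 0)
      = (\<Sum>f\<in>{f \<in> monic_polys d. P ^ j dvd f}. degree P)"
      by (rule sum.inter_filter[symmetric]) (rule finite_monic_polys)
    also have "\<dots> = q ^ (d - j * degree P) * degree P"
      using card_monic_multiples[OF lc, of d] P(2) by (simp add: dg q_def)
    finally show "(\<Sum>f\<in>(monic_polys d :: 'a poly set). case x of (P, j) \<Rightarrow> if P ^ j dvd f then degree P else 0)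
      = (case x of (P, j) \<Rightarrow> degree P * q ^ (d - j * degree P))" by (simp add: Pj)
  qed
  finally show ?thesis .
qed

definition exact_prime_powers :: "nat \<Rightarrow> ('a :: {finite, field_gcd} poly \<times> nat) set" where
  "exact_prime_powers d = {(P, j). prime P \<and> j \<ge> 1 \<and> j * degree P = d}"

lemma finite_exact_prime_powers: "finite (exact_prime_powers d :: ('a :: {finite, field_gcd} poly \<times> nat) set)"
  by (rule finite_subset[OF _ finite_prime_powers[of d]]) (auto simp: prime_powers_def exact_prime_powers_def)

text \<open>Gauss's formula. The prime powers of degree below \<open>d\<close> contribute to the
  identity at \<open>d\<close> exactly \<open>q\<close> times the whole identity at
  \<open>d - 1\<close>, and \<open>d * q^d - q * (d - 1) * q^(d-1) = q^d\<close> remains for those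
  of degree \<open>d\<close>.\<close>

lemma sum_exact_prime_powers:
  assumes "d \<ge> 1"
  shows "(\<Sum>(P :: 'a :: {finite, field_gcd} poly, j) \<in> exact_prime_powers d. degree P) = CARD('a) ^ d"
proof -
  let ?q = "CARD('a)"
  obtain e where d: "d = Suc e" using assms by (cases d) auto
  let ?g = "\<lambda>d (P :: 'a poly, j). degree P * ?q ^ (d - j * degree P)"
  have split: "prime_powers d = exact_prime_powers d \<union> (prime_powers e :: ('a poly \<times> nat) set)"
    "exact_prime_powers d \<inter> (prime_powers e :: ('a poly \<times> nat) set) = {}"
    by (auto simp: prime_powers_def exact_prime_powers_def d)
  have "d * ?q ^ d = (\<Sum>x\<in>exact_prime_powers d. ?g d x) + (\<Sum>x\<in>prime_powers e. ?g d x)"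
    using sum_prime_powers[of d, where 'a = 'a] unfolding split(1)
    by (subst (asm) sum.union_disjoint) (auto simp: split finite_prime_powers finite_exact_prime_powers)
  also have "(\<Sum>x\<in>prime_powers e. ?g d x) = (\<Sum>x\<in>prime_powers e. ?q * ?g e x)"
    by (rule sum.cong) (auto simp: prime_powers_def d Suc_diff_le)
  also have "\<dots> = ?q * (e * ?q ^ e)" using sum_prime_powers[of e, where 'a = 'a] by (simp add: sum_distrib_left)
  also have "(\<Sum>x\<in>exact_prime_powers d. ?g d x) = (\<Sum>(P :: 'a poly, j) \<in> exact_prime_powers d. degree P)"
    by (rule sum.cong) (auto simp: exact_prime_powers_def)
  finally show ?thesis by (simp add: d)
qed

lemma monic_irreducibles_card_le:
  "k * card (monic_irreducibles k :: 'a :: {finite, field_gcd} poly set) \<le> CARD('a) ^ k"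
proof (cases "k \<ge> 1")
  case True
  let ?S = "(\<lambda>P. (P, 1 :: nat)) ` (monic_irreducibles k :: 'a poly set)"
  have 1: "(\<Sum>(P, j) \<in> ?S. degree P) = k * card (monic_irreducibles k :: 'a poly set)"
    by (subst sum.reindex) (auto simp: inj_on_def monic_irreducibles_def monic_polys_def)
  have 2: "(\<Sum>(P, j) \<in> ?S. degree P) \<le> (\<Sum>(P :: 'a poly, j) \<in> exact_prime_powers k. degree P)"
    by (rule sum_mono2[OF finite_exact_prime_powers])
      (auto simp: exact_prime_powers_def monic_irreducibles_def monic_polys_def prime_iff_monic_irreducible)
  show ?thesis using 1 2 sum_exact_prime_powers[OF True, where 'a = 'a] by simp
next
  case False
  then have "k = 0" by simp
  then show ?thesis by simp
qed

text \<open>In Gauss's formula the terms with \<open>j \<ge> 2\<close> come from primes of degree at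
  most \<open>d div 2\<close>. By the upper bound they contribute at most
  \<open>(d div 2) * q^(d div 2)\<close>, which is at most half of \<open>q^d\<close> as soon as
  \<open>q \<ge> d\<close>.\<close>

lemma monic_irreducibles_card_ge:
  assumes d: "d \<ge> 1" and q: "CARD('a :: {finite, field_gcd}) \<ge> d"
  shows "CARD('a) ^ d \<le> 2 * d * card (monic_irreducibles d :: 'a poly set)"
proof -
  let ?q = "CARD('a)"
  let ?N = "\<lambda>k. card (monic_irreducibles k :: 'a poly set)"
  have finI: "finite (monic_irreducibles k :: 'a poly set)" for k
    by (rule finite_subset[OF _ finite_monic_polys[of k]]) (auto simp: monic_irreducibles_def)
  have q1: "?q \<ge> 1" by (simp add: Suc_leI)
  have sub: "exact_prime_powers d \<subseteq> (\<lambda>P. (P, 1 :: nat)) ` monic_irreducibles d \<union>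
    (\<Union>k\<in>{1..d div 2}. (\<lambda>P :: 'a poly. (P, d div k)) ` monic_irreducibles k)"
  proof
    fix x :: "'a poly \<times> nat" assume "x \<in> exact_prime_powers d"
    then obtain P j where x: "x = (P, j)" "prime P" "j \<ge> 1" "j * degree P = d" by (auto simp: exact_prime_powers_def)
    have P: "P \<in> monic_irreducibles (degree P)" "degree P \<ge> 1"
      using x(2) prime_iff_monic_irreducible[of P] prime_degree_pos[of P] by (auto simp: monic_irreducibles_def monic_polys_def)
    show "x \<in> (\<lambda>P. (P, 1 :: nat)) ` monic_irreducibles d \<union>
      (\<Union>k\<in>{1..d div 2}. (\<lambda>P :: 'a poly. (P, d div k)) ` monic_irreducibles k)"
    proof (cases "j = 1")
      case True
      then show ?thesis using x P by auto
    next
      case False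
      then have "2 \<le> j" using x(3) by simp
      then have "2 * degree P \<le> d" using mult_le_mono1[of 2 j "degree P"] x(4) by simp
      then have "degree P \<in> {1..d div 2}" using P by auto
      moreover have "j = d div degree P" using x(4) P(2) by auto
      ultimately show ?thesis using x(1) P(1) by blast
    qed
  qed
  let ?s = "\<lambda>A. (\<Sum>(P :: 'a poly, j) \<in> A. degree P)"
  have un: "?s (A \<union> B) \<le> ?s A + ?s B" if "finite A" "finite B" for A B
    using that by (simp add: sum_Un_nat)
  have "?q ^ d = ?s (exact_prime_powers d)" using sum_exact_prime_powers[OF d, where 'a = 'a] by simp
  also have "\<dots> \<le> ?s ((\<lambda>P. (P, 1 :: nat)) ` monic_irreducibles d \<union>
      (\<Union>k\<in>{1..d div 2}. (\<lambda>P :: 'a poly. (P, d div k)) ` monic_irreducibles k))"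
    by (rule sum_mono2[OF _ sub]) (auto simp: finI)
  also have "\<dots> \<le> ?s ((\<lambda>P. (P, 1 :: nat)) ` monic_irreducibles d) +
      ?s (\<Union>k\<in>{1..d div 2}. (\<lambda>P :: 'a poly. (P, d div k)) ` monic_irreducibles k)"
    by (rule un) (auto simp: finI)
  also have "?s ((\<lambda>P. (P, 1 :: nat)) ` monic_irreducibles d) = d * ?N d"
    by (subst sum.reindex) (auto simp: inj_on_def monic_irreducibles_def monic_polys_def)
  also have "?s (\<Union>k\<in>{1..d div 2}. (\<lambda>P :: 'a poly. (P, d div k)) ` monic_irreducibles k)
      = (\<Sum>k\<in>{1..d div 2}. ?s ((\<lambda>P :: 'a poly. (P, d div k)) ` monic_irreducibles k))"
    by (rule sum.UNION_disjoint, simp, simp add: finI, auto simp: monic_irreducibles_def monic_polys_def)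
  also have "\<dots> = (\<Sum>k\<in>{1..d div 2}. k * ?N k)"
    by (intro sum.cong refl, subst sum.reindex) (auto simp: inj_on_def monic_irreducibles_def monic_polys_def)
  also have "\<dots> \<le> (\<Sum>k\<in>{1..d div 2}. ?q ^ (d div 2))"
    by (rule sum_mono, rule order_trans[OF monic_irreducibles_card_le]) (use q1 in \<open>auto intro!: power_increasing\<close>)
  also have "\<dots> = (d div 2) * ?q ^ (d div 2)" by simp
  finally have main: "?q ^ d \<le> d * ?N d + (d div 2) * ?q ^ (d div 2)" by simp
  have "2 * ((d div 2) * ?q ^ (d div 2)) \<le> ?q ^ d"
  proof (cases "d \<ge> 2")
    case True
    have "2 * ((d div 2) * ?q ^ (d div 2)) \<le> ?q * ?q ^ (d div 2)" using q by (simp add: mult.assoc[symmetric])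
    also have "\<dots> = ?q ^ Suc (d div 2)" by simp
    also have "\<dots> \<le> ?q ^ d" using q1 True by (intro power_increasing) auto
    finally show ?thesis .
  next
    case False
    then have "d = 1" using d by simp
    then show ?thesis by simp
  qed
  then show ?thesis using main by simp
qed

text \<open>Reducibility modulo \<open>p\<close> of the polynomial with coefficients
  \<open>v\<close>, together with the case of a vanishing leading coefficient. It is phrased with
  integer polynomials, and not over the prime field, so that \<open>p\<close> can vary.\<close>

definition splits_mod :: "nat \<Rightarrow> nat \<Rightarrow> (nat \<Rightarrow> int) \<Rightarrow> bool" where
  "splits_mod p d v \<longleftrightarrow> int p dvd v d \<or> (\<exists>g h :: int poly. lead_coeff g = 1 \<and> lead_coeff h = 1 \<and>
     degree g \<ge> 1 \<and> degree h \<ge> 1 \<and> degree g + degree h = d \<and>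
     (\<forall>i\<le>d. int p dvd v i - v d * coeff (g * h) i))"

definition residue_vectors :: "nat \<Rightarrow> nat \<Rightarrow> (nat \<Rightarrow> int) set" where
  "residue_vectors p d = {..d} \<rightarrow>\<^sub>E {0..<int p}"

lemma finite_residue_vectors: "finite (residue_vectors p d)"
  by (auto simp: residue_vectors_def intro!: finite_PiE)

lemma card_residue_vectors: "card (residue_vectors p d) = p ^ Suc d"
  by (simp add: residue_vectors_def card_PiE)

text \<open>Non-zero constant multiples of monic irreducibles do not split, and there are
  \<open>p - 1\<close> of them for each monic irreducible. The factor 4 combines
  \<open>p \<le> 2 * (p - 1)\<close> with the factor 2 in the lower bound for irreducibles.\<close>

lemma card_not_splits_mod_typed:
  assumes d: "d \<ge> 1" and q: "CARD('a :: prime_card) \<ge> d"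
  shows "CARD('a) ^ Suc d \<le> 4 * d * card {v \<in> residue_vectors (CARD('a)) d. \<not> splits_mod (CARD('a)) d v}"
proof -
  let ?p = "CARD('a)"
  let ?I = "monic_irreducibles d :: 'a mod_ring poly set"
  define lift where "lift f = restrict (\<lambda>i. to_int_mod_ring (coeff f i)) {..d}" for f :: "'a mod_ring poly"
  define X where "X = (\<lambda>(c, f). smult c f) ` ((UNIV - {0}) \<times> ?I)"
  have ofint: "of_int (to_int_mod_ring x) = x" for x :: "'a mod_ring" by (simp add: of_int_of_int_mod_ring)
  have of_int_0: "of_int k = (0 :: 'a mod_ring) \<longleftrightarrow> int ?p dvd k" for k
    using of_int_eq_0_iff_char_dvd[of k, where 'a = "'a mod_ring"] by simp
  have finI: "finite ?I" by (rule finite_subset[OF _ finite_monic_polys[of d]]) (auto simp: monic_irreducibles_def)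
  have Xprop: "degree f = d" "irreducible f" "f \<noteq> 0" if "f \<in> X" for f
  proof -
    from that obtain c g where cg: "c \<noteq> 0" "g \<in> ?I" "f = smult c g" by (auto simp: X_def)
    then show "degree f = d" "f \<noteq> 0" "irreducible f"
      by (auto simp: monic_irreducibles_def monic_polys_def)
  qed
  have cardX: "card X = (?p - 1) * card ?I"
  proof -
    have "inj_on (\<lambda>(c, f). smult c f) ((UNIV - {0}) \<times> ?I)"
    proof (rule inj_onI)
      fix x y assume xy: "x \<in> (UNIV - {0}) \<times> ?I" "y \<in> (UNIV - {0}) \<times> ?I" "(\<lambda>(c, f). smult c f) x = (\<lambda>(c, f). smult c f) y"
      obtain c f c' f' where e: "x = (c, f)" "y = (c', f')" by (metis surj_pair)
      have *: "c \<noteq> 0" "c' \<noteq> 0" "f \<in> ?I" "f' \<in> ?I" "smult c f = smult c' f'" using xy by (auto simp: e)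
      have l: "lead_coeff f = 1" "lead_coeff f' = 1" using * by (auto simp: monic_irreducibles_def monic_polys_def)
      have "c = c'" using arg_cong[OF *(5), of lead_coeff] l by (simp only: lead_coeff_smult mult_1_right)
      then have "smult c (f - f') = 0" using *(5) by (simp add: smult_diff_right)
      then show "x = y" using \<open>c = c'\<close> *(1) by (simp add: e)
    qed
    then show ?thesis unfolding X_def by (simp add: card_image card_cartesian_product card_Diff_singleton)
  qed
  have inj: "inj_on lift X"
  proof (rule inj_onI)
    fix f g assume fg: "f \<in> X" "g \<in> X" "lift f = lift g"
    show "f = g"
    proof (rule poly_eqI)
      fix i show "coeff f i = coeff g i"
      proof (cases "i \<le> d")
        case True
        then have "to_int_mod_ring (coeff f i) = to_int_mod_ring (coeff g i)"
          using fun_cong[OF fg(3), of i] by (simp add: lift_def)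
        then show ?thesis by (metis ofint)
      next
        case False
        then show ?thesis using Xprop(1)[OF fg(1)] Xprop(1)[OF fg(2)] by (simp add: coeff_eq_0)
      qed
    qed
  qed
  have sub: "lift ` X \<subseteq> {v \<in> residue_vectors ?p d. \<not> splits_mod ?p d v}"
  proof
    fix v assume "v \<in> lift ` X"
    then obtain f where f: "f \<in> X" "v = lift f" by blast
    have rng: "to_int_mod_ring x \<in> {0..<int ?p}" for x :: "'a mod_ring"
      using range_to_int_mod_ring[where 'a = 'a] by auto
    have 1: "v \<in> residue_vectors ?p d" using rng unfolding f(2) lift_def residue_vectors_def by auto
    have vf: "of_int (v i) = coeff f i" if "i \<le> d" for i
      by (simp only: f(2) lift_def restrict_apply atMost_iff that if_True ofint)
    have "\<not> splits_mod ?p d v"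
    proof
      assume "splits_mod ?p d v"
      moreover have "\<not> int ?p dvd v d"
      proof
        assume "int ?p dvd v d"
        then have "of_int (v d) = (0 :: 'a mod_ring)" by (rule of_int_0[THEN iffD2])
        then have "coeff f d = 0" unfolding vf[OF order_refl] .
        then show False using Xprop[OF f(1)] by auto
      qed
      ultimately obtain g h :: "int poly" where gh: "lead_coeff g = 1" "lead_coeff h = 1" "degree g \<ge> 1" "degree h \<ge> 1"
        "degree g + degree h = d" "\<And>i. i \<le> d \<Longrightarrow> int ?p dvd v i - v d * coeff (g * h) i"
        unfolding splits_mod_def by blast
      define G where "G = (map_poly of_int g :: 'a mod_ring poly)"
      define H where "H = (map_poly of_int h :: 'a mod_ring poly)"
      have deg: "degree (map_poly of_int k :: 'a mod_ring poly) = degree k" if "lead_coeff k = 1" for k :: "int poly"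
      proof (rule antisym)
        show "degree (map_poly of_int k :: 'a mod_ring poly) \<le> degree k" by (rule degree_map_poly_le)
        have "coeff (map_poly of_int k :: 'a mod_ring poly) (degree k) = 1" using that by (simp add: coeff_map_poly)
        then show "degree k \<le> degree (map_poly of_int k :: 'a mod_ring poly)" by (intro le_degree) simp
      qed
      have dG: "degree G = degree g" "degree H = degree h"
        unfolding G_def H_def by (rule deg[OF gh(1)], rule deg[OF gh(2)])
      have cf: "coeff (map_poly of_int k :: 'a mod_ring poly) j = of_int (coeff k j)" for k j
        by (rule coeff_map_poly) (rule ring_1_class.of_int_0)
      have "f = smult (of_int (v d)) G * H"
      proof (rule poly_eqI)
        fix i
        have GH: "coeff (G * H) i = of_int (coeff (g * h) i)"
          unfolding G_def H_def coeff_mult cf of_int_sum of_int_mult ..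
        show "coeff f i = coeff (smult (of_int (v d)) G * H) i"
        proof (cases "i \<le> d")
          case True
          have "of_int (v i - v d * coeff (g * h) i) = (0 :: 'a mod_ring)"
            by (rule of_int_0[THEN iffD2, OF gh(6)[OF True]])
          then have "of_int (v i) = (of_int (v d) * of_int (coeff (g * h) i) :: 'a mod_ring)"
            by (simp only: of_int_diff of_int_mult right_minus_eq)
          then show ?thesis unfolding vf[OF True] mult_smult_left coeff_smult GH .
        next
          case False
          then have "coeff (g * h) i = 0" using degree_mult_le[of g h] gh(5) by (intro coeff_eq_0) simp
          moreover have "coeff f i = 0" using False Xprop(1)[OF f(1)] by (intro coeff_eq_0) simp
          ultimately show ?thesis
            by (simp only: mult_smult_left coeff_smult GH ring_1_class.of_int_0 mult_zero_right)
        qed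
      qed
      then have "is_unit (smult (of_int (v d)) G) \<or> is_unit H" using irreducibleD[OF Xprop(2)[OF f(1)]] by blast
      then show False
      proof
        assume "is_unit (smult (of_int (v d)) G)"
        then have "degree (smult (of_int (v d)) G) = 0" by (simp only: poly_dvd_1)
        moreover have "of_int (v d) \<noteq> (0 :: 'a mod_ring)"
          using vf[OF order_refl] Xprop[OF f(1)] by (metis leading_coeff_0_iff)
        ultimately have "degree G = 0" by (simp only: degree_smult_eq if_False)
        then show False using dG(1) gh(3) by simp
      next
        assume "is_unit H"
        then have "degree H = 0" by (simp only: poly_dvd_1)
        then show False using dG(2) gh(4) by simp
      qed
    qed
    then show "v \<in> {v \<in> residue_vectors ?p d. \<not> splits_mod ?p d v}" using 1 by blast
  qed
  have fin: "finite {v \<in> residue_vectors ?p d. \<not> splits_mod ?p d v}" using finite_residue_vectors by simp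
  have "card X \<le> card {v \<in> residue_vectors ?p d. \<not> splits_mod ?p d v}"
    using card_mono[OF fin sub] unfolding card_image[OF inj] .
  then have "4 * d * card X \<le> 4 * d * card {v \<in> residue_vectors ?p d. \<not> splits_mod ?p d v}" by (rule mult_le_mono2)
  moreover have "4 * d * (a * c) = 2 * a * (2 * d * c)" for a c :: nat by simp
  ultimately have "2 * (?p - 1) * (2 * d * card ?I) \<le> 4 * d * card {v \<in> residue_vectors ?p d. \<not> splits_mod ?p d v}"
    unfolding cardX by (simp only:)
  moreover have "2 * (?p - 1) * (2 * d * card ?I) \<ge> ?p * ?p ^ d"
  proof (rule mult_le_mono)
    show "?p \<le> 2 * (?p - 1)" using prime_ge_2_nat[OF prime_card[where 'a = 'a]] by simp
    show "?p ^ d \<le> 2 * d * card ?I" using monic_irreducibles_card_ge[OF d, where 'a = "'a mod_ring"] q by simp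
  qed
  ultimately show ?thesis unfolding power_Suc by (rule order_trans[rotated])
qed

text \<open>The library has prime fields only as types. To transfer the count to an arbitrary prime, instantiate it
  at a type whose cardinality is a counterexample if there is one.\<close>

definition counterexample :: "nat \<Rightarrow> bool" where
  "counterexample p \<longleftrightarrow> prime p \<and> (\<exists>d\<ge>1. p \<ge> d \<and> p ^ Suc d > 4 * d * card {v \<in> residue_vectors p d. \<not> splits_mod p d v})"

definition critical_prime :: nat where
  "critical_prime = (if \<exists>p. counterexample p then SOME p. counterexample p else 2)"

lemma prime_critical_prime: "prime critical_prime"
proof (cases "\<exists>p. counterexample p")
  case True
  then have "counterexample critical_prime" unfolding critical_prime_def using someI_ex[OF True] by simp
  then show ?thesis by (simp add: counterexample_def)
qed (simp add: critical_prime_def two_is_prime_nat)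

typedef critical_field = "{..<critical_prime}"
  using prime_gt_0_nat[OF prime_critical_prime] by auto

lemma card_critical_field: "CARD(critical_field) = critical_prime"
  using type_definition.card[OF type_definition_critical_field] by simp

instance critical_field :: prime_card
  by standard (simp add: card_critical_field prime_critical_prime)

lemma card_not_splits_mod:
  assumes "prime p" "d \<ge> 1" "p \<ge> d"
  shows "p ^ Suc d \<le> 4 * d * card {v \<in> residue_vectors p d. \<not> splits_mod p d v}"
proof (rule ccontr)
  assume "\<not> ?thesis"
  then have "counterexample p" using assms unfolding counterexample_def by (intro conjI exI[of _ d]) auto
  then have ex: "\<exists>p. counterexample p" ..
  have "counterexample critical_prime" unfolding critical_prime_def using someI_ex[OF ex] ex by simp
  then obtain d where "d \<ge> 1" "critical_prime \<ge> d"
    "critical_prime ^ Suc d > 4 * d * card {v \<in> residue_vectors critical_prime d. \<not> splits_mod critical_prime d v}"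
    by (auto simp: counterexample_def)
  then show False using card_not_splits_mod_typed[of d, where 'a = critical_field] by (simp add: card_critical_field)
qed

lemma card_splits_mod:
  assumes p: "prime p" "d \<ge> 1" "p \<ge> d"
  shows "real (card {v \<in> residue_vectors p d. splits_mod p d v}) \<le> (1 - 1 / (4 * d)) * real p ^ Suc d"
proof -
  let ?A = "{v \<in> residue_vectors p d. splits_mod p d v}" and ?B = "{v \<in> residue_vectors p d. \<not> splits_mod p d v}"
  have "card (?A \<union> ?B) = card ?A + card ?B"
    by (rule card_Un_disjoint) (auto simp: finite_residue_vectors)
  moreover have "?A \<union> ?B = residue_vectors p d" by auto
  ultimately have 1: "card ?A + card ?B = p ^ Suc d" by (simp add: card_residue_vectors)
  have "real (p ^ Suc d) \<le> real (4 * d * card ?B)" using card_not_splits_mod[OF p] by (rule of_nat_mono)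
  then have "real p ^ Suc d / (4 * d) \<le> real (card ?B)" using p(2) by (simp add: field_simps)
  moreover have "real (card ?A) + real (card ?B) = real p ^ Suc d"
  proof -
    have "real (p ^ Suc d) = real p ^ Suc d" by simp
    then show ?thesis using arg_cong[OF 1, of real] by (simp only: of_nat_add)
  qed
  ultimately show ?thesis by (simp add: algebra_simps)
qed

section \<open>Boxes of coefficient vectors and a sieve over finitely many primes\<close>

definition box :: "nat \<Rightarrow> nat \<Rightarrow> (nat \<Rightarrow> int) set" where
  "box d T = {..d} \<rightarrow>\<^sub>E {- int T..int T}"

lemma finite_box: "finite (box d T)"
  by (auto simp: box_def intro!: finite_PiE)

lemma prod_primes_dvd:
  assumes "finite P" "\<And>p. p \<in> P \<Longrightarrow> prime p" "\<And>p. p \<in> P \<Longrightarrow> int p dvd k"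
  shows "(\<Prod>p\<in>P. int p) dvd k"
  using assms
proof (induction P rule: finite_induct)
  case (insert q P)
  have "Rings.coprime (int q) (\<Prod>p\<in>P. int p)"
  proof (rule prod_coprime_right)
    fix p assume "p \<in> P"
    then show "Rings.coprime (int q) (int p)" using primes_coprime[of q p] insert by auto
  qed
  then show ?case using insert by (auto intro: divides_mult)
qed simp

text \<open>Chinese remainder theorem: a coordinate is determined by its residues modulo all
  \<open>p\<close> in \<open>P\<close> and by the quotient of the shifted coordinate by
  \<open>M = \<Prod>P\<close>. The choices of residues at distinct primes multiply, which gives
  \<open>\<delta> ^ card P\<close>; the summand \<open>\<Prod>P\<close> pays for an incomplete block
  of length \<open>M\<close>.\<close>

lemma sieve:
  fixes \<delta> :: real
  assumes P: "finite P" "\<And>p. p \<in> P \<Longrightarrow> prime p" and \<delta>: "\<And>p. p \<in> P \<Longrightarrow> real (card {v \<in> residue_vectors p d. A p v}) \<le> \<delta> * real p ^ Suc d"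
  shows "real (card {c \<in> box d T. \<forall>p\<in>P. A p (restrict (\<lambda>i. c i mod int p) {..d})})
     \<le> \<delta> ^ card P * real (2 * T + 1 + \<Prod>P) ^ Suc d"
proof -
  let ?C = "{c \<in> box d T. \<forall>p\<in>P. A p (restrict (\<lambda>i. c i mod int p) {..d})}"
  define M where "M = \<Prod>P"
  have M0: "M > 0" unfolding M_def using P by (intro prod_pos) (auto intro: prime_gt_0_nat)
  define Q where "Q = ({..d} \<rightarrow>\<^sub>E {0..int (2 * T) div int M})"
  define Y where "Y = (PiE P (\<lambda>p. {v \<in> residue_vectors p d. A p v}))"
  define F where "F c = (restrict (\<lambda>i. (c i + int T) div int M) {..d}, restrict (\<lambda>p. restrict (\<lambda>i. c i mod int p) {..d}) P)" for c :: "nat \<Rightarrow> int"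
  have finQ: "finite Q" unfolding Q_def by (intro finite_PiE) auto
  have finY: "finite Y" unfolding Y_def using P(1) by (intro finite_PiE) (auto simp: finite_residue_vectors)
  have inj: "inj_on F ?C"
  proof (rule inj_onI)
    fix c c' assume c: "c \<in> ?C" "c' \<in> ?C" "F c = F c'"
    have "c i = c' i" for i
    proof (cases "i \<le> d")
      case True
      have "fst (F c) i = fst (F c') i" using c(3) by simp
      then have q: "(c i + int T) div int M = (c' i + int T) div int M" using True by (simp add: F_def)
      have "int p dvd c i - c' i" if p: "p \<in> P" for p
      proof -
        have "snd (F c) p i = snd (F c') p i" using c(3) by simp
        then have "c i mod int p = c' i mod int p" using True p by (simp add: F_def)
        then show ?thesis by (simp add: mod_eq_dvd_iff)
      qed
      then have "(\<Prod>p\<in>P. int p) dvd c i - c' i" using P by (intro prod_primes_dvd) auto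
      then have "int M dvd (c i + int T) - (c' i + int T)" by (simp add: M_def)
      then have "(c i + int T) mod int M = (c' i + int T) mod int M" by (simp only: mod_eq_dvd_iff)
      with q have "c i + int T = c' i + int T" by (metis div_mult_mod_eq)
      then show ?thesis by simp
    next
      case False
      then show ?thesis using c by (auto simp: box_def PiE_def extensional_def)
    qed
    then show "c = c'" by blast
  qed
  have img: "F ` ?C \<subseteq> Q \<times> Y"
  proof
    fix y assume "y \<in> F ` ?C"
    then obtain c where c: "c \<in> ?C" "y = F c" by blast
    have "(c i + int T) div int M \<in> {0..int (2 * T) div int M}" if "i \<le> d" for i
    proof -
      have "- int T \<le> c i" "c i \<le> int T" using c(1) that by (auto simp: box_def PiE_def Pi_def)
      then show ?thesis using M0 by (auto intro!: zdiv_mono1 simp: pos_imp_zdiv_nonneg_iff)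
    qed
    moreover have "restrict (\<lambda>i. c i mod int p) {..d} \<in> {v \<in> residue_vectors p d. A p v}" if "p \<in> P" for p
      using c(1) that prime_gt_0_nat[OF P(2)[OF that]] by (auto simp: residue_vectors_def)
    ultimately show "y \<in> Q \<times> Y" by (auto simp: c(2) F_def Q_def Y_def)
  qed
  have "card ?C \<le> card Q * card Y"
    using card_inj_on_le[OF inj img] finQ finY by (simp add: card_cartesian_product)
  then have "real (card ?C) \<le> real (card Q * card Y)" by (rule of_nat_mono)
  then have C_le: "real (card ?C) \<le> real (card Q) * real (card Y)" unfolding of_nat_mult .
  have Q_eq: "real (card Q) = real (2 * T div M + 1) ^ Suc d"
  proof -
    have "int (2 * T) div int M = int (2 * T div M)" by (simp only: zdiv_int)
    then have "card {0..int (2 * T) div int M} = 2 * T div M + 1" by simp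
    moreover have "real (a ^ Suc d) = real a ^ Suc d" for a :: nat by simp
    ultimately show ?thesis unfolding Q_def by (simp only: card_PiE finite_atMost card_atMost prod_constant)
  qed
  have Y_le: "real (card Y) \<le> \<delta> ^ card P * real M ^ Suc d"
  proof -
    have "real (card Y) = (\<Prod>p\<in>P. real (card {v \<in> residue_vectors p d. A p v}))"
      unfolding Y_def using P(1) by (simp only: card_PiE of_nat_prod)
    also have "\<dots> \<le> (\<Prod>p\<in>P. \<delta> * real p ^ Suc d)" by (intro prod_mono conjI of_nat_0_le_iff \<delta>)
    also have "\<dots> = \<delta> ^ card P * real M ^ Suc d" by (simp only: prod.distrib prod_constant prod_power_distrib[symmetric] M_def of_nat_prod)
    finally show ?thesis .
  qed
  have "real (card ?C) \<le> real (2 * T div M + 1) ^ Suc d * (\<delta> ^ card P * real M ^ Suc d)"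
    by (rule order_trans[OF C_le[unfolded Q_eq] mult_left_mono[OF Y_le]]) (rule zero_le_power, rule of_nat_0_le_iff)
  also have "\<dots> = \<delta> ^ card P * (real (2 * T div M + 1) * real M) ^ Suc d" by (simp only: power_mult_distrib mult_ac)
  also have "\<dots> \<le> \<delta> ^ card P * real (2 * T + 1 + M) ^ Suc d"
  \<comment> \<open>Non-negativity of \<open>\<delta>\<close> is deduced from the count at some
    prime of \<open>P\<close>; with \<open>P\<close> empty the factor
    \<open>\<delta> ^ card P\<close> is 1.\<close>
  proof (cases "P = {}")
    case False
    then obtain p where p: "p \<in> P" by blast
    have "0 \<le> \<delta> * real p ^ Suc d" using \<delta>[OF p] by (meson of_nat_0_le_iff order_trans)
    have "real p ^ Suc d > 0" by (rule zero_less_power) (use prime_gt_0_nat[OF P(2)[OF p]] in simp)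
    have "\<delta> \<ge> 0"
    proof (rule ccontr)
      assume "\<not> \<delta> \<ge> 0"
      then have "\<delta> < 0" by simp
      from mult_neg_pos[OF this \<open>real p ^ Suc d > 0\<close>] show False using \<open>0 \<le> \<delta> * real p ^ Suc d\<close> by linarith
    qed
    moreover have "(2 * T div M + 1) * M \<le> 2 * T + 1 + M"
    proof -
      have "(2 * T div M + 1) * M = 2 * T div M * M + M" by (simp only: distrib_right mult_1_left)
      moreover have "2 * T div M * M \<le> 2 * T" by (rule div_times_less_eq_dividend)
      ultimately show ?thesis by linarith
    qed
    then have "real (2 * T div M + 1) * real M \<le> real (2 * T + 1 + M)" by (metis of_nat_mult of_nat_mono)
    ultimately show ?thesis by (intro mult_left_mono power_mono) auto
  next
    case True
    then have M: "M = 1" by (simp add: M_def)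
    have "(real (2 * T div M + 1) * real M) ^ Suc d \<le> real (2 * T + 1 + M) ^ Suc d"
      unfolding M by (rule power_mono) simp_all
    then show ?thesis by (simp only: True card.empty power_0 mult_1_left)
  qed
  finally show ?thesis by (simp add: M_def)
qed

section \<open>Counting points of bounded height\<close>

text \<open>Such an integer is determined by its sign and its exponents at the primes of
  \<open>S0\<close>, each below \<open>L\<close> because
  \<open>2^e \<le> \<bar>u\<bar> < 2^L\<close>. The number is therefore polynomial in the logarithm
  of the bound.\<close>

lemma S_units:
  fixes S0 :: "nat set"
  assumes S0: "finite S0" and L: "L \<ge> 1" "X < 2 ^ L"
  defines "U \<equiv> {u :: int. u \<noteq> 0 \<and> \<bar>u\<bar> \<le> int X \<and> (\<forall>p. prime p \<and> int p dvd u \<longrightarrow> p \<in> S0)}"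
  shows "finite U" "card U \<le> 2 * L ^ card S0"
proof -
  define P where "P = {p \<in> S0. prime p}"
  have P: "finite P" "card P \<le> card S0" using S0 by (auto simp: P_def intro: card_mono)
  define F where "F u = (sgn u, restrict (\<lambda>p. multiplicity p (nat \<bar>u\<bar>)) P)" for u :: int
  have pf: "nat \<bar>u\<bar> = (\<Prod>p\<in>P. p ^ multiplicity p (nat \<bar>u\<bar>))" if "u \<in> U" for u
  proof -
    have u0: "nat \<bar>u\<bar> \<noteq> 0" using that by (auto simp: U_def)
    have sub: "prime_factors (nat \<bar>u\<bar>) \<subseteq> P"
    proof
      fix p assume "p \<in> prime_factors (nat \<bar>u\<bar>)"
      then have p: "prime p" "p dvd nat \<bar>u\<bar>" by auto
      have "int p dvd u" using p(2) by (metis dvd_abs_iff int_dvd_int_iff int_nat_eq abs_ge_zero)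
      then show "p \<in> P" using that p by (auto simp: U_def P_def)
    qed
    have "nat \<bar>u\<bar> = (\<Prod>p\<in>prime_factors (nat \<bar>u\<bar>). p ^ multiplicity p (nat \<bar>u\<bar>))"
      using prod_prime_factors[OF u0] by simp
    also have "\<dots> = (\<Prod>p\<in>P. p ^ multiplicity p (nat \<bar>u\<bar>))"
      by (rule prod.mono_neutral_left[OF P(1) sub]) (auto simp: P_def prime_factors_multiplicity)
    finally show ?thesis .
  qed
  have inj: "inj_on F U"
  proof (rule inj_onI)
    fix u v assume uv: "u \<in> U" "v \<in> U" "F u = F v"
    have "multiplicity p (nat \<bar>u\<bar>) = multiplicity p (nat \<bar>v\<bar>)" if "p \<in> P" for p
    proof -
      have "snd (F u) p = snd (F v) p" using uv(3) by simp
      then show ?thesis using that by (simp add: F_def)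
    qed
    then have "nat \<bar>u\<bar> = nat \<bar>v\<bar>" using pf[OF uv(1)] pf[OF uv(2)] by (metis (no_types, lifting) prod.cong)
    then have "\<bar>u\<bar> = \<bar>v\<bar>" by (metis abs_ge_zero int_nat_eq)
    moreover have "sgn u = sgn v" using uv(3) by (simp add: F_def)
    ultimately show "u = v" by (metis sgn_mult_abs)
  qed
  have img: "F ` U \<subseteq> {-1, 1} \<times> (P \<rightarrow>\<^sub>E {..<L})"
  proof
    fix y assume "y \<in> F ` U"
    then obtain u where u: "u \<in> U" "y = F u" by blast
    have "multiplicity p (nat \<bar>u\<bar>) < L" if p: "p \<in> P" for p
    proof -
      let ?e = "multiplicity p (nat \<bar>u\<bar>)"
      have u0: "nat \<bar>u\<bar> > 0" using u by (auto simp: U_def)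
      have "2 ^ ?e \<le> p ^ ?e" using p by (intro power_mono) (auto simp: P_def prime_ge_2_nat)
      also have "\<dots> \<le> nat \<bar>u\<bar>" using u0 by (intro dvd_imp_le multiplicity_dvd)
      also have "\<dots> \<le> X" using u by (auto simp: U_def)
      finally have "2 ^ ?e < (2 :: nat) ^ L" using L(2) by (rule le_less_trans)
      then show ?thesis by (simp only: power_strict_increasing_iff one_less_numeral_iff semiring_norm)
    qed
    moreover have "sgn u \<in> {-1, 1}" using u by (auto simp: U_def sgn_if)
    ultimately show "y \<in> {-1, 1} \<times> (P \<rightarrow>\<^sub>E {..<L})" by (auto simp: u(2) F_def)
  qed
  have fin: "finite ({-1, 1 :: int} \<times> (P \<rightarrow>\<^sub>E {..<L}))" using P(1) by (auto intro!: finite_PiE)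
  show "finite U" using inj_on_finite[OF inj img fin] .
  have "card U \<le> card ({-1, 1 :: int} \<times> (P \<rightarrow>\<^sub>E {..<L}))" by (rule card_inj_on_le[OF inj img fin])
  also have "\<dots> = 2 * L ^ card P" using P(1) by (simp add: card_cartesian_product card_PiE)
  also have "\<dots> \<le> 2 * L ^ card S0" using P(2) L(1) by (intro mult_left_mono power_increasing) auto
  finally show "card U \<le> 2 * L ^ card S0" .
qed

lemma mahler_measure_height:
  assumes f: "minpoly_int f x"
  shows "mahler_measure f = height (Affine x) ^ degree f"
  unfolding height_Affine[OF f] using degree_minpoly_int_pos[OF f] mahler_measure_ge_0[of f] by simp

text \<open>Mignotte's bound involves two binomial coefficients of row \<open>degree f - 1\<close>,
  each at most \<open>2 ^ (degree f - 1)\<close>, and together they give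
  \<open>2 ^ degree f\<close>. Constants are treated separately because for degree 0 this sum would
  be 2.\<close>

lemma coeff_le_mahler_measure:
  fixes f :: "int poly"
  assumes "f \<noteq> 0" "degree f \<le> d"
  shows "real_of_int \<bar>coeff f i\<bar> \<le> 2 ^ d * mahler_measure f"
proof (cases "degree f = 0")
  case True
  then obtain c where "f = [:c:]" by (metis degree_eq_zeroE)
  then have "real_of_int \<bar>coeff f i\<bar> \<le> mahler_measure f"
    by (cases i) (auto simp: mahler_measure_def of_int_hom.map_poly_pCons_hom)
  also have "\<dots> \<le> 2 ^ d * mahler_measure f" using mahler_measure_ge_0[of f] by (simp add: mult_le_cancel_right1)
  finally show ?thesis .
next
  case False
  let ?n = "degree f - 1" and ?M = "mahler_measure f"
  have lc: "real_of_int \<bar>lead_coeff f\<bar> \<le> ?M"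
  proof -
    have "real_of_int \<bar>lead_coeff f\<bar> * 1 \<le> real_of_int \<bar>lead_coeff f\<bar> * mahler_measure_monic (map_poly of_int f)"
      by (intro mult_left_mono mahler_measure_monic_ge_1) auto
    then show ?thesis by (simp add: mahler_measure_def mahler_measure_poly_via_monic)
  qed
  have M0: "?M \<ge> 0" by (rule mahler_measure_ge_0)
  have b: "real (?n choose k) \<le> 2 ^ ?n" for k
    using of_nat_mono[OF binomial_le_pow2[of ?n k], where 'a = real] by simp
  have "real_of_int \<bar>coeff f i\<bar> \<le> real (?n choose i) * ?M + real (min i 1 * (?n choose (i - 1))) * real_of_int \<bar>lead_coeff f\<bar>"
    using mignotte_coeff_helper[of f i] by simp
  also have "\<dots> \<le> 2 ^ ?n * ?M + 2 ^ ?n * ?M"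
  proof (intro add_mono mult_mono b lc)
    have "min i 1 * (?n choose (i - 1)) \<le> (?n choose (i - 1))" by simp
    then show "real (min i 1 * (?n choose (i - 1))) \<le> 2 ^ ?n" by (rule order_trans[OF of_nat_mono b])
  qed (use M0 in auto)
  also have "\<dots> = 2 ^ Suc ?n * ?M" by simp
  also have "\<dots> \<le> 2 ^ d * ?M" using assms(2) False M0 by (intro mult_right_mono power_increasing) auto
  finally show ?thesis .
qed

lemma Affine_P1_deg_iff:
  assumes f: "minpoly_int f x"
  shows "Affine x \<in> P1_deg d \<longleftrightarrow> degree f \<le> d"
  using minpoly_int_Qbar[OF f] by (simp add: P1_deg_def P1_def degree_over_Q_field_generated[OF f] image_iff)

text \<open>Restriction makes the vector an element of the function space underlying
  \<open>box d T\<close>; a degree below \<open>d\<close> shows as zeros in the last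
  entries.\<close>

definition coeff_vector :: "nat \<Rightarrow> int poly \<Rightarrow> nat \<Rightarrow> int" where
  "coeff_vector d f = restrict (coeff f) {..d}"

lemma coeff_vector_inj: "degree f \<le> d \<Longrightarrow> degree g \<le> d \<Longrightarrow> coeff_vector d f = coeff_vector d g \<Longrightarrow> f = g"
proof (rule poly_eqI)
  fix i assume *: "degree f \<le> d" "degree g \<le> d" "coeff_vector d f = coeff_vector d g"
  show "coeff f i = coeff g i"
  proof (cases "i \<le> d")
    case True
    then show ?thesis using fun_cong[OF *(3), of i] by (simp add: coeff_vector_def)
  next
    case False
    then show ?thesis using *(1,2) by (simp add: coeff_eq_0)
  qed
qed

text \<open>A coefficient vector in \<open>C\<close> accounts for at most \<open>d\<close> points,
  the roots of its polynomial, and the summand 1 is the point at infinity. The lemma serves twice: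
  for finiteness of the denominator and for the upper bound of the numerator.\<close>

lemma points_of_bounded_height:
  assumes R: "R \<subseteq> P1_deg d" and B: "B \<ge> 1"
    and C: "finite C" "\<And>x f. Affine x \<in> R \<Longrightarrow> minpoly_int f x \<Longrightarrow>
      (\<forall>i\<le>d. real_of_int \<bar>coeff f i\<bar> \<le> 2 ^ d * B ^ d) \<Longrightarrow> coeff_vector d f \<in> C"
  shows "finite {P \<in> R. height P \<le> B}" "card {P \<in> R. height P \<le> B} \<le> 1 + d * card C"
proof -
  define Z where "Z c = (if \<exists>f. f \<noteq> 0 \<and> degree f \<le> d \<and> coeff_vector d f = c
    then {z :: complex. poly (map_poly of_int (THE f. degree f \<le> d \<and> coeff_vector d f = c)) z = 0} else {})" for c
  have Zeq: "Z (coeff_vector d f) = {z. poly (map_poly of_int f) z = 0}" if "f \<noteq> 0" "degree f \<le> d" for f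
  proof -
    have "(THE g. degree g \<le> d \<and> coeff_vector d g = coeff_vector d f) = f"
      using that coeff_vector_inj by (intro the_equality) auto
    then show ?thesis using that by (auto simp: Z_def)
  qed
  have Z: "finite (Z c) \<and> card (Z c) \<le> d" for c
  proof (cases "\<exists>f. f \<noteq> 0 \<and> degree f \<le> d \<and> coeff_vector d f = c")
    case True
    then obtain f where f: "f \<noteq> 0" "degree f \<le> d" "c = coeff_vector d f" by auto
    have f0: "map_poly of_int f \<noteq> (0 :: complex poly)" using f by simp
    show ?thesis unfolding f(3) Zeq[OF f(1,2)]
      using poly_roots_finite[OF f0] card_poly_roots_bound[OF f0] f(2) by simp
  qed (auto simp: Z_def)
  have sub: "{P \<in> R. height P \<le> B} \<subseteq> insert At_Infinity (Affine ` (\<Union>c\<in>C. Z c))"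
  proof
    fix P assume P: "P \<in> {P \<in> R. height P \<le> B}"
    show "P \<in> insert At_Infinity (Affine ` (\<Union>c\<in>C. Z c))"
    proof (cases P)
      case (Affine x)
      have "x \<in> Qbar" using P R Affine by (auto simp: P1_deg_def P1_def)
      then obtain f where f: "minpoly_int f x" using minpoly_int_exists by (auto simp: Qbar_def)
      have d: "degree f \<le> d" using Affine_P1_deg_iff[OF f] P R Affine by auto
      have h0: "height (Affine x) \<ge> 0"
        unfolding height_Affine[OF f] using mahler_measure_ge_0[of f] degree_minpoly_int_pos[OF f] by simp
      have "mahler_measure f \<le> B ^ degree f" unfolding mahler_measure_height[OF f]
        using P Affine h0 by (intro power_mono) auto
      also have "\<dots> \<le> B ^ d" using B d by (intro power_increasing)
      finally have M: "mahler_measure f \<le> B ^ d" .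
      have "real_of_int \<bar>coeff f i\<bar> \<le> 2 ^ d * B ^ d" for i
        using order_trans[OF coeff_le_mahler_measure[OF minpoly_int_nonzero[OF f] d, of i] mult_left_mono[OF M]] by simp
      then have "coeff_vector d f \<in> C" using C(2)[OF _ f] P Affine by blast
      moreover have "x \<in> Z (coeff_vector d f)"
        using Zeq[OF minpoly_int_nonzero[OF f] d] minpoly_int_root[OF f] by simp
      ultimately show ?thesis using Affine by blast
    qed simp
  qed
  have finU: "finite (\<Union>c\<in>C. Z c)" using C(1) Z by blast
  show "finite {P \<in> R. height P \<le> B}" using sub finU by (auto intro: finite_subset)
  have "card {P \<in> R. height P \<le> B} \<le> card (insert At_Infinity (Affine ` (\<Union>c\<in>C. Z c)))"
    using sub finU by (intro card_mono) auto
  also have "\<dots> \<le> 1 + card (Affine ` (\<Union>c\<in>C. Z c))" using finU by (simp add: card_insert_if)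
  also have "\<dots> \<le> 1 + card (\<Union>c\<in>C. Z c)" using card_image_le[OF finU, of Affine] by simp
  also have "card (\<Union>c\<in>C. Z c) \<le> (\<Sum>c\<in>C. card (Z c))" using card_UN_le[OF C(1)] .
  also have "\<dots> \<le> (\<Sum>c\<in>C. d)" by (intro sum_mono) (use Z in blast)
  finally show "card {P \<in> R. height P \<le> B} \<le> 1 + d * card C" by (simp add: mult.commute)
qed

section \<open>Eisenstein polynomials at 2 and the lower bound for the number of all points\<close>

lemma eisenstein_at_2_factor:
  fixes g h :: "int poly"
  assumes odd: "odd (coeff (g * h) d)" and even: "\<And>k. k < d \<Longrightarrow> even (coeff (g * h) k)"
    and h: "odd (coeff h 0)" and deg: "degree (g * h) = d"
  shows "degree h = 0"
proof -
  have nz: "g * h \<noteq> 0" using odd by auto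
  have g0: "g \<noteq> 0" "h \<noteq> 0" using nz by auto
  have "lead_coeff (g * h) = lead_coeff g * lead_coeff h" by (rule lead_coeff_mult)
  then have ex: "odd (coeff g (degree g))" using odd deg by (metis even_mult_iff)
  \<comment> \<open>The lowest odd coefficient of \<open>g\<close>. Since \<open>h\<close> has odd
    constant coefficient, the coefficient of \<open>g * h\<close> at the same place is odd, which
    forces it to be the leading one.\<close>
  define k where "k = (LEAST k. odd (coeff g k))"
  have k: "odd (coeff g k)" unfolding k_def by (rule LeastI[of "\<lambda>k. odd (coeff g k)"]) (rule ex)
  have least: "even (coeff g i)" if "i < k" for i using not_less_Least that unfolding k_def by blast
  have "coeff (g * h) k = (\<Sum>i\<le>k. coeff g i * coeff h (k - i))" by (rule coeff_mult)
  also have "\<dots> = (\<Sum>i<k. coeff g i * coeff h (k - i)) + coeff g k * coeff h 0"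
    by (simp add: lessThan_Suc_atMost[symmetric])
  finally have "odd (coeff (g * h) k)" using k h least by (auto intro!: dvd_sum)
  then have "\<not> k < d" using even by blast
  moreover have "k \<le> degree g" using k by (intro le_degree) auto
  moreover have "degree g + degree h = d" using deg g0 by (simp add: degree_mult_eq)
  ultimately show ?thesis by simp
qed

lemma eisenstein_at_2:
  fixes f :: "int poly"
  assumes "odd (coeff f (degree f))" "\<And>k. k < degree f \<Longrightarrow> even (coeff f k)" "\<not> 4 dvd coeff f 0"
    "degree f > 0" "content f = 1"
  shows "irreducible f"
proof (rule irreducibleI)
  show "f \<noteq> 0" using assms by auto
  show "\<not> f dvd 1" using assms(4) by (auto simp: poly_dvd_1)
  fix g h assume f: "f = g * h"
  have unit: "k dvd 1" if "degree k = 0" "k dvd f" for k :: "int poly"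
  proof -
    from that(1) obtain c where c: "k = [:c:]" by (metis degree_eq_zeroE)
    then have "c dvd content f" using that(2) by (simp add: const_poly_dvd_iff_dvd_content)
    then show ?thesis using c assms(5) by (simp add: is_unit_const_poly_iff)
  qed
  have "coeff f 0 = coeff g 0 * coeff h 0" by (simp add: f coeff_mult)
  then have "\<not> (2 * 2) dvd coeff g 0 * coeff h 0" using assms(3) by simp
  have "odd (coeff h 0) \<or> odd (coeff g 0)"
  proof (rule ccontr)
    assume "\<not> (odd (coeff h 0) \<or> odd (coeff g 0))"
    then have "even (coeff g 0)" "even (coeff h 0)" by simp_all
    from mult_dvd_mono[OF this] show False using \<open>\<not> (2 * 2) dvd coeff g 0 * coeff h 0\<close> by contradiction
  qed
  then show "g dvd 1 \<or> h dvd 1"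
  proof (rule disjE)
    assume h0: "odd (coeff h 0)"
    have "degree h = 0"
      by (rule eisenstein_at_2_factor[OF assms(1)[unfolded f] _ h0 refl]) (rule assms(2)[unfolded f])
    then have "h dvd 1" by (rule unit) (unfold f, rule dvd_triv_right)
    then show ?thesis by (rule disjI2)
  next
    assume g0: "odd (coeff g 0)"
    have f': "f = h * g" using f by (simp only: mult.commute)
    have "degree g = 0"
      by (rule eisenstein_at_2_factor[OF assms(1)[unfolded f'] _ g0 refl]) (rule assms(2)[unfolded f'])
    then have "g dvd 1" by (rule unit) (unfold f, rule dvd_triv_left)
    then show ?thesis by (rule disjI1)
  qed
qed

text \<open>Comparison with the telescoping series of \<open>1 / ((n + 1) * (n + 2))\<close>. The
  constant \<open>17 / 18\<close> is \<open>4 / 9 + 1 / 2\<close>, which makes the case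
  \<open>n = 1\<close> an equality; what matters later is that it is below 1.\<close>

lemma sum_odd_squares: "n \<ge> 1 \<Longrightarrow> (\<Sum>k\<in>{1..n}. 4 / (2 * real k + 1)\<^sup>2) \<le> 17 / 18 - 1 / (real n + 1)"
proof (induction n rule: nat_induct_at_least)
  case base
  show ?case by (simp add: power2_eq_square)
next
  case (Suc n)
  have "(2 * real (Suc n) + 1)\<^sup>2 \<ge> 4 * ((real n + 1) * (real n + 2))"
    by (simp add: power2_eq_square algebra_simps)
  then have "4 / (2 * real (Suc n) + 1)\<^sup>2 \<le> 4 / (4 * ((real n + 1) * (real n + 2)))"
    by (intro divide_left_mono) auto
  also have "\<dots> = 1 / ((real n + 1) * (real n + 2))" by simp
  also have "\<dots> = 1 / (real n + 1) - 1 / (real (Suc n) + 1)"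
    by (simp add: diff_frac_eq)
  finally show ?case using Suc by simp
qed

text \<open>A pair that is not coprime has an odd common divisor \<open>2 * k + 1 \<ge> 3\<close>.
  At most \<open>2 * N / (2 * k + 1)\<close> of the \<open>N\<close> odd numbers are multiples of
  it, and summing the squares leaves at least one pair in 18.\<close>

lemma coprime_odd_pairs:
  assumes N: "N \<ge> 1"
  defines "X \<equiv> {(i, j) \<in> {..<N} \<times> {..<N}. gcd (2 * i + 1) (2 * j + 1) = (1 :: nat)}"
  shows "real N ^ 2 \<le> 18 * real (card X)"
proof -
  let ?all = "{..<N} \<times> {..<N}"
  define I where "I k = {i. i < N \<and> (2 * k + 1) dvd (2 * i + 1)}" for k :: nat
  have cI: "real (card (I k)) \<le> 2 * real N / (2 * real k + 1)" for k
  proof -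
    have "card (I k) \<le> card {1..2 * N div (2 * k + 1)}"
    proof (rule card_inj_on_le[where f = "\<lambda>i. (2 * i + 1) div (2 * k + 1)"])
      show "inj_on (\<lambda>i. (2 * i + 1) div (2 * k + 1)) (I k)"
      proof (rule inj_onI)
        fix i j assume "i \<in> I k" "j \<in> I k" "(2 * i + 1) div (2 * k + 1) = (2 * j + 1) div (2 * k + 1)"
        then have "2 * i + 1 = 2 * j + 1" unfolding I_def by (metis (no_types, lifting) dvd_div_mult_self mem_Collect_eq)
        then show "i = j" by simp
      qed
      show "(\<lambda>i. (2 * i + 1) div (2 * k + 1)) ` I k \<subseteq> {1..2 * N div (2 * k + 1)}"
      proof
        fix y assume "y \<in> (\<lambda>i. (2 * i + 1) div (2 * k + 1)) ` I k"
        then obtain i where i: "i < N" "(2 * k + 1) dvd (2 * i + 1)" "y = (2 * i + 1) div (2 * k + 1)" by (auto simp: I_def)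
        have "y \<noteq> 0" using i(2,3) by (auto simp: dvd_div_eq_0_iff)
        moreover have "y \<le> 2 * N div (2 * k + 1)" unfolding i(3) using i(1) by (intro div_le_mono) simp
        ultimately show "y \<in> {1..2 * N div (2 * k + 1)}" by simp
      qed
    qed simp
    then have "real (card (I k)) \<le> real (2 * N div (2 * k + 1))" by simp
    also have "\<dots> \<le> real (2 * N) / real (2 * k + 1)" by (rule of_nat_div_le_of_nat)
    finally show ?thesis by (simp add: add.commute)
  qed
  have sub: "?all - X \<subseteq> (\<Union>k\<in>{1..N}. I k \<times> I k)"
  proof
    fix x assume "x \<in> ?all - X"
    then obtain i j where ij: "x = (i, j)" "i < N" "j < N" "gcd (2 * i + 1) (2 * j + 1) \<noteq> 1" by (auto simp: X_def)
    define g where "g = gcd (2 * i + 1) (2 * j + 1)"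
    have g: "g dvd 2 * i + 1" "g dvd 2 * j + 1" "g \<noteq> 1" using ij(4) by (simp_all add: g_def)
    have "odd g" using g(1) by (metis dvd_trans even_plus_one_iff even_mult_iff even_two_times_div_two dvd_triv_left odd_even_add odd_one)
    then obtain k where k: "g = 2 * k + 1" by (auto elim: oddE)
    have "g \<le> 2 * i + 1" using g(1) by (intro dvd_imp_le) auto
    then have "k \<in> {1..N}" using k g(3) ij by auto
    moreover have "x \<in> I k \<times> I k" using ij g k by (auto simp: I_def)
    ultimately show "x \<in> (\<Union>k\<in>{1..N}. I k \<times> I k)" by blast
  qed
  have finI: "finite (I k)" for k by (simp add: I_def)
  have "real (card (?all - X)) \<le> real (card (\<Union>k\<in>{1..N}. I k \<times> I k))"
    using card_mono[OF _ sub] finI by auto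
  also have "\<dots> \<le> real (\<Sum>k\<in>{1..N}. card (I k \<times> I k))" by (intro of_nat_mono card_UN_le) simp
  also have "\<dots> = (\<Sum>k\<in>{1..N}. real (card (I k)) ^ 2)" by (simp add: card_cartesian_product power2_eq_square)
  also have "\<dots> \<le> (\<Sum>k\<in>{1..N}. (2 * real N / (2 * real k + 1)) ^ 2)" by (intro sum_mono power_mono cI) auto
  also have "\<dots> = real N ^ 2 * (\<Sum>k\<in>{1..N}. 4 / (2 * real k + 1)\<^sup>2)"
    by (simp add: sum_distrib_left power_divide power_mult_distrib mult_ac)
  also have "\<dots> \<le> real N ^ 2 * (17 / 18)"
    by (intro mult_left_mono order_trans[OF sum_odd_squares[OF N]]) simp_all
  finally have 1: "real (card (?all - X)) \<le> real N ^ 2 * (17 / 18)" .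
  have "X \<subseteq> ?all" by (auto simp: X_def)
  then have "card ?all = card (?all - X) + card X"
    by (metis card_Diff_subset card_mono finite_SigmaI finite_lessThan finite_subset le_add_diff_inverse2)
  then have "real N ^ 2 = real (card (?all - X)) + real (card X)"
    by (simp add: card_cartesian_product power2_eq_square flip: of_nat_add of_nat_mult)
  then show ?thesis using 1 by simp
qed

text \<open>The leading coefficient is odd, the others are even, and the constant one is twice an
  odd number, as Eisenstein's criterion at 2 requires. Coprimality of the two odd parts makes the
  content 1, so these are minimal polynomials of their roots.\<close>

lemma eisenstein_family:
  fixes F :: "int poly"
  assumes d: "d \<ge> 1" and ij: "i < N" "j < N" "gcd (2 * i + 1) (2 * j + 1) = 1" and m: "\<And>k. k \<in> {1..<d} \<Longrightarrow> m k < N"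
    and cF: "\<And>k. coeff F k = (if k = 0 then 2 * (2 * int i + 1) else if k = d then 2 * int j + 1
      else if k < d then 2 * int (m k) else 0)"
  shows "degree F = d" "content F = 1" "lead_coeff F > 0" "irreducible F" "coeff F k \<ge> 0" "coeff F k \<le> 4 * int N"
proof -
  have c0: "coeff F 0 = 2 * (2 * int i + 1)" and cd: "coeff F d = 2 * int j + 1"
    using d unfolding cF by simp_all
  show deg: "degree F = d"
  proof (rule antisym)
    show "degree F \<le> d" by (rule degree_le) (simp add: cF)
    have "coeff F d \<noteq> 0" unfolding cd by presburger
    then show "d \<le> degree F" by (rule le_degree)
  qed
  have ev: "even (coeff F k)" if "k < d" for k
  proof (cases "k = 0")
    case False
    then have "coeff F k = 2 * int (m k)" using that unfolding cF by simp
    then show ?thesis by simp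
  qed (simp add: c0)
  have g1: "gcd (2 * (2 * int i + 1)) (2 * int j + 1) = 1"
  proof -
    have "gcd (2 * int i + 1) (2 * int j + 1) = int (gcd (2 * i + 1) (2 * j + 1))"
      using gcd_int_int_eq[of "2 * i + 1" "2 * j + 1"] by (simp add: add.commute)
    then have "Rings.coprime (2 * int i + 1) (2 * int j + 1)" using ij(3) by (simp add: coprime_iff_gcd_eq_1)
    moreover have "Rings.coprime 2 (2 * int j + 1)" by simp
    ultimately have "Rings.coprime (2 * (2 * int i + 1)) (2 * int j + 1)" by (simp only: coprime_mult_left_iff)
    then show ?thesis by (simp only: coprime_iff_gcd_eq_1)
  qed
  have "content F dvd coeff F 0" "content F dvd coeff F d" by (rule content_dvd_coeff)+
  then have "content F dvd gcd (2 * (2 * int i + 1)) (2 * int j + 1)" unfolding c0 cd by (rule gcd_greatest)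
  then have "content F dvd 1" unfolding g1 .
  then show cont: "content F = 1" using content_ge_0_int[of F] by (simp add: zdvd1_eq)
  show "lead_coeff F > 0" unfolding deg cd by simp
  show "irreducible F"
  proof (rule eisenstein_at_2)
    show "odd (coeff F (degree F))" unfolding deg cd by simp
    show "\<not> 4 dvd coeff F 0" unfolding c0 by presburger
    show "even (coeff F k)" if "k < degree F" for k using ev that unfolding deg .
    show "degree F > 0" using d unfolding deg by simp
  qed (rule cont)
  show "coeff F k \<ge> 0" unfolding cF by simp
  show "coeff F k \<le> 4 * int N"
  proof -
    consider "k = 0" | "k = d" | "k \<in> {1..<d}" | "k > d" by force
    then show ?thesis
    proof cases
      case 3
      then show ?thesis using m[OF 3] unfolding cF by simp
    qed (use ij d in \<open>auto simp: cF\<close>)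
  qed
qed

text \<open>At least \<open>N ^ 2 / 18\<close> choices of the outer coefficients and
  \<open>N ^ (d - 1)\<close> of the inner ones give distinct minimal polynomials. By Landau's
  inequality the Mahler measure is at most the Euclidean norm of the coefficients, and the
  hypothesis on \<open>N\<close> brings it below \<open>B ^ d\<close>.\<close>

lemma many_points:
  assumes d: "d \<ge> 1" and B: "B \<ge> 1" and N: "N \<ge> 1" "4 * (real d + 1) * real N \<le> B ^ d"
  shows "real N ^ Suc d \<le> 18 * real (card {P \<in> P1_deg d. height P \<le> B})"
proof -
  define X where "X = {(i, j) \<in> {..<N} \<times> {..<N}. gcd (2 * i + 1) (2 * j + 1) = (1 :: nat)}"
  define Y where "Y = ({1..<d} \<rightarrow>\<^sub>E {..<N})"
  define cf where "cf = (\<lambda>((i, j), m). \<lambda>k. if k = 0 then 2 * (2 * i + 1) else if k = d then 2 * j + 1 else 2 * m k :: nat)"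
  define F where "F t = (\<Sum>k\<le>d. monom (int (cf t k)) k)" for t
  have cF: "coeff (F t) k = (if k \<le> d then int (cf t k) else 0)" for t k
    unfolding F_def coeff_sum coeff_monom by (subst sum.delta) (simp_all only: finite_atMost atMost_iff)
  have "X \<subseteq> {..<N} \<times> {..<N}" unfolding X_def by blast
  then have "finite X" by (rule finite_subset) simp
  moreover have "finite Y" unfolding Y_def by (intro finite_PiE) simp_all
  ultimately have fin: "finite (X \<times> Y)" by (rule finite_cartesian_product)
  have props: "degree (F t) = d \<and> content (F t) = 1 \<and> lead_coeff (F t) > 0 \<and> irreducible (F t) \<and>
    (\<forall>k. coeff (F t) k \<ge> 0 \<and> coeff (F t) k \<le> 4 * int N)" if t: "t \<in> X \<times> Y" for t
  proof -
    obtain ij m where tm: "t = (ij, m)" by (cases t)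
    obtain i j where "ij = (i, j)" by (cases ij)
    then have t': "t = ((i, j), m)" using tm by simp
    have "m \<in> Y" "(i, j) \<in> X" using t unfolding t' by (rule mem_Sigma_iff[THEN iffD1, THEN conjunct2], rule mem_Sigma_iff[THEN iffD1, THEN conjunct1])
    have m: "m k < N" if "k \<in> {1..<d}" for k
      using PiE_mem[OF \<open>m \<in> Y\<close>[unfolded Y_def] that] by (simp only: lessThan_iff)
    have ij: "i < N" "j < N" "gcd (2 * i + 1) (2 * j + 1) = 1" using \<open>(i, j) \<in> X\<close> unfolding X_def
      by (simp_all only: mem_Collect_eq case_prod_conv mem_Sigma_iff lessThan_iff)
    have cf: "coeff (F t) k = (if k = 0 then 2 * (2 * int i + 1) else if k = d then 2 * int j + 1
      else if k < d then 2 * int (m k) else 0)" for k using d unfolding cF cf_def t' by simp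
    show ?thesis using eisenstein_family[OF d ij m cf] by blast
  qed
  have root: "\<exists>x. poly (map_poly of_int (F t)) x = (0 :: complex)" if t: "t \<in> X \<times> Y" for t
  proof -
    have "degree (map_poly of_int (F t) :: complex poly) \<noteq> 0" using props[OF t] d by simp
    then have "\<not> constant (poly (map_poly of_int (F t) :: complex poly))" by (simp add: constant_degree)
    then show ?thesis by (rule fundamental_theorem_of_algebra)
  qed
  \<comment> \<open>One root per polynomial is enough, and it makes injectivity immediate: a point
    determines its minimal polynomial.\<close>
  define G where "G t = Affine (SOME x. poly (map_poly of_int (F t)) x = 0)" for t
  have G: "\<exists>x. G t = Affine x \<and> minpoly_int (F t) x" if t: "t \<in> X \<times> Y" for t
  proof -
    have "poly (map_poly of_int (F t)) (SOME x. poly (map_poly of_int (F t)) x = (0 :: complex)) = 0"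
      using root[OF t] by (rule someI_ex)
    then show ?thesis using props[OF t] unfolding G_def by (intro exI conjI refl minpoly_int_if_irreducible) auto
  qed
  have inj: "inj_on G (X \<times> Y)"
  proof (rule inj_onI)
    fix s t assume st: "s \<in> X \<times> Y" "t \<in> X \<times> Y" "G s = G t"
    obtain x where x: "G s = Affine x" "minpoly_int (F s) x" using G[OF st(1)] by blast
    obtain y where y: "G t = Affine y" "minpoly_int (F t) y" using G[OF st(2)] by blast
    have "x = y" using x(1) y(1) st(3) by simp
    then have F: "F s = F t" using minpoly_int_unique[OF x(2)] y(2) by simp
    have cfe: "cf s k = cf t k" if "k \<le> d" for k
      using arg_cong[OF F, of "\<lambda>f. coeff f k"] that by (simp add: cF)
    obtain ij m where sm: "s = (ij, m)" by (cases s)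
    obtain i j where "ij = (i, j)" by (cases ij)
    moreover obtain ij' m' where tm: "t = (ij', m')" by (cases t)
    moreover obtain i' j' where "ij' = (i', j')" by (cases ij')
    ultimately have e: "s = ((i, j), m)" "t = ((i', j'), m')" using sm by simp_all
    have "i = i'" "j = j'" using cfe[of 0] cfe[of d] d by (auto simp: cf_def e)
    moreover have "m = m'"
    proof
      fix k show "m k = m' k"
      proof (cases "k \<in> {1..<d}")
        case True
        then show ?thesis using cfe[of k] by (auto simp: cf_def e)
      next
        case False
        then show ?thesis using st e by (auto simp: Y_def PiE_def extensional_def)
      qed
    qed
    ultimately show "s = t" by (simp add: e)
  qed
  have sub: "G ` (X \<times> Y) \<subseteq> {P \<in> P1_deg d. height P \<le> B}"
  proof
    fix P assume "P \<in> G ` (X \<times> Y)"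
    then obtain t where t: "t \<in> X \<times> Y" "P = G t" by blast
    obtain x where x: "P = Affine x" "minpoly_int (F t) x" using G[OF t(1)] t(2) by auto
    note p = props[OF t(1)]
    \<comment> \<open>All coefficients are at most \<open>4 * N\<close>, so the squares add up to at
      most \<open>(d + 1) * (4 * N)^2\<close>; the factor \<open>d + 1\<close> is then squared as
      well to avoid a square root in the constant.\<close>
    have "(\<Sum>a\<leftarrow>coeffs (F t). a * a) \<le> (\<Sum>a\<leftarrow>coeffs (F t). (4 * int N)\<^sup>2)"
    proof (rule sum_list_mono)
      fix a assume "a \<in> set (coeffs (F t))"
      then obtain k where "a = coeff (F t) k" by (auto simp: coeffs_def split: if_splits)
      then have "0 \<le> a" "a \<le> 4 * int N" using p by auto
      then show "a * a \<le> (4 * int N)\<^sup>2" unfolding power2_eq_square by (intro mult_mono) simp_all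
    qed
    also have "\<dots> = int (d + 1) * (4 * int N)\<^sup>2"
      using p d by (auto simp: sum_list_triv length_coeffs_degree)
    also have "\<dots> \<le> (int (d + 1) * (4 * int N))\<^sup>2" by (simp add: power2_eq_square algebra_simps)
    finally have "real_of_int (\<Sum>a\<leftarrow>coeffs (F t). a * a) \<le> real_of_int ((int (d + 1) * (4 * int N))\<^sup>2)"
      by (simp only: of_int_le_iff)
    also have "\<dots> = (4 * (real d + 1) * real N)\<^sup>2" by (simp add: mult_ac add.commute)
    finally have "sqrt (real_of_int (\<Sum>a\<leftarrow>coeffs (F t). a * a)) \<le> 4 * (real d + 1) * real N"
      by (intro real_le_lsqrt) (auto intro: order_trans[OF _ sum_list_nonneg])
    then have "mahler_measure (F t) \<le> B ^ d"
      using Landau_inequality_mahler_measure[of "F t"] N(2) by linarith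
    then have "height P \<le> root d (B ^ d)" unfolding x(1) height_Affine[OF x(2)] using p d by simp
    also have "\<dots> = B" using d B by (simp add: real_root_power_cancel)
    finally have "height P \<le> B" .
    moreover have "P \<in> P1_deg d" unfolding x(1) Affine_P1_deg_iff[OF x(2)] using p by simp
    ultimately show "P \<in> {P \<in> P1_deg d. height P \<le> B}" by blast
  qed
  have finall: "finite {P \<in> P1_deg d. height P \<le> B}"
  proof (rule points_of_bounded_height(1)[OF subset_refl B])
    let ?T = "\<lfloor>2 ^ d * B ^ d\<rfloor>"
    show "finite ({..d} \<rightarrow>\<^sub>E {- ?T..?T})" by (intro finite_PiE) auto
    fix x f assume *: "\<forall>i\<le>d. real_of_int \<bar>coeff f i\<bar> \<le> 2 ^ d * B ^ d"
    show "coeff_vector d f \<in> {..d} \<rightarrow>\<^sub>E {- ?T..?T}" unfolding coeff_vector_def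
    proof (rule restrict_PiE_iff[THEN iffD2], rule ballI)
      fix i assume "i \<in> {..d}"
      then have "\<bar>coeff f i\<bar> \<le> ?T" using * by (simp only: le_floor_iff atMost_iff)
      then show "coeff f i \<in> {- ?T..?T}" by (simp only: abs_le_iff atLeastAtMost_iff minus_le_iff)
    qed
  qed
  have "card (X \<times> Y) \<le> card {P \<in> P1_deg d. height P \<le> B}" by (rule card_inj_on_le[OF inj sub finall])
  moreover have "card (X \<times> Y) = card X * N ^ (d - 1)" by (simp add: card_cartesian_product Y_def card_PiE)
  ultimately have "card X * N ^ (d - 1) \<le> card {P \<in> P1_deg d. height P \<le> B}" by simp
  then have "real (card X * N ^ (d - 1)) \<le> real (card {P \<in> P1_deg d. height P \<le> B})" by (rule of_nat_mono)
  moreover have "real (a * b ^ k) = real a * real b ^ k" for a b k :: nat by simp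
  ultimately have le: "real (card X) * real N ^ (d - 1) \<le> real (card {P \<in> P1_deg d. height P \<le> B})"
    by (simp only:)
  have "Suc d = 2 + (d - 1)" using d by simp
  then have "real N ^ Suc d = real N ^ 2 * real N ^ (d - 1)" by (simp only: power_add)
  also have "\<dots> \<le> 18 * real (card X) * real N ^ (d - 1)"
    by (rule mult_right_mono[OF coprime_odd_pairs[OF N(1), folded X_def]]) simp
  also have "\<dots> \<le> 18 * real (card {P \<in> P1_deg d. height P \<le> B})"
    unfolding mult.assoc by (rule mult_left_mono[OF le]) simp
  finally show ?thesis .
qed

section \<open>Places of degree one\<close>

lemma finite_int_poly_values:
  fixes q :: "int poly"
  assumes "degree q > 0" "finite V"
  shows "finite {t. poly q t \<in> V}"
proof -
  have "{t. poly q t \<in> V} = (\<Union>v\<in>V. {t. poly (q - [:v:]) t = 0})" by auto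
  moreover have "finite {t. poly (q - [:v:]) t = 0}" for v
  proof (rule poly_roots_finite)
    show "q - [:v:] \<noteq> 0" using assms(1) by (metis degree_pCons_0 eq_iff_diff_eq_0 less_irrefl)
  qed
  ultimately show ?thesis using assms(2) by simp
qed

text \<open>Schur's theorem: for \<open>c = H(0)\<close> and a number \<open>M\<close> divisible by finitely many given primes, all prime
  factors of \<open>H(c * M * t) / c\<close> are new.\<close>

lemma infinitely_many_prime_divisors:
  fixes H :: "int poly"
  assumes deg: "degree H > 0"
  shows "infinite {p. prime p \<and> (\<exists>r. int p dvd poly H r)}"
proof
  let ?S = "{p. prime p \<and> (\<exists>r. int p dvd poly H r)}"
  assume fin: "finite ?S"
  obtain c K where H: "H = pCons c K" by (cases H)
  have c0: "c \<noteq> 0"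
  proof
    assume "c = 0"
    then have "poly H 0 = 0" by (simp add: H)
    then have "?S = {p. prime p}" by (metis (no_types, lifting) dvd_0_right)
    then show False using fin primes_infinite by simp
  qed
  define M where "M = (\<Prod>p\<in>?S. int p)"
  have M0: "M \<noteq> 0" unfolding M_def using fin by (auto simp: prime_gt_0_nat)
  \<comment> \<open>With \<open>H = c + X * K\<close> one has
    \<open>H(c * M * t) = c * q(t)\<close>, where \<open>q(t)\<close> is congruent to 1 modulo
    \<open>M\<close>; hence no prime of \<open>?S\<close> divides a value of
    \<open>q\<close>.\<close>
  define q where "q = [:1:] + smult M (pCons 0 (K \<circ>\<^sub>p [:0, c * M:]))"
  have val: "poly H (c * M * t) = c * poly q t" for t
    by (simp add: H q_def poly_pcompose algebra_simps)
  have K0: "K \<noteq> 0" using deg by (auto simp: H)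
  have dq: "degree q > 0"
  proof -
    have "degree (pcompose H [:0, c * M:]) = degree H" using c0 M0 by simp
    moreover have "pcompose H [:0, c * M:] = smult c q"
    proof (rule poly_eq_poly_eq_iff[THEN iffD1], rule ext)
      fix t
      have "poly [:0, c * M:] t = c * M * t" by simp
      then show "poly (H \<circ>\<^sub>p [:0, c * M:]) t = poly (smult c q) t" by (simp only: poly_pcompose val poly_smult)
    qed
    ultimately show ?thesis using deg c0 by simp
  qed
  have "finite {t. poly q t \<in> {0, 1, -1}}" by (rule finite_int_poly_values[OF dq]) simp
  then obtain t where "t \<notin> {t. poly q t \<in> {0, 1, -1}}" using infinite_UNIV_int ex_new_if_finite by blast
  then have t: "poly q t \<noteq> 0" "\<bar>poly q t\<bar> \<noteq> 1" by auto
  then have "nat \<bar>poly q t\<bar> \<noteq> 1" by linarith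
  then obtain p where p: "prime p" "p dvd nat \<bar>poly q t\<bar>" using prime_factor_nat by blast
  have pq: "int p dvd poly q t" using p(2) by (metis dvd_abs_iff int_dvd_int_iff int_nat_eq abs_ge_zero)
  then have "int p dvd poly H (c * M * t)" by (simp add: val)
  then have "p \<in> ?S" using p(1) by blast
  then have "int p dvd M" unfolding M_def using fin by (intro dvd_prodI)
  moreover have "poly q t = 1 + M * (t * poly (K \<circ>\<^sub>p [:0, c * M:]) t)" by (simp add: q_def)
  ultimately have "int p dvd 1" using pq by (metis dvd_add_left_iff dvd_mult2)
  then show False using prime_gt_1_nat[OF p(1)] by simp
qed

lemma polys_over_prod_list:
  assumes R: "subring R" and "set as \<subseteq> R"
  shows "(\<Prod>a\<leftarrow>as. [:- a, 1:]) \<in> polys_over R"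
  using assms(2)
proof (induction as)
  case Nil
  then show ?case by (simp add: polys_over_1[OF R])
next
  case (Cons a as)
  have "[:- a, 1:] \<in> polys_over R"
    using Cons.prems by (intro polys_over_pCons polys_over_0 R subring_1 subring_minus) auto
  moreover have "(\<Prod>a\<leftarrow>as. [:- a, 1:]) \<in> polys_over R" using Cons by simp
  ultimately have "[:- a, 1:] * (\<Prod>a\<leftarrow>as. [:- a, 1:]) \<in> polys_over R" by (rule polys_over_mult[OF R])
  then show ?case by (simp only: list.map prod_list.Cons)
qed

section \<open>Reduction of factorizations at a place\<close>

context padic_place
begin

text \<open>The coefficients of a monic polynomial are integral polynomial expressions in its roots.
  For factors of \<open>f\<close> over \<open>F\<close> this is Gauss's lemma at a single
  place.\<close>

lemma monic_factor_integral:
  fixes g :: "complex poly"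
  assumes "lead_coeff g = 1" and roots: "\<And>z. poly g z = 0 \<Longrightarrow> z \<in> Qbar \<and> w z \<le> 1"
  shows "g \<in> polys_over {x \<in> Qbar. w x \<le> 1}"
proof -
  let ?as = "complex_roots_complex g"
  have g: "g = (\<Prod>a\<leftarrow>?as. [:- a, 1:])" using complex_roots(1)[of g] assms(1) by simp
  have "poly g a = 0" if "a \<in> set ?as" for a
    using that by (subst g) (auto simp: poly_prod_list prod_list_zero_iff)
  then have "set ?as \<subseteq> {x \<in> Qbar. w x \<le> 1}" using roots by blast
  then show ?thesis by (subst g) (rule polys_over_prod_list[OF subring_integers])
qed

lemma sum_less_1:
  assumes "\<And>i. i \<in> A \<Longrightarrow> f i \<in> Qbar" "\<And>i. i \<in> A \<Longrightarrow> w (f i) < 1"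
  shows "w (sum f A) < 1"
  using assms
proof (induction A rule: infinite_finite_induct)
  case (insert i A)
  have "sum f A \<in> Qbar" using insert.prems by (intro subring_sum[OF Qbar_subring]) auto
  moreover have "w (sum f A) < 1" using insert by auto
  ultimately show ?case using insert.hyps insert.prems add_le[of "f i" "sum f A"] by fastforce
qed (auto simp: zero)

lemma mult_less_1: "x \<in> Qbar \<Longrightarrow> y \<in> Qbar \<Longrightarrow> w x < 1 \<Longrightarrow> w y \<le> 1 \<Longrightarrow> w (x * y) < 1"
  using le_less_trans[OF mult_left_le[OF _ nonneg[of x], of "w y"]] by (simp add: mult)

lemma add_less_1: "x \<in> Qbar \<Longrightarrow> y \<in> Qbar \<Longrightarrow> w x < 1 \<Longrightarrow> w y < 1 \<Longrightarrow> w (x + y) < 1"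
  using add_le[of x y] by simp

lemma diff_less_1: "x \<in> Qbar \<Longrightarrow> y \<in> Qbar \<Longrightarrow> w x < 1 \<Longrightarrow> w y < 1 \<Longrightarrow> w (x - y) < 1"
  using diff_le[of x y] by simp

end

context integral_generator
begin

text \<open>The inverse of \<open>H'(\<gamma>)\<close> in \<open>F\<close>, with its denominator
  \<open>N\<close> cleared, yields a relation \<open>g * H' - N = H * k\<close> between integer
  polynomials. It plays the part of the discriminant: a double root of \<open>H\<close> modulo
  \<open>p\<close> forces \<open>p\<close> to divide \<open>N\<close>.\<close>

lemma pderiv_resultant:
  obtains N where "N \<noteq> (0 :: int)" "\<And>p r. int p dvd poly H r \<Longrightarrow> int p dvd poly (pderiv H) r \<Longrightarrow> int p dvd N"
proof -
  let ?y = "poly (map_poly of_int (pderiv H)) \<gamma>"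
  have y0: "?y \<noteq> 0" by (rule minpoly_int_simple_root[OF H minpoly_int_root[OF H]])
  have "?y \<in> F" using subset_adjoin adjoin_Ints_iff O_subset_F by blast
  then have "inverse ?y \<in> F" by (rule is_subfield_inverse[OF subfield_F])
  then obtain q where q: "inverse ?y = poly (map_poly of_rat q) \<gamma>" by (auto simp: adjoin_Rats_iff)
  obtain d g where dg: "rat_to_int_poly q = (d, g)" by fastforce
  note * = rat_to_int_poly[OF dg]
  have "map_poly of_rat q = smult (inverse (of_int d)) (map_poly of_int g :: complex poly)"
    by (subst *(1), rule poly_eqI) (simp add: coeff_map_poly of_rat_mult of_rat_inverse)
  then have "of_int d * inverse ?y = poly (map_poly of_int g) \<gamma>" using q *(2) by simp
  then have dy: "of_int d = poly (map_poly of_int g) \<gamma> * ?y" using y0 by (simp add: field_simps)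
  have c: "poly (map_poly of_int [:d:]) \<gamma> = of_int d" by (simp add: of_int_hom.map_poly_pCons_hom)
  have "poly (map_poly of_int (g * pderiv H - [:d:])) \<gamma> = 0"
    unfolding of_int_poly_hom.hom_minus of_int_poly_hom.hom_mult poly_diff poly_mult c dy by simp
  then have "H dvd g * pderiv H - [:d:]" using minpoly_int_dvd_iff[OF H] by blast
  then obtain k where k: "g * pderiv H - [:d:] = H * k" by (rule dvdE)
  have "int p dvd d" if "int p dvd poly H r" "int p dvd poly (pderiv H) r" for p r
  proof -
    have "d = poly g r * poly (pderiv H) r - poly H r * poly k r"
      using arg_cong[OF k, of "\<lambda>q. poly q r"] by simp
    then show ?thesis using that by simp
  qed
  then show thesis using that[of d] *(2) by blast
qed

end

text \<open>A simple root \<open>r\<close> of \<open>H\<close> modulo \<open>p\<close> belongs to a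
  place at which the residue field of \<open>F\<close> has just \<open>p\<close> elements,
  \<open>\<gamma>\<close> being congruent to \<open>r\<close>. Factorizations over \<open>F\<close>
  then reduce to factorizations over the prime field.\<close>

locale degree_one_place = integral_generator H \<gamma> + padic_place p w
  for H \<gamma> p w +
  fixes r :: int
  assumes root: "int p dvd poly H r" and simple: "\<not> int p dvd poly (pderiv H) r"
    and near: "w (\<gamma> - of_int r) < 1"
begin

lemma gamma_le_1: "w \<gamma> \<le> 1"
  using le_1_if_lead_coeff_unit[OF H] monic prime_gt_1_nat[OF prime] by simp

lemma int_poly_le_1: "w (poly (map_poly of_int q) \<gamma>) \<le> 1"
  by (rule poly_int_le_1[OF gamma_Qbar gamma_le_1])

lemma int_poly_near: "w (poly (map_poly of_int q) \<gamma> - of_int (poly q r)) < 1"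
proof -
  have "map_poly of_int q \<in> polys_over {x \<in> Qbar. w x \<le> 1}"
    by (rule polys_over_int[OF subring_integers])
  from poly_close[OF this gamma_Qbar QbarI_int gamma_le_1 of_int_le_1 near]
  show ?thesis by simp
qed

lemma int_poly_less_1_iff: "w (poly (map_poly of_int q) \<gamma>) < 1 \<longleftrightarrow> int p dvd poly q r"
proof -
  let ?x = "poly (map_poly of_int q) \<gamma>" and ?k = "of_int (poly q r) :: complex"
  have Q: "?x \<in> Qbar" by (rule poly_int_Qbar[OF gamma_Qbar])
  have "w ?x < 1 \<longleftrightarrow> w ?k < 1"
    using add_less_1[OF Qbar_diff[OF Q QbarI_int] QbarI_int int_poly_near, of "poly q r"]
      diff_less_1[OF Q Qbar_diff[OF Q QbarI_int] _ int_poly_near] by auto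
  then show ?thesis by (simp only: of_int_less_1_iff)
qed

text \<open>The local ring of \<open>Og\<close> at the ideal generated by \<open>p\<close> and
  \<open>\<gamma> - r\<close>: the value of \<open>Q\<close> at \<open>\<gamma>\<close> lies outside
  this ideal exactly when \<open>p\<close> does not divide \<open>Q(r)\<close>.\<close>

definition localization :: "complex set" where
  "localization = {poly (map_poly of_int P) \<gamma> / poly (map_poly of_int Q) \<gamma> | P Q. \<not> int p dvd poly Q r}"

lemma denominator_unit:
  assumes "\<not> int p dvd poly Q r"
  shows "w (poly (map_poly of_int Q) \<gamma>) = 1" "poly (map_poly of_int Q) \<gamma> \<noteq> 0"
  using int_poly_less_1_iff[of Q] int_poly_le_1[of Q] assms zero by auto

lemma localization_divide:
  assumes "x \<in> localization" "\<not> int p dvd poly Q r"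
  shows "x / poly (map_poly of_int Q) \<gamma> \<in> localization"
proof -
  obtain P R where x: "x = poly (map_poly of_int P) \<gamma> / poly (map_poly of_int R) \<gamma>" "\<not> int p dvd poly R r"
    using assms(1) by (auto simp: localization_def)
  have "x / poly (map_poly of_int Q) \<gamma> = poly (map_poly of_int P) \<gamma> / poly (map_poly of_int (R * Q)) \<gamma>"
    by (simp add: x(1) hom_distribs)
  moreover have "\<not> int p dvd poly (R * Q) r"
    using x(2) assms(2) prime by (simp add: prime_dvd_mult_iff)
  ultimately show ?thesis unfolding localization_def by blast
qed

text \<open>Since \<open>r\<close> is a simple root of \<open>H\<close> modulo \<open>p\<close>, the localization is a discrete valuation ring with
  uniformizer \<open>p\<close>: from \<open>(\<gamma> - r) * H1(\<gamma>) = - H(r)\<close> one sees that \<open>p\<close> divides \<open>\<gamma> - r\<close>.\<close>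

lemma int_poly_divisible:
  assumes "int p dvd poly P r"
  obtains P' Q where "poly (map_poly of_int P) \<gamma> / of_nat p = poly (map_poly of_int P') \<gamma> / poly (map_poly of_int Q) \<gamma>"
    "\<not> int p dvd poly Q r"
proof -
  have expand: "\<exists>q1. q = [:poly q r:] + [:- r, 1:] * q1" for q :: "int poly"
  proof -
    have "poly (q - [:poly q r:]) r = 0" by simp
    then have "[:- r, 1:] dvd q - [:poly q r:]" by (simp only: poly_eq_0_iff_dvd)
    then obtain k where "q - [:poly q r:] = [:- r, 1:] * k" by (rule dvdE)
    then show ?thesis by (metis add.commute diff_add_cancel)
  qed
  obtain H1 where H1: "H = [:poly H r:] + [:- r, 1:] * H1" using expand by blast
  obtain P1 where P1: "P = [:poly P r:] + [:- r, 1:] * P1" using expand by blast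
  obtain h where h: "poly H r = int p * h" using root by (rule dvdE)
  obtain k where k: "poly P r = int p * k" using assms by (rule dvdE)
  have "poly (pderiv H) r = poly H1 r"
    using arg_cong[OF H1, of "\<lambda>q. poly (pderiv q) r"]
    by (simp only: pderiv_add pderiv_mult poly_add poly_mult) (simp add: pderiv_pCons)
  then have u: "\<not> int p dvd poly H1 r" using simple by simp
  let ?e = "\<lambda>q. poly (map_poly of_int q) \<gamma> :: complex"
  have eH: "of_int (int p * h) + (\<gamma> - of_int r) * ?e H1 = 0"
    using arg_cong[OF H1, of ?e] minpoly_int_root[OF H] by (simp add: hom_distribs h algebra_simps)
  have eP: "?e P = of_int (int p * k) + (\<gamma> - of_int r) * ?e P1"
    using arg_cong[OF P1, of ?e] by (simp add: hom_distribs k algebra_simps)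
  have H10: "?e H1 \<noteq> 0" using denominator_unit[OF u] by blast
  have p0: "of_nat p \<noteq> (0 :: complex)" using prime_gt_0_nat[OF prime] by simp
  have "?e P * ?e H1 = of_int (int p * k) * ?e H1 + ((\<gamma> - of_int r) * ?e H1) * ?e P1"
    by (simp add: eP algebra_simps)
  also have "(\<gamma> - of_int r) * ?e H1 = - of_int (int p * h)" using eH by (simp add: eq_neg_iff_add_eq_0 add.commute)
  finally have "?e P * ?e H1 = of_nat p * ?e (smult k H1 - smult h P1)"
    by (simp add: hom_distribs algebra_simps)
  then have "?e P / of_nat p = ?e (smult k H1 - smult h P1) / ?e H1"
    using H10 p0 by (simp add: field_simps)
  then show thesis using that u by blast
qed

text \<open>One factor \<open>p\<close> is cancelled at a time: size at most 1 of the quotient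
  forces \<open>p\<close> to divide \<open>P(r)\<close>, and dividing by \<open>p\<close> costs only
  a denominator that is a unit at \<open>w\<close>.\<close>

lemma int_poly_over_power:
  "w (poly (map_poly of_int P) \<gamma> / of_nat p ^ j) \<le> 1 \<Longrightarrow> poly (map_poly of_int P) \<gamma> / of_nat p ^ j \<in> localization"
proof (induction j arbitrary: P)
  case 0
  have "\<not> int p dvd poly [:1:] r" using prime_gt_1_nat[OF prime] by simp
  moreover have "poly (map_poly of_int P) \<gamma> / of_nat p ^ 0 = poly (map_poly of_int P) \<gamma> / poly (map_poly of_int [:1:]) \<gamma>"
    by (simp add: hom_distribs)
  ultimately show ?case unfolding localization_def by blast
next
  case (Suc j)
  let ?x = "poly (map_poly of_int P) \<gamma>"
  have xQ: "?x \<in> Qbar" by (rule poly_int_Qbar[OF gamma_Qbar])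
  have pQ: "of_nat p \<in> Qbar" using QbarI_int[of "int p"] by simp
  have p0: "of_nat p \<noteq> (0 :: complex)" using prime_gt_0_nat[OF prime] by simp
  have wp: "w (of_nat p) < 1" using of_int_less_1_iff[of "int p"] by simp
  have "?x = (?x / of_nat p ^ Suc j) * of_nat p ^ Suc j" using p0 by simp
  then have "w ?x = w (?x / of_nat p ^ Suc j) * w (of_nat p) ^ Suc j"
    using mult[OF Qbar_divide[OF xQ Qbar_power[OF pQ]] Qbar_power[OF pQ]] power[OF pQ] by metis
  also have "\<dots> \<le> 1 * w (of_nat p) ^ Suc j" using Suc.prems nonneg[OF pQ] by (intro mult_right_mono) auto
  also have "\<dots> < 1" unfolding mult_1_left by (rule power_Suc_less_one[OF pos[OF pQ p0] wp])
  finally have "int p dvd poly P r" using int_poly_less_1_iff by blast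
  then obtain P' Q where PQ: "?x / of_nat p = poly (map_poly of_int P') \<gamma> / poly (map_poly of_int Q) \<gamma>"
    "\<not> int p dvd poly Q r" by (rule int_poly_divisible)
  let ?x' = "poly (map_poly of_int P') \<gamma>" and ?y = "poly (map_poly of_int Q) \<gamma>"
  note y = denominator_unit[OF PQ(2)]
  have yQ: "?y \<in> Qbar" "?x' \<in> Qbar" by (rule poly_int_Qbar[OF gamma_Qbar])+
  have eq: "?x / of_nat p ^ Suc j = (?x' / of_nat p ^ j) / ?y"
  proof -
    have "?x / of_nat p ^ Suc j = (?x / of_nat p) / of_nat p ^ j" by simp
    then show ?thesis unfolding PQ(1) by simp
  qed
  have "w (?x' / of_nat p ^ j) = w (?x / of_nat p ^ Suc j)"
    unfolding eq using y divide[OF Qbar_divide[OF yQ(2) Qbar_power[OF pQ]] yQ(1)] by simp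
  then have "?x' / of_nat p ^ j \<in> localization" using Suc.IH Suc.prems by simp
  then show ?case unfolding eq by (rule localization_divide[OF _ PQ(2)])
qed

text \<open>Write \<open>x\<close> with an integer denominator and separate the
  \<open>p\<close>-part of it, which places \<open>x\<close> in the localization. A fraction
  \<open>P(\<gamma>) / Q(\<gamma>)\<close> is then congruent to \<open>P(r) / Q(r)\<close>, and
  \<open>Q(r)\<close> is invertible modulo \<open>p\<close>.\<close>

lemma residue_field:
  assumes x: "x \<in> F" "w x \<le> 1"
  obtains k where "w (x - of_int k) < 1"
proof -
  obtain q where q: "x = poly (map_poly of_rat q) \<gamma>" using x(1) by (auto simp: adjoin_Rats_iff)
  obtain d g where dg: "rat_to_int_poly q = (d, g)" by fastforce
  note * = rat_to_int_poly[OF dg]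
  have "map_poly of_rat q = smult (inverse (of_int d)) (map_poly of_int g :: complex poly)"
    by (subst *(1), rule poly_eqI) (simp add: coeff_map_poly of_rat_mult of_rat_inverse)
  then have x1: "x = poly (map_poly of_int g) \<gamma> / of_int d" using q by (simp add: field_simps)
  obtain e where e: "d = int p ^ multiplicity (int p) d * e" "\<not> int p dvd e"
  proof (rule multiplicity_decompose'[of d "int p"])
    show "d \<noteq> 0" "\<not> is_unit (int p)" using *(2) prime_gt_1_nat[OF prime] by auto
  qed
  let ?j = "multiplicity (int p) d"
  let ?z = "poly (map_poly of_int g) \<gamma> / of_nat p ^ ?j"
  have x2: "x = ?z / poly (map_poly of_int [:e:]) \<gamma>"
  proof -
    have "of_int d = of_nat p ^ ?j * (of_int e :: complex)" by (subst e(1)) simp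
    then show ?thesis unfolding x1 by (simp add: hom_distribs)
  qed
  have e': "\<not> int p dvd poly [:e:] r" using e(2) by simp
  have pQ: "of_nat p \<in> Qbar" using QbarI_int[of "int p"] by simp
  have zQ: "?z \<in> Qbar" by (intro Qbar_divide Qbar_power pQ poly_int_Qbar[OF gamma_Qbar])
  have "w x = w ?z" unfolding x2
    using divide[OF zQ poly_int_Qbar[OF gamma_Qbar]] denominator_unit[OF e'] by simp
  then have "?z \<in> localization" using int_poly_over_power x(2) by simp
  then have "x \<in> localization" unfolding x2 by (rule localization_divide[OF _ e'])
  then obtain P Q where PQ: "x = poly (map_poly of_int P) \<gamma> / poly (map_poly of_int Q) \<gamma>" "\<not> int p dvd poly Q r"
    unfolding localization_def by blast
  note y = denominator_unit[OF PQ(2)]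
  have "Rings.coprime (int p) (poly Q r)" using PQ(2) prime by (intro prime_imp_coprime) auto
  then obtain a b where ab: "a * int p + b * poly Q r = 1"
    using bezout_int[of "int p" "poly Q r"] by (auto simp: coprime_iff_gcd_eq_1)
  define k where "k = b * poly P r"
  have "poly (P - smult k Q) r = a * int p * poly P r"
  proof -
    have "poly (P - smult k Q) r = poly P r * (1 - b * poly Q r)" by (simp add: k_def algebra_simps)
    also have "1 - b * poly Q r = a * int p" using ab by simp
    finally show ?thesis by simp
  qed
  then have "int p dvd poly (P - smult k Q) r" by simp
  then have less: "w (poly (map_poly of_int (P - smult k Q)) \<gamma>) < 1" using int_poly_less_1_iff by blast
  have "x - of_int k = poly (map_poly of_int (P - smult k Q)) \<gamma> / poly (map_poly of_int Q) \<gamma>"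
    using y(2) by (simp add: PQ(1) hom_distribs field_simps)
  then have "w (x - of_int k) < 1"
    using less y(1) divide[OF poly_int_Qbar[OF gamma_Qbar] poly_int_Qbar[OF gamma_Qbar]] by simp
  then show thesis by (rule that)
qed

lemma monic_poly_near:
  assumes g: "g \<in> polys_over F" "g \<in> polys_over {x \<in> Qbar. w x \<le> 1}" "lead_coeff g = 1"
  obtains G :: "int poly" where "lead_coeff G = 1" "degree G = degree g" "\<And>i. w (coeff g i - of_int (coeff G i)) < 1"
proof -
  have "\<exists>k. w (coeff g i - of_int k) < 1" for i
    using residue_field[of "coeff g i"] g(1,2) unfolding polys_over_def by blast
  then obtain k where k: "\<And>i. w (coeff g i - of_int (k i)) < 1" by metis
  define G where "G = monom 1 (degree g) + (\<Sum>i<degree g. monom (k i) i)"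
  have cG: "coeff G i = (if i = degree g then 1 else if i < degree g then k i else 0)" for i
    by (simp add: G_def coeff_sum)
  have "degree G \<le> degree g" by (rule degree_le) (simp add: cG)
  moreover have "degree G \<ge> degree g" by (rule le_degree) (simp add: cG)
  ultimately have dG: "degree G = degree g" by simp
  show thesis
  proof (rule that[of G])
    show "w (coeff g i - of_int (coeff G i)) < 1" for i
      using k[of i] g(3) zero by (cases "i = degree g"; cases "i < degree g") (auto simp: cG coeff_eq_0)
  qed (simp_all add: dG cG)
qed

text \<open>Failure of genericity is a factorization of \<open>f\<close> over \<open>F\<close> into
  its leading coefficient and two non-constant monic factors. If \<open>p\<close> does not divide
  that coefficient, the roots of \<open>f\<close> are integral at \<open>w\<close>, hence so are the
  factors; replacing their coefficients by congruent integers gives a factorization modulo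
  \<open>p\<close>.\<close>

lemma splits_if_not_generic:
  assumes f: "minpoly_int f \<alpha>" and ng: "\<not> generic f \<alpha>"
  shows "splits_mod p (degree f) (restrict (\<lambda>i. coeff f i mod int p) {..degree f})"
proof (cases "int p dvd lead_coeff f")
  case True
  then show ?thesis by (simp add: splits_mod_def dvd_mod)
next
  case False
  note FR = is_subfield_subring[OF subfield_F]
  let ?f = "map_poly of_int f :: complex poly" and ?l = "of_int (lead_coeff f) :: complex"
  have f0: "?f \<noteq> 0" using minpoly_int_nonzero[OF f] by simp
  have fF: "?f \<in> polys_over F" by (rule polys_over_int[OF FR])
  obtain E0 where E0: "E0 \<in> polys_over F" "poly E0 \<alpha> = 0" "E0 \<noteq> 0" "degree E0 < degree f"
    using ng unfolding generic_def by (auto simp: not_le)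
  \<comment> \<open>\<open>E\<close> is, up to a constant, the minimal polynomial of
    \<open>\<alpha>\<close> over \<open>F\<close>; minimality of its degree makes it a divisor of
    \<open>f\<close>.\<close>
  then obtain E where E: "E \<in> polys_over F" "poly E \<alpha> = 0" "E \<noteq> 0"
    and min: "\<And>E'. E' \<in> polys_over F \<Longrightarrow> poly E' \<alpha> = 0 \<Longrightarrow> E' \<noteq> 0 \<Longrightarrow> degree E \<le> degree E'"
    using ex_has_least_nat[of "\<lambda>E. E \<in> polys_over F \<and> poly E \<alpha> = 0 \<and> E \<noteq> 0" E0 degree] by blast
  have dE: "degree E < degree f" using min[OF E0(1-3)] E0(4) by simp
  define g where "g = smult (inverse (lead_coeff E)) E"
  have gF: "g \<in> polys_over F" unfolding g_def
    by (intro polys_over_smult FR is_subfield_inverse[OF subfield_F] E) (use E(1) in \<open>simp add: polys_over_def\<close>)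
  have g1: "lead_coeff g = 1" and dg: "degree g = degree E" and g\<alpha>: "poly g \<alpha> = 0" using E by (simp_all add: g_def)
  have g0: "g \<noteq> 0" using g1 by auto
  obtain q r' where qr: "q \<in> polys_over F" "r' \<in> polys_over F" "?f = q * g + r'" "r' = 0 \<or> degree r' < degree g"
    using polys_over_division[OF subfield_F gF g0 fF] by blast
  have "poly r' \<alpha> = 0"
    using arg_cong[OF qr(3), of "\<lambda>p. poly p \<alpha>"] minpoly_int_root[OF f] g\<alpha> by simp
  then have "r' = 0" using min[OF qr(2)] qr(4) dg by (metis not_le)
  then have fqg: "?f = q * g" using qr(3) by simp
  have q0: "q \<noteq> 0" using fqg f0 by auto
  have lq: "lead_coeff q = ?l" using arg_cong[OF fqg, of lead_coeff] g1 by (simp add: lead_coeff_mult)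
  define h where "h = smult (inverse ?l) q"
  have l0: "?l \<noteq> 0" using minpoly_int_nonzero[OF f] by simp
  have hF: "h \<in> polys_over F" unfolding h_def
    by (intro polys_over_smult FR is_subfield_inverse[OF subfield_F] subring_of_int qr)
  have h1: "lead_coeff h = 1" using lq l0 by (simp add: h_def)
  have fgh: "?f = smult ?l (g * h)" using fqg l0 by (simp add: h_def mult.commute)
  have deg: "degree g + degree h = degree f"
    using arg_cong[OF fqg, of degree] q0 g0 l0 by (simp add: degree_mult_eq h_def add.commute)
  have dg1: "degree g \<ge> 1"
  proof (rule ccontr)
    assume "\<not> degree g \<ge> 1"
    then obtain c where c: "g = [:c:]" by (metis degree_eq_zeroE less_one not_le)
    then show False using g1 g\<alpha> by simp
  qed
  have dh1: "degree h \<ge> 1" using deg dE dg by simp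
  have rootf: "z \<in> Qbar \<and> w z \<le> 1" if "poly ?f z = 0" for z
    using minpoly_int_Qbar le_1_if_lead_coeff_unit[OF _ False] minpoly_int_conjugate[OF f that] by blast
  have gI: "g \<in> polys_over {x \<in> Qbar. w x \<le> 1}"
    by (rule monic_factor_integral[OF g1]) (simp add: rootf fgh)
  have hI: "h \<in> polys_over {x \<in> Qbar. w x \<le> 1}"
    by (rule monic_factor_integral[OF h1]) (simp add: rootf fgh)
  obtain G where G: "lead_coeff G = 1" "degree G = degree g" "\<And>i. w (coeff g i - of_int (coeff G i)) < 1"
    using monic_poly_near[OF gF gI g1] by blast
  obtain K where K: "lead_coeff K = 1" "degree K = degree h" "\<And>i. w (coeff h i - of_int (coeff K i)) < 1"
    using monic_poly_near[OF hF hI h1] by blast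
  have cQ: "coeff g i \<in> Qbar" "coeff h i \<in> Qbar" "w (coeff g i) \<le> 1" "w (coeff h i) \<le> 1" for i
    using gI hI by (auto simp: polys_over_def)
  have dvd: "int p dvd coeff f i - lead_coeff f * coeff (G * K) i" for i
  proof -
    let ?t = "\<lambda>j. coeff g j * coeff h (i - j) - of_int (coeff G j) * of_int (coeff K (i - j))"
    have tj: "?t j \<in> Qbar \<and> w (?t j) < 1" for j
    proof -
      have eq: "?t j = (coeff g j - of_int (coeff G j)) * coeff h (i - j)
          + of_int (coeff G j) * (coeff h (i - j) - of_int (coeff K (i - j)))" by (simp add: algebra_simps)
      have a: "w ((coeff g j - of_int (coeff G j)) * coeff h (i - j)) < 1"
        by (intro mult_less_1 Qbar_diff cQ QbarI_int G)
      have b: "w ((coeff h (i - j) - of_int (coeff K (i - j))) * of_int (coeff G j)) < 1"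
        by (intro mult_less_1 Qbar_diff cQ QbarI_int K of_int_le_1)
      have "?t j \<in> Qbar" by (intro Qbar_diff Qbar_mult cQ QbarI_int)
      moreover have "w (?t j) < 1" unfolding eq
        by (intro add_less_1 a b[unfolded mult.commute[of _ "of_int (coeff G j)"]] Qbar_mult Qbar_diff cQ QbarI_int)
      ultimately show ?thesis by blast
    qed
    have s: "w (\<Sum>j\<le>i. ?t j) < 1" "(\<Sum>j\<le>i. ?t j) \<in> Qbar"
      using tj by (auto intro!: sum_less_1 subring_sum[OF Qbar_subring])
    have "of_int (coeff f i - lead_coeff f * coeff (G * K) i) = (\<Sum>j\<le>i. ?t j) * ?l"
    proof -
      have "of_int (coeff f i) = coeff ?f i" by (simp add: coeff_map_poly)
      also have "\<dots> = ?l * (\<Sum>j\<le>i. coeff g j * coeff h (i - j))" by (subst fgh) (simp add: coeff_mult)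
      finally show ?thesis by (simp add: coeff_mult sum_subtractf algebra_simps)
    qed
    then have "w (of_int (coeff f i - lead_coeff f * coeff (G * K) i)) < 1"
      using mult_less_1[OF s(2) QbarI_int s(1) of_int_le_1, of "lead_coeff f"] by (simp only:)
    then show ?thesis by (simp only: of_int_less_1_iff)
  qed
  \<comment> \<open>The sieve counts residue vectors, so the congruence is restated for the reduced
    coefficients.\<close>
  have "int p dvd coeff f i mod int p - (lead_coeff f mod int p) * coeff (G * K) i" for i
  proof -
    have "(coeff f i mod int p - (lead_coeff f mod int p) * coeff (G * K) i) mod int p
      = (coeff f i - lead_coeff f * coeff (G * K) i) mod int p"
      by (intro mod_diff_cong mod_mult_cong mod_mod_trivial refl)
    then show ?thesis using dvd[of i] by (simp only: dvd_eq_mod_eq_0)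
  qed
  then show ?thesis unfolding splits_mod_def
    by (intro disjI2 exI[of _ G] exI[of _ K]) (use G K dg1 dh1 deg in auto)
qed

end

section \<open>Sets of coefficient vectors of density zero\<close>

text \<open>\<open>real T ^ Suc d\<close> is the size of the box up to a bounded factor, so this is
  vanishing proportion in boxes.\<close>

definition density_zero :: "nat \<Rightarrow> (nat \<Rightarrow> int) set \<Rightarrow> bool" where
  "density_zero d W \<longleftrightarrow> (\<forall>\<epsilon>>0. \<forall>\<^sub>F T in sequentially. real (card (box d T \<inter> W)) \<le> \<epsilon> * real T ^ Suc d)"

lemma density_zero_mono:
  assumes "density_zero d W" "V \<subseteq> W"
  shows "density_zero d V"
  unfolding density_zero_def
proof (intro allI impI)
  fix \<epsilon> :: real assume "\<epsilon> > 0"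
  then have "\<forall>\<^sub>F T in sequentially. real (card (box d T \<inter> W)) \<le> \<epsilon> * real T ^ Suc d"
    using assms(1) unfolding density_zero_def by blast
  then show "\<forall>\<^sub>F T in sequentially. real (card (box d T \<inter> V)) \<le> \<epsilon> * real T ^ Suc d"
  proof (rule eventually_mono)
    fix T assume *: "real (card (box d T \<inter> W)) \<le> \<epsilon> * real T ^ Suc d"
    have "card (box d T \<inter> V) \<le> card (box d T \<inter> W)"
      using assms(2) finite_box[of d T] by (intro card_mono) auto
    then show "real (card (box d T \<inter> V)) \<le> \<epsilon> * real T ^ Suc d" using * by linarith
  qed
qed

lemma density_zero_union:
  assumes "density_zero d V" "density_zero d W"
  shows "density_zero d (V \<union> W)"
  unfolding density_zero_def
proof (intro allI impI)
  fix \<epsilon> :: real assume "\<epsilon> > 0"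
  then have "\<epsilon> / 2 > 0" by simp
  then have "\<forall>\<^sub>F T in sequentially. real (card (box d T \<inter> V)) \<le> \<epsilon> / 2 * real T ^ Suc d"
    "\<forall>\<^sub>F T in sequentially. real (card (box d T \<inter> W)) \<le> \<epsilon> / 2 * real T ^ Suc d"
    using assms unfolding density_zero_def by blast+
  then show "\<forall>\<^sub>F T in sequentially. real (card (box d T \<inter> (V \<union> W))) \<le> \<epsilon> * real T ^ Suc d"
  proof (rule eventually_elim2)
    fix T assume *: "real (card (box d T \<inter> V)) \<le> \<epsilon> / 2 * real T ^ Suc d" "real (card (box d T \<inter> W)) \<le> \<epsilon> / 2 * real T ^ Suc d"
    have "card (box d T \<inter> (V \<union> W)) \<le> card (box d T \<inter> V) + card (box d T \<inter> W)"
      unfolding Int_Un_distrib by (rule card_Un_le)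
    then have "real (card (box d T \<inter> (V \<union> W))) \<le> \<epsilon> / 2 * real T ^ Suc d + \<epsilon> / 2 * real T ^ Suc d"
      using * by linarith
    then show "real (card (box d T \<inter> (V \<union> W))) \<le> \<epsilon> * real T ^ Suc d"
      by (simp only: distrib_right[symmetric] field_sum_of_halves)
  qed
qed

text \<open>The box is fibred over all coordinates except the \<open>k\<close>-th. The number of
  fibres is one power of \<open>T\<close> below the size of the box, so \<open>m\<close> may grow
  like a power of \<open>log T\<close>.\<close>

lemma card_box_fibres:
  assumes k: "k \<le> d"
    and m: "\<And>e. e \<in> ({..d} - {k}) \<rightarrow>\<^sub>E {- int T..int T} \<Longrightarrow> card {t \<in> {- int T..int T}. e(k := t) \<in> W} \<le> m"
  shows "card (box d T \<inter> W) \<le> m * (2 * T + 1) ^ d"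
proof -
  let ?I = "{- int T..int T}"
  define E where "E = (({..d} - {k}) \<rightarrow>\<^sub>E ?I)"
  define Z where "Z e = (\<lambda>t. e(k := t)) ` {t \<in> ?I. e(k := t) \<in> W}" for e :: "nat \<Rightarrow> int"
  have finE: "finite E" unfolding E_def by (intro finite_PiE) simp_all
  have cE: "card E = (2 * T + 1) ^ d"
  proof -
    have "card ?I = 2 * T + 1" by simp
    moreover have "card ({..d} - {k}) = d" using k by simp
    ultimately show ?thesis unfolding E_def by (simp only: card_PiE finite_Diff finite_atMost prod_constant)
  qed
  have finT: "finite {t \<in> ?I. e(k := t) \<in> W}" for e by (rule finite_subset[of _ ?I]) auto
  have finZ: "finite (Z e)" for e unfolding Z_def by (rule finite_imageI[OF finT])
  have cZ: "card (Z e) \<le> m" if "e \<in> E" for e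
    unfolding Z_def by (rule order_trans[OF card_image_le[OF finT] m[OF that[unfolded E_def]]])
  have sub: "box d T \<inter> W \<subseteq> (\<Union>e\<in>E. Z e)"
  proof
    fix c assume c: "c \<in> box d T \<inter> W"
    have cI: "c i \<in> ?I" if "i \<le> d" for i using c that by (auto simp: box_def PiE_def Pi_def)
    \<comment> \<open>Elements of \<open>E\<close> take the value \<open>undefined\<close> at
      \<open>k\<close>, which is outside their domain.\<close>
    have "c(k := undefined) \<in> E" unfolding E_def
    proof (rule PiE_I)
      show "(c(k := undefined)) i \<in> ?I" if "i \<in> {..d} - {k}" for i using that cI[of i] by simp
      show "(c(k := undefined)) i = undefined" if "i \<notin> {..d} - {k}" for i
        using that c by (auto simp: box_def PiE_def extensional_def)
    qed
    moreover have "c \<in> Z (c(k := undefined))" unfolding Z_def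
      by (rule image_eqI[of _ _ "c k"]) (use c cI[OF k] in auto)
    ultimately show "c \<in> (\<Union>e\<in>E. Z e)" by blast
  qed
  have "card (box d T \<inter> W) \<le> card (\<Union>e\<in>E. Z e)" using finE finZ by (intro card_mono[OF _ sub]) blast
  also have "\<dots> \<le> (\<Sum>e\<in>E. card (Z e))" by (rule card_UN_le[OF finE])
  also have "\<dots> \<le> (\<Sum>e\<in>E. m)" by (rule sum_mono) (rule cZ)
  also have "\<dots> = m * (2 * T + 1) ^ d" by (simp add: cE)
  finally show ?thesis .
qed

lemma log_power_le_linear:
  assumes "\<delta> > (0 :: real)"
  shows "\<forall>\<^sub>F T in sequentially. (ln (real T) + c) ^ s \<le> \<delta> * real T"
proof -
  have "filterlim (\<lambda>T. ln (real T)) at_top sequentially"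
    by (rule filterlim_compose[OF ln_at_top filterlim_real_sequentially])
  then have "filterlim (\<lambda>T. c + ln (real T)) at_top sequentially"
    by (rule filterlim_tendsto_add_at_top[OF tendsto_const])
  then have "filterlim (\<lambda>T. ln (real T) + c) at_top sequentially" by (simp only: add.commute)
  \<comment> \<open>The limit of \<open>x^s / exp x\<close> is used along
    \<open>x = ln T + c\<close>, where \<open>exp x\<close> is a constant times
    \<open>T\<close>.\<close>
  from filterlim_compose[OF tendsto_power_div_exp_0 this]
  have "((\<lambda>T. (ln (real T) + c) ^ s / exp (ln (real T) + c)) \<longlongrightarrow> 0) sequentially" .
  then have "\<forall>\<^sub>F T in sequentially. (ln (real T) + c) ^ s / exp (ln (real T) + c) < \<delta> / exp c"
    by (rule order_tendstoD(2)) (use assms in simp)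
  then show ?thesis using eventually_gt_at_top[of "0 :: nat"]
  proof (rule eventually_elim2)
    fix T :: nat assume *: "(ln (real T) + c) ^ s / exp (ln (real T) + c) < \<delta> / exp c" and T: "0 < T"
    have "(ln (real T) + c) ^ s < \<delta> / exp c * exp (ln (real T) + c)"
      using * by (simp only: pos_divide_less_eq exp_gt_zero)
    also have "\<dots> = \<delta> * real T" using T by (simp add: exp_add)
    finally show "(ln (real T) + c) ^ s \<le> \<delta> * real T" by simp
  qed
qed

text \<open>With \<open>k\<close> about the binary logarithm of \<open>T\<close> the bound is of
  order \<open>(log T)^s * T^d\<close>, which is negligible against \<open>T^(d+1)\<close>. Its
  shape is that of a count of \<open>S\<close>-units in each fibre.\<close>

lemma density_zero_if_log_bound:
  assumes bound: "\<And>T k. T \<ge> 1 \<Longrightarrow> k \<ge> 1 \<Longrightarrow> T < 2 ^ k \<Longrightarrow> card (box d T \<inter> W) \<le> A * (N * (M + k)) ^ s * (2 * T + 1) ^ d"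
  shows "density_zero d W"
  unfolding density_zero_def
proof (intro allI impI)
  fix \<epsilon> :: real assume \<epsilon>: "\<epsilon> > 0"
  define c where "c = real M + 1"
  define P where "P = real A * (2 * real N) ^ s * 3 ^ d"
  have P0: "P \<ge> 0" by (simp add: P_def)
  \<comment> \<open>\<open>P + 1\<close> takes the place of \<open>P\<close> because
    \<open>P\<close> can be zero.\<close>
  have "\<epsilon> / (P + 1) > 0" using \<epsilon> P0 by simp
  then have "\<forall>\<^sub>F T in sequentially. (ln (real T) + c) ^ s \<le> \<epsilon> / (P + 1) * real T" by (rule log_power_le_linear)
  then show "\<forall>\<^sub>F T in sequentially. real (card (box d T \<inter> W)) \<le> \<epsilon> * real T ^ Suc d"
    using eventually_ge_at_top[of "1 :: nat"]
  proof (rule eventually_elim2)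
    fix T :: nat assume log: "(ln (real T) + c) ^ s \<le> \<epsilon> / (P + 1) * real T" and T: "1 \<le> T"
    from ex_power_ivl1[of 2 T] T obtain k where k: "2 ^ k \<le> T" "T < 2 ^ (k + 1)" by auto
    have lT: "ln (real T) \<ge> 0" using T by simp
    have "real k * ln 2 = ln (2 ^ k)" by (simp add: ln_realpow)
    also have "\<dots> \<le> ln (real T)"
    proof -
      have "(2 :: real) ^ k \<le> real T" using of_nat_mono[OF k(1), where 'a = real] by simp
      then show ?thesis using T by simp
    qed
    finally have "real k * ln 2 \<le> ln (real T)" .
    moreover have "real k * (1 / 2) \<le> real k * ln 2" using ln2_ge_two_thirds by (intro mult_left_mono) auto
    ultimately have rk: "real k \<le> 2 * ln (real T)" by linarith
    have "real (N * (M + (k + 1))) \<le> 2 * real N * (ln (real T) + c)"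
    proof -
      have "real (M + (k + 1)) \<le> 2 * (ln (real T) + c)" using rk lT by (simp add: c_def)
      then have "real N * real (M + (k + 1)) \<le> real N * (2 * (ln (real T) + c))" by (rule mult_left_mono) simp
      then show ?thesis by (simp only: of_nat_mult mult.assoc mult.left_commute)
    qed
    then have p1: "real (N * (M + (k + 1))) ^ s \<le> (2 * real N * (ln (real T) + c)) ^ s"
      by (rule power_mono) simp
    have p2: "real (2 * T + 1) ^ d \<le> (3 * real T) ^ d" by (rule power_mono) (use T in simp_all)
    have "real (card (box d T \<inter> W)) \<le> real (A * (N * (M + (k + 1))) ^ s * (2 * T + 1) ^ d)"
      by (rule of_nat_mono) (rule bound[OF T _ k(2)], simp)
    also have "\<dots> = real A * real (N * (M + (k + 1))) ^ s * real (2 * T + 1) ^ d"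
    proof -
      have "real (a * b ^ s * c ^ d) = real a * real b ^ s * real c ^ d" for a b c :: nat by simp
      then show ?thesis .
    qed
    also have "\<dots> \<le> real A * (2 * real N * (ln (real T) + c)) ^ s * (3 * real T) ^ d"
      using lT by (intro mult_mono p1 p2 order_refl) (auto simp: c_def)
    also have "\<dots> = P * (ln (real T) + c) ^ s * real T ^ d"
      by (simp only: P_def power_mult_distrib mult_ac)
    also have "\<dots> \<le> P * (\<epsilon> / (P + 1) * real T) * real T ^ d"
      by (intro mult_right_mono mult_left_mono log P0) simp
    also have "\<dots> = (P / (P + 1)) * (\<epsilon> * real T ^ Suc d)" by simp
    also have "\<dots> \<le> 1 * (\<epsilon> * real T ^ Suc d)" using P0 \<epsilon> by (intro mult_right_mono) auto
    finally show "real (card (box d T \<inter> W)) \<le> \<epsilon> * real T ^ Suc d" by simp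
  qed
qed

lemma density_zero_coordinate:
  assumes k: "k \<le> d"
  shows "density_zero d {c. c k = 0}"
proof (rule density_zero_if_log_bound[where A = 1 and s = 0 and N = 0 and M = 0])
  fix T j :: nat
  have "card (box d T \<inter> {c. c k = 0}) \<le> 1 * (2 * T + 1) ^ d"
  proof (rule card_box_fibres[OF k])
    fix e :: "nat \<Rightarrow> int"
    have "card {t \<in> {- int T..int T}. e(k := t) \<in> {c. c k = 0}} \<le> card {0 :: int}"
      by (rule card_mono) auto
    then show "card {t \<in> {- int T..int T}. e(k := t) \<in> {c. c k = 0}} \<le> 1" by simp
  qed
  then show "card (box d T \<inter> {c. c k = 0}) \<le> 1 * (0 * (0 + j)) ^ 0 * (2 * T + 1) ^ d" by simp
qed

lemma norm_prod_list_le: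
  fixes as :: "complex list"
  assumes "\<And>a. a \<in> set as \<Longrightarrow> norm a \<le> K"
  shows "norm (\<Prod>a\<leftarrow>as. - a) \<le> K ^ length as"
  using assms
proof (induction as)
  case (Cons a as)
  have "norm a * norm (\<Prod>a\<leftarrow>as. - a) \<le> K * K ^ length as"
  proof (rule mult_mono)
    show "norm a \<le> K" using Cons.prems by simp
    then show "0 \<le> K" using norm_ge_zero[of a] by linarith
    show "norm (\<Prod>a\<leftarrow>as. - a) \<le> K ^ length as" by (rule Cons.IH) (use Cons.prems in simp)
  qed (rule norm_ge_zero)
  then show ?case by (simp add: norm_mult)
qed simp

text \<open>Up to sign the constant coefficient of a monic polynomial is the product of its
  roots.\<close>

lemma norm_poly_0_le:
  fixes g :: "complex poly"
  assumes "lead_coeff g = 1" "degree g \<le> n" "K \<ge> 1" and roots: "\<And>z. poly g z = 0 \<Longrightarrow> norm z \<le> K"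
  shows "norm (poly g 0) \<le> K ^ n"
proof -
  let ?as = "complex_roots_complex g"
  have g: "g = (\<Prod>a\<leftarrow>?as. [:- a, 1:])" using complex_roots(1)[of g] assms(1) by simp
  have val: "poly g z = (\<Prod>a\<leftarrow>?as. z - a)" for z
    by (subst g) (simp add: poly_prod_list o_def)
  have "norm a \<le> K" if "a \<in> set ?as" for a
  proof (rule roots)
    show "poly g a = 0" unfolding val using that by (auto simp: prod_list_zero_iff)
  qed
  then have "norm (\<Prod>a\<leftarrow>?as. - a) \<le> K ^ length ?as" by (rule norm_prod_list_le)
  also have "\<dots> \<le> K ^ n" by (rule power_increasing) (use assms complex_roots(2)[of g] in simp_all)
  finally show ?thesis unfolding val by simp
qed

context integral_generator
begin

lemma infinitely_many_simple_roots:
  "infinite {p. prime p \<and> d \<le> p \<and> (\<exists>r. int p dvd poly H r \<and> \<not> int p dvd poly (pderiv H) r)}"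
proof
  let ?P = "{p. prime p \<and> d \<le> p \<and> (\<exists>r. int p dvd poly H r \<and> \<not> int p dvd poly (pderiv H) r)}"
  assume fin: "finite ?P"
  show False
  proof (rule pderiv_resultant)
    fix N :: int assume N: "N \<noteq> 0" "\<And>p r. int p dvd poly H r \<Longrightarrow> int p dvd poly (pderiv H) r \<Longrightarrow> int p dvd N"
    have "{p. prime p \<and> (\<exists>r. int p dvd poly H r)} \<subseteq> ?P \<union> {p. prime p \<and> int p dvd N} \<union> {..<d}"
    proof
      fix p assume "p \<in> {p. prime p \<and> (\<exists>r. int p dvd poly H r)}"
      then obtain r where p: "prime p" "int p dvd poly H r" by blast
      show "p \<in> ?P \<union> {p. prime p \<and> int p dvd N} \<union> {..<d}"
      proof (cases "int p dvd poly (pderiv H) r")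
        case True
        then have "int p dvd N" by (rule N(2)[OF p(2)])
        then show ?thesis using p(1) by simp
      next
        case False
        then show ?thesis using p by (cases "d \<le> p") auto
      qed
    qed
    moreover have "finite (?P \<union> {p. prime p \<and> int p dvd N} \<union> {..<d})"
      using fin finite_primes_dvd[OF N(1)] by simp
    ultimately have "finite {p. prime p \<and> (\<exists>r. int p dvd poly H r)}" by (rule finite_subset)
    then show False using infinitely_many_prime_divisors[OF n_pos] by contradiction
  qed
qed

text \<open>By the sieve \<open>k\<close> primes leave at most a proportion
  \<open>\<delta>^k\<close> of the box, up to the factor \<open>3 ^ Suc d\<close> coming from
  \<open>2 * T + 1 + M \<le> 3 * T\<close>. As \<open>H\<close> has a simple root modulo infinitely
  many primes, \<open>k\<close> can be taken as large as \<open>\<epsilon>\<close> demands.\<close>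

lemma density_zero_not_generic:
  assumes d: "d \<ge> 1"
  shows "density_zero d {c. \<exists>f \<alpha>. c = coeff_vector d f \<and> degree f = d \<and> minpoly_int f \<alpha> \<and> \<not> generic f \<alpha>}" (is "density_zero d ?W")
  unfolding density_zero_def
proof (intro allI impI)
  fix \<epsilon> :: real assume \<epsilon>: "\<epsilon> > 0"
  define \<delta> where "\<delta> = 1 - 1 / (4 * real d)"
  have \<delta>: "\<delta> < 1" "\<delta> \<ge> 0" using d by (simp_all add: \<delta>_def field_simps)
  obtain k where k: "\<delta> ^ k < \<epsilon> / 3 ^ Suc d" using real_arch_pow_inv[of "\<epsilon> / 3 ^ Suc d" \<delta>] \<epsilon> \<delta>(1) by auto
  let ?P = "{p. prime p \<and> d \<le> p \<and> (\<exists>r. int p dvd poly H r \<and> \<not> int p dvd poly (pderiv H) r)}"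
  from infinite_arbitrarily_large[OF infinitely_many_simple_roots[of d], of k]
  obtain P where "finite P \<and> card P = k \<and> P \<subseteq> ?P" by (rule exE)
  then have P: "finite P" "card P = k" "P \<subseteq> ?P" by - (elim conjE, assumption)+
  define M where "M = \<Prod>P"
  have sub: "box d T \<inter> ?W \<subseteq> {c \<in> box d T. \<forall>p\<in>P. splits_mod p d (restrict (\<lambda>i. c i mod int p) {..d})}" for T
  proof
    fix c assume c: "c \<in> box d T \<inter> ?W"
    then have "c \<in> ?W" by (rule IntD2)
    then obtain f \<alpha> where "c = coeff_vector d f \<and> degree f = d \<and> minpoly_int f \<alpha> \<and> \<not> generic f \<alpha>"
      unfolding mem_Collect_eq by (elim exE)
    then have f: "c = coeff_vector d f" "degree f = d" "minpoly_int f \<alpha>" "\<not> generic f \<alpha>" by - (elim conjE, assumption)+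
    have "splits_mod p d (restrict (\<lambda>i. c i mod int p) {..d})" if "p \<in> P" for p
    proof -
      from that P(3) obtain r where p: "prime p" "int p dvd poly H r" "\<not> int p dvd poly (pderiv H) r" by blast
      from place_near_root_mod_p[OF H p(1,2)] obtain w where w: "w \<in> padic_places p" "w (\<gamma> - of_int r) < 1"
        by blast
      interpret degree_one_place H \<gamma> p w r using p w by unfold_locales
      have "restrict (\<lambda>i. c i mod int p) {..d} = restrict (\<lambda>i. coeff f i mod int p) {..d}"
        by (rule restrict_ext) (simp add: f(1) coeff_vector_def)
      then show ?thesis using splits_if_not_generic[OF f(3,4)] unfolding f(2) by simp
    qed
    then show "c \<in> {c \<in> box d T. \<forall>p\<in>P. splits_mod p d (restrict (\<lambda>i. c i mod int p) {..d})}"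
      unfolding mem_Collect_eq by (intro conjI ballI IntD1[OF c])
  qed
  have "\<forall>\<^sub>F T in sequentially. T \<ge> M + 1" by (rule eventually_ge_at_top)
  then show "\<forall>\<^sub>F T in sequentially. real (card (box d T \<inter> ?W)) \<le> \<epsilon> * real T ^ Suc d"
  proof (rule eventually_mono)
    fix T assume T: "T \<ge> M + 1"
    have "card (box d T \<inter> ?W) \<le> card {c \<in> box d T. \<forall>p\<in>P. splits_mod p d (restrict (\<lambda>i. c i mod int p) {..d})}"
      by (rule card_mono[OF _ sub]) (simp add: finite_box)
    then have "real (card (box d T \<inter> ?W)) \<le> real (card {c \<in> box d T. \<forall>p\<in>P. splits_mod p d (restrict (\<lambda>i. c i mod int p) {..d})})"
      by (rule of_nat_mono)
    also have "\<dots> \<le> \<delta> ^ card P * real (2 * T + 1 + \<Prod>P) ^ Suc d"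
    proof (rule sieve[OF P(1)])
      fix p assume "p \<in> P"
      then have p: "prime p" "d \<le> p" using P(3) by blast+
      show "prime p" by (rule p)
      show "real (card {v \<in> residue_vectors p d. splits_mod p d v}) \<le> \<delta> * real p ^ Suc d"
        unfolding \<delta>_def using card_splits_mod[OF p(1) d p(2)] by simp
    qed
    also have "\<dots> \<le> (\<epsilon> / 3 ^ Suc d) * (3 * real T) ^ Suc d"
      unfolding P(2) M_def[symmetric]
    proof (rule mult_mono)
      show "real (2 * T + 1 + M) ^ Suc d \<le> (3 * real T) ^ Suc d" by (rule power_mono) (use T in simp_all)
    qed (use k \<epsilon> in simp_all)
    also have "\<dots> = \<epsilon> * real T ^ Suc d" by (simp only: power_mult_distrib) simp
    finally show "real (card (box d T \<inter> ?W)) \<le> \<epsilon> * real T ^ Suc d" .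
  qed
qed

text \<open>For generic \<open>f\<close>, the constant coefficient of the minimal polynomial of \<open>b^d * f(\<gamma> / b)\<close> is an \<open>S\<close>-unit.
  Changing the constant coefficient of \<open>f\<close> translates this minimal polynomial, so each value of it is taken
  at most \<open>n\<close> times when the other coefficients are fixed.\<close>

lemma density_zero_generic:
  assumes b: "b \<noteq> 0" and S0: "finite S0" and bS: "\<And>p. prime p \<Longrightarrow> int p dvd b \<Longrightarrow> p \<in> S0"
  shows "density_zero d {c. \<exists>f \<alpha>. c = coeff_vector d f \<and> degree f = d \<and> minpoly_int f \<alpha> \<and> generic f \<alpha> \<and>
    (\<forall>p w. prime p \<and> p \<notin> S0 \<and> w \<in> padic_places p \<longrightarrow> \<not> w (of_int b * \<alpha> - \<gamma>) < 1)}" (is "density_zero d ?W")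
proof (rule minpoly_xi[of d b])
  fix C :: real assume C: "C \<ge> 1" "\<And>f T. (\<And>i. i \<le> d \<Longrightarrow> \<bar>coeff f i\<bar> \<le> T) \<Longrightarrow>
    \<exists>g. minpoly_int g (xi b d f) \<and> lead_coeff g = 1 \<and> degree g \<le> n \<and>
      (\<forall>z::complex. poly (map_poly of_int g) z = 0 \<longrightarrow> norm z \<le> C * of_int T)"
  define M where "M = nat \<lceil>C\<rceil>"
  have CM: "C \<le> real M" unfolding M_def by (rule real_nat_ceiling_ge)
  have M1: "M \<ge> 1" using CM C(1) by linarith
  show ?thesis
  proof (rule density_zero_if_log_bound[where A = "2 * n" and N = n and M = M and s = "card S0"])
    fix T k :: nat assume T: "T \<ge> 1" and k: "k \<ge> 1" "T < 2 ^ k"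
    \<comment> \<open>The polynomial \<open>g\<close> has at most \<open>n\<close> roots, each of
      size at most \<open>M * T\<close>, so \<open>X\<close> bounds its constant
      coefficient.\<close>
    define X where "X = (M * T) ^ n"
    define L where "L = n * (M + k)"
    define U where "U = {u :: int. u \<noteq> 0 \<and> \<bar>u\<bar> \<le> int X \<and> (\<forall>p. prime p \<and> int p dvd u \<longrightarrow> p \<in> S0)}"
    have L1: "L \<ge> 1" using n_pos k by (simp add: L_def Suc_leI)
    have XL: "X < 2 ^ L"
    proof -
      have "M * T < 2 ^ M * 2 ^ k" by (rule mult_strict_mono) (use k(2) in simp_all)
      then have "M * T < 2 ^ (M + k)" by (simp only: power_add)
      then have "(M * T) ^ n < (2 ^ (M + k)) ^ n" using n_pos by (intro power_strict_mono) simp_all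
      then show ?thesis unfolding X_def L_def by (simp only: power_mult mult.commute[of n])
    qed
    have finU: "finite U" and cU: "card U \<le> 2 * L ^ card S0"
      unfolding U_def by (rule S_units[OF S0 L1 XL])+
    have "card (box d T \<inter> ?W) \<le> (n * card U) * (2 * T + 1) ^ d"
    proof (rule card_box_fibres)
      fix e :: "nat \<Rightarrow> int" assume e: "e \<in> ({..d} - {0}) \<rightarrow>\<^sub>E {- int T..int T}"
      define h where "h t = (\<Sum>i\<le>d. monom ((e(0 := t)) i) i)" for t
      have ch: "coeff (h t) i = (e(0 := t)) i" if "i \<le> d" for t i
        unfolding h_def coeff_sum coeff_monom by (subst sum.delta) (use that in simp_all)
      have bound: "\<bar>coeff (h t) i\<bar> \<le> int T" if "i \<le> d" "\<bar>t\<bar> \<le> int T" for t i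
      proof (cases "i = 0")
        case False
        then have "e i \<in> {- int T..int T}" using that(1) by (intro PiE_mem[OF e]) simp
        then show ?thesis using ch[OF that(1)] False by (simp add: abs_le_iff)
      qed (use ch[OF that(1)] that(2) in simp)
      \<comment> \<open>Within a fibre only the term of index 0 changes, and there
        \<open>\<gamma>\<close> has exponent 0, so \<open>xi\<close> moves by an integer.\<close>
      have xi_h: "xi b d (h t) = xi b d (h 0) + of_int (t * b ^ d)" for t
      proof -
        have s: "xi b d (h t) = of_int (t * b ^ d) + (\<Sum>i\<in>{..d} - {0}. of_int (e i * b ^ (d - i)) * \<gamma> ^ i)" for t
        proof -
          have "xi b d (h t) = (\<Sum>i\<le>d. of_int ((e(0 := t)) i * b ^ (d - i)) * \<gamma> ^ i)"
            unfolding xi_def by (rule sum.cong[OF refl]) (simp only: ch atMost_iff)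
          also have "\<dots> = of_int ((e(0 := t)) 0 * b ^ (d - 0)) * \<gamma> ^ 0
              + (\<Sum>i\<in>{..d} - {0}. of_int ((e(0 := t)) i * b ^ (d - i)) * \<gamma> ^ i)"
            by (rule sum.remove) simp_all
          also have "(\<Sum>i\<in>{..d} - {0}. of_int ((e(0 := t)) i * b ^ (d - i)) * \<gamma> ^ i)
            = (\<Sum>i\<in>{..d} - {0}. of_int (e i * b ^ (d - i)) * \<gamma> ^ i)" by (rule sum.cong) simp_all
          finally show ?thesis by simp
        qed
        show ?thesis unfolding s[of t] s[of 0] by simp
      qed
      have min: "\<exists>g. minpoly_int g (xi b d (h t)) \<and> lead_coeff g = 1 \<and> degree g \<le> n \<and>
          (\<forall>z::complex. poly (map_poly of_int g) z = 0 \<longrightarrow> norm z \<le> C * of_int (int T))"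
        if "\<bar>t\<bar> \<le> int T" for t by (rule C(2)) (rule bound[OF _ that])
      have "\<bar>0\<bar> \<le> int T" by simp
      from min[OF this] obtain g1 where "minpoly_int g1 (xi b d (h 0)) \<and> lead_coeff g1 = 1 \<and> degree g1 \<le> n \<and>
          (\<forall>z::complex. poly (map_poly of_int g1) z = 0 \<longrightarrow> norm z \<le> C * of_int (int T))" by (rule exE)
      then have g1: "minpoly_int g1 (xi b d (h 0))" "lead_coeff g1 = 1" "degree g1 \<le> n" by - (elim conjE, assumption)+
      have g1d: "degree g1 > 0" by (rule degree_minpoly_int_pos[OF g1(1)])
      have inU: "poly g1 (- (t * b ^ d)) \<in> U" if t: "t \<in> {- int T..int T}" "e(0 := t) \<in> ?W" for t
      proof -
        have "\<bar>t\<bar> \<le> int T" using t(1) by (simp add: abs_le_iff)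
        from min[OF this] obtain g where "minpoly_int g (xi b d (h t)) \<and> lead_coeff g = 1 \<and> degree g \<le> n \<and>
          (\<forall>z::complex. poly (map_poly of_int g) z = 0 \<longrightarrow> norm z \<le> C * of_int (int T))" by (rule exE)
        then have g: "minpoly_int g (xi b d (h t))" "lead_coeff g = 1" "degree g \<le> n"
          and g_roots: "\<forall>z::complex. poly (map_poly of_int g) z = 0 \<longrightarrow> norm z \<le> C * of_int (int T)"
          by - (elim conjE, assumption)+
        have "g = g1 \<circ>\<^sub>p [:- (t * b ^ d), 1:]"
          by (rule minpoly_int_shift[OF g1(1,2) g(1)[unfolded xi_h[of t]] g(2)])
        then have g0: "poly g 0 = poly g1 (- (t * b ^ d))" by (simp add: poly_pcompose)
        from t(2) obtain f \<alpha> where "e(0 := t) = coeff_vector d f \<and> degree f = d \<and> minpoly_int f \<alpha> \<and> generic f \<alpha> \<and>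
          (\<forall>p w. prime p \<and> p \<notin> S0 \<and> w \<in> padic_places p \<longrightarrow> \<not> w (of_int b * \<alpha> - \<gamma>) < 1)"
          unfolding mem_Collect_eq by (elim exE)
        then have f: "e(0 := t) = coeff_vector d f" "degree f = d" "minpoly_int f \<alpha>" "generic f \<alpha>"
          and far: "\<forall>p w. prime p \<and> p \<notin> S0 \<and> w \<in> padic_places p \<longrightarrow> \<not> w (of_int b * \<alpha> - \<gamma>) < 1"
          by - (elim conjE, assumption)+
        have cf: "coeff f i = (e(0 := t)) i" if "i \<le> d" for i
          using fun_cong[OF f(1), of i] that by (simp add: coeff_vector_def)
        have "xi b d f = xi b d (h t)" unfolding xi_def
          by (rule sum.cong[OF refl]) (simp only: cf ch atMost_iff)
        then have gf: "minpoly_int g (xi b (degree f) f)" using g(1) f(2) by simp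
        have primes: "p \<in> S0" if p: "prime p" "int p dvd poly g 0" for p
        proof (rule ccontr)
          assume "p \<notin> S0"
          then have "\<not> int p dvd b" using bS p(1) by blast
          from place_near_if_dvd_norm[OF f(3,4) p(1) this gf p(2)]
          obtain w where w: "w \<in> padic_places p" "w (of_int b * \<alpha> - \<gamma>) < 1" by blast
          show False using far[rule_format, OF conjI[OF p(1) conjI[OF \<open>p \<notin> S0\<close> w(1)]]] w(2) by contradiction
        qed
        \<comment> \<open>Zero is divisible by every prime, so \<open>primes\<close> would put all
          primes into \<open>S0\<close>.\<close>
        have ne: "poly g 0 \<noteq> 0"
        proof
          assume "poly g 0 = 0"
          then have "{p :: nat. prime p} \<subseteq> S0" using primes by (intro subsetI) simp
          from finite_subset[OF this S0] show False using primes_infinite by contradiction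
        qed
        have le: "\<bar>poly g 0\<bar> \<le> int X"
        proof -
          have "norm (poly (map_poly of_int g :: complex poly) 0) \<le> (real M * real T) ^ n"
          proof (rule norm_poly_0_le)
            show "lead_coeff (map_poly of_int g :: complex poly) = 1" using g(2) by simp
            show "degree (map_poly of_int g :: complex poly) \<le> n" using g(3) by simp
            have "1 * 1 \<le> real M * real T" by (rule mult_mono) (use M1 T in simp_all)
            then show "1 \<le> real M * real T" by simp
            fix z :: complex assume "poly (map_poly of_int g) z = 0"
            from g_roots[rule_format, OF this] have "norm z \<le> C * real T" by simp
            also have "\<dots> \<le> real M * real T" by (rule mult_right_mono[OF CM]) simp
            finally show "norm z \<le> real M * real T" .
          qed
          moreover have "poly (map_poly of_int g :: complex poly) 0 = of_int (poly g 0)"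
            by (simp add: poly_0_coeff_0 coeff_map_poly)
          ultimately have "real_of_int \<bar>poly g 0\<bar> \<le> real_of_int (int X)"
            by (simp add: X_def)
          then show ?thesis by (simp only: of_int_le_iff)
        qed
        have "poly g 0 \<in> U" unfolding U_def mem_Collect_eq
        proof (intro conjI allI impI ne le)
          fix p assume "prime p \<and> int p dvd poly g 0"
          then show "p \<in> S0" by (elim conjE) (rule primes)
        qed
        then show ?thesis unfolding g0 .
      qed
      have inj: "inj_on (\<lambda>t. - (t * b ^ d)) A" for A using b by (auto simp: inj_on_def)
      let ?A = "{t \<in> {- int T..int T}. e(0 := t) \<in> ?W}"
      let ?R = "\<lambda>u. {y. poly (g1 - [:u:]) y = 0}"
      have nz: "g1 - [:u:] \<noteq> 0" for u
      proof
        assume "g1 - [:u:] = 0"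
        then have "g1 = [:u:]" by simp
        then show False using g1d by simp
      qed
      have R: "finite (?R u)" "card (?R u) \<le> n" for u
      proof -
        show "finite (?R u)" by (rule poly_roots_finite[OF nz])
        have "card (?R u) \<le> degree (g1 - [:u:])" by (rule card_poly_roots_bound[OF nz])
        also have "\<dots> \<le> n" using degree_diff_le[of g1 n "[:u:]"] g1(3) by simp
        finally show "card (?R u) \<le> n" .
      qed
      \<comment> \<open>Since \<open>b\<close> is non-zero, \<open>t\<close> can be recovered from
        the argument of \<open>g1\<close>, and the non-constant \<open>g1\<close> takes each value
        in \<open>U\<close> at most \<open>n\<close> times.\<close>
      have "card ?A \<le> card (\<Union>u\<in>U. ?R u)"
      proof (rule card_inj_on_le[OF inj])
        show "finite (\<Union>u\<in>U. ?R u)" using finU R(1) by blast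
        show "(\<lambda>t. - (t * b ^ d)) ` ?A \<subseteq> (\<Union>u\<in>U. ?R u)"
        proof
          fix y assume "y \<in> (\<lambda>t. - (t * b ^ d)) ` ?A"
          then have "poly g1 y \<in> U" using inU by blast
          then show "y \<in> (\<Union>u\<in>U. ?R u)" by simp
        qed
      qed
      also have "\<dots> \<le> (\<Sum>u\<in>U. card (?R u))" by (rule card_UN_le[OF finU])
      also have "\<dots> \<le> (\<Sum>u\<in>U. n)" by (rule sum_mono) (rule R(2))
      finally show "card ?A \<le> n * card U" by (simp add: mult.commute)
    qed simp
    also have "\<dots> \<le> (n * (2 * L ^ card S0)) * (2 * T + 1) ^ d" by (intro mult_le_mono cU order_refl)
    finally show "card (box d T \<inter> ?W) \<le> 2 * n * (n * (M + k)) ^ card S0 * (2 * T + 1) ^ d"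
      unfolding L_def by (simp only: mult.assoc mult.left_commute)
  qed
qed

end

text \<open>The reversal of \<open>g\<close> vanishes at \<open>\<alpha>\<close>, so
  \<open>f\<close> divides it, and the leading coefficient of the reversal is the constant
  coefficient of \<open>g\<close>, unless that is zero and the claim trivial.\<close>

lemma lead_coeff_dvd_reciprocal:
  assumes f: "minpoly_int f \<alpha>" and g: "minpoly_int g (inverse \<alpha>)" and "\<alpha> \<noteq> 0"
  shows "lead_coeff f dvd coeff g 0"
proof (cases "coeff g 0 = 0")
  case False
  have r: "map_poly of_int (reflect_poly g) = reflect_poly (map_poly of_int g :: complex poly)"
    by (rule poly_eqI) (simp add: coeff_reflect_poly coeff_map_poly)
  have "poly (map_poly of_int (reflect_poly g)) \<alpha> = 0"
    unfolding r poly_reflect_poly_nz[OF assms(3)] using minpoly_int_root[OF g] by simp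
  then have "f dvd reflect_poly g" using minpoly_int_dvd_iff[OF f] by blast
  then obtain k where "reflect_poly g = f * k" by (rule dvdE)
  then have "lead_coeff (reflect_poly g) = lead_coeff f * lead_coeff k" by (simp only: lead_coeff_mult)
  moreover have "lead_coeff (reflect_poly g) = coeff g 0"
    using False by (simp add: degree_reflect_poly_eq coeff_reflect_poly)
  ultimately show ?thesis by (simp only: dvd_triv_left)
qed simp

text \<open>A prime dividing the leading coefficient of \<open>f\<close> divides the constant
  coefficient of the minimal polynomial of \<open>inverse \<alpha>\<close>, and so yields a place
  where \<open>inverse \<alpha>\<close> is small. Hence, with the other coordinates fixed, the
  coordinate \<open>d\<close> takes only \<open>S\<close>-unit values.\<close>

lemma density_zero_near_infinity:
  assumes S0: "finite S0"
  shows "density_zero d {c. \<exists>f \<alpha>. c = coeff_vector d f \<and> degree f = d \<and> minpoly_int f \<alpha> \<and> \<alpha> \<noteq> 0 \<and>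
    (\<forall>p w. prime p \<and> p \<notin> S0 \<and> w \<in> padic_places p \<longrightarrow> \<not> w (inverse \<alpha>) < 1)}" (is "density_zero d ?W")
proof (rule density_zero_if_log_bound[where A = 2 and N = 1 and M = 0 and s = "card S0"])
  fix T k :: nat assume k: "k \<ge> 1" "T < 2 ^ k"
  define U where "U = {u :: int. u \<noteq> 0 \<and> \<bar>u\<bar> \<le> int T \<and> (\<forall>p. prime p \<and> int p dvd u \<longrightarrow> p \<in> S0)}"
  have finU: "finite U" and cU: "card U \<le> 2 * k ^ card S0"
    unfolding U_def by (rule S_units[OF S0 k])+
  have "card (box d T \<inter> ?W) \<le> card U * (2 * T + 1) ^ d"
  proof (rule card_box_fibres)
    fix e :: "nat \<Rightarrow> int"
    show "card {t \<in> {- int T..int T}. e(d := t) \<in> ?W} \<le> card U"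
    proof (rule card_mono[OF finU], rule subsetI)
      fix t assume t: "t \<in> {t \<in> {- int T..int T}. e(d := t) \<in> ?W}"
      then have "e(d := t) \<in> ?W" unfolding mem_Collect_eq[of t] by (rule conjunct2)
      then obtain f \<alpha> where "e(d := t) = coeff_vector d f \<and> degree f = d \<and> minpoly_int f \<alpha> \<and> \<alpha> \<noteq> 0 \<and>
          (\<forall>p w. prime p \<and> p \<notin> S0 \<and> w \<in> padic_places p \<longrightarrow> \<not> w (inverse \<alpha>) < 1)"
        unfolding mem_Collect_eq by (elim exE)
      then have f: "e(d := t) = coeff_vector d f" "degree f = d" "minpoly_int f \<alpha>" "\<alpha> \<noteq> 0"
        and far: "\<forall>p w. prime p \<and> p \<notin> S0 \<and> w \<in> padic_places p \<longrightarrow> \<not> w (inverse \<alpha>) < 1"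
        by - (elim conjE, assumption)+
      have lf: "lead_coeff f = t" using fun_cong[OF f(1), of d] f(2) by (simp add: coeff_vector_def)
      have primes: "p \<in> S0" if p: "prime p" "int p dvd t" for p
      proof (rule ccontr)
        assume "p \<notin> S0"
        have "inverse \<alpha> \<in> Qbar" by (rule Qbar_inverse[OF minpoly_int_Qbar[OF f(3)]])
        then obtain g where g: "minpoly_int g (inverse \<alpha>)" using minpoly_int_exists unfolding Qbar_def by blast
        have "int p dvd coeff g 0"
          by (rule dvd_trans[OF p(2)[folded lf] lead_coeff_dvd_reciprocal[OF f(3) g f(4)]])
        then have "int p dvd poly g 0" by (simp only: poly_0_coeff_0)
        from place_near_root_mod_p[OF g p(1) this] obtain w
          where w: "w \<in> padic_places p" "w (inverse \<alpha> - of_int 0) < 1" by blast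
        then have "w (inverse \<alpha>) < 1" by (simp only: ring_1_class.of_int_0 diff_zero)
        then show False using far[rule_format, OF conjI[OF p(1) conjI[OF \<open>p \<notin> S0\<close> w(1)]]] by contradiction
      qed
      have t0: "t \<noteq> 0" using minpoly_int_lead_coeff[OF f(3)] lf by simp
      have "t \<in> {- int T..int T}" using t unfolding mem_Collect_eq[of t] by (rule conjunct1)
      then have le: "\<bar>t\<bar> \<le> int T" by (simp add: abs_le_iff)
      show "t \<in> U" unfolding U_def mem_Collect_eq
      proof (intro conjI allI impI t0 le)
        fix p assume "prime p \<and> int p dvd t"
        then show "p \<in> S0" by (elim conjE) (rule primes)
      qed
    qed
  qed simp
  also have "\<dots> \<le> (2 * k ^ card S0) * (2 * T + 1) ^ d" by (intro mult_le_mono cU order_refl)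
  finally show "card (box d T \<inter> ?W) \<le> 2 * (1 * (0 + k)) ^ card S0 * (2 * T + 1) ^ d" by simp
qed

text \<open>The box with \<open>T\<close> about \<open>2^d * B^d\<close> contains the coefficient
  vectors of all points of height at most \<open>B\<close>, while the lower bound uses
  \<open>N\<close> about \<open>B^d / m\<close>. As \<open>T \<le> \<kappa> * N\<close>, numerator
  and denominator are compared through \<open>N^(d+1)\<close>.\<close>

lemma limit_if_density_zero:
  assumes d: "d \<ge> 1" and R: "R \<subseteq> P1_deg d"
    and dz: "density_zero d {c. \<exists>x f. Affine x \<in> R \<and> minpoly_int f x \<and> c = coeff_vector d f}" (is "density_zero d ?V")
  shows "((\<lambda>B. real (card {P \<in> R. height P \<le> B}) / real (card {P \<in> P1_deg d. height P \<le> B})) \<longlongrightarrow> 0) at_top"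
proof (rule tendstoI)
  fix \<epsilon> :: real assume \<epsilon>: "\<epsilon> > 0"
  define m where "m = 4 * (real d + 1)"
  define \<kappa> where "\<kappa> = 2 ^ d * (2 * m)"
  have m4: "m \<ge> 4" by (simp add: m_def)
  have \<kappa>: "\<kappa> > 0" using m4 by (simp add: \<kappa>_def)
  \<comment> \<open>Chosen so that the numerator is at most
    \<open>1 + \<epsilon> / 36 * N^(d+1)\<close>. The denominator is at least
    \<open>N^(d+1) / 18\<close>, so half of the allowance remains for the summand 1.\<close>
  define \<delta> where "\<delta> = \<epsilon> / (36 * (real d * \<kappa> ^ Suc d))"
  have dk: "real d * \<kappa> ^ Suc d > 0" using d \<kappa> by simp
  have \<delta>: "\<delta> > 0" using \<epsilon> dk by (simp add: \<delta>_def)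
  from dz[unfolded density_zero_def eventually_sequentially, rule_format, OF this]
  obtain T0 where T0: "\<forall>T\<ge>T0. real (card (box d T \<inter> ?V)) \<le> \<delta> * real T ^ Suc d" by (rule exE)
  \<comment> \<open>Ensures \<open>1 < \<epsilon> / 36 * N\<close>, which absorbs the summand 1 of
    the point at infinity.\<close>
  define N0 where "N0 = nat \<lceil>36 / \<epsilon>\<rceil> + 1"
  define B0 where "B0 = max (max 1 (real T0)) (m * real N0)"
  have main: "dist (real (card {P \<in> R. height P \<le> B}) / real (card {P \<in> P1_deg d. height P \<le> B})) 0 < \<epsilon>"
    if B: "B \<ge> B0" for B
  proof -
    define y where "y = B ^ d"
    define T where "T = nat \<lfloor>2 ^ d * y\<rfloor>"
    define N where "N = nat \<lfloor>y / m\<rfloor>"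
    have B1: "B \<ge> 1" "B \<ge> real T0" "B \<ge> m * real N0" using B by (simp_all add: B0_def)
    have yB: "y \<ge> B" unfolding y_def using self_le_power[OF B1(1)] d by simp
    have y1: "y \<ge> 1" using yB B1(1) by linarith
    have y2: "1 * y \<le> 2 ^ d * y" using y1 by (intro mult_right_mono) simp_all
    have T: "T \<ge> T0" "real T \<le> 2 ^ d * y"
    proof -
      have "real T0 \<le> 2 ^ d * y" using y2 yB B1(2) by linarith
      then show "T \<ge> T0" unfolding T_def by (simp add: le_nat_floor)
      show "real T \<le> 2 ^ d * y" unfolding T_def using y1 by (intro of_nat_floor) simp
    qed
    have "real N0 \<le> y / m"
    proof -
      have "real N0 * m \<le> y" using B1(3) yB by (simp only: mult.commute)
      then show ?thesis using m4 by (simp add: pos_le_divide_eq)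
    qed
    then have NN: "N \<ge> N0" unfolding N_def by (simp add: le_nat_floor)
    have N1: "N \<ge> 1" using NN by (simp add: N0_def)
    have Ny: "real N \<le> y / m" unfolding N_def using y1 m4 by (intro of_nat_floor) simp
    have "y / m < real N + 1" unfolding N_def using y1 m4 by (simp add: floor_less_iff)
    then have "y / m \<le> 2 * real N" using N1 by linarith
    then have "y \<le> 2 * real N * m" using m4 by (simp add: pos_divide_le_eq)
    then have "2 ^ d * y \<le> 2 ^ d * (2 * real N * m)" by (rule mult_left_mono) simp
    from order_trans[OF T(2) this] have T\<kappa>: "real T \<le> \<kappa> * real N" by (simp only: \<kappa>_def mult_ac)
    let ?D = "real (card {P \<in> P1_deg d. height P \<le> B})" and ?Num = "real (card {P \<in> R. height P \<le> B})"
    have D: "real N ^ Suc d \<le> 18 * ?D"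
    proof (rule many_points[OF d B1(1) N1])
      have "m * real N \<le> y" using Ny m4 by (simp add: pos_le_divide_eq mult.commute)
      then show "4 * (real d + 1) * real N \<le> B ^ d" unfolding m_def y_def .
    qed
    have "card {P \<in> R. height P \<le> B} \<le> 1 + d * card (box d T \<inter> ?V)"
    proof (rule points_of_bounded_height(2)[OF R B1(1)])
      show "finite (box d T \<inter> ?V)" by (rule finite_Int[OF disjI1[OF finite_box]])
      fix x f assume x: "Affine x \<in> R" "minpoly_int f x" and b: "\<forall>i\<le>d. real_of_int \<bar>coeff f i\<bar> \<le> 2 ^ d * B ^ d"
      have inV: "coeff_vector d f \<in> ?V" unfolding mem_Collect_eq by (intro exI conjI, rule x(1), rule x(2), rule refl)
      have "coeff_vector d f \<in> box d T" unfolding coeff_vector_def box_def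
      proof (rule restrict_PiE_iff[THEN iffD2], rule ballI)
        fix i assume "i \<in> {..d}"
        then have "\<bar>coeff f i\<bar> \<le> \<lfloor>2 ^ d * y\<rfloor>" using b by (simp only: le_floor_iff atMost_iff y_def)
        moreover have "\<lfloor>2 ^ d * y\<rfloor> = int T" unfolding T_def using y1 by simp
        ultimately show "coeff f i \<in> {- int T..int T}" by (simp add: abs_le_iff)
      qed
      then show "coeff_vector d f \<in> box d T \<inter> ?V" by (rule IntI[OF _ inV])
    qed
    then have "?Num \<le> real (1 + d * card (box d T \<inter> ?V))" by (rule of_nat_mono)
    also have "\<dots> = 1 + real d * real (card (box d T \<inter> ?V))" by simp
    also have "\<dots> \<le> 1 + real d * (\<delta> * (\<kappa> * real N) ^ Suc d)"
    proof -
      have "real (card (box d T \<inter> ?V)) \<le> \<delta> * real T ^ Suc d" by (rule T0[rule_format, OF T(1)])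
      also have "\<dots> \<le> \<delta> * (\<kappa> * real N) ^ Suc d"
        using \<delta> by (intro mult_left_mono power_mono T\<kappa>) simp_all
      finally show ?thesis by (intro add_left_mono mult_left_mono) simp_all
    qed
    also have "\<dots> = 1 + \<delta> * (real d * \<kappa> ^ Suc d) * real N ^ Suc d" by (simp only: power_mult_distrib mult_ac)
    also have "\<delta> * (real d * \<kappa> ^ Suc d) = \<epsilon> / 36"
    proof -
      have "e / (36 * z) * z = e / 36" if "z > 0" for e z :: real using that by simp
      then show ?thesis unfolding \<delta>_def using dk by blast
    qed
    finally have num: "?Num \<le> 1 + \<epsilon> / 36 * real N ^ Suc d" .
    have big: "36 / \<epsilon> < real N"
    proof -
      have "36 / \<epsilon> \<le> real (nat \<lceil>36 / \<epsilon>\<rceil>)" by (rule real_nat_ceiling_ge)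
      also have "\<dots> < real N0" by (simp add: N0_def)
      also have "\<dots> \<le> real N" using NN by simp
      finally show ?thesis .
    qed
    have "1 < \<epsilon> / 36 * real N" using big \<epsilon> by (simp add: field_simps)
    also have "\<dots> \<le> \<epsilon> / 36 * real N ^ Suc d"
      using \<epsilon> self_le_power[of "real N" "Suc d"] N1 by (intro mult_left_mono) simp_all
    finally have "1 < \<epsilon> / 36 * real N ^ Suc d" .
    then have "?Num < \<epsilon> / 18 * real N ^ Suc d" using num by linarith
    also have "\<dots> \<le> \<epsilon> / 18 * (18 * ?D)" using \<epsilon> by (intro mult_left_mono D) simp
    finally have lt: "?Num < \<epsilon> * ?D" by simp
    moreover have "?D > 0"
    proof -
      have "real N ^ Suc d > 0" using N1 by simp
      then show ?thesis using D by linarith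
    qed
    ultimately have "?Num / ?D < \<epsilon>" by (simp add: pos_divide_less_eq)
    then show ?thesis by simp
  qed
  show "\<forall>\<^sub>F B in at_top. dist (real (card {P \<in> R. height P \<le> B}) / real (card {P \<in> P1_deg d. height P \<le> B})) 0 < \<epsilon>"
    unfolding eventually_at_top_linorder by (rule exI[of _ B0]) (intro allI impI main)
qed

text \<open>A degree below \<open>d\<close> puts the vector into the hyperplane
  \<open>c d = 0\<close>. For a finite point of the support the rest is divided into generic and
  non-generic polynomials; for infinity only \<open>x = 0\<close> has to be set aside, and its
  vector lies in \<open>c 0 = 0\<close>.\<close>

lemma integral_points_density_zero:
  assumes d: "d \<ge> 1" and K: "number_field K" and S: "finite S"
    and D: "divisor_over K D" "effective D" "D \<noteq> 0" and R: "R \<subseteq> P1_deg d" "integral_points K D S R"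
  shows "density_zero d {c. \<exists>x f. Affine x \<in> R \<and> minpoly_int f x \<and> c = coeff_vector d f}" (is "density_zero d ?V")
proof -
  have deg: "degree f < d \<or> degree f = d" if "Affine x \<in> R" "minpoly_int f x" for f x
  proof (rule le_imp_less_or_eq)
    show "degree f \<le> d" using Affine_P1_deg_iff[OF that(2), of d] subsetD[OF R(1) that(1)] by (rule iffD1)
  qed
  have low: "coeff_vector d f \<in> {c. c d = 0}" if "degree f < d" for f
    using that by (simp add: coeff_vector_def coeff_eq_0)
  show ?thesis
  proof (rule integral_points_avoidance[OF K S D R(2)])
    fix S0 \<beta> assume S0: "finite S0" and \<beta>: "\<beta> \<in> Qbar"
      and far: "\<And>p w a. prime p \<Longrightarrow> p \<notin> S0 \<Longrightarrow> w \<in> padic_places p \<Longrightarrow> Affine a \<in> R \<Longrightarrow> \<not> w (a - \<beta>) < 1"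
    obtain b H where b: "b > (0 :: int)" and H: "minpoly_int H (of_int b * \<beta>)" "lead_coeff H = 1"
      using integral_multiple[OF \<beta>] by blast
    interpret integral_generator H "of_int b * \<beta>" using H by unfold_locales
    \<comment> \<open>For primes not dividing \<open>b\<close>, multiplication by \<open>b\<close>
      preserves sizes, so \<open>x\<close> is as far from \<open>\<beta>\<close> as
      \<open>b * x\<close> is from \<open>b * \<beta>\<close>.\<close>
    define S1 where "S1 = S0 \<union> {p. prime p \<and> int p dvd b}"
    have b0: "b \<noteq> 0" using b by simp
    have S1: "finite S1" unfolding S1_def using S0 finite_primes_dvd[OF b0] by blast
    have bS: "p \<in> S1" if "prime p" "int p dvd b" for p using that unfolding S1_def by blast
    let ?G = "{c. \<exists>f \<alpha>. c = coeff_vector d f \<and> degree f = d \<and> minpoly_int f \<alpha> \<and> generic f \<alpha> \<and>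
      (\<forall>p w. prime p \<and> p \<notin> S1 \<and> w \<in> padic_places p \<longrightarrow> \<not> w (of_int b * \<alpha> - of_int b * \<beta>) < 1)}"
    let ?N = "{c. \<exists>f \<alpha>. c = coeff_vector d f \<and> degree f = d \<and> minpoly_int f \<alpha> \<and> \<not> generic f \<alpha>}"
    have far': "\<not> w (of_int b * x - of_int b * \<beta>) < 1"
      if p: "prime p \<and> p \<notin> S1 \<and> w \<in> padic_places p" and x: "Affine x \<in> R" "minpoly_int f x" for p w x f
    proof -
      interpret padic_place p w
        by unfold_locales (rule conjunct1[OF p], rule conjunct2[OF conjunct2[OF p]])
      have "\<not> int p dvd b" and pS: "p \<notin> S0" using p unfolding S1_def by blast+
      then have "w (of_int b) = 1" by (intro of_int_eq_1)
      moreover have "of_int b * x - of_int b * \<beta> = of_int b * (x - \<beta>)" by (simp only: right_diff_distrib)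
      ultimately have "w (of_int b * x - of_int b * \<beta>) = w (x - \<beta>)"
        using mult[OF QbarI_int Qbar_diff[OF minpoly_int_Qbar[OF x(2)] \<beta>], of b] by simp
      then show ?thesis using far[of p w x] p pS x(1) by simp
    qed
    have "?V \<subseteq> {c. c d = 0} \<union> (?N \<union> ?G)"
    proof
      fix c assume "c \<in> ?V"
      then obtain x f where "Affine x \<in> R \<and> minpoly_int f x \<and> c = coeff_vector d f"
        unfolding mem_Collect_eq by (elim exE)
      then have x: "Affine x \<in> R" "minpoly_int f x" and c: "c = coeff_vector d f" by - (elim conjE, assumption)+
      from deg[OF x] show "c \<in> {c. c d = 0} \<union> (?N \<union> ?G)"
      proof (rule disjE)
        assume "degree f < d"
        then show ?thesis unfolding c by (rule UnI1[OF low])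
      next
        assume df: "degree f = d"
        show ?thesis
        proof (cases "generic f x")
          case True
          have "\<forall>p w. prime p \<and> p \<notin> S1 \<and> w \<in> padic_places p \<longrightarrow> \<not> w (of_int b * x - of_int b * \<beta>) < 1"
            by (intro allI impI, rule far'[OF _ x])
          then have "c \<in> ?G" unfolding mem_Collect_eq by (intro exI[of _ f] exI[of _ x] conjI c df x(2) True)
          then show ?thesis by (rule UnI2[OF UnI2])
        next
          case False
          then have "c \<in> ?N" unfolding mem_Collect_eq by (intro exI[of _ f] exI[of _ x] conjI c df x(2))
          then show ?thesis by (rule UnI2[OF UnI1])
        qed
      qed
    qed
    moreover have "density_zero d ({c. c d = 0} \<union> (?N \<union> ?G))"
      by (intro density_zero_union density_zero_coordinate order_refl density_zero_not_generic[OF d]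
          density_zero_generic[OF b0 S1 bS])
    ultimately show ?thesis by (rule density_zero_mono[rotated])
  next
    fix S0 assume S0: "finite S0"
      and far: "\<And>p w a. prime p \<Longrightarrow> p \<notin> S0 \<Longrightarrow> w \<in> padic_places p \<Longrightarrow> Affine a \<in> R \<Longrightarrow> a \<noteq> 0 \<Longrightarrow> \<not> w (inverse a) < 1"
    let ?I = "{c. \<exists>f \<alpha>. c = coeff_vector d f \<and> degree f = d \<and> minpoly_int f \<alpha> \<and> \<alpha> \<noteq> 0 \<and>
      (\<forall>p w. prime p \<and> p \<notin> S0 \<and> w \<in> padic_places p \<longrightarrow> \<not> w (inverse \<alpha>) < 1)}"
    have "?V \<subseteq> {c. c d = 0} \<union> ({c. c 0 = 0} \<union> ?I)"
    proof
      fix c assume "c \<in> ?V"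
      then obtain x f where "Affine x \<in> R \<and> minpoly_int f x \<and> c = coeff_vector d f"
        unfolding mem_Collect_eq by (elim exE)
      then have x: "Affine x \<in> R" "minpoly_int f x" and c: "c = coeff_vector d f" by - (elim conjE, assumption)+
      from deg[OF x] show "c \<in> {c. c d = 0} \<union> ({c. c 0 = 0} \<union> ?I)"
      proof (rule disjE)
        assume "degree f < d"
        then show ?thesis unfolding c by (rule UnI1[OF low])
      next
        assume df: "degree f = d"
        show ?thesis
        proof (cases "x = 0")
          case True
          then have "coeff f 0 = 0" using minpoly_int_root[OF x(2)] by (simp add: poly_0_coeff_0 coeff_map_poly)
          then show ?thesis by (simp add: c coeff_vector_def)
        next
          case False
          have "\<forall>p w. prime p \<and> p \<notin> S0 \<and> w \<in> padic_places p \<longrightarrow> \<not> w (inverse x) < 1"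
            by (intro allI impI, elim conjE, rule far[OF _ _ _ x(1) False])
          then have "c \<in> ?I" unfolding mem_Collect_eq by (intro exI[of _ f] exI[of _ x] conjI c df x(2) False)
          then show ?thesis by (rule UnI2[OF UnI2])
        qed
      qed
    qed
    moreover have "density_zero d ({c. c d = 0} \<union> ({c. c 0 = 0} \<union> ?I))"
      by (intro density_zero_union density_zero_coordinate order_refl le0 density_zero_near_infinity[OF S0])
    ultimately show ?thesis by (rule density_zero_mono[rotated])
  qed
qed

theorem theorem1p4:
  fixes d :: nat and K :: "complex set" and S :: "(complex \<Rightarrow> real) set"
    and D :: divisor and R :: "proj1 set"
  assumes "d \<ge> 1"
    and "number_field K"
    and "finite S" and "S \<subseteq> places K" and "{v \<in> places K. archimedean v} \<subseteq> S"
    and "divisor_over K D" and "effective D" and "D \<noteq> 0"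
    and "R \<subseteq> P1_deg d" and "integral_points K D S R"
  shows "((\<lambda>B::real. real (card {P \<in> R. height P \<le> B}) /
            real (card {P \<in> P1_deg d. height P \<le> B})) \<longlongrightarrow> 0) at_top"
  by (rule limit_if_density_zero[OF assms(1,9)
    integral_points_density_zero[OF assms(1-3,6-8) assms(9,10)]])

end
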